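(* Let $m\geq 3$ be an integer and let $\gamma$ be a real number with $$1-2^{-2^{m^2 4^m}}<\gamma<1.$$ Let $\mathcal{A}$ be a subset of $\mathcal{P}_\gamma$ with $$\limsup_{x\to+\infty}\frac{|\mathcal{A}\cap[1,x]|}{x^\gamma(\log x)^{-1}}>0.$$ Then $\mathcal{A}$ contains infinitely many non-trivial $m$-term arithmetic progressions.
   Context: For $\gamma\in(0,1)$, $\mathcal{P}_\gamma:=\{p\text{ prime}: p=[n^{1/\gamma}]\text{ for some }n\in\mathbb{N}\}$ (the Piatetski-Shapiro primes), where $[x]$ denotes the integer part of $x$. A non-trivial $m$-term arithmetic progression is a set $a,a+d,\ldots,a+(m-1)d$ with $a,d$ positive integers; $\mathcal{A}$ contains it if all $m$ terms lie in $\mathcal{A}$. *)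

theory Defs
  imports "HOL-Analysis.Analysis" "HOL-Computational_Algebra.Primes"
begin

definition piatetski_shapiro_primes :: "real \<Rightarrow> nat set" where
  "piatetski_shapiro_primes \<gamma> =
     {p. prime p \<and> (\<exists>n::nat. int p = \<lfloor>real n powr (1 / \<gamma>)\<rfloor>)}"

(* Progressions are sets of terms; "non-trivial" is the positivity of the common difference. *)
definition nontrivial_AP :: "nat \<Rightarrow> nat set \<Rightarrow> bool" where
  "nontrivial_AP m P \<longleftrightarrow> (\<exists>a d. a > 0 \<and> d > 0 \<and> P = {a + i * d | i. i < m})"

end

theory Submission
 imports Defs "HOL-Library.Nat_Bijection" "HOL-Number_Theory.Totient" "HOL-Real_Asymp.Real_Asymp"
begin

text \<open>On short stretches the sequence \<open>[n powr (1 / \<gamma>)]\<close> is linear up to a bounded error. Dirichlet approximation of its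
 slope therefore turns a dense set of Piatetski-Shapiro primes into a set of \<open>t < T\<close> of density about
 \<open>(W / totient W) / ln T\<close> for which \<open>b + M t\<close> lies in the set, where \<open>M\<close> is a multiple of the product \<open>W\<close> of the
 small primes; the factor \<open>W / totient W\<close> is gained because the starting points are equidistributed modulo \<open>W\<close>.
 A Selberg sieve weight majorises the normalised indicator function of these \<open>t\<close> and satisfies a linear
 forms condition modulo a suitable \<open>N\<close> of size about \<open>2 T\<close>. The transference argument of Conlon, Fox and Zhao
 replaces the indicator function by a dense function with values in \<open>[0, 1]\<close>, and Varnavides' averaged form
 of Szemeredi's theorem, deduced from the density Hales-Jewett theorem by density increments as in the
 proof of Dodos, Kanellopoulos and Tyros, counts its progressions.\<close>

section \<open>The density Hales-Jewett theorem\<close>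

text \<open>Two densities have to cancel. Among the indices up to \<open>X\<close>, those giving
  elements of \<open>A\<close> have density about \<open>1 / ln X\<close>, while the sieve weight
  takes on the set the value \<open>V\<close>, at least a constant times
  \<open>mertens w * ln N\<close>. As \<open>mertens w = totient W / W\<close>, the factor gained
  from coprimality to \<open>W\<close> is exactly what keeps the mean of the normalised indicator
  bounded below. For this gain the Dirichlet denominator \<open>q\<close> must be at least
  \<open>W\<close>, so blocks whose slope is too well approximated with a small denominator are
  discarded; and \<open>W\<close> must be below a tiny power of \<open>X\<close>, so
  \<open>w\<close> is kept at \<open>sqrt (ln X)\<close>. The linear forms errors, however, ask
  every sieving prime to exceed a high power of \<open>ln N\<close>. The primes between these two
  thresholds stay unsieved at the cost of a constant factor. The difference \<open>M = a * W\<close>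
  has an uncontrolled factor \<open>a\<close>; large primes dividing \<open>M\<close> stay unsieved
  too, again at bounded cost. The modulus \<open>N\<close> is 1 modulo \<open>fact m\<close>, which
  makes the small coefficients of all forms invertible.\<close>

definition wd :: "nat => nat => nat list set" where
 "wd k n = {w. length w = n \<and> set w \<subseteq> {..<k}}"

text \<open>A \<open>d\<close>-dimensional combinatorial subspace: \<open>Inl c\<close> is a fixed
  letter, \<open>Inr j\<close> a place of the \<open>j\<close>-th wildcard. The equivalence makes
  every wildcard below \<open>d\<close> occur, hence substitution is injective. For
  \<open>d = 1\<close> these are the combinatorial lines.\<close>

definition tmpl :: "nat => nat => nat => (nat + nat) list => bool" where
 "tmpl k d n t \<longleftrightarrow> length t = n \<and> (\<forall>c. Inl c \<in> set t --> c < k) \<and> (\<forall>j. Inr j \<in> set t \<longleftrightarrow> j < d)"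

definition tsub :: "(nat + nat) list => nat list => nat list" where
 "tsub t w = map (case_sum (\<lambda>c. c) (\<lambda>j. w ! j)) t"

definition tcomp :: "(nat + nat) list => (nat + nat) list => (nat + nat) list" where
 "tcomp t s = map (case_sum Inl (\<lambda>j. s ! j)) t"

text \<open>Applied with the last letter \<open>k\<close> of an alphabet of size
  \<open>Suc k\<close>, this links the two alphabets in all inductions on \<open>k\<close>.\<close>

definition repl :: "nat => nat => nat list => nat list" where
 "repl k i w = map (\<lambda>c. if c = k then i else c) w"

lemma finite_wd [simp]: "finite (wd k n)"
 and card_wd: "card (wd k n) = k ^ n"
proof -
 have eq: "wd k n = {xs. set xs \<subseteq> {..<k} \<and> length xs = n}" by (auto simp: wd_def)
 show "finite (wd k n)" unfolding eq by (rule finite_lists_length_eq) simp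
 show "card (wd k n) = k ^ n" unfolding eq by (subst card_lists_length_eq) auto
qed

lemma wd_mono: "k <= K ==> w \<in> wd k n ==> w \<in> wd K n"
 by (force simp: wd_def)

lemma wd_Suc_letter: "w \<in> wd (Suc k) n ==> k \<notin> set w ==> w \<in> wd k n"
 by (force simp: wd_def less_Suc_eq)

lemma wd_length: "w \<in> wd k n ==> length w = n"
 by (simp add: wd_def)

lemma wd_nth: "w \<in> wd k n ==> i < n ==> w ! i < k"
 by (auto simp: wd_def subset_iff)

lemma wd_append: "x \<in> wd k m ==> y \<in> wd k n ==> x @ y \<in> wd k (m + n)"
 by (auto simp: wd_def)

lemma wd_Cons: "c # y \<in> wd k (Suc n) \<longleftrightarrow> c < k \<and> y \<in> wd k n"
 by (auto simp: wd_def)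

lemma wd_split: "w \<in> wd k (m + n) ==> \<exists>x\<in>wd k m. \<exists>y\<in>wd k n. w = x @ y"
 by (rule bexI[of _ "take m w"], rule bexI[of _ "drop m w"])
  (auto simp: wd_def dest: in_set_takeD in_set_dropD)

lemma finite_tmpl: "finite {t. tmpl k d n t}"
proof (rule finite_subset)
 show "{t. tmpl k d n t} \<subseteq> {xs. set xs \<subseteq> Inl ` {..<k} \<union> Inr ` {..<d} \<and> length xs = n}"
 proof
  fix t assume "t \<in> {t. tmpl k d n t}"
  thus "t \<in> {xs. set xs \<subseteq> Inl ` {..<k} \<union> Inr ` {..<d} \<and> length xs = n}"
   by (auto simp: tmpl_def elim!: ) (metis (no_types, lifting) imageI lessThan_iff old.sum.exhaust)
 qed
qed (rule finite_lists_length_eq, simp)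

lemma tmpl_length: "tmpl k d n t ==> length t = n"
 by (simp add: tmpl_def)

lemma tmpl_mono: "tmpl k d n t ==> k <= K ==> tmpl K d n t"
 by (force simp: tmpl_def)

lemma tsub_wd: assumes "tmpl k d n t" "w \<in> wd k d" shows "tsub t w \<in> wd k n"
proof -
 have "case_sum (\<lambda>c. c) (\<lambda>j. w ! j) x < k" if "x \<in> set t" for x
  by (cases x rule: sum.exhaust) (use that assms in "auto simp: tmpl_def wd_nth")
 with assms show ?thesis by (auto simp: wd_def tsub_def tmpl_def)
qed

lemma tsub_inj: assumes "tmpl k d n t" shows "inj_on (tsub t) (wd K d)"
proof (rule inj_onI)
 fix x y assume x: "x \<in> wd K d" and y: "y \<in> wd K d" and eq: "tsub t x = tsub t y"
 show "x = y"
 proof (rule nth_equalityI)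
  show "length x = length y" using x y by (simp add: wd_def)
  fix i assume "i < length x"
  hence "Inr i \<in> set t" using assms x by (simp add: wd_def tmpl_def)
  with eq show "x ! i = y ! i" by (force simp: tsub_def)
 qed
qed

lemma tcomp_tmpl: assumes "tmpl k d n t" "tmpl k e d s" shows "tmpl k e n (tcomp t s)"
 unfolding tmpl_def
proof (intro conjI allI impI)
 show "length (tcomp t s) = n" using assms by (simp add: tcomp_def tmpl_def)
 have nth: "s ! j \<in> set s" if "Inr j \<in> set t" for j
  using that assms by (simp add: tmpl_def)
 {
  fix c assume "Inl c \<in> set (tcomp t s)"
  then obtain x where x: "x \<in> set t" "case_sum Inl (\<lambda>j. s ! j) x = Inl c" by (force simp: tcomp_def)
  show "c < k" by (cases x rule: sum.exhaust) (use x assms nth in "auto simp: tmpl_def, metis")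
 }
 fix j show "Inr j \<in> set (tcomp t s) \<longleftrightarrow> j < e"
 proof
  assume "Inr j \<in> set (tcomp t s)"
  then obtain x where x: "x \<in> set t" "case_sum Inl (\<lambda>j. s ! j) x = Inr j" by (force simp: tcomp_def)
  show "j < e" by (cases x rule: sum.exhaust) (use x assms nth in "auto simp: tmpl_def, metis")
 next
  assume "j < e"
  hence "Inr j \<in> set s" using assms by (simp add: tmpl_def)
  then obtain i where i: "i < d" "s ! i = Inr j" using assms by (metis in_set_conv_nth tmpl_def)
  hence "Inr i \<in> set t" using assms by (simp add: tmpl_def)
  thus "Inr j \<in> set (tcomp t s)" using i by (force simp: tcomp_def image_iff)
 qed
qed

lemma tcomp_tsub: assumes "tmpl k d n t" "length s = d"
 shows "tsub (tcomp t s) w = tsub t (tsub s w)"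
proof -
 have *: "case_sum (\<lambda>c. c) (\<lambda>j. w ! j) (case_sum Inl (\<lambda>j. s ! j) x)
   = case_sum (\<lambda>c. c) (\<lambda>j. tsub s w ! j) x" if "x \<in> set t" for x
  by (cases x rule: sum.exhaust) (use that assms in "auto simp: tmpl_def tsub_def")
 have "tsub (tcomp t s) w = map (\<lambda>x. case_sum (\<lambda>c. c) (\<lambda>j. w ! j) (case_sum Inl (\<lambda>j. s ! j) x)) t"
  by (simp add: tsub_def tcomp_def comp_def)
 also have "... = tsub t (tsub s w)" unfolding tsub_def[of t] by (rule map_cong[OF refl *])
 finally show ?thesis .
qed

definition tid :: "nat => (nat + nat) list" where "tid n = map Inr [0..<n]"

lemma tid_tmpl: "tmpl k n n (tid n)" by (auto simp: tmpl_def tid_def)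

lemma tid_tsub: "length w = n ==> tsub (tid n) w = w"
 by (auto simp: tsub_def tid_def intro: nth_equalityI)

lemma tsub_append: "tsub (s @ t) w = tsub s w @ tsub t w" by (simp add: tsub_def)

lemma tsub_const [simp]: "tsub (map Inl y) w = y" by (simp add: tsub_def comp_def)

text \<open>Keeps the wildcards of two concatenated templates apart.\<close>

definition tshift :: "nat => (nat + nat) list => (nat + nat) list" where
 "tshift d t = map (case_sum Inl (\<lambda>j. Inr (d + j))) t"

lemma tsub_tshift: assumes "length u = d" shows "tsub (tshift d t) (u @ v) = tsub t v"
 unfolding tsub_def tshift_def map_map comp_def
 by (rule map_cong[OF refl]) (auto split: sum.split simp: assms nth_append)

lemma tsub_prefix: assumes "tmpl k d n t" "length u = d" shows "tsub t (u @ v) = tsub t u"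
 unfolding tsub_def
 by (rule map_cong[OF refl]) (use assms in "auto split: sum.split simp: nth_append tmpl_def")

lemma tmpl_append: assumes "tmpl k d m s" "tmpl k e n t" shows "tmpl k (d + e) (m + n) (s @ tshift d t)"
proof -
 have 1: "Inl c \<in> set (tshift d t) \<longleftrightarrow> Inl c \<in> set t" for c
 proof
  assume "Inl c \<in> set (tshift d t)"
  thus "Inl c \<in> set t" by (auto simp: tshift_def split: sum.splits)
 next
  assume "Inl c \<in> set t"
  thus "Inl c \<in> set (tshift d t)" by (force simp: tshift_def image_iff)
 qed
 have 2: "Inr j \<in> set (tshift d t) \<longleftrightarrow> d <= j \<and> Inr (j - d) \<in> set t" for j
 proof
  assume "Inr j \<in> set (tshift d t)"
  thus "d <= j \<and> Inr (j - d) \<in> set t" by (auto simp: tshift_def split: sum.splits)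
 next
  assume "d <= j \<and> Inr (j - d) \<in> set t"
  thus "Inr j \<in> set (tshift d t)" by (force simp: tshift_def image_iff)
 qed
 have 3: "length (tshift d t) = length t" by (simp add: tshift_def)
 show ?thesis using assms unfolding tmpl_def set_append Un_iff 1 2 length_append 3 by auto
qed

lemma tmpl_append_const: assumes "tmpl k d m s" "y \<in> wd k n" shows "tmpl k d (m + n) (s @ map Inl y)"
 using assms by (auto simp: tmpl_def wd_def)

lemma tmpl_const_append: assumes "tmpl k d m s" "y \<in> wd k n" shows "tmpl k d (n + m) (map Inl y @ s)"
 using assms by (auto simp: tmpl_def wd_def)

lemma repl_wd: "i < k ==> w \<in> wd (Suc k) n ==> repl k i w \<in> wd k n"
 by (force simp: wd_def repl_def less_Suc_eq)

lemma repl_tsub: assumes "tmpl k d n t" "w \<in> wd (Suc k) d"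
 shows "repl k i (tsub t w) = tsub t (repl k i w)"
 unfolding repl_def tsub_def map_map comp_def
proof (rule map_cong[OF refl])
 fix x assume "x \<in> set t"
 with assms show "(if (case x of Inl c => c | Inr j => w ! j) = k then i else case x of Inl c => c | Inr j => w ! j) =
  (case x of Inl c => c | Inr j => map (\<lambda>c. if c = k then i else c) w ! j)"
  by (auto simp: tmpl_def wd_def split: sum.split)
qed

text \<open>In contrast to \<open>repl_tsub\<close>, the template may itself contain the letter
  \<open>k\<close>, so an outer replacement is needed on both sides.\<close>

lemma repl_repl_tsub: assumes "tmpl (Suc k) d n t" "w \<in> wd (Suc k) d" "i < k"
 shows "repl k i (tsub t (repl k i w)) = repl k i (tsub t w)"
 unfolding repl_def tsub_def map_map comp_def
proof (rule map_cong[OF refl])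
 fix x assume "x \<in> set t"
 thus "(if (case x of Inl c => c | Inr j => map (\<lambda>c. if c = k then i else c) w ! j) = k then i
  else case x of Inl c => c | Inr j => map (\<lambda>c. if c = k then i else c) w ! j) =
    (if (case x of Inl c => c | Inr j => w ! j) = k then i else case x of Inl c => c | Inr j => w ! j)"
  using assms by (auto simp: tmpl_def wd_def split: sum.split)
qed

lemma repl_id: "k \<notin> set w ==> repl k i w = w"
 by (induction w) (auto simp: repl_def)

lemma length_repl [simp]: "length (repl k i w) = length w" by (simp add: repl_def)

lemma repl_append: "repl k i (x @ y) = repl k i x @ repl k i y" by (simp add: repl_def)

section \<open>Colouring theorems: Hales-Jewett, and Graham-Rothschild for lines\<close>

definition vcol :: "(nat list => nat) => nat list list => nat list => nat" where
 "vcol col xs y = list_encode (map (\<lambda>x. col (x @ y)) xs)"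

lemma vcol_eq: "vcol col xs y = vcol col xs z ==> x \<in> set xs ==> col (x @ y) = col (x @ z)"
 by (auto simp: vcol_def list_encode_eq)

lemma card_list_encode:
 assumes "finite C" "card C <= r" "\<And>y. y \<in> Y ==> length (F y) = l \<and> set (F y) \<subseteq> C"
 shows "finite ((\<lambda>y. list_encode (F y)) ` Y)" "card ((\<lambda>y. list_encode (F y)) ` Y) <= r ^ l"
proof -
 let ?E = "(\<lambda>y. list_encode (F y)) ` Y"
 let ?L = "{xs. set xs \<subseteq> C \<and> length xs = l}"
 have sub: "?E \<subseteq> list_encode ` ?L" using assms(3) by blast
 have fin: "finite ?L" by (rule finite_lists_length_eq[OF assms(1)])
 show "finite (?E)" using finite_subset[OF sub] fin by blast
 have "card (?E) <= card (list_encode ` ?L)"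
  by (rule card_mono[OF _ sub]) (simp add: fin)
 also have "... <= card ?L" by (rule card_image_le[OF fin])
 also have "... = card C ^ l" by (rule card_lists_length_eq[OF assms(1)])
 also have "... <= r ^ l" using assms(2) by (rule power_mono) simp
 finally show "card (?E) <= r ^ l" .
qed

lemma card_image_mono_col:
 assumes "card (col ` wd k n) <= r" "f ` Y \<subseteq> wd k n"
 shows "card ((\<lambda>y. col (f y)) ` Y) <= r"
proof -
 have "card ((\<lambda>y. col (f y)) ` Y) <= card (col ` wd k n)"
  by (rule card_mono) (use assms(2) in auto)
 with assms(1) show ?thesis by simp
qed

text \<open>Shelah's insensitivity lemma, by induction on \<open>m\<close>. Among the
  \<open>L + 1\<close> prefixes consisting of letters \<open>k - 1\<close> followed by letters
  \<open>k\<close>, two induce the same colouring of the suffixes; the stretch on which they differ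
  is a wildcard that cannot tell \<open>k\<close> from \<open>k - 1\<close>. The other wildcards are
  found in the suffix.\<close>

lemma shelah:
 assumes k: "k >= 1"
 shows "\<exists>n. \<forall>col::nat list => nat. card (col ` wd (Suc k) n) <= r -->
  (\<exists>t. tmpl (Suc k) m n t \<and> (\<forall>w\<in>wd (Suc k) m. col (tsub t w) = col (tsub t (repl k (k - 1) w))))"
proof (induction m arbitrary: r)
 case 0
 show ?case
  by (rule exI[of _ 0]) (auto simp: tmpl_def tsub_def intro!: exI[of _ "[]"])
next
 case (Suc m)
 let ?K = "Suc k"
 from Suc[of "r ^ ?K"] obtain n where n: "\<And>col::nat list => nat. card (col ` wd ?K n) <= r ^ ?K ==>
  (\<exists>t. tmpl ?K m n t \<and> (\<forall>w\<in>wd ?K m. col (tsub t w) = col (tsub t (repl k (k - 1) w))))" by blast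
 obtain ys where ys: "set ys = wd ?K n" using finite_list[OF finite_wd] by blast
 define L where "L = r ^ length ys"
 show ?case
 proof (rule exI[of _ "L + n"], intro allI impI)
  fix col :: "nat list => nat" assume col: "card (col ` wd ?K (L + n)) <= r"
  define u where "u = (\<lambda>j. replicate j (k - 1) @ replicate (L - j) k)"
  have u_wd: "u j \<in> wd ?K L" if "j <= L" for j using that by (auto simp: u_def wd_def)
  define F where "F = (\<lambda>j. map (\<lambda>y. col (u j @ y)) ys)"
  have "card ((\<lambda>j. list_encode (F j)) ` {..L}) <= r ^ length ys"
   by (rule card_list_encode(2)[OF _ col]) (auto simp: F_def ys intro!: imageI wd_append u_wd)
  hence "\<not> inj_on (\<lambda>j. list_encode (F j)) {..L}"
   using card_image[of "\<lambda>j. list_encode (F j)" "{..L}"] by (auto simp: L_def)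
  then obtain i j where ij: "i < j" "j <= L" "F i = F j"
   unfolding inj_on_def by (metis atMost_iff linorder_neqE_nat list_encode_eq)
  define s :: "(nat + nat) list" where "s = map Inl (replicate i (k - 1)) @ replicate (j - i) (Inr 0) @ map Inl (replicate (L - j) k)"
  have s: "tmpl ?K 1 L s" using ij by (auto simp: tmpl_def s_def)
  have "tsub s [k - 1] = u j"
   using ij by (simp add: s_def tsub_def u_def replicate_add[symmetric])
  moreover have "tsub s [k] = u i"
   using ij by (simp add: s_def tsub_def u_def replicate_add[symmetric])
  ultimately have s_eq: "col (tsub s [k] @ y) = col (tsub s [k - 1] @ y)" if "y \<in> wd ?K n" for y
   using ij(3) that ys by (auto simp: F_def)
  \<comment> \<open>The colour of a suffix \<open>y\<close> now records the colours of all
    \<open>x @ y\<close> with \<open>x\<close> on the line just found. This needs at most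
    \<open>r ^ Suc k\<close> colours, which explains the instance of the induction
    hypothesis.\<close>
  define xs where "xs = map (\<lambda>c. tsub s [c]) [0..<?K]"
  have xs_wd: "x \<in> wd ?K L" if "x \<in> set xs" for x
  proof -
   from that obtain c where "c < ?K" "x = tsub s [c]" by (auto simp: xs_def simp del: upt_Suc)
   thus ?thesis using tsub_wd[OF s, of "[c]"] by (simp add: wd_def)
  qed
  have "card (vcol col xs ` wd ?K n) <= r ^ ?K"
   unfolding vcol_def
   by (rule card_list_encode(2)[OF _ col]) (auto simp: xs_wd intro!: imageI wd_append, simp add: xs_def)
  from n[OF this] obtain t where t: "tmpl ?K m n t"
   and teq: "\<And>w. w \<in> wd ?K m ==> vcol col xs (tsub t w) = vcol col xs (tsub t (repl k (k - 1) w))" by blast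
  let ?U = "s @ tshift (Suc 0) t"
  have "tmpl ?K (Suc m) (L + n) ?U" using tmpl_append[OF s t] by simp
  moreover have "col (tsub ?U w) = col (tsub ?U (repl k (k - 1) w))" if w: "w \<in> wd ?K (Suc m)" for w
  proof -
   obtain c v where cv: "w = c # v" "c < ?K" "v \<in> wd ?K m"
    using w by (cases w) (auto simp: wd_def)
   have U: "tsub ?U (a # b) = tsub s [a] @ tsub t b" for a b
    using tsub_prefix[OF s, of "[a]" b] tsub_tshift[of "[a]" 1 t b] by (simp add: tsub_append)
   have rw: "repl k (k - 1) w = (if c = k then k - 1 else c) # repl k (k - 1) v" by (simp add: cv repl_def)
   have "tsub s [c] \<in> set xs" using cv by (auto simp: xs_def simp del: upt_Suc)
   from vcol_eq[OF teq[OF cv(3)] this]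
   have "col (tsub ?U w) = col (tsub s [c] @ tsub t (repl k (k - 1) v))" by (simp add: U cv)
   also have "... = col (tsub ?U (repl k (k - 1) w))"
   proof (cases "c = k")
    case True
    have "repl k (k - 1) v \<in> wd ?K m" using k cv by (intro wd_mono[OF _ repl_wd]) auto
    with True s_eq[OF tsub_wd[OF t this]] show ?thesis unfolding rw U by simp
   next
    case False
    thus ?thesis unfolding rw U by simp
   qed
   finally show ?thesis .
  qed
  ultimately show "\<exists>t. tmpl ?K (Suc m) (L + n) t \<and> (\<forall>w\<in>wd ?K (Suc m). col (tsub t w) = col (tsub t (repl k (k - 1) w)))"
   by blast
 qed
qed

text \<open>Induction on the alphabet: inside a Shelah subspace the letter \<open>k\<close> is
  interchangeable with \<open>k - 1\<close>, so a subspace monochromatic over \<open>k\<close>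
  letters stays monochromatic over \<open>Suc k\<close>.\<close>

theorem hales_jewett:
 "\<exists>n. \<forall>col::nat list => nat. card (col ` wd k n) <= r -->
  (\<exists>t c. tmpl k m n t \<and> (\<forall>w\<in>wd k m. col (tsub t w) = c))"
proof (induction k arbitrary: m)
 case 0
 show ?case
 proof (rule exI[of _ m], intro allI impI)
  fix col :: "nat list => nat"
  have "tmpl 0 m m (tid m) \<and> (\<forall>w\<in>wd 0 m. col (tsub (tid m) w) = col [])"
   by (auto simp: tid_tmpl tid_tsub wd_def)
  thus "\<exists>t c. tmpl 0 m m t \<and> (\<forall>w\<in>wd 0 m. col (tsub t w) = c)" by blast
 qed
next
 case (Suc k)
 show ?case
 proof (cases "k = 0")
  case True
  have "w = replicate m 0" if "w \<in> wd (Suc k) m" for w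
   using that True by (auto simp: wd_def intro!: replicate_eqI)
  hence "tmpl (Suc k) m m (tid m) \<and> (\<forall>w\<in>wd (Suc k) m. col (tsub (tid m) w) = col (replicate m 0))"
   for col :: "nat list => nat"
   using tid_tsub[of _ m] by (metis tid_tmpl wd_length)
  thus ?thesis by (intro exI[of _ m]) blast
 next
  case False
  from Suc[of m] obtain m' where m': "\<And>col::nat list => nat. card (col ` wd k m') <= r ==>
   (\<exists>t c. tmpl k m m' t \<and> (\<forall>w\<in>wd k m. col (tsub t w) = c))" by blast
  from False shelah[of k r m'] obtain n where n: "\<And>col::nat list => nat. card (col ` wd (Suc k) n) <= r ==>
   (\<exists>t. tmpl (Suc k) m' n t \<and> (\<forall>w\<in>wd (Suc k) m'. col (tsub t w) = col (tsub t (repl k (k - 1) w))))" by auto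
  show ?thesis
  proof (rule exI[of _ n], intro allI impI)
   fix col :: "nat list => nat" assume col: "card (col ` wd (Suc k) n) <= r"
   from n[OF col] obtain t where t: "tmpl (Suc k) m' n t"
    and teq: "\<And>w. w \<in> wd (Suc k) m' ==> col (tsub t w) = col (tsub t (repl k (k - 1) w))" by blast
   have "card ((\<lambda>w. col (tsub t w)) ` wd k m') <= r"
    by (rule card_image_mono_col[OF col]) (auto intro!: tsub_wd[OF t] wd_mono[of k])
   from m'[OF this] obtain s c where s: "tmpl k m m' s" and sc: "\<And>w. w \<in> wd k m ==> col (tsub t (tsub s w)) = c" by blast
   have s': "tmpl (Suc k) m m' s" using s by (rule tmpl_mono) simp
   have "col (tsub (tcomp t s) w) = c" if w: "w \<in> wd (Suc k) m" for w
   proof -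
    have "col (tsub (tcomp t s) w) = col (tsub t (tsub s w))"
     using tcomp_tsub[OF t tmpl_length[OF s]] by simp
    also have "... = col (tsub t (repl k (k - 1) (tsub s w)))" by (rule teq) (rule tsub_wd[OF s' w])
    also have "repl k (k - 1) (tsub s w) = tsub s (repl k (k - 1) w)" by (rule repl_tsub[OF s w])
    also have "col (tsub t ...) = c" by (rule sc) (use False repl_wd[OF _ w] in auto)
    finally show ?thesis .
   qed
   with tcomp_tmpl[OF t s'] show "\<exists>t c. tmpl (Suc k) m n t \<and> (\<forall>w\<in>wd (Suc k) m. col (tsub t w) = c)" by blast
  qed
 qed
qed

definition fstk :: "nat => nat list => nat list" where
 "fstk k x = takeWhile (\<lambda>c. c ~= k) x"

text \<open>The letter \<open>k\<close> of \<open>V\<close> becomes a further occurrence of a new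
  leading wildcard \<open>0\<close>. The result has no constant letter \<open>k\<close>, as
  Graham-Rothschild demands, yet the value \<open>k\<close> for that wildcard restores
  \<open>V\<close>.\<close>

definition tie :: "nat => (nat + nat) list => (nat + nat) list" where
 "tie k V = Inr 0 # map (case_sum (\<lambda>c. if c = k then Inr 0 else Inl c) (\<lambda>j. Inr (Suc j))) V"

lemma tie_tmpl: assumes "tmpl (Suc k) d n V" shows "tmpl k (Suc d) (Suc n) (tie k V)"
proof -
 have 1: "Inl c \<in> set (tie k V) ==> c < k" for c
 proof -
  assume "Inl c \<in> set (tie k V)"
  then obtain x where x: "x \<in> set V" "case_sum (\<lambda>c. if c = k then Inr 0 else Inl c) (\<lambda>j. Inr (Suc j)) x = Inl c"
   by (force simp: tie_def)
  show "c < k" by (cases x rule: sum.exhaust) (use x assms in "auto simp: tmpl_def less_Suc_eq split: if_splits")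
 qed
 have 2: "Inr j \<in> set (tie k V) ==> j < Suc d" for j
 proof -
  assume "Inr j \<in> set (tie k V)"
  hence "j = 0 \<or> (\<exists>x\<in>set V. case_sum (\<lambda>c. if c = k then Inr 0 else Inl c) (\<lambda>j. Inr (Suc j)) x = Inr j)"
   by (force simp: tie_def)
  thus "j < Suc d"
  proof (elim disjE bexE)
   fix x assume x: "x \<in> set V" "case_sum (\<lambda>c. if c = k then Inr 0 else Inl c) (\<lambda>j. Inr (Suc j)) x = Inr j"
   show "j < Suc d" by (cases x rule: sum.exhaust) (use x assms in "auto simp: tmpl_def split: if_splits")
  qed simp
 qed
 have 3: "Inr j \<in> set (tie k V)" if "j < Suc d" for j
 proof (cases j)
  case (Suc i)
  hence "Inr i \<in> set V" using that assms by (simp add: tmpl_def)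
  thus ?thesis using Suc by (force simp: tie_def image_iff)
 qed (simp add: tie_def)
 show ?thesis using 1 2 3 assms by (auto simp: tmpl_def) (simp add: tie_def)
qed

lemma tie_tsub': assumes "tmpl (Suc k) d n V"
 shows "tsub (tie k V) (k # z) = k # tsub V z"
 unfolding tie_def tsub_def by (auto split: sum.split)

text \<open>Peels off the first wildcard. Where it equals \<open>k\<close>, Hales-Jewett has made
  the colour constant; for its values \<open>c < k\<close> the colours are bundled into one colour
  of the remaining word, to which the induction hypothesis applies.\<close>

lemma first_var_tail:
 assumes k: "k >= 1"
 shows "\<exists>M. \<forall>col::nat list => nat. card (col ` wd (Suc k) M) <= r -->
  (\<exists>U F. tmpl k m M U \<and> (\<forall>x\<in>wd (Suc k) m. k \<in> set x --> col (tsub U x) = F (fstk k x)))"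
proof (induction m arbitrary: r)
 case 0
 show ?case by (rule exI[of _ 0]) (auto simp: tmpl_def wd_def intro!: exI[of _ "[]"])
next
 case (Suc m)
 let ?K = "Suc k"
 from Suc[of "r ^ k"] obtain L where L: "\<And>col::nat list => nat. card (col ` wd ?K L) <= r ^ k ==>
  (\<exists>U F. tmpl k m L U \<and> (\<forall>x\<in>wd ?K m. k \<in> set x --> col (tsub U x) = F (fstk k x)))" by blast
 from hales_jewett[of ?K r L] obtain n where n: "\<And>col::nat list => nat. card (col ` wd ?K n) <= r ==>
  (\<exists>t c. tmpl ?K L n t \<and> (\<forall>w\<in>wd ?K L. col (tsub t w) = c))" by blast
 show ?case
 proof (rule exI[of _ "Suc n"], intro allI impI)
  fix col :: "nat list => nat" assume col: "card (col ` wd ?K (Suc n)) <= r"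
  have "card ((\<lambda>y. col (k # y)) ` wd ?K n) <= r"
   by (rule card_image_mono_col[OF col]) (auto simp: wd_Cons)
  from n[OF this] obtain V c0 where V: "tmpl ?K L n V" and Vc: "\<And>w. w \<in> wd ?K L ==> col (k # tsub V w) = c0" by blast
  define G where "G = (\<lambda>c z. tsub (tie k V) (c # z))"
  have tie: "tmpl k (Suc L) (Suc n) (tie k V)" by (rule tie_tmpl[OF V])
  have tie': "tmpl ?K (Suc L) (Suc n) (tie k V)" using tie by (rule tmpl_mono) simp
  have Gw: "G c z \<in> wd ?K (Suc n)" if "c < ?K" "z \<in> wd ?K L" for c z
   unfolding G_def by (rule tsub_wd[OF tie']) (use that in "simp add: wd_Cons")
  define col' where "col' = (\<lambda>z. list_encode (map (\<lambda>c. col (G c z)) [0..<k]))"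
  have "card (col' ` wd ?K L) <= r ^ k"
   unfolding col'_def
   by (rule card_list_encode(2)[OF _ col]) (auto intro!: imageI Gw)
  from L[OF this] obtain U F where U: "tmpl k m L U"
   and UF: "\<And>x. x \<in> wd ?K m ==> k \<in> set x ==> col' (tsub U x) = F (fstk k x)" by blast
  have U': "tmpl ?K m L U" using U by (rule tmpl_mono) simp
  define S where "S = Inr 0 # tshift 1 U"
  have S: "tmpl k (Suc m) (Suc L) S"
   using tmpl_append[of k 1 1 "[Inr 0]" m L U] U by (simp add: S_def tmpl_def)
  have S_sub: "tsub S (c # z) = c # tsub U z" for c z
   using tsub_tshift[of "[c]" 1 U z] by (simp add: S_def tsub_def)
  define H where "H = (\<lambda>p. if p = [] then c0 else list_decode (F (tl p)) ! hd p)"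
  have "col (tsub (tcomp (tie k V) S) x) = H (fstk k x)" if x: "x \<in> wd ?K (Suc m)" "k \<in> set x" for x
  proof -
   obtain c z where cz: "x = c # z" "c < ?K" "z \<in> wd ?K m" using x(1) by (cases x) (auto simp: wd_def)
   have e: "tsub (tcomp (tie k V) S) x = G c (tsub U z)"
    by (simp add: tcomp_tsub[OF tie tmpl_length[OF S]] cz S_sub G_def)
   show ?thesis
   proof (cases "c = k")
    case True
    have "col (G k (tsub U z)) = c0"
     unfolding G_def tie_tsub'[OF V] by (rule Vc) (rule tsub_wd[OF U' cz(3)])
    thus ?thesis using True e by (simp add: H_def cz fstk_def)
   next
    case False
    hence kz: "k \<in> set z" and ck: "c < k" using cz x by auto
    have "list_decode (col' (tsub U z)) ! c = col (G c (tsub U z))" using ck by (simp add: col'_def)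
    thus ?thesis using UF[OF cz(3) kz] e False by (simp add: H_def cz fstk_def)
   qed
  qed
  with tcomp_tmpl[OF tie S]
  show "\<exists>U F. tmpl k (Suc m) (Suc n) U \<and> (\<forall>x\<in>wd ?K (Suc m). k \<in> set x --> col (tsub U x) = F (fstk k x))"
   by blast
 qed
qed

lemma in_set_tsub: assumes "tmpl k d n t" "length x = d" "k \<in> set x" shows "k \<in> set (tsub t x)"
proof -
 obtain j where "j < d" "x ! j = k" using assms by (metis in_set_conv_nth)
 moreover hence "Inr j \<in> set t" using assms by (simp add: tmpl_def)
 ultimately show ?thesis by (force simp: tsub_def)
qed

lemma fstk_append: "k \<in> set x ==> fstk k (x @ y) = fstk k x"
 by (simp add: fstk_def takeWhile_append1)

lemma fstk_append_k: "k \<notin> set x ==> fstk k (x @ [k]) = x"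
 by (induction x) (auto simp: fstk_def)

lemma fstk_replicate: "a ~= k ==> fstk k (replicate i a @ replicate j k) = replicate i a"
 by (induction i) (cases j, auto simp: fstk_def)

lemma fstk_less: "k \<in> set x ==> length (fstk k x) < length x \<and> x ! length (fstk k x) = k"
 by (induction x) (auto simp: fstk_def)

text \<open>By \<open>first_var_tail\<close> the colour depends only on the prefix before the first
  \<open>k\<close>. Hales-Jewett over \<open>k\<close> letters makes all words whose only
  \<open>k\<close> is in the last place agree. If a \<open>k\<close> occurs earlier, the last letter
  does not influence the colour; it is set to \<open>0\<close> and the induction hypothesis is
  applied to the rest.\<close>

lemma first_var_position:
 assumes k: "k >= 1"
 shows "\<exists>M. \<forall>col::nat list => nat. card (col ` wd (Suc k) M) <= r -->
  (\<exists>U F. tmpl k m M U \<and> (\<forall>x\<in>wd (Suc k) m. k \<in> set x --> col (tsub U x) = F (length (fstk k x))))"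
proof (induction m)
 case 0
 show ?case by (rule exI[of _ 0]) (auto simp: tmpl_def wd_def intro!: exI[of _ "[]"])
next
 case (Suc m)
 let ?K = "Suc k"
 from Suc obtain N where N: "\<And>col::nat list => nat. card (col ` wd ?K N) <= r ==>
  (\<exists>U F. tmpl k m N U \<and> (\<forall>x\<in>wd ?K m. k \<in> set x --> col (tsub U x) = F (length (fstk k x))))" by blast
 from hales_jewett[of k r N] obtain L where L: "\<And>col::nat list => nat. card (col ` wd k L) <= r ==>
  (\<exists>t c. tmpl k N L t \<and> (\<forall>w\<in>wd k N. col (tsub t w) = c))" by blast
 from first_var_tail[OF k, of r "L + 1"] obtain M where M: "\<And>col::nat list => nat. card (col ` wd ?K M) <= r ==>
  (\<exists>U F. tmpl k (L + 1) M U \<and> (\<forall>x\<in>wd ?K (L + 1). k \<in> set x --> col (tsub U x) = F (fstk k x)))" by blast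
 show ?case
 proof (rule exI[of _ M], intro allI impI)
  fix col :: "nat list => nat" assume col: "card (col ` wd ?K M) <= r"
  from M[OF col] obtain A F where A: "tmpl k (L + 1) M A"
   and AF: "\<And>x. x \<in> wd ?K (L + 1) ==> k \<in> set x ==> col (tsub A x) = F (fstk k x)" by blast
  have A': "tmpl ?K (L + 1) M A" using A by (rule tmpl_mono) simp
  have k1: "[k] \<in> wd ?K 1" "[0] \<in> wd ?K 1" by (auto simp: wd_def)
  have "card ((\<lambda>p. col (tsub A (p @ [k]))) ` wd k L) <= r"
   by (rule card_image_mono_col[OF col]) (auto intro!: tsub_wd[OF A'] wd_append k1 intro: wd_mono[of k ?K])
  from L[OF this] obtain V c0 where V: "tmpl k N L V" and Vc: "\<And>w. w \<in> wd k N ==> col (tsub A (tsub V w @ [k])) = c0" by blast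
  have V': "tmpl ?K N L V" using V by (rule tmpl_mono) simp
  have "card ((\<lambda>z. col (tsub A (tsub V z @ [0]))) ` wd ?K N) <= r"
   by (rule card_image_mono_col[OF col]) (auto intro!: tsub_wd[OF A'] wd_append tsub_wd[OF V'] k1)
  from N[OF this] obtain B G where B: "tmpl k m N B"
   and BG: "\<And>x. x \<in> wd ?K m ==> k \<in> set x ==> col (tsub A (tsub V (tsub B x) @ [0])) = G (length (fstk k x))" by blast
  have B': "tmpl ?K m N B" using B by (rule tmpl_mono) simp
  define S where "S = tcomp V B @ tshift m [Inr 0]"
  have VB: "tmpl k m L (tcomp V B)" by (rule tcomp_tmpl[OF V B])
  have S: "tmpl k (m + 1) (L + 1) S"
   unfolding S_def by (rule tmpl_append[OF VB]) (simp add: tmpl_def)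
  have S_sub: "tsub S (x @ [c]) = tsub V (tsub B x) @ [c]" if "length x = m" for x c
   using tsub_tshift[OF that, of "[Inr 0]" "[c]"] tsub_prefix[OF VB that, of "[c]"]
   by (simp add: S_def tsub_append tcomp_tsub[OF V tmpl_length[OF B]]) (simp add: tsub_def)
  define H where "H = (\<lambda>j. if j = m then c0 else G j)"
  have "col (tsub (tcomp A S) x) = H (length (fstk k x))" if x: "x \<in> wd ?K (m + 1)" "k \<in> set x" for x
  proof -
   obtain z y where zy: "x = z @ y" "z \<in> wd ?K m" "y \<in> wd ?K 1" using wd_split[OF x(1)] by blast
   then obtain c where c: "y = [c]" "c < ?K" by (auto simp: wd_def length_Suc_conv)
   have e: "tsub (tcomp A S) x = tsub A (tsub V (tsub B z) @ [c])"
    using zy c by (simp add: tcomp_tsub[OF A tmpl_length[OF S]] S_sub wd_length)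
   have VBz: "tsub V (tsub B z) \<in> wd ?K L" by (intro tsub_wd[OF V'] tsub_wd[OF B'] zy)
   show ?thesis
   proof (cases "k \<in> set z")
    case True
    have kV: "k \<in> set (tsub V (tsub B z))"
     by (rule in_set_tsub[OF V wd_length[OF tsub_wd[OF B' zy(2)]] in_set_tsub[OF B wd_length[OF zy(2)] True]])
    have "col (tsub A (tsub V (tsub B z) @ [c])) = col (tsub A (tsub V (tsub B z) @ [0]))"
     using AF[of "tsub V (tsub B z) @ [c]"] AF[of "tsub V (tsub B z) @ [0]"] kV VBz c
     by (simp add: fstk_append) (simp add: wd_def)
    also have "... = G (length (fstk k z))" by (rule BG[OF zy(2) True])
    also have "... = H (length (fstk k x))"
    proof -
     have "length (fstk k z) < length z" using True fstk_less by blast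
     thus ?thesis using True zy by (simp add: H_def fstk_append wd_length)
    qed
    finally show ?thesis using e by simp
   next
    case False
    hence ck: "c = k" using x zy c by auto
    have "z \<in> wd k m" by (rule wd_Suc_letter[OF zy(2) False])
    from Vc[OF tsub_wd[OF B this]] have "col (tsub A (tsub V (tsub B z) @ [c])) = c0"
     by (simp only: ck)
    moreover have "length (fstk k x) = m"
     by (simp only: zy(1) c(1) ck fstk_append_k[OF False] wd_length[OF zy(2)])
    ultimately show ?thesis by (simp add: e H_def)
   qed
  qed
  with tcomp_tmpl[OF A S]
  show "\<exists>U F. tmpl k (Suc m) M U \<and> (\<forall>x\<in>wd ?K (Suc m). k \<in> set x --> col (tsub U x) = F (length (fstk k x)))"
   unfolding Suc_eq_plus1 by blast
 qed
qed

text \<open>Words over \<open>Suc k\<close> letters containing \<open>k\<close> encode combinatorial lines over \<open>k\<close> letters, so this is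
 the Graham--Rothschild theorem for lines.\<close>

theorem graham_rothschild_lines:
 assumes k: "k >= 1"
 shows "\<exists>M. \<forall>col::nat list => nat. (\<forall>x. col x < r) -->
  (\<exists>U c. tmpl k m M U \<and> (\<forall>x\<in>wd (Suc k) m. k \<in> set x --> col (tsub U x) = c))"
proof -
 let ?K = "Suc k"
 from first_var_position[OF k, of r "m * r"] obtain M where M: "\<And>col::nat list => nat. card (col ` wd ?K M) <= r ==>
  (\<exists>U F. tmpl k (m * r) M U \<and> (\<forall>x\<in>wd ?K (m * r). k \<in> set x --> col (tsub U x) = F (length (fstk k x))))" by blast
 show ?thesis
 proof (rule exI[of _ M], intro allI impI)
  fix col :: "nat list => nat" assume col: "\<forall>x. col x < r"
  hence r: "r > 0" by (cases r) auto
  have "col ` wd ?K M \<subseteq> {..<r}" using col by auto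
  from card_mono[OF _ this] have "card (col ` wd ?K M) <= r" by simp
  from M[OF this] obtain U F where U: "tmpl k (m * r) M U"
   and UF: "\<And>x. x \<in> wd ?K (m * r) ==> k \<in> set x ==> col (tsub U x) = F (length (fstk k x))" by blast
  show "\<exists>U c. tmpl k m M U \<and> (\<forall>x\<in>wd ?K m. k \<in> set x --> col (tsub U x) = c)"
  proof (cases "m = 0")
   case True
   hence "k \<notin> set x" if "x \<in> wd ?K m" for x using that by (simp add: wd_def)
   with U True show ?thesis by (intro exI[of _ U] exI[of _ 0]) simp
  next
   case False
   have Fr: "F i < r" if "i < m * r" for i
   proof -
    let ?x = "replicate i 0 @ replicate (m * r - i) k"
    have "?x \<in> wd ?K (m * r)" "k \<in> set ?x" using that by (auto simp: wd_def)
    moreover have "fstk k ?x = replicate i 0" using k fstk_replicate[of 0 k] by simp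
    ultimately show ?thesis using UF[of ?x] col[rule_format, of "tsub U ?x"] by simp
   qed
   \<comment> \<open>Pigeonhole: some colour is taken at \<open>m\<close> of the
     \<open>m * r\<close> positions. Only these become wildcards; the others get the letter
     \<open>0\<close>, so the first \<open>k\<close> always stands at a position of this
     colour.\<close>
   obtain c where c: "m <= card {i. i < m * r \<and> F i = c}"
   proof (rule ccontr)
    assume "\<not> thesis"
    have less: "card {i. i < m * r \<and> F i = c} <= m - 1" for c
    proof -
     have "\<not> m <= card {i. i < m * r \<and> F i = c}" using that \<open>\<not> thesis\<close> by blast
     thus ?thesis by simp
    qed
    have "{i. i < m * r} = (\<Union>c<r. {i. i < m * r \<and> F i = c})" using Fr by auto
    hence "card {i. i < m * r} <= (\<Sum>c<r. card {i. i < m * r \<and> F i = c})"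
     by (metis card_UN_le finite_lessThan)
    also have "... <= (\<Sum>c<r. m - 1)" by (intro sum_mono less)
    also have "... = r * (m - 1)" by simp
    also have "... < r * m" using False r by simp
    finally show False by (simp add: mult.commute)
   qed
   obtain J where J: "J \<subseteq> {i. i < m * r \<and> F i = c}" "card J = m"
    by (rule obtain_subset_with_card_n[OF c])
   have finJ: "finite J" using J(1) by (rule finite_subset) simp
   obtain g where g: "bij_betw g J {..<m}"
    using ex_bij_betw_finite_nat[OF finJ] J by (auto simp: atLeast0LessThan)
   define S :: "(nat + nat) list" where "S = map (\<lambda>i. if i \<in> J then Inr (g i) else Inl 0) [0..<m * r]"
   have S: "tmpl k m (m * r) S" unfolding tmpl_def
   proof (intro conjI allI iffI impI)
    fix c show "Inl c \<in> set S ==> c < k" using k by (auto simp: S_def split: if_splits)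
    fix j show "Inr j \<in> set S ==> j < m" using g by (auto simp: S_def bij_betw_def split: if_splits)
    assume "j < m"
    hence "j \<in> g ` J" using g by (simp add: bij_betw_def)
    then obtain i where "i \<in> J" "g i = j" by blast
    thus "Inr j \<in> set S" using J(1) by (force simp: S_def image_iff)
   qed (simp add: S_def)
   have S': "tmpl ?K m (m * r) S" using S by (rule tmpl_mono) simp
   have "col (tsub (tcomp U S) x) = c" if x: "x \<in> wd ?K m" "k \<in> set x" for x
   proof -
    let ?y = "tsub S x"
    have y: "?y \<in> wd ?K (m * r)" by (rule tsub_wd[OF S' x(1)])
    have ky: "k \<in> set ?y" using in_set_tsub[OF S wd_length[OF x(1)] x(2)] .
    define l where "l = length (fstk k ?y)"
    have l: "l < length ?y" "?y ! l = k" using fstk_less[OF ky] by (auto simp: l_def)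
    moreover have "l < m * r" using l y by (simp add: wd_length)
    ultimately have "l \<in> J" using k by (auto simp: tsub_def S_def split: if_splits)
    hence "F l = c" using J by auto
    thus ?thesis using UF[OF y ky] by (simp add: tcomp_tsub[OF U tmpl_length[OF S]] l_def)
   qed
   with tcomp_tmpl[OF U S] show ?thesis by blast
  qed
 qed
qed

section \<open>Averaging over sections and multidimensional density Hales-Jewett\<close>

lemma section_count:
 assumes "A \<subseteq> wd K (m + n)"
 shows "card A = (\<Sum>y\<in>wd K n. card {x\<in>wd K m. x @ y \<in> A})"
  and "card A = (\<Sum>x\<in>wd K m. card {y\<in>wd K n. x @ y \<in> A})"
proof -
 let ?P = "{(x, y). x \<in> wd K m \<and> y \<in> wd K n \<and> x @ y \<in> A}"
 have eq: "A = (\<lambda>(x, y). x @ y) ` ?P"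
 proof (intro equalityI subsetI)
  fix w assume "w \<in> A"
  then obtain x y where "x \<in> wd K m" "y \<in> wd K n" "w = x @ y" using assms wd_split[of w K m n] by blast
  thus "w \<in> (\<lambda>(x, y). x @ y) ` ?P" using \<open>w \<in> A\<close> by (intro image_eqI[of _ _ "(x, y)"]) auto
 qed auto
 have "inj_on (\<lambda>(x, y). x @ y) ?P"
  by (auto simp: inj_on_def wd_def)
 from card_image[OF this] have 1: "card A = card ?P" unfolding eq[symmetric] .
 have "?P = (SIGMA x:wd K m. {y\<in>wd K n. x @ y \<in> A})" by auto
 thus "card A = (\<Sum>x\<in>wd K m. card {y\<in>wd K n. x @ y \<in> A})" using 1 by simp
 have "card ?P = card (prod.swap ` ?P)" by (rule card_image[symmetric]) simp
 also have "prod.swap ` ?P = (SIGMA y:wd K n. {x\<in>wd K m. x @ y \<in> A})" by auto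
 finally show "card A = (\<Sum>y\<in>wd K n. card {x\<in>wd K m. x @ y \<in> A})" using 1 by simp
qed

lemma markov_count:
 fixes f :: "'a => real"
 assumes "finite Y" "\<And>y. y \<in> Y ==> f y <= M" "a >= 0" "M >= 0"
 shows "(\<Sum>y\<in>Y. f y) <= M * card {y\<in>Y. f y >= a} + a * card Y"
proof -
 have "(\<Sum>y\<in>Y. f y) <= (\<Sum>y\<in>Y. M * (if f y >= a then 1 else 0) + a)"
  using assms by (intro sum_mono) (auto simp: add_increasing2)
 also have "... = M * (\<Sum>y\<in>Y. if f y >= a then 1 else 0) + a * card Y"
  by (simp add: sum.distrib sum_distrib_left mult.commute)
 also have "(\<Sum>y\<in>Y. if f y >= a then 1 else 0) = real (card {y\<in>Y. f y >= a})"
  using assms(1) by (simp add: sum.If_cases Int_def)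
 finally show ?thesis .
qed

lemma pigeonhole_cover:
 assumes "finite T" "finite Y" "Y \<subseteq> (\<Union>t\<in>T. Z t)" "Y ~= {}" "\<And>t. t \<in> T ==> finite (Z t)"
 shows "\<exists>t\<in>T. card Y <= card T * card (Z t)"
proof (rule ccontr)
 assume "\<not> ?thesis"
 hence *: "\<And>t. t \<in> T ==> card T * card (Z t) < card Y" by force
 have T: "T ~= {}" using assms by auto
 have "card Y <= card (\<Union>t\<in>T. Z t)" using assms by (intro card_mono) auto
 also have "... <= (\<Sum>t\<in>T. card (Z t))" by (rule card_UN_le[OF assms(1)])
 finally have "card T * card Y <= (\<Sum>t\<in>T. card T * card (Z t))" by (simp add: sum_distrib_left[symmetric])
 also have "... < (\<Sum>t\<in>T. card Y)" by (rule sum_strict_mono[OF assms(1) T *])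
 finally show False by simp
qed

definition DHJ :: "nat => bool" where
 "DHJ k \<longleftrightarrow> (\<forall>dl>0. \<exists>n. \<forall>A\<subseteq>wd k n. real (card A) >= dl * real k ^ n -->
  (\<exists>t. tmpl k 1 n t \<and> (\<forall>i<k. tsub t [i] \<in> A)))"

lemma dense_sections:
 assumes k: "k >= 1" and A: "A \<subseteq> wd k (m + n)" and d: "real (card A) >= dl * real k ^ (m + n)" and dl: "dl > 0"
 defines "Y \<equiv> {y\<in>wd k n. real (card {x\<in>wd k m. x @ y \<in> A}) >= dl / 2 * real k ^ m}"
 shows "real (card Y) >= dl / 2 * real k ^ n"
proof -
 have "dl * real k ^ (m + n) <= (\<Sum>y\<in>wd k n. real (card {x\<in>wd k m. x @ y \<in> A}))"
  using d section_count(1)[OF A] by simp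
 also have "... <= real k ^ m * card Y + dl / 2 * real k ^ m * card (wd k n)"
  unfolding Y_def
 proof (rule markov_count)
  fix y
  have "card {x\<in>wd k m. x @ y \<in> A} <= card (wd k m)" by (rule card_mono) auto
  thus "real (card {x\<in>wd k m. x @ y \<in> A}) <= real k ^ m" by (simp add: card_wd flip: of_nat_power)
 qed (use dl in auto)
 finally have "real k ^ m * (dl / 2 * real k ^ n) <= real k ^ m * card Y"
  by (simp add: card_wd power_add algebra_simps)
 thus ?thesis using k by (simp add: zero_less_power)
qed

text \<open>Many suffixes \<open>y\<close> have a dense section, each such section contains a line,
  and as there are finitely many lines a positive proportion of the \<open>y\<close> share one. The
  induction hypothesis finds the remaining dimensions among these \<open>y\<close>.\<close>

lemma MDHJ:
 assumes D: "DHJ k" and k: "k >= 1"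
 shows "dl > 0 ==> \<exists>n. \<forall>A\<subseteq>wd k n. real (card A) >= dl * real k ^ n -->
  (\<exists>t. tmpl k d n t \<and> tsub t ` wd k d \<subseteq> A)"
proof (induction d arbitrary: dl)
 case 0
 show ?case
 proof (rule exI[of _ 0], intro allI impI)
  fix A assume A: "A \<subseteq> wd k 0" "real (card A) >= dl * real k ^ 0"
  hence "A ~= {}" using 0 by auto
  hence "[] \<in> A" using A by (auto simp: wd_def)
  thus "\<exists>t. tmpl k 0 0 t \<and> tsub t ` wd k 0 \<subseteq> A"
   by (intro exI[of _ "[]"]) (auto simp: tmpl_def tsub_def)
 qed
next
 case (Suc d)
 from D Suc.prems obtain n1 where n1: "\<And>A. A \<subseteq> wd k n1 ==> real (card A) >= dl / 2 * real k ^ n1 ==>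
  (\<exists>t. tmpl k 1 n1 t \<and> (\<forall>i<k. tsub t [i] \<in> A))" unfolding DHJ_def by (meson half_gt_zero)
 define T where "T = {t. tmpl k 1 n1 t}"
 have finT: "finite T" unfolding T_def by (rule finite_tmpl)
 define dl' where "dl' = dl / 2 / (card T + 1)"
 have "dl' > 0" using Suc.prems by (simp add: dl'_def)
 from Suc.IH[OF this] obtain n2 where n2: "\<And>A. A \<subseteq> wd k n2 ==> real (card A) >= dl' * real k ^ n2 ==>
  (\<exists>t. tmpl k d n2 t \<and> tsub t ` wd k d \<subseteq> A)" by blast
 show ?case
 proof (rule exI[of _ "n1 + n2"], intro allI impI)
  fix A assume A: "A \<subseteq> wd k (n1 + n2)" "real (card A) >= dl * real k ^ (n1 + n2)"
  define Y where "Y = {y\<in>wd k n2. real (card {x\<in>wd k n1. x @ y \<in> A}) >= dl / 2 * real k ^ n1}"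
  define Z where "Z = (\<lambda>t. {y\<in>wd k n2. \<forall>i<k. tsub t [i] @ y \<in> A})"
  have Y: "real (card Y) >= dl / 2 * real k ^ n2"
   unfolding Y_def by (rule dense_sections[OF k A Suc.prems])
  have "dl / 2 * real k ^ n2 > 0" using Suc.prems k by simp
  with Y have "Y ~= {}" by (metis card.empty linorder_not_less of_nat_0)
  moreover have "Y \<subseteq> (\<Union>t\<in>T. Z t)"
  proof
   fix y assume y: "y \<in> Y"
   then obtain t where "tmpl k 1 n1 t" "\<forall>i<k. tsub t [i] \<in> {x\<in>wd k n1. x @ y \<in> A}"
    using n1[of "{x\<in>wd k n1. x @ y \<in> A}"] by (auto simp: Y_def)
   thus "y \<in> (\<Union>t\<in>T. Z t)" using y by (auto simp: T_def Z_def Y_def)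
  qed
  ultimately obtain t where t: "t \<in> T" "card Y <= card T * card (Z t)"
   using pigeonhole_cover[OF finT, of Y Z] by (auto simp: Y_def Z_def)
  have "dl / 2 * real k ^ n2 <= real (card T * card (Z t))" using Y t(2) by linarith
  also have "... <= (card T + 1) * card (Z t)" by simp
  finally have "real (card (Z t)) >= dl' * real k ^ n2" by (simp add: dl'_def field_simps)
  from n2[OF _ this] obtain s where s: "tmpl k d n2 s" "tsub s ` wd k d \<subseteq> Z t" by (auto simp: Z_def)
  have t': "tmpl k 1 n1 t" using t by (simp add: T_def)
  have "tsub (t @ tshift 1 s) w \<in> A" if w: "w \<in> wd k (1 + d)" for w
  proof -
   obtain c v where cv: "w = [c] @ v" "c < k" "v \<in> wd k d" using w by (cases w) (auto simp: wd_def)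
   have "tsub (t @ tshift 1 s) w = tsub t [c] @ tsub s v"
    unfolding cv tsub_append by (subst tsub_prefix[OF t'], simp, subst tsub_tshift) simp_all
   thus ?thesis using s(2) cv by (auto simp: Z_def)
  qed
  with tmpl_append[OF t' s(1)] show "\<exists>t. tmpl k (Suc d) (n1 + n2) t \<and> tsub t ` wd k (Suc d) \<subseteq> A"
   by (intro exI[of _ "t @ tshift 1 s"]) auto
 qed
qed

text \<open>Density passes to a section of length \<open>n0\<close>, with the suffix frozen. The
  uniform version is needed because later the length is the size of a position set and cannot be
  prescribed.\<close>

lemma MDHJ_ge:
 assumes D: "DHJ k" and k: "k >= 1" and dl: "dl > 0"
 shows "\<exists>n0. \<forall>n\<ge>n0. \<forall>A\<subseteq>wd k n. real (card A) >= dl * real k ^ n -->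
  (\<exists>t. tmpl k d n t \<and> tsub t ` wd k d \<subseteq> A)"
proof -
 from MDHJ[OF D k, of "dl / 2" d] dl obtain n0 where n0: "\<And>A. A \<subseteq> wd k n0 ==> real (card A) >= dl / 2 * real k ^ n0 ==>
  (\<exists>t. tmpl k d n0 t \<and> tsub t ` wd k d \<subseteq> A)" by (meson half_gt_zero)
 have "\<exists>t. tmpl k d (n0 + e) t \<and> tsub t ` wd k d \<subseteq> A"
  if A: "A \<subseteq> wd k (n0 + e)" "real (card A) >= dl * real k ^ (n0 + e)" for e A
 proof -
  have "real (card {y\<in>wd k e. real (card {x\<in>wd k n0. x @ y \<in> A}) >= dl / 2 * real k ^ n0}) >= dl / 2 * real k ^ e"
   by (rule dense_sections[OF k A dl])
  moreover have "dl / 2 * real k ^ e > 0" using dl k by simp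
  ultimately have "{y\<in>wd k e. real (card {x\<in>wd k n0. x @ y \<in> A}) >= dl / 2 * real k ^ n0} ~= {}"
   by (metis card.empty linorder_not_less of_nat_0)
  then obtain y where y: "y \<in> wd k e" "real (card {x\<in>wd k n0. x @ y \<in> A}) >= dl / 2 * real k ^ n0" by blast
  from n0[OF _ y(2)] obtain t where t: "tmpl k d n0 t" "tsub t ` wd k d \<subseteq> {x\<in>wd k n0. x @ y \<in> A}" by auto
  show ?thesis
   by (intro exI[of _ "t @ map Inl y"] conjI tmpl_append_const[OF t(1) y(1)])
    (use t(2) in "auto simp: tsub_append")
 qed
 thus ?thesis by (metis le_Suc_ex)
qed

section \<open>Insensitive sets and their partition into subspaces\<close>

definition insens :: "nat => nat => nat => nat list set => bool" where
 "insens k i n S \<longleftrightarrow> S \<subseteq> wd (Suc k) n \<and> (\<forall>w\<in>wd (Suc k) n. w \<in> S \<longleftrightarrow> repl k i w \<in> S)"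

lemma insensD: "insens k i n S ==> w \<in> wd (Suc k) n ==> w \<in> S \<longleftrightarrow> repl k i w \<in> S"
 by (simp add: insens_def)

lemma repl_wd': "i < k ==> w \<in> wd (Suc k) n ==> repl k i w \<in> wd (Suc k) n"
 by (rule wd_mono[OF _ repl_wd]) auto

lemma sum_Pow_power: "finite A ==> (\<Sum>J\<in>Pow A. x ^ card J) = (1 + x :: real) ^ card A"
proof (induction A rule: finite_induct)
 case (insert a A)
 have "(\<Sum>J\<in>Pow (insert a A). x ^ card J) = (\<Sum>J\<in>Pow A. x ^ card J) + (\<Sum>J\<in>insert a ` Pow A. x ^ card J)"
  unfolding Pow_insert by (rule sum.union_disjoint) (use insert in auto)
 also have "(\<Sum>J\<in>insert a ` Pow A. x ^ card J) = (\<Sum>J\<in>Pow A. x ^ card (insert a J))"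
  by (rule sum.reindex_cong[of "insert a"]) (use insert in "auto simp: inj_on_def")
 also have "... = (\<Sum>J\<in>Pow A. x * x ^ card J)"
  by (rule sum.cong[OF refl]) (use insert in "auto simp: card_insert_if finite_subset subset_iff")
 finally show ?case using insert by (simp add: sum_distrib_left[symmetric] algebra_simps)
qed simp

definition pos :: "nat => nat list => nat set" where
 "pos k w = {p. p < length w \<and> w ! p ~= k}"

text \<open>Off \<open>J\<close> the letter is forced to be \<open>k\<close>, on \<open>J\<close>
  any letter below \<open>k\<close> is allowed: the class is a copy of the words over
  \<open>k\<close> letters.\<close>

lemma pos_template:
 assumes J: "J \<subseteq> {..<m}"
 shows "\<exists>E. tmpl (Suc k) (card J) m E \<and> {w\<in>wd (Suc k) m. pos k w = J} = tsub E ` wd k (card J)"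
proof -
 have fin: "finite J" using J by (rule finite_subset) simp
 obtain g where g: "bij_betw g J {..<card J}"
  using ex_bij_betw_finite_nat[OF fin] by (auto simp: atLeast0LessThan)
 define E :: "(nat + nat) list" where "E = map (\<lambda>p. if p \<in> J then Inr (g p) else Inl k) [0..<m]"
 have E: "tmpl (Suc k) (card J) m E" unfolding tmpl_def
 proof (intro conjI allI iffI impI)
  fix c show "Inl c \<in> set E ==> c < Suc k" by (auto simp: E_def split: if_splits)
  fix j show "Inr j \<in> set E ==> j < card J" using g by (auto simp: E_def bij_betw_def split: if_splits)
  assume "j < card J"
  hence "j \<in> g ` J" using g by (simp add: bij_betw_def)
    then obtain i where "i \<in> J" "g i = j" by blast
  thus "Inr j \<in> set E" using J by (force simp: E_def image_iff)
 qed (simp add: E_def)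
 have nth: "tsub E v ! p = (if p \<in> J then v ! g p else k)" if "p < m" for v p
  using that by (simp add: tsub_def E_def)
 have len: "length (tsub E v) = m" for v by (simp add: tsub_def E_def)
 have gJ: "g p < card J" if "p \<in> J" for p using g that by (auto simp: bij_betw_def)
 have "{w\<in>wd (Suc k) m. pos k w = J} = tsub E ` wd k (card J)"
 proof (intro equalityI subsetI)
  fix w assume "w \<in> {w\<in>wd (Suc k) m. pos k w = J}"
  hence w: "w \<in> wd (Suc k) m" "pos k w = J" by auto
  define v where "v = map (\<lambda>i. w ! inv_into J g i) [0..<card J]"
  have inv: "inv_into J g i \<in> J" if "i < card J" for i
   using g that by (metis bij_betw_def inv_into_into lessThan_iff)
  have "w ! inv_into J g i < k" if "i < card J" for i
   using inv[OF that] w wd_nth[OF w(1), of "inv_into J g i"] by (auto simp: pos_def wd_length)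
  hence v: "v \<in> wd k (card J)" by (auto simp: v_def wd_def)
  have "w = tsub E v"
  proof (rule nth_equalityI)
   show "length w = length (tsub E v)" using w by (simp add: len wd_length)
   fix p assume "p < length w"
   hence p: "p < m" using w by (simp add: wd_length)
   show "w ! p = tsub E v ! p"
   proof (cases "p \<in> J")
    case True
    thus ?thesis using p g gJ[OF True] by (simp add: nth v_def bij_betw_def)
   next
    case False
    thus ?thesis using p w by (auto simp: nth pos_def wd_length)
   qed
  qed
  thus "w \<in> tsub E ` wd k (card J)" using v by blast
 next
  fix w assume "w \<in> tsub E ` wd k (card J)"
  then obtain v where v: "v \<in> wd k (card J)" "w = tsub E v" by blast
  have vg: "v ! g p ~= k" if "p \<in> J" for p using wd_nth[OF v(1) gJ[OF that]] by simp
  have "w \<in> wd (Suc k) m" unfolding v by (rule tsub_wd[OF E]) (rule wd_mono[OF _ v(1)], simp)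
  moreover have "p \<in> pos k w \<longleftrightarrow> p \<in> J" for p
   by (cases "p < m"; cases "p \<in> J") (use J in "auto simp: pos_def v(2) len nth vg")
  hence "pos k w = J" by blast
  ultimately show "w \<in> {w\<in>wd (Suc k) m. pos k w = J}" by simp
 qed
 with E show ?thesis by blast
qed

text \<open>Sorting words by the set \<open>J\<close> of places without \<open>k\<close> turns each
  class into words over \<open>k\<close> letters, where \<open>DHJ k\<close> applies once
  \<open>J\<close> is large and the class dense. The subspace so found extends to the letter
  \<open>k\<close>, because changing \<open>k\<close> to \<open>i\<close> does not affect membership
  in \<open>S\<close>.\<close>

lemma insens_subspace:
 assumes D: "DHJ k" and k: "k >= 1" and i: "i < k" and ep: "ep > 0"
 shows "\<exists>m. \<forall>S. insens k i m S \<and> real (card S) >= ep * real (Suc k) ^ m -->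
  (\<exists>t. tmpl (Suc k) d m t \<and> tsub t ` wd (Suc k) d \<subseteq> S)"
proof -
 let ?K = "Suc k"
 from MDHJ_ge[OF D k, of "ep / 2" d] ep obtain n0 where n0: "\<And>n A. n >= n0 ==> A \<subseteq> wd k n ==>
  real (card A) >= ep / 2 * real k ^ n ==> (\<exists>t. tmpl k d n t \<and> tsub t ` wd k d \<subseteq> A)" by (meson half_gt_zero)
 \<comment> \<open>Weighting \<open>J\<close> by \<open>2 ^ n0 / 2 ^ card J\<close> shows that the
   classes with \<open>card J < n0\<close> have at most \<open>2 ^ n0 * a ^ m\<close> words
   together, against \<open>b ^ m\<close> words in all.\<close>
 define a b where "a = 1 + real k / 2" and "b = 1 + real k"
 have ab: "0 < a" "a < b" using k by (auto simp: a_def b_def)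
 have "(\<lambda>m. 2 ^ n0 * (a / b) ^ m) \<longlonglongrightarrow> 2 ^ n0 * 0"
  by (intro tendsto_mult tendsto_const LIMSEQ_realpow_zero) (use ab in auto)
 hence "eventually (\<lambda>m. 2 ^ n0 * (a / b) ^ m < ep / 2) sequentially"
  by (rule order_tendstoD(2)) (use ep in auto)
 then obtain m where "2 ^ n0 * (a / b) ^ m < ep / 2" by (auto simp: eventually_sequentially)
 hence "2 ^ n0 * a ^ m < ep / 2 * b ^ m" using ab by (simp add: power_divide pos_divide_less_eq)
 hence m: "2 ^ n0 * (1 + real k / 2) ^ m < ep / 2 * (1 + real k) ^ m" by (simp only: a_def b_def)
 show ?thesis
 proof (rule exI[of _ m], intro allI impI, elim conjE)
  fix S assume S: "insens k i m S" "real (card S) >= ep * real ?K ^ m"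
  have Ssub: "S \<subseteq> wd ?K m" and finS: "finite S" using S(1) by (auto simp: insens_def intro: finite_subset)
  have "\<exists>J. J \<subseteq> {..<m} \<and> n0 <= card J \<and> real (card {w\<in>S. pos k w = J}) >= ep / 2 * real k ^ card J"
  proof (rule ccontr)
   assume neg: "\<not> ?thesis"
   have bound: "real (card {w\<in>S. pos k w = J}) <= ep / 2 * real k ^ card J + 2 ^ n0 * (real k / 2) ^ card J"
    if J: "J \<in> Pow {..<m}" for J
   proof (cases "n0 <= card J")
    case True
    hence "real (card {w\<in>S. pos k w = J}) <= ep / 2 * real k ^ card J" using neg J by (meson PowD linorder_not_less order_less_imp_le)
    moreover have "0 <= 2 ^ n0 * (real k / 2) ^ card J" by simp
    ultimately show ?thesis by linarith
   next
    case False
    obtain E where E: "{w\<in>wd ?K m. pos k w = J} = tsub E ` wd k (card J)" using pos_template[of J m k] J by blast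
    have "card {w\<in>S. pos k w = J} <= card {w\<in>wd ?K m. pos k w = J}"
     using Ssub by (intro card_mono) auto
    also have "... <= k ^ card J" unfolding E card_wd[symmetric] by (rule card_image_le) simp
    finally have "real (card {w\<in>S. pos k w = J}) <= real (k ^ card J)" by (rule of_nat_mono)
    hence "real (card {w\<in>S. pos k w = J}) <= real k ^ card J" by simp
    also have "... = 2 ^ card J * (real k / 2) ^ card J" by (simp add: power_divide)
    also have "... <= 2 ^ n0 * (real k / 2) ^ card J" using False by (intro mult_right_mono power_increasing) auto
    also have "... <= ep / 2 * real k ^ card J + 2 ^ n0 * (real k / 2) ^ card J" using ep by simp
    finally show ?thesis .
   qed
   have "S = (\<Union>J\<in>Pow {..<m}. {w\<in>S. pos k w = J})"
   proof (intro equalityI subsetI)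
    fix w assume w: "w \<in> S"
    hence "pos k w \<in> Pow {..<m}" using Ssub by (auto simp: pos_def dest: wd_length)
    with w show "w \<in> (\<Union>J\<in>Pow {..<m}. {w\<in>S. pos k w = J})" by blast
   qed blast
   hence "card S = card (\<Union>J\<in>Pow {..<m}. {w\<in>S. pos k w = J})" by (rule arg_cong)
   also have "... <= (\<Sum>J\<in>Pow {..<m}. card {w\<in>S. pos k w = J})" by (rule card_UN_le) simp
   finally have "card S <= (\<Sum>J\<in>Pow {..<m}. card {w\<in>S. pos k w = J})" .
   from of_nat_mono[OF this, where 'a = real]
   have "real (card S) <= (\<Sum>J\<in>Pow {..<m}. real (card {w\<in>S. pos k w = J}))" by simp
   also have "... <= (\<Sum>J\<in>Pow {..<m}. ep / 2 * real k ^ card J + 2 ^ n0 * (real k / 2) ^ card J)"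
    by (intro sum_mono bound)
   also have "... = ep / 2 * (1 + real k) ^ m + 2 ^ n0 * (1 + real k / 2) ^ m"
    unfolding sum.distrib sum_distrib_left[symmetric] by (simp add: sum_Pow_power)
   also have "... < ep * (1 + real k) ^ m" using m by simp
   finally show False using S(2) by simp
  qed
  then obtain J where J: "J \<subseteq> {..<m}" "n0 <= card J" "real (card {w\<in>S. pos k w = J}) >= ep / 2 * real k ^ card J" by blast
  obtain E where E: "tmpl ?K (card J) m E" "{w\<in>wd ?K m. pos k w = J} = tsub E ` wd k (card J)"
   using pos_template[OF J(1)] by blast
  define A where "A = {v\<in>wd k (card J). tsub E v \<in> S}"
  have "{w\<in>S. pos k w = J} \<subseteq> tsub E ` A" using E(2) Ssub by (auto simp: A_def)
  hence "card {w\<in>S. pos k w = J} <= card A" by (rule surj_card_le[rotated]) (simp add: A_def)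
  hence "real (card A) >= ep / 2 * real k ^ card J" using J(3) by linarith
  from n0[OF J(2) _ this] obtain t where t: "tmpl k d (card J) t" "tsub t ` wd k d \<subseteq> A" by (auto simp: A_def)
  have t': "tmpl ?K d (card J) t" using t(1) by (rule tmpl_mono) simp
  have "tsub (tcomp E t) w \<in> S" if w: "w \<in> wd ?K d" for w
  proof -
   have tw: "tsub t w \<in> wd ?K (card J)" by (rule tsub_wd[OF t' w])
   have Etw: "tsub E (tsub t w) \<in> wd ?K m" by (rule tsub_wd[OF E(1) tw])
   have rw: "repl k i w \<in> wd k d" by (rule repl_wd[OF i w])
   have inS: "tsub E (tsub t (repl k i w)) \<in> S" using t(2) rw by (auto simp: A_def)
   \<comment> \<open>Both words have the same image under \<open>repl k i\<close>, so they belong to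
     \<open>S\<close> together, although \<open>E\<close> itself contains the letter
     \<open>k\<close>.\<close>
   have "repl k i (tsub E (tsub t (repl k i w))) = repl k i (tsub E (tsub t w))"
    using repl_repl_tsub[OF E(1) tw i] repl_tsub[OF t(1) w, of i] by simp
   moreover have "repl k i (tsub E (tsub t (repl k i w))) \<in> S"
    using insensD[OF S(1)] inS Ssub by blast
   ultimately have "tsub E (tsub t w) \<in> S" using insensD[OF S(1) Etw] by simp
   thus ?thesis by (simp add: tcomp_tsub[OF E(1) tmpl_length[OF t(1)]])
  qed
  with tcomp_tmpl[OF E(1) t'] show "\<exists>t. tmpl ?K d m t \<and> tsub t ` wd ?K d \<subseteq> S" by blast
 qed
qed

definition covers :: "nat => nat => nat => nat list set => (nat + nat) list set => bool" where
 "covers K d n S F \<longleftrightarrow> (\<forall>t\<in>F. tmpl K d n t \<and> tsub t ` wd K d \<subseteq> S) \<and>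
  (\<forall>s\<in>F. \<forall>t\<in>F. s ~= t --> tsub s ` wd K d \<inter> tsub t ` wd K d = {})"

definition cov :: "nat => nat => (nat + nat) list set => nat list set" where
 "cov K d F = (\<Union>t\<in>F. tsub t ` wd K d)"

lemma covers_finite: "covers K d n S F ==> finite F"
 by (rule finite_subset[OF _ finite_tmpl[of K d n]]) (auto simp: covers_def)

lemma card_image_tsub: "tmpl K d n t ==> card (tsub t ` wd K d) = K ^ d"
 by (simp add: card_image tsub_inj card_wd)

lemma cov_subset: "covers K d n S F ==> cov K d F \<subseteq> S"
 by (auto simp: covers_def cov_def)

lemma card_cov: assumes "covers K d n S F" shows "card (cov K d F) = card F * K ^ d"
proof -
 have "card (cov K d F) = (\<Sum>t\<in>F. card (tsub t ` wd K d))"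
  unfolding cov_def
  by (rule card_UN_disjoint) (use assms covers_finite[OF assms] in "auto simp: covers_def")
 also have "... = (\<Sum>t\<in>F. K ^ d)" by (rule sum.cong) (use assms in "auto simp: covers_def card_image_tsub")
 finally show ?thesis by simp
qed

lemma insens_section:
 assumes S: "insens k i (m + n) S" and i: "i < k" and y: "y \<in> wd (Suc k) n"
 shows "insens k i m {z\<in>wd (Suc k) m. z @ y \<in> S}"
  and "{z\<in>wd (Suc k) m. z @ repl k i y \<in> S} = {z\<in>wd (Suc k) m. z @ y \<in> S}"
proof -
 have idem: "repl k i (repl k i w) = repl k i w" for w using i by (simp add: repl_def)
 have *: "z @ y \<in> S \<longleftrightarrow> repl k i z @ repl k i y \<in> S" if "z \<in> wd (Suc k) m" for z
  using insensD[OF S wd_append[OF that y]] by (simp add: repl_append)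
 have **: "z @ repl k i y \<in> S \<longleftrightarrow> repl k i z @ repl k i y \<in> S" if "z \<in> wd (Suc k) m" for z
  using insensD[OF S wd_append[OF that repl_wd'[OF i y]]] by (simp add: repl_append idem)
 show "{z\<in>wd (Suc k) m. z @ repl k i y \<in> S} = {z\<in>wd (Suc k) m. z @ y \<in> S}"
  using * ** by blast
 have "z @ y \<in> S \<longleftrightarrow> repl k i z @ y \<in> S" if "z \<in> wd (Suc k) m" for z
  using *[OF that] *[OF repl_wd'[OF i that]] by (simp add: idem)
 thus "insens k i m {z\<in>wd (Suc k) m. z @ y \<in> S}"
  using repl_wd'[OF i] by (auto simp: insens_def)
qed

text \<open>Each round spends \<open>m\<close> coordinates. From every dense section one subspace,
  hence at least one word, is removed; so the excess of \<open>card S\<close> over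
  \<open>ep * K ^ n\<close> shrinks by the factor \<open>1 - 1 / K ^ m\<close>. The remainder, cut
  along its first \<open>m\<close> letters, is insensitive again and enters the next round.\<close>

lemma insens_partition_step:
 assumes D: "DHJ k" and k: "k >= 1" and i: "i < k" and ep: "ep > 0"
 defines "K \<equiv> Suc k"
 shows "\<exists>m. \<forall>R n S. n >= R * m \<and> insens k i n S --> (\<exists>F. covers K d n S F \<and>
  real (card (S - cov K d F)) <= ep * real K ^ n + (1 - 1 / real K ^ m) ^ R * (real (card S) - ep * real K ^ n))"
proof -
 from insens_subspace[OF D k i ep, of d] obtain m where m: "\<And>S. insens k i m S ==> real (card S) >= ep * real K ^ m ==>
  (\<exists>t. tmpl K d m t \<and> tsub t ` wd K d \<subseteq> S)" unfolding K_def by blast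
 define q where "q = 1 - 1 / real K ^ m"
 have q: "0 <= q" "q <= 1" by (auto simp: q_def K_def)
 \<comment> \<open>The subspace is chosen as a function of the section alone. Suffixes identified by
   \<open>repl k i\<close> have equal sections and therefore lose the same words, which keeps the
   remainder insensitive.\<close>
 define ta where "ta = (\<lambda>X. SOME t. tmpl K d m t \<and> tsub t ` wd K d \<subseteq> X)"
 have ta: "tmpl K d m (ta S) \<and> tsub (ta S) ` wd K d \<subseteq> S" if "insens k i m S" "real (card S) >= ep * real K ^ m" for S
  unfolding ta_def by (rule someI_ex) (rule m[OF that])
 have "\<exists>F. covers K d n S F \<and> real (card (S - cov K d F)) <= ep * real K ^ n + q ^ R * (real (card S) - ep * real K ^ n)"
  if "n >= R * m" "insens k i n S" for R n S
  using that
 proof (induction R arbitrary: n S)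
  case 0
  show ?case by (rule exI[of _ "{}"]) (simp add: covers_def cov_def)
 next
  case (Suc R)
  define n' where "n' = n - m"
  have n: "n = m + n'" "n' >= R * m" using Suc.prems(1) by (auto simp: n'_def)
  have S: "insens k i (m + n') S" using Suc.prems n by simp
  have Ssub: "S \<subseteq> wd K (m + n')" using S by (simp add: insens_def K_def)
  have finS: "finite S" using Ssub by (rule finite_subset) simp
  define s where "s = (\<lambda>y. {z\<in>wd K m. z @ y \<in> S})"
  define Y where "Y = {y\<in>wd K n'. real (card (s y)) >= ep * real K ^ m}"
  have s_ins: "insens k i m (s y)" if "y \<in> wd K n'" for y
   using insens_section(1)[OF S i, of y] that by (simp add: s_def K_def)
  have s_repl: "s (repl k i y) = s y" if "y \<in> wd K n'" for y
   using insens_section(2)[OF S i, of y] that by (simp add: s_def K_def)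
  have tY: "tmpl K d m (ta (s y))" "tsub (ta (s y)) ` wd K d \<subseteq> s y" if "y \<in> Y" for y
   using ta[OF s_ins] that by (auto simp: Y_def)
  define im where "im = (\<lambda>y. if y \<in> Y then tsub (ta (s y)) ` wd K d else {})"
  define T where "T = (\<lambda>z. {y\<in>wd K n'. z @ y \<in> S \<and> z \<notin> im y})"
  have replY: "repl k i y \<in> Y \<longleftrightarrow> y \<in> Y" if "y \<in> wd K n'" for y
   using that s_repl[OF that] repl_wd'[OF i, of y n'] by (auto simp: Y_def K_def)
  have T_ins: "insens k i n' (T z)" if z: "z \<in> wd K m" for z
   unfolding insens_def
  proof (intro conjI ballI)
   show "T z \<subseteq> wd (Suc k) n'" by (auto simp: T_def K_def)
   fix y assume y: "y \<in> wd (Suc k) n'"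
   hence y': "y \<in> wd K n'" by (simp add: K_def)
   have "im (repl k i y) = im y" using replY[OF y'] s_repl[OF y'] by (simp add: im_def)
   moreover have "z @ repl k i y \<in> S \<longleftrightarrow> z @ y \<in> S" using s_repl[OF y'] z by (auto simp: s_def)
   ultimately show "y \<in> T z \<longleftrightarrow> repl k i y \<in> T z"
    using repl_wd'[OF i y] y by (simp add: T_def K_def)
  qed
  have "\<forall>z\<in>wd K m. \<exists>F. covers K d n' (T z) F \<and> real (card (T z - cov K d F)) <=
    ep * real K ^ n' + q ^ R * (real (card (T z)) - ep * real K ^ n')"
   using Suc.IH[OF n(2) T_ins] by blast
  then obtain G where G: "\<And>z. z \<in> wd K m ==> covers K d n' (T z) (G z)"
   and Gc: "\<And>z. z \<in> wd K m ==> real (card (T z - cov K d (G z))) <=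
    ep * real K ^ n' + q ^ R * (real (card (T z)) - ep * real K ^ n')" by metis
  define F1 where "F1 = (\<lambda>y. ta (s y) @ map Inl y) ` Y"
  define F2 where "F2 = (\<Union>z\<in>wd K m. (\<lambda>t. map Inl z @ t) ` G z)"
  have im1: "tsub (ta (s y) @ map Inl y) ` wd K d = (\<lambda>z. z @ y) ` im y" if "y \<in> Y" for y
   using that by (auto simp: im_def tsub_append image_image)
  have im2: "tsub (map Inl z @ t) ` wd K d = (\<lambda>y. z @ y) ` tsub t ` wd K d" for z t
   by (auto simp: tsub_append image_image)
  have lenim: "z \<in> im y ==> length z = m" for z y
   using tY(2)[of y] by (auto simp: im_def s_def wd_def split: if_splits)
  have lenT: "y \<in> T z ==> length y = n'" for z y by (auto simp: T_def wd_def)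
  have GT: "t \<in> G z ==> z \<in> wd K m ==> tmpl K d n' t \<and> tsub t ` wd K d \<subseteq> T z" for z t
   using G[of z] by (auto simp: covers_def)
  have "covers K d n S (F1 \<union> F2)"
   unfolding covers_def
  proof (intro conjI ballI impI)
   fix t assume "t \<in> F1 \<union> F2"
   then consider y where "y \<in> Y" "t = ta (s y) @ map Inl y" | z u where "z \<in> wd K m" "u \<in> G z" "t = map Inl z @ u"
    by (auto simp: F1_def F2_def)
   hence "tmpl K d n t \<and> tsub t ` wd K d \<subseteq> S"
   proof cases
    case 1
    thus ?thesis using tmpl_append_const[OF tY(1)[OF 1(1)], of y n'] im1[OF 1(1)] tY(2)[OF 1(1)] n
     by (auto simp: Y_def im_def s_def)
   next
    case 2
    thus ?thesis using tmpl_const_append[of K d n' u z m] GT[OF 2(2,1)] im2[of z u] n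
     by (auto simp: T_def)
   qed
   thus "tmpl K d n t" "tsub t ` wd K d \<subseteq> S" by auto
  next
   fix t t' assume t: "t \<in> F1 \<union> F2" and t': "t' \<in> F1 \<union> F2" and ne: "t ~= t'"
   have d12: "(\<lambda>z. z @ y) ` im y \<inter> (\<lambda>y. z @ y) ` tsub u ` wd K d = {}"
    if "y \<in> Y" "z \<in> wd K m" "u \<in> G z" for y z u
   proof (rule ccontr)
    assume "\<not> ?thesis"
    then obtain a b where ab: "a \<in> im y" "b \<in> tsub u ` wd K d" "a @ y = z @ b" by auto
    have "length a = length z" using lenim[OF ab(1)] that(2) by (simp add: wd_length)
    hence "a = z" "b = y" using ab(3) by auto
    thus False using ab(1,2) GT[OF that(3,2)] by (auto simp: T_def)
   qed
   from t consider y where "y \<in> Y" "t = ta (s y) @ map Inl y" | z u where "z \<in> wd K m" "u \<in> G z" "t = map Inl z @ u"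
    by (auto simp: F1_def F2_def)
   thus "tsub t ` wd K d \<inter> tsub t' ` wd K d = {}"
   proof cases
    case 1
    from t' consider y' where "y' \<in> Y" "t' = ta (s y') @ map Inl y'" | z u where "z \<in> wd K m" "u \<in> G z" "t' = map Inl z @ u"
     by (auto simp: F1_def F2_def)
    thus ?thesis
    proof cases
     case (1 y')
     hence "y ~= y'" using ne \<open>t = _\<close> by auto
     thus ?thesis unfolding \<open>t = _\<close> 1(2) im1[OF \<open>y \<in> Y\<close>] im1[OF 1(1)]
      using lenim by (auto dest: append_eq_append_conv[THEN iffD1, rotated])
    next
     case (2 z u)
     thus ?thesis unfolding \<open>t = _\<close> 2(3) im1[OF \<open>y \<in> Y\<close>] im2 using d12[OF \<open>y \<in> Y\<close> 2(1,2)] by blast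
    qed
   next
    case 2
    from t' consider y' where "y' \<in> Y" "t' = ta (s y') @ map Inl y'" | z' u' where "z' \<in> wd K m" "u' \<in> G z'" "t' = map Inl z' @ u'"
     by (auto simp: F1_def F2_def)
    thus ?thesis
    proof cases
     case (1 y')
     thus ?thesis unfolding 2(3) 1(2) im1[OF 1(1)] im2 using d12[OF 1(1) 2(1,2)] by blast
    next
     case 22: (2 z' u')
     show ?thesis
     proof (cases "z = z'")
      case True
      hence "u ~= u'" using ne 2 22 by auto
      hence "tsub u ` wd K d \<inter> tsub u' ` wd K d = {}" using G[OF 2(1)] 2 22 True by (auto simp: covers_def)
      thus ?thesis unfolding 2(3) 22(3) im2 True by auto
     next
      case False
      thus ?thesis unfolding 2(3) 22(3) im2 using 2(1) 22(1) by (auto simp: wd_def)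
     qed
    qed
   qed
  qed
  moreover have "real (card (S - cov K d (F1 \<union> F2))) <= ep * real K ^ n + q ^ Suc R * (real (card S) - ep * real K ^ n)"
  proof -
   have covF: "cov K d (F1 \<union> F2) = (\<Union>y\<in>Y. (\<lambda>z. z @ y) ` im y) \<union> (\<Union>z\<in>wd K m. (\<lambda>y. z @ y) ` cov K d (G z))"
   proof -
    have "cov K d F1 = (\<Union>y\<in>Y. tsub (ta (s y) @ map Inl y) ` wd K d)" by (simp add: cov_def F1_def)
    also have "... = (\<Union>y\<in>Y. (\<lambda>z. z @ y) ` im y)" by (rule SUP_cong[OF refl im1])
    finally have "cov K d F1 = ..." .
    moreover have "cov K d F2 = (\<Union>z\<in>wd K m. \<Union>t\<in>G z. tsub (map Inl z @ t) ` wd K d)" by (simp add: cov_def F2_def)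
    hence "cov K d F2 = (\<Union>z\<in>wd K m. (\<lambda>y. z @ y) ` cov K d (G z))" unfolding im2 cov_def image_UN .
    ultimately show ?thesis by (simp add: cov_def)
   qed
   have "S - cov K d (F1 \<union> F2) \<subseteq> (\<Union>z\<in>wd K m. (\<lambda>y. z @ y) ` (T z - cov K d (G z)))"
   proof
    fix w assume w: "w \<in> S - cov K d (F1 \<union> F2)"
    then obtain z y where zy: "z \<in> wd K m" "y \<in> wd K n'" "w = z @ y" using Ssub wd_split[of w K m n'] by blast
    have "z \<notin> im y" using w zy unfolding covF by (cases "y \<in> Y") (auto simp: im_def)
    hence "y \<in> T z" using w zy by (simp add: T_def)
    moreover have "y \<notin> cov K d (G z)" using w zy unfolding covF by blast
    ultimately show "w \<in> (\<Union>z\<in>wd K m. (\<lambda>y. z @ y) ` (T z - cov K d (G z)))" using zy by blast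
   qed
   hence "card (S - cov K d (F1 \<union> F2)) <= card (\<Union>z\<in>wd K m. (\<lambda>y. z @ y) ` (T z - cov K d (G z)))"
    by (intro card_mono) (auto simp: T_def)
   also have "... <= (\<Sum>z\<in>wd K m. card ((\<lambda>y. z @ y) ` (T z - cov K d (G z))))" by (rule card_UN_le) simp
   also have "... <= (\<Sum>z\<in>wd K m. card (T z - cov K d (G z)))" 
    by (intro sum_mono card_image_le) (auto simp: T_def)
   finally have "real (card (S - cov K d (F1 \<union> F2))) <= (\<Sum>z\<in>wd K m. real (card (T z - cov K d (G z))))"
    using of_nat_mono[where 'a = real] by fastforce
   also have "... <= (\<Sum>z\<in>wd K m. ep * real K ^ n' + q ^ R * (real (card (T z)) - ep * real K ^ n'))"
    by (intro sum_mono Gc)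
   also have "... = ep * real K ^ n + q ^ R * ((\<Sum>z\<in>wd K m. real (card (T z))) - ep * real K ^ n)"
    by (simp add: sum.distrib sum_subtractf sum_distrib_left[symmetric] card_wd n(1) power_add algebra_simps)
   finally have 1: "real (card (S - cov K d (F1 \<union> F2))) <= ..." .
   define S' where "S' = S - (\<Union>y\<in>Y. (\<lambda>z. z @ y) ` im y)"
   have S'sub: "S' \<subseteq> wd K (m + n')" using Ssub by (auto simp: S'_def)
   have "{y\<in>wd K n'. z @ y \<in> S'} = T z" if "z \<in> wd K m" for z
   proof -
    have "z @ y \<in> (\<Union>y\<in>Y. (\<lambda>z. z @ y) ` im y) \<longleftrightarrow> z \<in> im y" if "y \<in> wd K n'" for y
    proof
     assume "z @ y \<in> (\<Union>y\<in>Y. (\<lambda>z. z @ y) ` im y)"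
     then obtain y' z' where "z' \<in> im y'" "z @ y = z' @ y'" by auto
     thus "z \<in> im y" using lenim[of z' y'] \<open>z \<in> wd K m\<close> by (simp add: wd_length)
    next
     assume "z \<in> im y" thus "z @ y \<in> (\<Union>y\<in>Y. (\<lambda>z. z @ y) ` im y)"
      by (cases "y \<in> Y") (auto simp: im_def)
    qed
    thus ?thesis by (auto simp: T_def S'_def)
   qed
   hence sumT: "(\<Sum>z\<in>wd K m. card (T z)) = card S'" using section_count(2)[OF S'sub] by simp
   define pick where "pick = (\<lambda>y. (SOME z. z \<in> im y) @ y)"
   have imne: "(SOME z. z \<in> im y) \<in> im y" if "y \<in> Y" for y
   proof -
    have "replicate d 0 \<in> wd K d" by (auto simp: wd_def K_def)
    hence "im y ~= {}" using that by (auto simp: im_def)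
    thus ?thesis by (meson ex_in_conv someI_ex)
   qed
   have "length (SOME z. z \<in> im y) = m" if "y \<in> Y" for y by (rule lenim[OF imne[OF that]])
   hence "inj_on pick Y" by (auto simp: inj_on_def pick_def)
   moreover have "pick ` Y \<subseteq> S - S'"
    using imne tY(2) by (force simp: pick_def S'_def im_def s_def)
   ultimately have "card Y <= card (S - S')" by (intro card_inj_on_le[of pick]) (use finS in auto)
   also have "... = card S - card S'" by (rule card_Diff_subset) (use finS in "auto simp: S'_def")
   finally have Y1: "card S' + card Y <= card S"
    using card_mono[OF finS, of S'] by (auto simp: S'_def)
   have "real (card S) <= real K ^ m * card Y + ep * real K ^ m * card (wd K n')"
    unfolding section_count(1)[OF Ssub] of_nat_sum Y_def s_def
   proof (rule markov_count)
    fix y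
    have "card {z \<in> wd K m. z @ y \<in> S} <= card (wd K m)" by (rule card_mono) auto
    thus "real (card {z \<in> wd K m. z @ y \<in> S}) <= real K ^ m" by (simp add: card_wd flip: of_nat_power)
   qed (use ep in auto)
   hence "(1 - q) * (real (card S) - ep * real K ^ n) <= card Y"
    by (simp add: q_def card_wd n(1) power_add field_simps K_def)
   with Y1 have "real (card S') - ep * real K ^ n <= q * (real (card S) - ep * real K ^ n)"
    by (simp add: algebra_simps)
   hence "q ^ R * (real (card S') - ep * real K ^ n) <= q ^ R * (q * (real (card S) - ep * real K ^ n))"
    using q by (intro mult_left_mono) auto
   with 1 show ?thesis using sumT by (simp add: mult_ac flip: of_nat_sum)
  qed
  ultimately show ?case by blast
 qed
 thus ?thesis unfolding q_def by blast
qed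

lemma insens_partition:
 assumes D: "DHJ k" and k: "k >= 1" and i: "i < k" and ep: "ep > 0"
 shows "\<exists>n0. \<forall>n\<ge>n0. \<forall>S. insens k i n S --> (\<exists>F. covers (Suc k) d n S F \<and>
  real (card (S - cov (Suc k) d F)) <= ep * real (Suc k) ^ n)"
proof -
 let ?K = "Suc k"
 have ep2: "ep / 2 > 0" using ep by simp
 from insens_partition_step[OF D k i ep2, of d] obtain m where
  m: "\<And>R n S. n >= R * m ==> insens k i n S ==> (\<exists>F. covers ?K d n S F \<and>
  real (card (S - cov ?K d F)) <= ep / 2 * real ?K ^ n + (1 - 1 / real ?K ^ m) ^ R * (real (card S) - ep / 2 * real ?K ^ n))"
  by blast
 define q where "q = 1 - 1 / real ?K ^ m"
 have q: "0 <= q" "q < 1" by (auto simp: q_def)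
 then obtain R where R: "q ^ R < ep / 2" using real_arch_pow_inv[of "ep / 2" q] ep by auto
 have "\<exists>F. covers ?K d n S F \<and> real (card (S - cov ?K d F)) <= ep * real ?K ^ n"
  if n: "n >= R * m" and S: "insens k i n S" for n S
 proof -
  from m[OF n S] obtain F where F: "covers ?K d n S F"
   "real (card (S - cov ?K d F)) <= ep / 2 * real ?K ^ n + q ^ R * (real (card S) - ep / 2 * real ?K ^ n)"
   unfolding q_def by blast
  have "card S <= card (wd ?K n)" using S by (intro card_mono) (auto simp: insens_def)
  hence "real (card S) <= real ?K ^ n" using of_nat_mono[where 'a = real] by (fastforce simp: card_wd)
  moreover have "ep / 2 * real ?K ^ n >= 0" using ep by simp
  ultimately have "real (card S) - ep / 2 * real ?K ^ n <= real ?K ^ n" by linarith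
  hence "q ^ R * (real (card S) - ep / 2 * real ?K ^ n) <= q ^ R * real ?K ^ n"
   using q by (intro mult_left_mono) auto
  also have "... <= ep / 2 * real ?K ^ n" using R by (intro mult_right_mono) auto
  finally show ?thesis using F by (intro exI[of _ F]) auto
 qed
 thus ?thesis by blast
qed

lemma insens_pullback:
 assumes S: "insens k i n S" and t: "tmpl (Suc k) d n t" and i: "i < k"
 shows "insens k i d {v\<in>wd (Suc k) d. tsub t v \<in> S}"
 unfolding insens_def
proof (intro conjI ballI)
 fix v assume v: "v \<in> wd (Suc k) d"
 have "tsub t v \<in> S \<longleftrightarrow> repl k i (tsub t v) \<in> S" by (rule insensD[OF S tsub_wd[OF t v]])
 also have "repl k i (tsub t v) = repl k i (tsub t (repl k i v))" using repl_repl_tsub[OF t v i] by simp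
 also have "... \<in> S \<longleftrightarrow> tsub t (repl k i v) \<in> S" using insensD[OF S tsub_wd[OF t repl_wd'[OF i v]]] by simp
 finally show "v \<in> {v\<in>wd (Suc k) d. tsub t v \<in> S} \<longleftrightarrow> repl k i v \<in> {v\<in>wd (Suc k) d. tsub t v \<in> S}"
  using v repl_wd'[OF i v] by simp
qed auto

lemma tcomp_inj_image:
 assumes t: "tmpl K d n t" and s: "tmpl K e d s"
 shows "tsub (tcomp t s) ` wd K e = tsub t ` tsub s ` wd K e"
 by (simp add: image_image tcomp_tsub[OF t tmpl_length[OF s]])

text \<open>The set of the head \<open>i\<close> is partitioned into subspaces of a dimension
  \<open>d1\<close> so large that inside each of them the pullbacks of the other sets can be
  partitioned by the induction hypothesis. Each of the two leftovers costs
  \<open>ep / 2\<close>.\<close>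

lemma insens_Int_partition:
 assumes D: "DHJ k" and k: "k >= 1"
 shows "\<forall>i\<in>set I. i < k ==> ep > 0 ==> \<exists>n0. \<forall>n\<ge>n0. \<forall>S. (\<forall>i\<in>set I. insens k i n (S i)) -->
  (\<exists>F. covers (Suc k) d n (wd (Suc k) n \<inter> (\<Inter>i\<in>set I. S i)) F \<and>
   real (card (wd (Suc k) n \<inter> (\<Inter>i\<in>set I. S i) - cov (Suc k) d F)) <= ep * real (Suc k) ^ n)"
proof (induction I arbitrary: d ep)
 case Nil
 let ?K = "Suc k"
 have "\<exists>F. covers ?K d n (wd ?K n) F \<and> real (card (wd ?K n - cov ?K d F)) <= ep * real ?K ^ n" if n: "n >= d" for n
 proof -
  define F where "F = (\<lambda>y. tid d @ map Inl y) ` wd ?K (n - d)"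
  have im: "tsub (tid d @ map Inl y) ` wd ?K d = (\<lambda>x. x @ y) ` wd ?K d" for y
   by (rule image_cong) (auto simp: tsub_append tid_tsub wd_length)
  have "covers ?K d n (wd ?K n) F"
   unfolding covers_def
  proof (intro conjI ballI impI)
   fix t assume "t \<in> F"
   thus t: "tmpl ?K d n t" using tmpl_append_const[OF tid_tmpl[of ?K d], of _ "n - d"] n by (auto simp: F_def)
   show "tsub t ` wd ?K d \<subseteq> wd ?K n" using tsub_wd[OF t] by blast
  next
   fix s t assume "s \<in> F" "t \<in> F" "s ~= t"
   then obtain y y' where y: "s = tid d @ map Inl y" "t = tid d @ map Inl y'" "y ~= y'" by (auto simp: F_def)
   have "a @ y ~= b @ y'" if "a \<in> wd ?K d" "b \<in> wd ?K d" for a b using that y(3) by (simp add: wd_length)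
   thus "tsub s ` wd ?K d \<inter> tsub t ` wd ?K d = {}" unfolding y(1,2) im by blast
  qed
  moreover have "real (card (wd ?K n - cov ?K d F)) <= ep * real ?K ^ n"
  proof -
   have "w \<in> cov ?K d F" if "w \<in> wd ?K n" for w
    using wd_split[of w ?K d "n - d"] that n by (fastforce simp: cov_def F_def im)
   hence "wd ?K n - cov ?K d F = {}" by blast
   hence "real (card (wd ?K n - cov ?K d F)) = 0" by (simp only: card.empty of_nat_0)
   thus ?thesis using Nil by (simp only:) simp
  qed
  ultimately show ?thesis by blast
 qed
 thus ?case by (intro exI[of _ d]) simp
next
 case (Cons i I)
 let ?K = "Suc k"
 have i: "i < k" and I: "\<forall>i\<in>set I. i < k" and ep2: "ep / 2 > 0" using Cons.prems by auto
 from Cons.IH[OF I ep2, of d] obtain d1 where d1: "\<And>S. (\<forall>i\<in>set I. insens k i d1 (S i)) ==>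
  (\<exists>F. covers ?K d d1 (wd ?K d1 \<inter> (\<Inter>i\<in>set I. S i)) F \<and>
   real (card (wd ?K d1 \<inter> (\<Inter>i\<in>set I. S i) - cov ?K d F)) <= ep / 2 * real ?K ^ d1)" by blast
 from insens_partition[OF D k i ep2, of d1] obtain n0 where n0: "\<And>n S. n >= n0 ==> insens k i n S ==> (\<exists>F. covers ?K d1 n S F \<and>
  real (card (S - cov ?K d1 F)) <= ep / 2 * real ?K ^ n)" by blast
 show ?case
 proof (rule exI[of _ n0], intro allI impI)
  fix n S assume n: "n0 <= n" and S: "\<forall>i\<in>set (i # I). insens k i n (S i)"
  define X where "X = wd ?K n \<inter> (\<Inter>i\<in>set I. S i)"
  have Xeq: "wd ?K n \<inter> (\<Inter>i\<in>set (i # I). S i) = S i \<inter> X" by (auto simp: X_def)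
  have Ssub: "S i \<subseteq> wd ?K n" using S by (simp add: insens_def)
  from n0[OF n, of "S i"] S obtain F1 where F1: "covers ?K d1 n (S i) F1"
   and F1c: "real (card (S i - cov ?K d1 F1)) <= ep / 2 * real ?K ^ n" by auto
  have F1t: "tmpl ?K d1 n t" "tsub t ` wd ?K d1 \<subseteq> S i" if "t \<in> F1" for t using F1 that by (auto simp: covers_def)
  define P where "P = (\<lambda>t. {v\<in>wd ?K d1. tsub t v \<in> X})"
  have "\<exists>F. covers ?K d d1 (P t) F \<and> real (card (P t - cov ?K d F)) <= ep / 2 * real ?K ^ d1" if t: "t \<in> F1" for t
  proof -
   have "wd ?K d1 \<inter> (\<Inter>i\<in>set I. {v\<in>wd ?K d1. tsub t v \<in> S i}) = P t"
    using tsub_wd[OF F1t(1)[OF t]] by (auto simp: P_def X_def)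
   moreover have "\<forall>i\<in>set I. insens k i d1 {v\<in>wd ?K d1. tsub t v \<in> S i}"
    using insens_pullback[OF _ F1t(1)[OF t]] S I by auto
   ultimately show ?thesis using d1[of "\<lambda>i. {v\<in>wd ?K d1. tsub t v \<in> S i}"] by simp
  qed
  then obtain G where G: "\<And>t. t \<in> F1 ==> covers ?K d d1 (P t) (G t)"
   and Gc: "\<And>t. t \<in> F1 ==> real (card (P t - cov ?K d (G t))) <= ep / 2 * real ?K ^ d1" by metis
  have Gs: "tmpl ?K d d1 s" "tsub s ` wd ?K d \<subseteq> P t" "tsub s ` wd ?K d \<subseteq> wd ?K d1" if "t \<in> F1" "s \<in> G t" for s t
   using G[OF that(1)] that by (auto simp: covers_def P_def)
  define F where "F = (\<Union>t\<in>F1. tcomp t ` G t)"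
  have im: "tsub (tcomp t s) ` wd ?K d = tsub t ` tsub s ` wd ?K d" if "t \<in> F1" "s \<in> G t" for t s
   by (rule tcomp_inj_image[OF F1t(1)[OF that(1)] Gs(1)[OF that]])
  have "covers ?K d n (S i \<inter> X) F"
   unfolding covers_def
  proof (intro conjI ballI impI)
   fix u assume "u \<in> F"
   then obtain t s where ts: "t \<in> F1" "s \<in> G t" "u = tcomp t s" by (auto simp: F_def)
   show "tmpl ?K d n u" unfolding ts by (rule tcomp_tmpl[OF F1t(1)[OF ts(1)] Gs(1)[OF ts(1,2)]])
   show "tsub u ` wd ?K d \<subseteq> S i \<inter> X"
    unfolding ts(3) im[OF ts(1,2)] using Gs(2,3)[OF ts(1,2)] F1t(2)[OF ts(1)] by (auto simp: P_def)
  next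
   fix u u' assume "u \<in> F" "u' \<in> F" and ne: "u ~= u'"
   then obtain t s t' s' where ts: "t \<in> F1" "s \<in> G t" "u = tcomp t s" and ts': "t' \<in> F1" "s' \<in> G t'" "u' = tcomp t' s'"
    by (auto simp: F_def)
   show "tsub u ` wd ?K d \<inter> tsub u' ` wd ?K d = {}"
   proof (cases "t = t'")
    case False
    hence "tsub t ` wd ?K d1 \<inter> tsub t' ` wd ?K d1 = {}" using F1 ts(1) ts'(1) by (auto simp: covers_def)
    thus ?thesis unfolding ts(3) ts'(3) im[OF ts(1,2)] im[OF ts'(1,2)]
     using Gs(3)[OF ts(1,2)] Gs(3)[OF ts'(1,2)] by blast
   next
    case True
    hence "s ~= s'" using ne ts ts' by auto
    hence "tsub s ` wd ?K d \<inter> tsub s' ` wd ?K d = {}" using G[OF ts(1)] ts ts' True by (auto simp: covers_def)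
    moreover have "tsub t ` (tsub s ` wd ?K d \<inter> tsub s' ` wd ?K d) = tsub t ` tsub s ` wd ?K d \<inter> tsub t ` tsub s' ` wd ?K d"
     by (rule inj_on_image_Int[OF tsub_inj[OF F1t(1)[OF ts(1)]] Gs(3)[OF ts(1,2)] Gs(3)[OF ts'(1,2)]])
    ultimately show ?thesis unfolding ts(3) ts'(3) im[OF ts(1,2)] im[OF ts'(1,2)] using True by simp
   qed
  qed
  moreover have "real (card (S i \<inter> X - cov ?K d F)) <= ep * real ?K ^ n"
  proof -
   have finS: "finite (S i)" using Ssub by (rule finite_subset) simp
   have fin1: "finite F1" by (rule covers_finite[OF F1])
   have "S i \<inter> X - cov ?K d F \<subseteq> (S i - cov ?K d1 F1) \<union> (\<Union>t\<in>F1. tsub t ` (P t - cov ?K d (G t)))"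
   proof
    fix w assume w: "w \<in> S i \<inter> X - cov ?K d F"
    show "w \<in> (S i - cov ?K d1 F1) \<union> (\<Union>t\<in>F1. tsub t ` (P t - cov ?K d (G t)))"
    proof (cases "w \<in> cov ?K d1 F1")
     case True
     then obtain t v where tv: "t \<in> F1" "v \<in> wd ?K d1" "w = tsub t v" by (auto simp: cov_def)
     have "v \<in> P t" using w tv by (simp add: P_def)
     moreover have "v \<notin> cov ?K d (G t)"
     proof
      assume "v \<in> cov ?K d (G t)"
      then obtain s where s: "s \<in> G t" "v \<in> tsub s ` wd ?K d" by (auto simp: cov_def)
      hence "w \<in> tsub (tcomp t s) ` wd ?K d" using im[OF tv(1) s(1)] tv by auto
      hence "w \<in> cov ?K d F" using tv s by (auto simp: cov_def F_def)
      thus False using w by simp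
     qed
     ultimately show ?thesis using tv by blast
    next
     case False
     thus ?thesis using w by blast
    qed
   qed
   hence "card (S i \<inter> X - cov ?K d F) <= card ((S i - cov ?K d1 F1) \<union> (\<Union>t\<in>F1. tsub t ` (P t - cov ?K d (G t))))"
    by (intro card_mono) (use finS fin1 in "auto simp: P_def")
   also have "... <= card (S i - cov ?K d1 F1) + card (\<Union>t\<in>F1. tsub t ` (P t - cov ?K d (G t)))" by (rule card_Un_le)
   also have "card (\<Union>t\<in>F1. tsub t ` (P t - cov ?K d (G t))) <= (\<Sum>t\<in>F1. card (tsub t ` (P t - cov ?K d (G t))))"
    by (rule card_UN_le[OF fin1])
   also have "... <= (\<Sum>t\<in>F1. card (P t - cov ?K d (G t)))"
    by (intro sum_mono card_image_le) (auto simp: P_def)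
   finally have "card (S i \<inter> X - cov ?K d F) <= card (S i - cov ?K d1 F1) + (\<Sum>t\<in>F1. card (P t - cov ?K d (G t)))" by simp
   from of_nat_mono[OF this, where 'a = real]
   have "real (card (S i \<inter> X - cov ?K d F)) <= real (card (S i - cov ?K d1 F1)) + (\<Sum>t\<in>F1. real (card (P t - cov ?K d (G t))))" by simp
   also have "... <= ep / 2 * real ?K ^ n + (\<Sum>t\<in>F1. ep / 2 * real ?K ^ d1)"
    by (intro add_mono F1c sum_mono Gc)
   also have "... = ep / 2 * real ?K ^ n + ep / 2 * real (card F1 * ?K ^ d1)" by simp
   also have "card F1 * ?K ^ d1 <= ?K ^ n"
    using card_cov[OF F1] card_mono[OF finite_wd order_trans[OF cov_subset[OF F1] Ssub]] by (simp add: card_wd)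
   finally show ?thesis using ep2 by simp
  qed
  ultimately show "\<exists>F. covers ?K d n (wd ?K n \<inter> (\<Inter>i\<in>set (i # I). S i)) F \<and>
   real (card (wd ?K n \<inter> (\<Inter>i\<in>set (i # I). S i) - cov ?K d F)) <= ep * real ?K ^ n"
   unfolding Xeq by blast
 qed
qed

section \<open>The density increment\<close>

definition linefree :: "nat => nat => nat list set => bool" where
 "linefree K n A \<longleftrightarrow> A \<subseteq> wd K n \<and> \<not> (\<exists>t. tmpl K 1 n t \<and> (\<forall>i<K. tsub t [i] \<in> A))"

lemma linefree_section:
 assumes "linefree K (m + n) A" "x \<in> wd K m"
 shows "linefree K n {y\<in>wd K n. x @ y \<in> A}"
 unfolding linefree_def
proof (intro conjI notI)
 assume "\<exists>t. tmpl K 1 n t \<and> (\<forall>i<K. tsub t [i] \<in> {y \<in> wd K n. x @ y \<in> A})"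
 then obtain t where t: "tmpl K 1 n t" "\<forall>i<K. x @ tsub t [i] \<in> A" by auto
 have "tmpl K 1 (m + n) (map Inl x @ t)" by (rule tmpl_const_append[OF t(1) assms(2)])
 moreover have "\<forall>i<K. tsub (map Inl x @ t) [i] \<in> A" using t(2) by (simp add: tsub_append)
 ultimately show False using assms(1) by (auto simp: linefree_def)
qed auto

lemma linefree_pullback:
 assumes "linefree K n A" "tmpl K d n t"
 shows "linefree K d {v\<in>wd K d. tsub t v \<in> A}"
 unfolding linefree_def
proof (intro conjI notI)
 assume "\<exists>s. tmpl K 1 d s \<and> (\<forall>i<K. tsub s [i] \<in> {v \<in> wd K d. tsub t v \<in> A})"
 then obtain s where s: "tmpl K 1 d s" "\<forall>i<K. tsub t (tsub s [i]) \<in> A" by auto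
 have "\<forall>i<K. tsub (tcomp t s) [i] \<in> A" using s by (simp add: tcomp_tsub[OF assms(2) tmpl_length])
 with tcomp_tmpl[OF assms(2) s(1)] assms(1) show False by (auto simp: linefree_def)
qed auto

lemma linefree_section2:
 assumes "linefree K (m + n) A" "y \<in> wd K n" "tmpl K d m t"
 shows "linefree K d {x\<in>wd K d. tsub t x @ y \<in> A}"
 using linefree_pullback[OF assms(1) tmpl_append_const[OF assms(3,2)]] by (simp add: tsub_append)

lemma double_count:
 assumes "finite X" "finite Y"
 shows "(\<Sum>y\<in>Y. card {x\<in>X. P x y}) = (\<Sum>x\<in>X. card {y\<in>Y. P x y})"
proof -
 have "(\<Sum>y\<in>Y. card {x\<in>X. P x y}) = (\<Sum>y\<in>Y. \<Sum>x\<in>X. if P x y then 1 else 0)"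
  using assms by (intro sum.cong refl) (simp add: sum.If_cases Int_def)
 also have "... = (\<Sum>x\<in>X. \<Sum>y\<in>Y. if P x y then 1 else 0)" by (rule sum.swap)
 also have "... = (\<Sum>x\<in>X. card {y\<in>Y. P x y})"
  using assms by (intro sum.cong refl) (simp add: sum.If_cases Int_def)
 finally show ?thesis .
qed

lemma exists_ge_average:
 fixes f :: "'a => real" and c :: real
 assumes "finite Y" "Y ~= {}" "(\<Sum>y\<in>Y. f y) >= c * card Y"
 shows "\<exists>y\<in>Y. f y >= c"
proof (rule ccontr)
 assume "\<not> ?thesis"
 hence "(\<Sum>y\<in>Y. f y) < (\<Sum>y\<in>Y. c)" using assms by (intro sum_strict_mono) (auto simp: not_le)
 with assms(3) show False by (simp add: mult.commute)
qed

lemma card_wd_le: "A \<subseteq> wd K n ==> real (card A) <= real K ^ n"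
 using of_nat_mono[OF card_mono[OF finite_wd, of A K n], where 'a = real] by (simp add: card_wd)

lemma word_line:
 assumes "x \<in> wd (Suc k) n" "k \<in> set x"
 shows "\<exists>t. tmpl (Suc k) 1 n t \<and> tsub t [k] = x \<and> (\<forall>i<k. tsub t [i] = repl k i x)"
proof (intro exI conjI allI impI)
 let ?t = "map (\<lambda>c. if c = k then Inr 0 else Inl c) x"
 show "tmpl (Suc k) 1 n ?t" using assms by (auto simp: tmpl_def wd_def)
 show "tsub ?t [k] = x" by (induction x) (auto simp: tsub_def)
 show "tsub ?t [i] = repl k i x" for i by (auto simp: tsub_def repl_def)
qed

lemma linefree_upper:
 assumes "\<And>A. linefree K m A ==> real (card A) < a * real K ^ m" and K: "K >= 1" and A: "linefree K (m + n) A"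
 shows "real (card A) < a * real K ^ (m + n)"
proof -
 have A': "A \<subseteq> wd K (m + n)" using A by (simp add: linefree_def)
 have sec: "linefree K m {x\<in>wd K m. x @ y \<in> A}" if "y \<in> wd K n" for y
  using linefree_section2[OF A that tid_tmpl] by (simp add: tid_tsub wd_length cong: conj_cong)
 have "replicate n 0 \<in> wd K n" using K by (auto simp: wd_def)
 hence ne: "wd K n ~= {}" by blast
 have "real (card A) = (\<Sum>y\<in>wd K n. real (card {x\<in>wd K m. x @ y \<in> A}))"
  using section_count(1)[OF A'] by simp
 also have "... < (\<Sum>y\<in>wd K n. a * real K ^ m)"
  by (rule sum_strict_mono[OF finite_wd ne assms(1)[OF sec]])
 finally show ?thesis by (simp add: card_wd power_add mult_ac)
qed

lemma DHJ_linefree: "DHJ k \<longleftrightarrow> (\<forall>dl>0. \<exists>n. \<forall>A. linefree k n A --> real (card A) < dl * real k ^ n)"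
proof -
 have "(\<forall>A\<subseteq>wd k n. real (card A) >= dl * real k ^ n --> (\<exists>t. tmpl k 1 n t \<and> (\<forall>i<k. tsub t [i] \<in> A)))
  \<longleftrightarrow> (\<forall>A. linefree k n A --> real (card A) < dl * real k ^ n)" for n and dl :: real
  unfolding linefree_def not_le[symmetric, of _ "dl * real k ^ n"] by blast
 thus ?thesis unfolding DHJ_def by simp
qed

text \<open>Let \<open>dl\<close> be the supremum of the densities attained by line-free sets in
  every length. A line-free set of density near \<open>dl\<close> is shown to have density at least
  \<open>dl + c\<close> on some \<open>d\<close>-dimensional subspace, too much for
  \<open>d\<close>. The increment comes from the words all of whose replacements of \<open>k\<close>
  lie in the set: if such a word contains \<open>k\<close>, it cannot lie in the set itself. So the
  set is denser on the other words, and these are a disjoint union of \<open>k\<close> intersections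
  of insensitive sets, hence almost a union of subspaces.\<close>

lemma DHJ_step:
 assumes D: "DHJ k" and k: "k >= 1"
 shows "DHJ (Suc k)"
proof (rule ccontr)
 define K where "K = Suc k"
 have K: "K >= 1" by (simp add: K_def)
 have Kpos: "real K ^ n > 0" for n using K by simp
 assume "\<not> DHJ (Suc k)"
 then obtain dl0 where dl0: "dl0 > 0" and bad: "\<And>n. \<exists>A. linefree K n A \<and> real (card A) >= dl0 * real K ^ n"
  unfolding DHJ_linefree K_def[symmetric] by (auto simp: not_less)
 define X where "X = {dl. \<forall>n. \<exists>A. linefree K n A \<and> real (card A) >= dl * real K ^ n}"
 have X0: "dl0 \<in> X" using bad by (simp add: X_def)
 have X1: "dl <= 1" if "dl \<in> X" for dl
 proof -
  from that obtain A where A: "linefree K 0 A" "real (card A) >= dl * real K ^ 0" unfolding X_def by blast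
  thus ?thesis using card_wd_le[of A K 0] by (simp add: linefree_def)
 qed
 have bdd: "bdd_above X" using X1 by (rule bdd_aboveI)
 define dl where "dl = Sup X"
 have dl: "0 < dl" "dl <= 1"
  using cSup_upper[OF X0 bdd] dl0 cSup_least[of X 1] X0 X1 by (auto simp: dl_def)
 have lower: "\<exists>A. linefree K n A \<and> real (card A) >= (dl - c) * real K ^ n" if "c > 0" for c n
 proof -
  obtain dl' where "dl' \<in> X" "dl - c < dl'"
  proof -
   have "X ~= {}" "dl - c < Sup X" using X0 \<open>c > 0\<close> by (auto simp: dl_def)
   from less_cSupD[OF this] show ?thesis using that by blast
  qed
  then obtain A where A: "linefree K n A" "real (card A) >= dl' * real K ^ n" by (auto simp: X_def)
  have "(dl - c) * real K ^ n <= dl' * real K ^ n" using \<open>dl - c < dl'\<close> by (intro mult_right_mono) auto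
  thus ?thesis using A by (intro exI[of _ A]) auto
 qed
 have upper: "\<exists>n1. \<forall>n\<ge>n1. \<forall>A. linefree K n A --> real (card A) < (dl + c) * real K ^ n" if "c > 0" for c
 proof -
  have "dl + c \<notin> X" using cSup_upper[OF _ bdd, of "dl + c"] that by (auto simp: dl_def)
  then obtain m where m: "\<And>A. linefree K m A ==> real (card A) < (dl + c) * real K ^ m"
   unfolding X_def by (auto simp: not_le)
  have "real (card A) < (dl + c) * real K ^ n" if "n >= m" "linefree K n A" for n A
   using linefree_upper[of K m "dl + c" "n - m" A, OF m K] that by simp
  thus ?thesis by blast
 qed

 have dl4: "dl / 4 > 0" using dl by simp
 obtain m0 where m0: "\<And>A. A \<subseteq> wd k m0 ==> real (card A) >= dl / 4 * real k ^ m0 ==>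
  (\<exists>t. tmpl k 1 m0 t \<and> (\<forall>i<k. tsub t [i] \<in> A))" using D dl4 unfolding DHJ_def by blast
 define T where "T = {t. tmpl k 1 m0 t}"
 have finT: "finite T" unfolding T_def by (rule finite_tmpl)
 \<comment> \<open>The share of suffixes that remains for a single line after pigeonholing over all
   lines of length \<open>m0\<close>.\<close>
 define th where "th = dl / 4 / (card T + 1)"
 have th: "0 < th" "th <= 1" using dl by (auto simp: th_def divide_simps)
 \<comment> \<open>Half of the increment \<open>dl * th / (2 * k)\<close> obtained below on one
   piece; the other half pays for the part of the piece not covered by subspaces.\<close>
 define c where "c = dl * th / (4 * k)"
 have c: "c > 0" using dl th k by (simp add: c_def)
 obtain d where d: "\<And>A. linefree K d A ==> real (card A) < (dl + c) * real K ^ d" using upper[OF c] by blast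
 have "\<forall>i\<in>set [0..<k]. i < k" by simp
 from insens_Int_partition[OF D k this c, of d]
 obtain p where p: "\<And>n S. n >= p ==> (\<forall>i\<in>set [0..<k]. insens k i n (S i)) ==>
  (\<exists>F. covers K d n (wd K n \<inter> (\<Inter>i\<in>set [0..<k]. S i)) F \<and>
   real (card (wd K n \<inter> (\<Inter>i\<in>set [0..<k]. S i) - cov K d F)) <= c * real K ^ n)"
  unfolding K_def by blast
 have "(\<lambda>m. (real k / real K) ^ m) \<longlonglongrightarrow> 0"
  by (rule LIMSEQ_realpow_zero) (auto simp: K_def)
 hence "eventually (\<lambda>m. (real k / real K) ^ m < dl * th / 8) sequentially"
  by (rule order_tendstoD(2)) (use dl th in auto)
 then obtain m2 where m2: "\<And>m. m >= m2 ==> (real k / real K) ^ m < dl * th / 8" by (auto simp: eventually_sequentially)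
 define m1 where "m1 = max m2 (max p m0)"
 have m1: "m1 >= p" "m1 >= m0" "m1 >= m2" by (auto simp: m1_def)
 have tau: "real k ^ m1 <= dl * th / 8 * real K ^ m1"
  using m2[OF m1(3)] Kpos[of m1] by (simp add: power_divide pos_divide_less_eq)
 obtain M where M: "\<And>col::nat list => nat. (\<And>x. col x < 2) ==>
  (\<exists>U c. tmpl k m1 M U \<and> (\<forall>x\<in>wd K m1. k \<in> set x --> col (tsub U x) = c))"
  using graham_rothschild_lines[OF k, of 2 m1] unfolding K_def by blast
 define et where "et = dl * th / 8"
 have "dl * th <= dl * 1" using dl th by (intro mult_left_mono) auto
 hence et: "0 < et" "et <= dl / 2" using dl th by (auto simp: et_def)
 define c' where "c' = et / (2 * real K ^ M)"
 have c': "c' > 0" using et Kpos by (simp add: c'_def)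
 obtain n where n: "\<And>A. linefree K n A ==> real (card A) < (dl + c') * real K ^ n" using upper[OF c'] by blast
 obtain A where A: "linefree K (M + n) A" "real (card A) >= (dl - c') * real K ^ (M + n)" using lower[OF c'] by blast
 have Asub: "A \<subseteq> wd K (M + n)" using A by (simp add: linefree_def)
 define s where "s = (\<lambda>x. {y\<in>wd K n. x @ y \<in> A})"
 \<comment> \<open>No section is denser than \<open>dl + c'\<close> and their mean is at least
   \<open>dl - c'\<close>. With \<open>K ^ M\<close> sections, one below \<open>dl - et\<close>
   would pull the mean down too far; this fixes \<open>c'\<close>.\<close>
 have s: "real (card (s x)) >= (dl - et) * real K ^ n" if x: "x \<in> wd K M" for x
 proof -
  have "(dl - c') * real K ^ (M + n) <= (\<Sum>x\<in>wd K M. real (card (s x)))"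
   using A(2) section_count(2)[OF Asub] by (simp add: s_def)
  also have "... = real (card (s x)) + (\<Sum>x\<in>wd K M - {x}. real (card (s x)))"
   by (rule sum.remove) (use x in auto)
  also have "(\<Sum>x\<in>wd K M - {x}. real (card (s x))) <= (\<Sum>x\<in>wd K M - {x}. (dl + c') * real K ^ n)"
   by (intro sum_mono less_imp_le n) (use linefree_section[OF A(1)] in "auto simp: s_def")
  also have "... = real (K ^ M - 1) * ((dl + c') * real K ^ n)"
   using x by (simp add: card_wd)
  also have "real (K ^ M - 1) = real K ^ M - 1" using K by (simp add: of_nat_diff)
  finally have "real (card (s x)) >= (dl - c') * real K ^ (M + n) - (real K ^ M - 1) * ((dl + c') * real K ^ n)" by simp
  also have "(dl - c') * real K ^ (M + n) - (real K ^ M - 1) * ((dl + c') * real K ^ n)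
   = (dl - 2 * real K ^ M * c' + c') * real K ^ n" by (simp add: power_add algebra_simps)
  finally have "(dl - 2 * real K ^ M * c' + c') * real K ^ n <= real (card (s x))" .
  moreover have "2 * real K ^ M * c' = et" using Kpos[of M] by (simp add: c'_def)
  ultimately have "(dl - et + c') * real K ^ n <= real (card (s x))" by simp
  moreover have "(dl - et) * real K ^ n <= (dl - et + c') * real K ^ n" using c' by (intro mult_right_mono) auto
  ultimately show ?thesis by linarith
 qed
 \<comment> \<open>For \<open>x\<close> containing \<open>k\<close>: many common suffixes put the
   first \<open>k\<close> points of the line through \<open>x\<close> into \<open>A\<close>.
   Graham-Rothschild makes this property constant on a subspace, and \<open>DHJ k\<close> provides
   one good word there.\<close>
 define good where "good = (\<lambda>x. real (card {y\<in>wd K n. \<forall>i<k. repl k i x @ y \<in> A}) >= th * real K ^ n)"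
 have "\<exists>U c. tmpl k m1 M U \<and> (\<forall>x\<in>wd K m1. k \<in> set x --> (if good (tsub U x) then 1 else 0) = (c::nat))"
  by (rule M) simp
 then obtain U c0 where U: "tmpl k m1 M U"
  and Uc: "\<And>x. x \<in> wd K m1 ==> k \<in> set x ==> (if good (tsub U x) then 1 else 0) = (c0::nat)" by blast
 have U': "tmpl K m1 M U" using U by (rule tmpl_mono) (simp add: K_def)
 define z0 where "z0 = replicate (m1 - m0) (0::nat)"
 have z0k: "z0 \<in> wd k (m1 - m0)" using k by (auto simp: z0_def wd_def)
 have z0: "z0 \<in> wd K (m1 - m0)" using wd_mono[OF _ z0k] by (simp add: K_def)
 have uz: "u @ z0 \<in> wd K m1" if "u \<in> wd K m0" for u using wd_append[OF that z0] m1(2) by simp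
 have kK: "w \<in> wd K j" if "w \<in> wd k j" for w j using wd_mono[OF _ that, of K] by (simp add: K_def)
 have "\<exists>x\<in>wd K m1. k \<in> set x \<and> good (tsub U x)"
 proof -
  define xx where "xx = (\<lambda>u. tsub U (u @ z0))"
  have xx: "xx u \<in> wd K M" if "u \<in> wd k m0" for u unfolding xx_def by (rule tsub_wd[OF U' uz[OF kK[OF that]]])
  define Y where "Y = {y\<in>wd K n. real (card {u\<in>wd k m0. xx u @ y \<in> A}) >= dl / 4 * real k ^ m0}"
  define Z where "Z = (\<lambda>t. {y\<in>wd K n. \<forall>i<k. xx (tsub t [i]) @ y \<in> A})"
  have "real k ^ m0 * (dl / 2 * real K ^ n) = (\<Sum>u\<in>wd k m0. dl / 2 * real K ^ n)" by (simp add: card_wd)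
  also have "... <= (\<Sum>u\<in>wd k m0. real (card (s (xx u))))"
  proof (rule sum_mono)
   fix u assume "u \<in> wd k m0"
   have "dl / 2 * real K ^ n <= (dl - et) * real K ^ n" using et by (intro mult_right_mono) auto
   thus "dl / 2 * real K ^ n <= real (card (s (xx u)))" using s[OF xx[OF \<open>u \<in> _\<close>]] by linarith
  qed
  also have "... = (\<Sum>y\<in>wd K n. real (card {u\<in>wd k m0. xx u @ y \<in> A}))"
   using double_count[of "wd k m0" "wd K n" "\<lambda>u y. xx u @ y \<in> A"] unfolding s_def of_nat_sum[symmetric] by simp
  also have "... <= real k ^ m0 * card Y + dl / 4 * real k ^ m0 * card (wd K n)"
   unfolding Y_def by (rule markov_count) (use dl card_wd_le in auto)
  finally have "real k ^ m0 * (dl / 4 * real K ^ n) <= real k ^ m0 * card Y" by (simp add: card_wd algebra_simps)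
  hence Y: "dl / 4 * real K ^ n <= card Y" using k by simp
  have "dl / 4 * real K ^ n > 0" using dl Kpos by simp
  hence "Y ~= {}" using Y by (metis card.empty linorder_not_less of_nat_0)
  moreover have "Y \<subseteq> (\<Union>t\<in>T. Z t)"
  proof
   fix y assume y: "y \<in> Y"
   then obtain t where "tmpl k 1 m0 t" "\<forall>i<k. tsub t [i] \<in> {u\<in>wd k m0. xx u @ y \<in> A}"
    using m0[of "{u\<in>wd k m0. xx u @ y \<in> A}"] by (auto simp: Y_def)
   thus "y \<in> (\<Union>t\<in>T. Z t)" using y by (auto simp: T_def Z_def Y_def)
  qed
  ultimately obtain t where t: "t \<in> T" "card Y <= card T * card (Z t)"
   using pigeonhole_cover[OF finT, of Y Z] by (auto simp: Y_def Z_def)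
  have "dl / 4 * real K ^ n <= real (card T * card (Z t))" using Y of_nat_mono[OF t(2), where 'a = real] by linarith
  also have "... <= (card T + 1) * card (Z t)" by simp
  finally have Zt: "real (card (Z t)) >= th * real K ^ n" by (simp add: th_def field_simps)
  have t': "tmpl k 1 m0 t" using t by (simp add: T_def)
  have t'': "tmpl K 1 m0 t" using t' by (rule tmpl_mono) (simp add: K_def)
  define x where "x = tsub t [k] @ z0"
  have kw: "[k] \<in> wd K 1" by (simp add: wd_def K_def)
  have x: "x \<in> wd K m1" unfolding x_def by (rule uz[OF tsub_wd[OF t'' kw]])
  have kx: "k \<in> set x" using in_set_tsub[OF t', of "[k]"] by (simp add: x_def)
  have "repl k i (tsub U x) = xx (tsub t [i])" if "i < k" for i
  proof -
   have "repl k i (tsub U x) = tsub U (repl k i x)" using repl_tsub[OF U] x by (simp add: K_def)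
   also have "repl k i x = tsub t (repl k i [k]) @ repl k i z0"
    unfolding x_def repl_append using repl_tsub[OF t', of "[k]"] kw by (simp add: K_def)
   also have "repl k i z0 = z0" by (rule repl_id) (use k in "auto simp: z0_def")
   finally show ?thesis by (simp add: xx_def repl_def)
  qed
  hence "{y\<in>wd K n. \<forall>i<k. repl k i (tsub U x) @ y \<in> A} = Z t" by (auto simp: Z_def)
  hence "good (tsub U x)" using Zt by (simp add: good_def)
  with x kx show ?thesis by blast
 qed
 hence c01: "c0 = 1" using Uc by force
 have all_good: "good (tsub U x)" if x: "x \<in> wd K m1" "k \<in> set x" for x
 proof (rule ccontr)
  assume "\<not> good (tsub U x)"
  hence "0 = c0" using Uc[OF x] by (simp only: if_False)
  with c01 show False by simp
 qed

 define B where "B = (\<lambda>y. {x\<in>wd K m1. tsub U x @ y \<in> A})"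
 define E where "E = (\<lambda>y. {x\<in>wd K m1. \<forall>i<k. repl k i x \<in> B y})"
 have replK: "repl k i x \<in> wd K m1" if "i < k" "x \<in> wd K m1" for i x using repl_wd'[of i k x m1] that by (simp add: K_def)
 have sumB: "(\<Sum>y\<in>wd K n. real (card (B y))) >= real K ^ m1 * ((dl - et) * real K ^ n)"
 proof -
  have "real K ^ m1 * ((dl - et) * real K ^ n) = (\<Sum>x\<in>wd K m1. (dl - et) * real K ^ n)" by (simp add: card_wd)
  also have "... <= (\<Sum>x\<in>wd K m1. real (card (s (tsub U x))))" by (intro sum_mono s tsub_wd[OF U'])
  also have "... = (\<Sum>y\<in>wd K n. real (card (B y)))"
   using double_count[of "wd K m1" "wd K n" "\<lambda>u y. tsub U u @ y \<in> A"] unfolding s_def B_def of_nat_sum[symmetric] by simp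
  finally show ?thesis .
 qed
 have sumE: "(\<Sum>y\<in>wd K n. real (card (E y))) >= (real K ^ m1 - real k ^ m1) * (th * real K ^ n)"
 proof -
  have "wd k m1 \<subseteq> wd K m1" using kK by blast
  hence "real (card (wd K m1 - wd k m1)) = real K ^ m1 - real k ^ m1"
   by (subst card_Diff_subset) (auto simp: card_wd of_nat_diff power_mono K_def)
  hence "(real K ^ m1 - real k ^ m1) * (th * real K ^ n) = (\<Sum>x\<in>wd K m1 - wd k m1. th * real K ^ n)" by simp
  also have "... <= (\<Sum>x\<in>wd K m1 - wd k m1. real (card {y\<in>wd K n. \<forall>i<k. repl k i x \<in> B y}))"
  proof (rule sum_mono)
   fix x assume x: "x \<in> wd K m1 - wd k m1"
   hence "k \<in> set x" using wd_Suc_letter[of x k m1] by (auto simp: K_def)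
   hence "good (tsub U x)" using all_good x by blast
   moreover have "{y\<in>wd K n. \<forall>i<k. repl k i x \<in> B y} = {y\<in>wd K n. \<forall>i<k. repl k i (tsub U x) @ y \<in> A}"
    using repl_tsub[OF U, of x] replK[of _ x] x by (auto simp: B_def K_def)
   ultimately show "th * real K ^ n <= real (card {y\<in>wd K n. \<forall>i<k. repl k i x \<in> B y})" by (simp add: good_def)
  qed
  also have "... <= (\<Sum>x\<in>wd K m1. real (card {y\<in>wd K n. \<forall>i<k. repl k i x \<in> B y}))" by (intro sum_mono2) auto
  also have "... = (\<Sum>y\<in>wd K n. real (card (E y)))"
   using double_count[of "wd K m1" "wd K n" "\<lambda>x y. \<forall>i<k. repl k i x \<in> B y"] unfolding E_def of_nat_sum[symmetric] by simp
  finally show ?thesis .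
 qed
 \<comment> \<open>One suffix must serve both counts, hence the average of a weighted sum; the
   weight \<open>dl\<close> is the one that occurs in \<open>key\<close>.\<close>
 have "\<exists>y\<in>wd K n. real (card (B y)) + dl * real (card (E y)) >= real K ^ m1 * (dl - et) + dl * th * (real K ^ m1 - real k ^ m1)"
 proof (rule exists_ge_average)
  have "replicate n 0 \<in> wd K n" by (auto simp: wd_def K_def)
  thus "wd K n ~= {}" by blast
  have E1: "dl * (\<Sum>y\<in>wd K n. real (card (E y))) >= dl * ((real K ^ m1 - real k ^ m1) * (th * real K ^ n))"
   using sumE dl by (intro mult_left_mono) auto
  have "(real K ^ m1 * (dl - et) + dl * th * (real K ^ m1 - real k ^ m1)) * card (wd K n)
   = real K ^ m1 * ((dl - et) * real K ^ n) + dl * ((real K ^ m1 - real k ^ m1) * (th * real K ^ n))"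
   unfolding card_wd of_nat_power by algebra
  also have "... <= (\<Sum>y\<in>wd K n. real (card (B y))) + dl * (\<Sum>y\<in>wd K n. real (card (E y)))"
   by (rule add_mono[OF sumB E1])
  also have "... = (\<Sum>y\<in>wd K n. real (card (B y)) + dl * real (card (E y)))"
   by (simp only: sum.distrib sum_distrib_left)
  finally show "(real K ^ m1 * (dl - et) + dl * th * (real K ^ m1 - real k ^ m1)) * card (wd K n)
    <= (\<Sum>y\<in>wd K n. real (card (B y)) + dl * real (card (E y)))" .
 qed simp
 then obtain y where y: "y \<in> wd K n"
  and ybig: "real (card (B y)) + dl * real (card (E y)) >= real K ^ m1 * (dl - et) + dl * th * (real K ^ m1 - real k ^ m1)" by blast
 define b where "b = B y"
 define e where "e = E y"
 have b_lf: "linefree K m1 b" unfolding b_def B_def by (rule linefree_section2[OF A(1) y U'])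
 have bsub: "b \<subseteq> wd K m1" using b_lf by (simp add: linefree_def)
 have finb: "finite b" using bsub by (rule finite_subset) simp
 have esub: "e \<subseteq> wd K m1" by (auto simp: e_def E_def)
 \<comment> \<open>A common word containing \<open>k\<close> would complete a line in
   \<open>b\<close>. The words without \<open>k\<close> are negligible by
   \<open>tau\<close>.\<close>
 have "b \<inter> e \<subseteq> wd k m1"
 proof
  fix x assume x: "x \<in> b \<inter> e"
  show "x \<in> wd k m1"
  proof (cases "k \<in> set x")
   case True
   have "x \<in> wd (Suc k) m1" using x esub by (auto simp: K_def)
   from word_line[OF this True] obtain t where t: "tmpl K 1 m1 t" "tsub t [k] = x" "\<forall>i<k. tsub t [i] = repl k i x"
    unfolding K_def by blast
   have "tsub t [i] \<in> b" if "i < K" for i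
   proof (cases "i = k")
    case True thus ?thesis using t x by simp
   next
    case False
    hence "i < k" using that by (simp add: K_def)
    thus ?thesis using t x by (auto simp: e_def E_def b_def)
   qed
   thus ?thesis using b_lf t(1) by (auto simp: linefree_def)
  next
   case False
   thus ?thesis using wd_Suc_letter[of x k m1] x esub by (auto simp: K_def)
  qed
 qed
 hence be: "real (card (b \<inter> e)) <= real k ^ m1" by (rule card_wd_le)
 have "card b = card (b \<inter> e) + card (b - e)" using card_Int_Diff[OF finb] .
 hence bdiff: "real (card b) = real (card (b \<inter> e)) + real (card (b - e))" by simp
 have ediff: "real (card (wd K m1 - e)) = real K ^ m1 - real (card e)"
  using esub card_wd_le[OF esub] card_mono[OF finite_wd esub] by (subst card_Diff_subset) (auto simp: card_wd of_nat_diff finite_subset[OF esub])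
 have dt1: "dl * th * real k ^ m1 <= real k ^ m1"
 proof -
  have "dl * th <= 1" using \<open>dl * th <= dl * 1\<close> dl by linarith
  thus ?thesis by (intro mult_left_le_one_le) (use dl th in auto)
 qed
 have key: "real (card (b - e)) - dl * real (card (wd K m1 - e)) >= dl * th / 2 * real K ^ m1"
 proof -
  have "real (card (b - e)) - dl * real (card (wd K m1 - e)) >= real (card b) - real k ^ m1 - dl * real K ^ m1 + dl * real (card e)"
   using bdiff be unfolding ediff by (simp add: algebra_simps)
  also have "real (card b) - real k ^ m1 - dl * real K ^ m1 + dl * real (card e)
   >= dl * th * real K ^ m1 - dl * th * real k ^ m1 - et * real K ^ m1 - real k ^ m1"
   using ybig by (simp add: b_def e_def algebra_simps)
  also have "dl * th * real K ^ m1 - dl * th * real k ^ m1 - et * real K ^ m1 - real k ^ m1 >= dl * th / 2 * real K ^ m1"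
  proof -
   have "dl * th * real K ^ m1 >= 0" using dl th by simp
   thus ?thesis using tau dt1 unfolding et_def by (simp add: algebra_simps)
  qed
  finally show ?thesis by simp
 qed
 \<comment> \<open>The words outside \<open>e\<close>, sorted by the first letter \<open>j\<close>
   whose replacement leaves \<open>b\<close>. Each condition involves one \<open>repl k i\<close>
   only, so \<open>S j\<close> is an intersection of insensitive sets.\<close>
 define S where "S = (\<lambda>j. {x\<in>wd K m1. (\<forall>i<j. repl k i x \<in> b) \<and> repl k j x \<notin> b})"
 have Sunion: "wd K m1 - e = (\<Union>j<k. S j)"
 proof (intro equalityI subsetI)
  fix x assume x: "x \<in> wd K m1 - e"
  hence ex: "\<exists>i. i < k \<and> repl k i x \<notin> b" by (auto simp: e_def E_def b_def)
  define j where "j = (LEAST i. i < k \<and> repl k i x \<notin> b)"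
  have j: "j < k" "repl k j x \<notin> b" using LeastI_ex[OF ex] by (auto simp: j_def)
  have "repl k i x \<in> b" if "i < j" for i using not_less_Least[of i "\<lambda>i. i < k \<and> repl k i x \<notin> b"] that j(1) unfolding j_def[symmetric] by simp
  thus "x \<in> (\<Union>j<k. S j)" using j x by (auto simp: S_def)
 next
  fix x assume "x \<in> (\<Union>j<k. S j)"
  thus "x \<in> wd K m1 - e" by (auto simp: S_def e_def E_def b_def)
 qed
 have Sdisj: "S i \<inter> S j = {}" if "i ~= j" for i j
  using that by (auto simp: S_def) (metis linorder_neqE_nat)
 have finS: "finite (S j)" for j by (simp add: S_def)
 have cardS: "card (wd K m1 - e) = (\<Sum>j<k. card (S j))"
  unfolding Sunion by (rule card_UN_disjoint) (use finS Sdisj in auto)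
 have "b - e = (\<Union>j<k. b \<inter> S j)" using Sunion bsub by blast
 hence cardb: "card (b - e) = (\<Sum>j<k. card (b \<inter> S j))"
  using card_UN_disjoint[of "{..<k}" "\<lambda>j. b \<inter> S j"] finS Sdisj by fastforce
 have "\<exists>j\<in>{..<k}. real (card (b \<inter> S j)) - dl * real (card (S j)) >= dl * th / (2 * k) * real K ^ m1"
 proof (rule exists_ge_average)
  have "0 \<in> {..<k}" using k by simp
  thus "{..<k} ~= {}" by blast
  show "dl * th / (2 * k) * real K ^ m1 * card {..<k} <= (\<Sum>j<k. real (card (b \<inter> S j)) - dl * real (card (S j)))"
   using key k unfolding cardS cardb by (simp add: sum_subtractf sum_distrib_left)
 qed simp
 then obtain j where j: "j < k" and Sj: "real (card (b \<inter> S j)) - dl * real (card (S j)) >= dl * th / (2 * k) * real K ^ m1" by auto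
 define S' where "S' = (\<lambda>i. if i < j then {x\<in>wd K m1. repl k i x \<in> b} else if i = j then {x\<in>wd K m1. repl k j x \<notin> b} else wd K m1)"
 have idem: "repl k i (repl k i w) = repl k i w" if "i < k" for i w using that by (simp add: repl_def)
 have "\<forall>i\<in>set [0..<k]. insens k i m1 (S' i)"
 proof
  fix i assume "i \<in> set [0..<k]"
  hence "i < k" by simp
  thus "insens k i m1 (S' i)" using replK idem by (auto simp: insens_def S'_def K_def)
 qed
 moreover have SjS': "wd K m1 \<inter> (\<Inter>i\<in>set [0..<k]. S' i) = S j"
 proof (intro equalityI subsetI)
  fix x assume "x \<in> wd K m1 \<inter> (\<Inter>i\<in>set [0..<k]. S' i)"
  hence x: "x \<in> wd K m1" and xS: "\<And>i. i < k ==> x \<in> S' i" by simp_all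
  have "repl k i x \<in> b" if "i < j" for i
  proof -
   have "i < k" using that j by simp
   from xS[OF this] that show ?thesis by (simp add: S'_def)
  qed
  moreover have "repl k j x \<notin> b" using xS[OF j] by (simp add: S'_def)
  ultimately show "x \<in> S j" using x by (simp add: S_def)
 next
  fix x assume x: "x \<in> S j"
  hence "x \<in> S' i" for i by (simp add: S_def S'_def)
  thus "x \<in> wd K m1 \<inter> (\<Inter>i\<in>set [0..<k]. S' i)" using x by (simp add: S_def)
 qed
 ultimately obtain F where F: "covers K d m1 (S j) F" and Fc: "real (card (S j - cov K d F)) <= c * real K ^ m1"
  using p[OF m1(1), of S'] by metis
 have Ft: "tmpl K d m1 t" if "t \<in> F" for t using F that by (simp add: covers_def)
 have finF: "finite F" by (rule covers_finite[OF F])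
 have covS: "cov K d F \<subseteq> S j" by (rule cov_subset[OF F])
 have "card (b \<inter> S j) <= card ((b \<inter> cov K d F) \<union> (S j - cov K d F))"
  by (rule card_mono) (use finb finS in auto)
 also have "... <= card (b \<inter> cov K d F) + card (S j - cov K d F)" by (rule card_Un_le)
 finally have 1: "real (card (b \<inter> S j)) <= real (card (b \<inter> cov K d F)) + c * real K ^ m1" using Fc by linarith
 have 2: "dl * real (card (cov K d F)) <= dl * real (card (S j))"
  using dl card_mono[OF finS covS] by (intro mult_left_mono) auto
 have cc: "dl * th / (2 * k) = 2 * c" by (simp add: c_def)
 have 3: "real (card (b \<inter> cov K d F)) >= dl * real (card (cov K d F)) + c * real K ^ m1"
  using 1 2 Sj unfolding cc by linarith
 have ct: "card (b \<inter> tsub t ` wd K d) = card {v\<in>wd K d. tsub t v \<in> b}" if "t \<in> F" for t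
 proof -
  have "b \<inter> tsub t ` wd K d = tsub t ` {v\<in>wd K d. tsub t v \<in> b}" by auto
  moreover have "inj_on (tsub t) {v\<in>wd K d. tsub t v \<in> b}"
   by (rule inj_on_subset[OF tsub_inj[OF Ft[OF that]]]) auto
  ultimately show ?thesis by (simp add: card_image)
 qed
 have "card (b \<inter> cov K d F) <= (\<Sum>t\<in>F. card (b \<inter> tsub t ` wd K d))"
  unfolding cov_def Int_UN_distrib by (rule card_UN_le[OF finF])
 also have "... = (\<Sum>t\<in>F. card {v\<in>wd K d. tsub t v \<in> b})" by (rule sum.cong[OF refl ct])
 finally have "real (card (b \<inter> cov K d F)) <= (\<Sum>t\<in>F. real (card {v\<in>wd K d. tsub t v \<in> b}))"
  using of_nat_mono[where 'a = real] by fastforce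
 also have "... <= (\<Sum>t\<in>F. (dl + c) * real K ^ d)"
  by (intro sum_mono less_imp_le d linefree_pullback[OF b_lf Ft])
 also have "... = (dl + c) * real (card (cov K d F))" by (simp add: card_cov[OF F])
 finally have 4: "real (card (b \<inter> cov K d F)) <= (dl + c) * real (card (cov K d F))" .
 have "F ~= {}"
 proof
  assume "F = {}"
  hence "real (card (b \<inter> cov K d F)) = 0" "real (card (cov K d F)) = 0" by (simp_all add: cov_def)
  moreover have "c * real K ^ m1 > 0" using c Kpos by simp
  ultimately show False using 3 by simp
 qed
 then obtain t where t: "t \<in> F" by blast
 have strict: "real (card (b \<inter> cov K d F)) < (dl + c) * real (card (cov K d F))"
 proof -
  have "real (card (b \<inter> cov K d F)) <= (\<Sum>t\<in>F. real (card {v\<in>wd K d. tsub t v \<in> b}))" by fact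
  also have "... < (\<Sum>t\<in>F. (dl + c) * real K ^ d)"
   by (rule sum_strict_mono[OF finF]) (use t in blast, intro d linefree_pullback[OF b_lf Ft])
  also have "... = (dl + c) * real (card (cov K d F))" by (simp add: card_cov[OF F])
  finally show ?thesis .
 qed
 have "c * real (card (cov K d F)) <= c * real K ^ m1"
  using c covS card_wd_le[of "cov K d F" K m1] by (intro mult_left_mono) (auto simp: S_def)
 with strict 3 show False by (simp add: algebra_simps)
qed

theorem density_hales_jewett: "k >= 1 ==> DHJ k"
proof (induction k rule: nat_induct_at_least)
 case base
 show ?case unfolding DHJ_def
 proof (intro allI impI, rule exI[of _ 1], intro allI impI)
  fix dl :: real and A assume dl: "0 < dl" and A: "A \<subseteq> wd 1 1" "dl * real 1 ^ 1 <= real (card A)"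
  have "wd 1 1 = {[0]}" by (auto simp: wd_def length_Suc_conv)
  moreover have "A ~= {}" using A(2) dl by auto
  ultimately have "[0] \<in> A" using A(1) by auto
  thus "\<exists>t. tmpl 1 1 1 t \<and> (\<forall>i<1. tsub t [i] \<in> A)"
   by (intro exI[of _ "[Inr 0]"]) (auto simp: tmpl_def tsub_def)
 qed
next
 case (Suc n)
 thus ?case by (intro DHJ_step)
qed

section \<open>Progressions in dense functions on residues\<close>

definition avg :: "nat => (int => real) => real" where
 "avg N g = (\<Sum>t\<in>{0..<int N}. g t) / real N"

definition periodic :: "nat => (int => real) => bool" where
 "periodic N g \<longleftrightarrow> (\<forall>t. g (t + int N) = g t)"

lemma periodic_mult: assumes "periodic N g" shows "g (t + int N * m) = g t"
proof (induction m rule: int_induct[of _ 0])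
 case (step1 i)
 have "g (t + int N * (i + 1)) = g ((t + int N * i) + int N)" by (simp add: algebra_simps)
 with step1 assms show ?case by (simp add: periodic_def)
next
 case (step2 i)
 have "g (t + int N * i) = g ((t + int N * (i - 1)) + int N)" by (simp add: algebra_simps)
 with step2 assms show ?case by (simp add: periodic_def)
qed simp

lemma periodic_mod: assumes "periodic N g" shows "g (t mod int N) = g t"
 using periodic_mult[OF assms, of "t mod int N" "t div int N"] by (simp add: mod_mult_div_eq)

lemma periodic_cong: assumes "periodic N g" "s mod int N = t mod int N" shows "g s = g t"
 using periodic_mod[OF assms(1)] assms(2) by metis

lemma avg_reindex:
 assumes g: "periodic N g" and N: "N > 0" and inj: "\<And>s t. (ff s - ff t) mod int N = 0 ==> (s - t) mod int N = 0"
 shows "avg N (\<lambda>t. g (ff t)) = avg N g"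
proof -
 have "inj_on (\<lambda>t. ff t mod int N) {0..<int N}"
 proof (rule inj_onI)
  fix s t assume st: "s \<in> {0..<int N}" "t \<in> {0..<int N}" "ff s mod int N = ff t mod int N"
  hence "(ff s - ff t) mod int N = 0" by (simp add: mod_diff_cong[of "ff s" _ "ff t" "ff t" "ff t"] mod_eq_dvd_iff dvd_eq_mod_eq_0[symmetric])
  from inj[OF this] have "int N dvd s - t" by (simp add: dvd_eq_mod_eq_0)
  hence "s mod int N = t mod int N" by (simp add: mod_eq_dvd_iff)
  thus "s = t" using st by simp
 qed
 moreover have "(\<lambda>t. ff t mod int N) ` {0..<int N} \<subseteq> {0..<int N}" using N by auto
 ultimately have bij: "bij_betw (\<lambda>t. ff t mod int N) {0..<int N} {0..<int N}"
  by (simp add: bij_betw_def endo_inj_surj)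
 have "(\<Sum>t\<in>{0..<int N}. g (ff t)) = (\<Sum>t\<in>{0..<int N}. g (ff t mod int N))"
  by (simp add: periodic_mod[OF g])
 also have "... = (\<Sum>t\<in>{0..<int N}. g t)" by (rule sum.reindex_bij_betw[OF bij])
 finally show ?thesis by (simp add: avg_def)
qed

lemma avg_shift: "periodic N g ==> N > 0 ==> avg N (\<lambda>t. g (t + c)) = avg N g"
 by (rule avg_reindex) auto

lemma avg_scale: assumes "periodic N g" "N > 0" "coprime a (int N)" shows "avg N (\<lambda>t. g (a * t)) = avg N g"
proof (rule avg_reindex[OF assms(1,2)])
 fix s t assume "(a * s - a * t) mod int N = 0"
 hence "int N dvd a * (s - t)" by (simp add: dvd_eq_mod_eq_0 right_diff_distrib)
 hence "int N dvd s - t" using assms(3) by (simp add: coprime_commute coprime_dvd_mult_right_iff)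
 thus "(s - t) mod int N = 0" by (simp add: dvd_eq_mod_eq_0)
qed

lemma avg_mono: "(\<And>t. f t <= g t) ==> avg N f <= avg N g"
 unfolding avg_def by (intro divide_right_mono sum_mono) auto

lemma avg_const: "N > 0 ==> avg N (\<lambda>_. c) = c" by (simp add: avg_def)

definition av :: "nat => nat => ((nat => int) => real) => (nat => int) => real" where
 "av N i F x = avg N (\<lambda>t. F (x(i := t)))"

text \<open>Only the listed coordinates are averaged; all others stay free as parameters, so
  averages can be nested and permuted.\<close>

definition ex :: "nat => nat list => ((nat => int) => real) => (nat => int) => real" where
 "ex N is F = foldr (av N) is F"

definition ign :: "nat => ((nat => int) => 'a) => bool" where
 "ign i F \<longleftrightarrow> (\<forall>x t. F (x(i := t)) = F x)"

definition per :: "nat => nat => ((nat => int) => real) => bool" where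
 "per N i F \<longleftrightarrow> (\<forall>x. F (x(i := x i + int N)) = F x)"

lemma ex_Nil [simp]: "ex N [] F = F" and ex_Cons [simp]: "ex N (i # is) F = av N i (ex N is F)"
 by (simp_all add: ex_def)

lemma ex_append: "ex N (is @ js) F = ex N is (ex N js F)" by (simp add: ex_def)

lemma av_commute: "av N i (av N j F) = av N j (av N i F)"
proof (cases "i = j")
 case False
 show ?thesis
 proof
  fix x
  have "(\<Sum>t\<in>{0..<int N}. \<Sum>s\<in>{0..<int N}. F (x(i := t, j := s))) = (\<Sum>s\<in>{0..<int N}. \<Sum>t\<in>{0..<int N}. F (x(i := t, j := s)))"
   by (rule sum.swap)
  thus "av N i (av N j F) x = av N j (av N i F) x"
   using False by (simp add: av_def avg_def fun_upd_twist sum_divide_distrib[symmetric])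
 qed
qed simp

lemma av_ex_commute: "av N i (ex N is F) = ex N is (av N i F)"
 by (induction "is") (simp_all add: av_commute[of N i])

lemma ex_perm: "mset is = mset js ==> ex N is F = ex N js F"
proof (induction "is" arbitrary: js)
 case (Cons i "is")
 hence "i \<in> set js" by (metis list.set_intros(1) set_mset_mset)
 then obtain xs ys where js: "js = xs @ i # ys" by (meson split_list)
 hence "mset is = mset (xs @ ys)" using Cons.prems by simp
 from Cons.IH[OF this] show ?case by (simp add: js ex_append av_ex_commute)
qed simp

lemma av_mono: "(\<And>x. F x <= G x) ==> av N i F x <= av N i G x"
 unfolding av_def by (rule avg_mono)

lemma ex_mono: "(\<And>x. F x <= G x) ==> ex N is F x <= ex N is G x"
 by (induction "is" arbitrary: x) (auto intro: av_mono)

lemma av_add: "av N i (\<lambda>x. F x + G x) = (\<lambda>x. av N i F x + av N i G x)"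
 by (rule ext) (simp add: av_def avg_def sum.distrib add_divide_distrib)

lemma av_cmult: "av N i (\<lambda>x. c * F x) = (\<lambda>x. c * av N i F x)"
 by (rule ext) (simp add: av_def avg_def sum_distrib_left[symmetric])

lemma ex_add: "ex N is (\<lambda>x. F x + G x) = (\<lambda>x. ex N is F x + ex N is G x)"
 by (induction "is") (simp_all add: av_add)

lemma ex_cmult: "ex N is (\<lambda>x. c * F x) = (\<lambda>x. c * ex N is F x)"
 by (induction "is") (simp_all add: av_cmult)

lemma ex_minus: "ex N is (\<lambda>x. - F x) = (\<lambda>x. - ex N is F x)"
 using ex_cmult[of N "is" "-1" F] by simp

lemma ex_diff: "ex N is (\<lambda>x. F x - G x) = (\<lambda>x. ex N is F x - ex N is G x)"
 using ex_add[of N "is" F "\<lambda>x. - G x"] by (simp add: ex_minus)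

lemma ex_const: "N > 0 ==> ex N is (\<lambda>x. c) = (\<lambda>x. c)"
 by (induction "is") (auto simp: av_def avg_const)

lemma ex_sum: "N > 0 ==> ex N is (\<lambda>x. \<Sum>a\<in>A. F a x) = (\<lambda>x. \<Sum>a\<in>A. ex N is (F a) x)"
 by (induction A rule: infinite_finite_induct) (simp_all add: ex_const ex_add)

lemma ex_nonneg: "(\<And>x. 0 <= F x) ==> N > 0 ==> 0 <= ex N is F x"
 using ex_mono[of "\<lambda>_. 0" F N "is" x] by (simp add: ex_const)

lemma ex_abs: "N > 0 ==> \<bar>ex N is F x\<bar> <= ex N is (\<lambda>x. \<bar>F x\<bar>) x"
 using ex_mono[of F "\<lambda>x. \<bar>F x\<bar>" N "is" x] ex_mono[of "\<lambda>x. - F x" "\<lambda>x. \<bar>F x\<bar>" N "is" x]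
 by (simp add: ex_minus abs_le_iff)

lemma ignD: "ign i F ==> F (x(i := t)) = F x" by (simp add: ign_def)

lemma av_ign: "ign i F ==> N > 0 ==> av N i F = F"
 by (rule ext) (simp add: av_def ignD avg_const)

lemma av_mult_ign: "ign i G ==> av N i (\<lambda>x. G x * F x) = (\<lambda>x. G x * av N i F x)"
 by (rule ext) (simp add: av_def avg_def ignD sum_distrib_left[symmetric])

lemma ign_av: "ign i (av N i F)" by (simp add: ign_def av_def)

lemma ign_av': "ign j F ==> ign j (av N i F)"
 by (cases "i = j") (auto simp: ign_av, simp add: ign_def av_def fun_upd_twist)

lemma ign_ex: "ign j F \<or> j \<in> set is ==> ign j (ex N is F)"
 by (induction "is") (auto intro: ign_av ign_av')

lemma ign_binop: "ign i F ==> ign i G ==> ign i (\<lambda>x. f (F x) (G x))" by (simp add: ign_def)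

lemma ign_unop: "ign i F ==> ign i (\<lambda>x. f (F x))" by (simp add: ign_def)

lemma ex_mult_ign: "(\<And>i. i \<in> set is ==> ign i G) ==> ex N is (\<lambda>x. G x * F x) = (\<lambda>x. G x * ex N is F x)"
 by (induction "is") (simp_all add: av_mult_ign)

lemma av_shift:
 assumes F: "per N i F" and c: "ign i c" and N: "N > 0"
 shows "av N i (\<lambda>x. F (x(i := x i + c x))) = av N i F"
proof
 fix x
 have "periodic N (\<lambda>t. F (x(i := t)))" unfolding periodic_def
 proof
  fix t show "F (x(i := t + int N)) = F (x(i := t))"
   using F[unfolded per_def, rule_format, of "x(i := t)"] by simp
 qed
 from avg_shift[OF this N, of "c x"] show "av N i (\<lambda>x. F (x(i := x i + c x))) x = av N i F x"
  by (simp add: av_def ignD[OF c])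
qed

lemma av_scale:
 assumes F: "per N i F" and N: "N > 0" and a: "coprime a (int N)"
 shows "av N i (\<lambda>x. F (x(i := a * x i))) = av N i F"
proof
 fix x
 have "periodic N (\<lambda>t. F (x(i := t)))" unfolding periodic_def
 proof
  fix t show "F (x(i := t + int N)) = F (x(i := t))"
   using F[unfolded per_def, rule_format, of "x(i := t)"] by simp
 qed
 from avg_scale[OF this N a] show "av N i (\<lambda>x. F (x(i := a * x i))) x = av N i F x"
  by (simp add: av_def)
qed

lemma ex_one_form:
 assumes N: "N > 0" and g: "periodic N g" and u: "u \<in> set is" and C: "ign u C"
 shows "ex N is (\<lambda>x. g (x u + C x)) y = avg N g"
proof -
 have "mset is = mset (remove1 u is @ [u])" using u by simp
 hence "ex N is (\<lambda>x. g (x u + C x)) = ex N (remove1 u is) (av N u (\<lambda>x. g (x u + C x)))"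
  by (simp only: ex_perm[of "is" "remove1 u is @ [u]"] ex_append ex_Cons ex_Nil)
 also have "av N u (\<lambda>x. g (x u + C x)) = (\<lambda>x. avg N g)"
  by (rule ext) (simp add: av_def ignD[OF C] avg_shift[OF g N])
 finally show ?thesis by (simp add: ex_const[OF N])
qed

definition av2 :: "nat => (int => int => real) => real" where
 "av2 N h = avg N (\<lambda>d. avg N (\<lambda>a. h a d))"

text \<open>Averaging over \<open>u\<close> first removes \<open>C\<close>, which may therefore
  still depend on \<open>v\<close>; \<open>D\<close> must be free of both variables.\<close>

lemma ex_two_forms:
 assumes N: "N > 0" and h1: "\<And>d. periodic N (\<lambda>a. h a d)" and h2: "\<And>a. periodic N (\<lambda>d. h a d)"
  and uv: "u ~= v" "u \<in> set is" "v \<in> set is" "distinct is"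
  and C: "ign u C" and D: "ign u D" "ign v D"
 shows "ex N is (\<lambda>x. h (x u + C x) (x v + D x)) y = av2 N h"
proof -
 define rest where "rest = remove1 u (remove1 v is)"
 have "count (mset is) u > 0" "count (mset is) v > 0" using uv by simp_all
 hence "mset is = mset (rest @ [v, u])"
  using uv(1) by (auto simp: rest_def multiset_eq_iff)
 hence "ex N is (\<lambda>x. h (x u + C x) (x v + D x)) = ex N rest (av N v (av N u (\<lambda>x. h (x u + C x) (x v + D x))))"
  by (simp add: ex_perm[of "is" "rest @ [v, u]"] ex_append)
 also have "av N u (\<lambda>x. h (x u + C x) (x v + D x)) = (\<lambda>x. avg N (\<lambda>a. h a (x v + D x)))"
  by (rule ext) (use uv avg_shift[OF h1 N] in "simp add: av_def ignD[OF C] ignD[OF D(1)]")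
 also have "av N v (\<lambda>x. avg N (\<lambda>a. h a (x v + D x))) = (\<lambda>x. av2 N h)"
 proof
  fix x
  have "periodic N (\<lambda>d. avg N (\<lambda>a. h a d))" using h2 by (simp add: periodic_def avg_def)
  from avg_shift[OF this N, of "D x"] show "av N v (\<lambda>x. avg N (\<lambda>a. h a (x v + D x))) x = av2 N h"
   by (simp add: av_def ignD[OF D(2)] av2_def)
 qed
 finally show ?thesis by (simp add: ex_const[OF N])
qed

lemma ign_sum_notin: "u \<notin> f ` J ==> ign u (\<lambda>x. \<Sum>j\<in>J. x (f j) * c j)"
 unfolding ign_def by (intro allI sum.cong refl) auto

text \<open>A random \<open>x\<close> sends the word \<open>w\<close> to the residue
  \<open>x 0\<close> plus the sum of the \<open>x (Suc j) * w ! j\<close>. Every single word is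
  uniformly distributed, so on average a positive proportion of words hits the level set, and then
  density Hales-Jewett finds a line in it. A line is an arithmetic progression with jointly uniform
  first term and difference; one of the finitely many lines must therefore be hit with positive
  frequency.\<close>

theorem varnavides:
 assumes k: "k >= 1" and dl: "dl > 0"
 shows "\<exists>c>0. \<forall>N>0. \<forall>f. periodic N f \<and> (\<forall>x. 0 <= f x \<and> f x <= 1) \<and> avg N f >= dl -->
  av2 N (\<lambda>a d. \<Prod>i<k. f (a + int i * d)) >= c"
proof -
 have dl4: "dl / 4 > 0" using dl by simp
 obtain n where n: "\<And>A. A \<subseteq> wd k n ==> real (card A) >= dl / 4 * real k ^ n ==>
  (\<exists>t. tmpl k 1 n t \<and> (\<forall>i<k. tsub t [i] \<in> A))" using density_hales_jewett[OF k] dl4 unfolding DHJ_def by blast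
 define T where "T = {t. tmpl k 1 n t}"
 have finT: "finite T" unfolding T_def by (rule finite_tmpl)
 define c where "c = (dl / 2) ^ k * (dl / 4 / (card T + 1))"
 have c: "c > 0" using dl by (simp add: c_def)
 have "av2 N (\<lambda>a d. \<Prod>i<k. f (a + int i * d)) >= c"
  if N: "N > 0" and f: "periodic N f" and f01: "\<And>x. 0 <= f x" "\<And>x. f x <= 1" and fd: "avg N f >= dl" for N f
 proof -
  \<comment> \<open>Passing to the level set of \<open>dl / 2\<close> keeps density
    \<open>dl / 2\<close> and costs the factor \<open>(dl / 2) ^ k\<close> at the end.\<close>
  define S where "S = (\<lambda>t. if f t >= dl / 2 then 1 else 0 :: real)"
  have S01: "0 <= S t" "S t <= 1" for t by (auto simp: S_def)
  have Sper: "periodic N S" using f by (simp add: periodic_def S_def)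
  have "avg N f <= avg N (\<lambda>t. S t + dl / 2)"
   using f01 dl by (intro avg_mono) (auto simp: S_def add_increasing2)
  also have "... = avg N S + dl / 2" using N by (simp add: avg_def sum.distrib add_divide_distrib)
  finally have Sd: "avg N S >= dl / 2" using fd by simp
  define val where "val = (\<lambda>w x. x 0 + (\<Sum>j<n. x (Suc j) * int (w ! j)))"
  define y0 :: "nat => int" where "y0 = (\<lambda>_. 0)"
  define E where "E = (\<lambda>F. ex N [0..<Suc n] F y0)"
  have E_val: "ex N [0..<Suc n] (\<lambda>x. S (val w x)) y0 = avg N S" for w
   unfolding val_def
   by (rule ex_one_form[OF N Sper]) (auto intro: ign_sum_notin)
  define P where "P = (\<lambda>t x. \<Prod>i<k. S (val (tsub t [i]) x))"
  have P0: "0 <= P t x" for t x unfolding P_def by (intro prod_nonneg) (auto simp: S01)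
  have kn: "real k ^ n > 0" using k by simp
  have pt: "(1 / real k ^ n) * (\<Sum>w\<in>wd k n. S (val w x)) <= dl / 4 + (\<Sum>t\<in>T. P t x)" for x
  proof -
   define A where "A = {w\<in>wd k n. S (val w x) = 1}"
   have SA: "(\<Sum>w\<in>wd k n. S (val w x)) = real (card A)"
   proof -
    have "(\<Sum>w\<in>wd k n. S (val w x)) = (\<Sum>w\<in>A. S (val w x))"
     by (rule sum.mono_neutral_right) (auto simp: A_def S_def)
    thus ?thesis by (simp add: A_def)
   qed
   show ?thesis
   proof (cases "real (card A) >= dl / 4 * real k ^ n")
    case True
    from n[OF _ this] obtain t where t: "t \<in> T" "\<forall>i<k. tsub t [i] \<in> A" by (auto simp: A_def T_def)
    hence "P t x = 1" by (simp add: P_def A_def)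
    moreover have "P t x <= (\<Sum>t\<in>T. P t x)" by (rule member_le_sum[OF t(1) P0 finT])
    moreover have "(1 / real k ^ n) * real (card A) <= 1" using card_wd_le[of A k n] kn by (simp add: A_def)
    ultimately show ?thesis using dl SA by simp
   next
    case False
    hence "(1 / real k ^ n) * real (card A) <= dl / 4" using kn by (simp add: field_simps)
    moreover have "0 <= (\<Sum>t\<in>T. P t x)" by (intro sum_nonneg P0)
    ultimately show ?thesis unfolding SA by linarith
   qed
  qed
  have "dl / 2 <= E (\<lambda>x. (1 / real k ^ n) * (\<Sum>w\<in>wd k n. S (val w x)))"
   unfolding E_def ex_cmult ex_sum[OF N] E_val using Sd kn by (simp add: card_wd)
  also have "... <= E (\<lambda>x. dl / 4 + (\<Sum>t\<in>T. P t x))" unfolding E_def by (rule ex_mono) (rule pt)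
  also have "... = dl / 4 + (\<Sum>t\<in>T. E (P t))" unfolding E_def by (simp add: ex_add ex_sum[OF N] ex_const[OF N])
  finally have sumT: "dl / 4 <= (\<Sum>t\<in>T. E (P t))" by simp
  have "\<exists>t\<in>T. E (P t) >= dl / 4 / (card T + 1)"
  proof (rule exists_ge_average[OF finT])
   show "T ~= {}" using sumT dl by auto
   have "dl / 4 / (card T + 1) * card T <= dl / 4 / (card T + 1) * (card T + 1)" using dl by (intro mult_left_mono) auto
   also have "... = dl / 4"
   proof -
    have "real (card T + 1) ~= 0" by (simp only: of_nat_eq_0_iff)
    thus ?thesis by (subst times_divide_eq_left) (rule nonzero_mult_div_cancel_right)
   qed
   finally show "dl / 4 / (card T + 1) * card T <= (\<Sum>t\<in>T. E (P t))" using sumT by linarith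
  qed
  then obtain t where t: "t \<in> T" and Et: "E (P t) >= dl / 4 / (card T + 1)" by blast
  have t': "tmpl k 1 n t" using t by (simp add: T_def)
  have "Inr 0 \<in> set t" using t' by (simp add: tmpl_def)
  \<comment> \<open>A place of the wildcard: its variable \<open>x (Suc v)\<close> enters the common
    difference with coefficient 1 and the first term not at all.\<close>
  then obtain v where v: "v < n" "t ! v = Inr 0" using t' by (metis in_set_conv_nth tmpl_length)
  define C where "C = (\<lambda>x. \<Sum>j<n. x (Suc j) * (case t ! j of Inl c => int c | Inr _ => 0))"
  define D where "D = (\<lambda>x. \<Sum>j\<in>{..<n} - {v}. x (Suc j) * (case t ! j of Inl c => 0 | Inr _ => (1::int)))"
  have tsub_t: "int (tsub t [i] ! j) = (case t ! j of Inl c => int c | Inr _ => 0) + int i * (case t ! j of Inl c => 0 | Inr _ => 1)"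
   if "j < n" for i j
  proof -
   have jl: "j < length t" using that t' by (simp add: tmpl_length)
   hence "t ! j \<in> set t" by simp
   hence "t ! j = Inr l ==> l = 0" for l using t' by (auto simp: tmpl_def)
   thus ?thesis using jl by (auto simp: tsub_def split: sum.split)
  qed
  have val_t: "val (tsub t [i]) x = (x 0 + C x) + int i * (x (Suc v) + D x)" for i x
  proof -
   have "(\<Sum>j<n. x (Suc j) * int (tsub t [i] ! j)) = (\<Sum>j<n. x (Suc j) * (case t ! j of Inl c => int c | Inr _ => 0)
     + int i * (x (Suc j) * (case t ! j of Inl c => 0 | Inr _ => 1)))"
    by (intro sum.cong refl) (simp add: tsub_t algebra_simps)
   also have "... = C x + int i * (\<Sum>j<n. x (Suc j) * (case t ! j of Inl c => 0 | Inr _ => 1))"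
    by (simp add: C_def sum.distrib sum_distrib_left)
   also have "(\<Sum>j<n. x (Suc j) * (case t ! j of Inl c => 0 | Inr _ => 1)) = x (Suc v) + D x"
    unfolding D_def by (subst sum.remove[of _ v]) (use v in auto)
   finally show ?thesis by (simp add: val_def)
  qed
  define h where "h = (\<lambda>a d. \<Prod>i<k. S (a + int i * d))"
  have "E (P t) = av2 N h"
  proof -
   have "P t = (\<lambda>x. h (x 0 + C x) (x (Suc v) + D x))" by (rule ext) (simp add: P_def h_def val_t)
   moreover have "ex N [0..<Suc n] (\<lambda>x. h (x 0 + C x) (x (Suc v) + D x)) y0 = av2 N h"
   proof (rule ex_two_forms[OF N])
    show "periodic N (\<lambda>a. h a d)" for d
     using Sper by (simp add: periodic_def h_def add.assoc add.commute[of "int N"]) (simp add: add.assoc[symmetric])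
    show "periodic N (\<lambda>d. h a d)" for a
     using periodic_mult[OF Sper] by (simp add: periodic_def h_def distrib_left add.assoc[symmetric] mult.commute[of _ "int N"])
    show "ign 0 C" "ign 0 D" "ign (Suc v) D" unfolding C_def D_def by (auto intro!: ign_sum_notin)
   qed (use v in auto)
   ultimately show ?thesis by (simp add: E_def)
  qed
  hence hbig: "av2 N h >= dl / 4 / (card T + 1)" using Et by simp
  have "c <= (dl / 2) ^ k * av2 N h" unfolding c_def using hbig dl by (intro mult_left_mono) auto
  also have "... = av2 N (\<lambda>a d. (dl / 2) ^ k * h a d)" by (simp add: av2_def avg_def sum_distrib_left)
  also have "... <= av2 N (\<lambda>a d. \<Prod>i<k. f (a + int i * d))"
   unfolding av2_def
  proof (intro avg_mono)
   fix d a
   have "(dl / 2) ^ k * h a d = (\<Prod>i<k. dl / 2 * S (a + int i * d))" by (simp only: h_def prod.distrib prod_constant card_lessThan)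
   also have "... <= (\<Prod>i<k. f (a + int i * d))" using dl f01 by (intro prod_mono) (auto simp: S_def)
   finally show "(dl / 2) ^ k * h a d <= (\<Prod>i<k. f (a + int i * d))" .
  qed
  finally show ?thesis .
 qed
 with c show ?thesis by blast
qed

section \<open>A relative Szemeredi theorem\<close>

text \<open>The Cauchy-Schwarz inequality as a statement about the discriminant.\<close>

lemma quad_disc:
 fixes a b e :: real
 assumes "\<And>s. s\<^sup>2 * a - 2 * s * e + b >= 0" "a >= 0"
 shows "e\<^sup>2 <= a * b"
proof (cases "a = 0")
 case True
 have "e = 0"
 proof (rule ccontr)
  assume "e ~= 0"
  thus False using assms(1)[of "(b + 1) / (2 * e)"] True by simp
 qed
 with True show ?thesis by simp
next
 case False
 hence a: "a > 0" using assms(2) by simp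
 have "(e / a)\<^sup>2 * a - 2 * (e / a) * e + b = b - e\<^sup>2 / a" using a by (simp add: field_simps power2_eq_square)
 with assms(1)[of "e / a"] have "e\<^sup>2 / a <= b" by simp
 thus ?thesis using a by (simp add: field_simps)
qed

lemma ex_weighted_CS:
 assumes N: "N > 0" and b: "\<And>x. \<bar>b x\<bar> <= B x"
 shows "(ex N is (\<lambda>x. b x * G x) y)\<^sup>2 <= ex N is B y * ex N is (\<lambda>x. B x * (G x)\<^sup>2) y"
proof -
 have B0: "B x >= 0" for x using b[of x] by linarith
 define e where "e = ex N is (\<lambda>x. B x * \<bar>G x\<bar>) y"
 have e: "\<bar>ex N is (\<lambda>x. b x * G x) y\<bar> <= e"
 proof -
  have "\<bar>ex N is (\<lambda>x. b x * G x) y\<bar> <= ex N is (\<lambda>x. \<bar>b x * G x\<bar>) y" by (rule ex_abs[OF N])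
  also have "... <= e" unfolding e_def
   by (rule ex_mono) (simp add: abs_mult mult_right_mono b)
  finally show ?thesis .
 qed
 have "e\<^sup>2 <= ex N is B y * ex N is (\<lambda>x. B x * (G x)\<^sup>2) y"
 proof (rule quad_disc)
  fix s :: real
  have "0 <= ex N is (\<lambda>x. B x * (s - \<bar>G x\<bar>)\<^sup>2) y" by (rule ex_nonneg[OF _ N]) (simp add: B0)
  also have "(\<lambda>x. B x * (s - \<bar>G x\<bar>)\<^sup>2) = (\<lambda>x. (s\<^sup>2 * B x - (2 * s) * (B x * \<bar>G x\<bar>)) + B x * (G x)\<^sup>2)"
   by (rule ext) (simp add: power2_diff algebra_simps)
  also have "ex N is ... y = s\<^sup>2 * ex N is B y - 2 * s * e + ex N is (\<lambda>x. B x * (G x)\<^sup>2) y"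
   unfolding ex_add ex_diff ex_cmult e_def ..
  finally show "0 <= s\<^sup>2 * ex N is B y - 2 * s * e + ex N is (\<lambda>x. B x * (G x)\<^sup>2) y" .
  show "0 <= ex N is B y" by (rule ex_nonneg[OF B0 N])
 qed
 moreover have "(ex N is (\<lambda>x. b x * G x) y)\<^sup>2 <= e\<^sup>2" using e by (metis power2_abs abs_ge_zero power_mono)
 ultimately show ?thesis by linarith
qed

section \<open>Cauchy-Schwarz by doubling variables\<close>

definition dbl :: "nat => nat => ((nat => int) => real) => (nat => int) => real" where
 "dbl k j F x = F x * F (x(j := x (j + k)))"

lemma avg_mult_right: "avg N (\<lambda>t. g t * c) = avg N g * c"
 by (simp add: avg_def sum_distrib_right[symmetric])

text \<open>A product of two averages over \<open>j\<close> is one average over two independent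
  variables, the second of which is stored in coordinate \<open>j + k\<close>.\<close>

lemma av_product_copy:
 assumes k: "k > 0" and P: "ign (j + k) P" and Q: "ign (j + k) Q"
 shows "av N (j + k) (av N j (\<lambda>x. P x * Q (x(j := x (j + k))))) = (\<lambda>x. av N j P x * av N j Q x)"
proof
 fix x
 have 1: "av N j (\<lambda>x. P x * Q (x(j := x (j + k)))) = (\<lambda>x. Q (x(j := x (j + k))) * av N j P x)"
  by (rule ext) (use k in "simp add: av_def avg_def sum_distrib_right[symmetric] mult.commute")
 have "av N (j + k) (\<lambda>x. Q (x(j := x (j + k))) * av N j P x) x
   = avg N (\<lambda>t. Q (x(j := t)) * av N j P x)"
  unfolding av_def[of N "j + k"]
  using ignD[OF ign_av'[OF P]] ignD[OF Q] k by (simp add: fun_upd_twist)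
 also have "... = av N j P x * av N j Q x"
  unfolding avg_mult_right by (simp add: av_def mult.commute)
 finally show "av N (j + k) (av N j (\<lambda>x. P x * Q (x(j := x (j + k))))) x = av N j P x * av N j Q x"
  by (simp only: 1)
qed

definition Ex :: "nat => nat => ((nat => int) => real) => real" where
 "Ex N k F = ex N [0..<2 * k] F (\<lambda>_. 0)"

lemma Ex_split:
 assumes "j < 2 * k"
 shows "Ex N k F = ex N (remove1 j [0..<2 * k]) (av N j F) (\<lambda>_. 0)"
proof -
 have "mset [0..<2 * k] = mset (remove1 j [0..<2 * k] @ [j])" using assms by simp
 thus ?thesis unfolding Ex_def
  by (simp only: ex_perm[of "[0..<2 * k]" "remove1 j [0..<2 * k] @ [j]"] ex_append ex_Cons ex_Nil)
qed

lemma Ex_mono: "(\<And>x. F x <= G x) ==> Ex N k F <= Ex N k G" unfolding Ex_def by (rule ex_mono)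
lemma Ex_add: "Ex N k (\<lambda>x. F x + G x) = Ex N k F + Ex N k G" by (simp add: Ex_def ex_add)
lemma Ex_diff: "Ex N k (\<lambda>x. F x - G x) = Ex N k F - Ex N k G" by (simp add: Ex_def ex_diff)
lemma Ex_cmult: "Ex N k (\<lambda>x. c * F x) = c * Ex N k F" by (simp add: Ex_def ex_cmult)
lemma Ex_const: "N > 0 ==> Ex N k (\<lambda>x. c) = c" by (simp add: Ex_def ex_const)
lemma Ex_sum: "N > 0 ==> Ex N k (\<lambda>x. \<Sum>a\<in>A. F a x) = (\<Sum>a\<in>A. Ex N k (F a))" by (simp add: Ex_def ex_sum)
lemma Ex_abs: "N > 0 ==> \<bar>Ex N k F\<bar> <= Ex N k (\<lambda>x. \<bar>F x\<bar>)" unfolding Ex_def by (rule ex_abs)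
lemma Ex_nonneg: "(\<And>x. 0 <= F x) ==> N > 0 ==> 0 <= Ex N k F" unfolding Ex_def by (rule ex_nonneg)
lemma Ex_CS: "N > 0 ==> (\<And>x. \<bar>b x\<bar> <= B x) ==> (Ex N k (\<lambda>x. b x * G x))\<^sup>2 <= Ex N k B * Ex N k (\<lambda>x. B x * (G x)\<^sup>2)"
 unfolding Ex_def by (rule ex_weighted_CS)

lemma Ex_av: assumes "j < 2 * k" "N > 0" shows "Ex N k (av N j F) = Ex N k F"
 unfolding Ex_split[OF assms(1)] av_ign[OF ign_av assms(2)] ..

lemma Ex_mult_av:
 assumes "j < 2 * k" "N > 0" "ign j G"
 shows "Ex N k (\<lambda>x. G x * av N j F x) = Ex N k (\<lambda>x. G x * F x)"
 using Ex_av[OF assms(1,2), of "\<lambda>x. G x * F x"] by (simp add: av_mult_ign[OF assms(3)])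

lemma Ex_product_copy:
 assumes j: "j < k" and N: "N > 0" and P: "ign (j + k) P" and Q: "ign (j + k) Q" and f: "ign j f" "ign (j + k) f"
 shows "Ex N k (\<lambda>x. f x * (av N j P x * av N j Q x)) = Ex N k (\<lambda>x. f x * (P x * Q (x(j := x (j + k)))))"
proof -
 have k: "k > 0" and jk: "j + k < 2 * k" "j < 2 * k" using j by auto
 have "Ex N k (\<lambda>x. f x * (P x * Q (x(j := x (j + k))))) = Ex N k (av N (j + k) (av N j (\<lambda>x. f x * (P x * Q (x(j := x (j + k)))))))"
  by (simp add: Ex_av[OF jk(1) N] Ex_av[OF jk(2) N])
 also have "... = Ex N k (\<lambda>x. f x * (av N j P x * av N j Q x))"
  by (simp only: av_mult_ign[OF f(1)] av_mult_ign[OF f(2)] av_product_copy[OF k P Q])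
 finally show ?thesis by simp
qed

text \<open>As \<open>b\<close> does not see variable \<open>j\<close>, the other factor may be
  averaged over it before Cauchy-Schwarz is applied with weight \<open>B\<close>; expanding the
  square doubles \<open>j\<close>.\<close>

lemma CS_step:
 assumes j: "j < k" and N: "N > 0" and b: "\<And>x. \<bar>b x\<bar> <= B x" "ign j b" and B: "ign j B" "ign (j + k) B"
  and R: "ign (j + k) R"
 shows "(Ex N k (\<lambda>x. b x * R x))\<^sup>2 <= Ex N k B * Ex N k (\<lambda>x. B x * dbl k j R x)"
proof -
 have j2: "j < 2 * k" using j by simp
 have "Ex N k (\<lambda>x. b x * R x) = Ex N k (\<lambda>x. b x * av N j R x)"
  by (rule Ex_mult_av[OF j2 N b(2), symmetric])
 hence "(Ex N k (\<lambda>x. b x * R x))\<^sup>2 <= Ex N k B * Ex N k (\<lambda>x. B x * (av N j R x)\<^sup>2)"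
  using Ex_CS[OF N b(1), where k = k and G = "av N j R"] by simp
 also have "Ex N k (\<lambda>x. B x * (av N j R x)\<^sup>2) = Ex N k (\<lambda>x. B x * dbl k j R x)"
  unfolding power2_eq_square dbl_def by (rule Ex_product_copy[OF j N R R B])
 finally show ?thesis .
qed

text \<open>What remains after one Cauchy-Schwarz step for each listed variable: every step doubles
  \<open>h\<close> and the later weights and multiplies in the weight of the eliminated
  factor.\<close>

fun fin :: "nat => nat list => ((nat => int) => real) => (nat => (nat => int) => real) => (nat => int) => real" where
 "fin k [] h B = h"
| "fin k (j # js) h B = fin k js (\<lambda>x. B j x * dbl k j h x) (\<lambda>i. dbl k j (B i))"

text \<open>Each weight has bounded mean in the doubled form in which its own step meets it.\<close>

fun okB :: "nat => nat => real => nat list => (nat => (nat => int) => real) => bool" where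
 "okB N k C [] B = True"
| "okB N k C (j # js) B = (Ex N k (B j) <= C \<and> okB N k C js (\<lambda>i. dbl k j (B i)))"

lemma ign_dbl: "ign i F ==> i ~= j ==> i ~= j + k ==> ign i (dbl k j F)"
 unfolding ign_def dbl_def by (simp add: fun_upd_twist[of i j])

lemma dbl_mult: "dbl k j (\<lambda>x. F x * G x) = (\<lambda>x. dbl k j F x * dbl k j G x)"
 by (rule ext) (simp add: dbl_def)

lemma dbl_prod: "dbl k j (\<lambda>x. \<Prod>i\<in>I. F i x) = (\<lambda>x. \<Prod>i\<in>I. dbl k j (F i) x)"
 by (rule ext) (simp add: dbl_def prod.distrib)

lemma ign_prod: "(\<And>i. i \<in> I ==> ign l (F i)) ==> ign l (\<lambda>x. \<Prod>i\<in>I. F i x :: real)"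
 unfolding ign_def by (intro allI prod.cong refl) auto

text \<open>The factor \<open>b i\<close> is eliminated by Cauchy-Schwarz in the variable
  \<open>i\<close>, on which it does not depend. Each of the steps squares the left-hand
  side.\<close>

lemma CS_iterated:
 assumes N: "N > 0" and C: "C >= 0"
 shows "distinct js ==> (\<And>j. j \<in> set js ==> j < k) ==>
  (\<And>i x. i \<in> set js ==> \<bar>b i x\<bar> <= B i x) ==>
  (\<And>i. i \<in> set js ==> ign i (b i)) ==> (\<And>i. i \<in> set js ==> ign i (B i)) ==>
  (\<And>i l. i \<in> set js ==> l \<in> set js ==> ign (l + k) (b i)) ==> (\<And>i l. i \<in> set js ==> l \<in> set js ==> ign (l + k) (B i)) ==>
  (\<And>l. l \<in> set js ==> ign (l + k) h) ==> okB N k C js B ==>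
  \<bar>Ex N k (\<lambda>x. h x * (\<Prod>i\<in>set js. b i x))\<bar> ^ (2 ^ length js) <= C ^ (2 ^ length js - 1) * \<bar>Ex N k (fin k js h B)\<bar>"
proof (induction js arbitrary: h b B)
 case Nil
 thus ?case by simp
next
 case (Cons j js)
 define R where "R = (\<lambda>x. h x * (\<Prod>i\<in>set js. b i x))"
 define n where "n = length js"
 have jjs: "j \<notin> set js" and djs: "distinct js" and jk: "j < k" using Cons.prems(1,2) by auto
 have hR: "(\<lambda>x. h x * (\<Prod>i\<in>set (j # js). b i x)) = (\<lambda>x. b j x * R x)"
  using jjs by (simp add: R_def mult_ac)
 have R: "ign (j + k) R"
  unfolding R_def by (intro ign_binop[of _ _ _ "(*)"] ign_prod Cons.prems(6,8)) auto
 have "(Ex N k (\<lambda>x. b j x * R x))\<^sup>2 <= Ex N k (B j) * Ex N k (\<lambda>x. B j x * dbl k j R x)"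
  by (rule CS_step[OF jk N _ _ _ _ R]) (use Cons.prems in auto)
 also have "... <= C * \<bar>Ex N k (\<lambda>x. B j x * dbl k j R x)\<bar>"
 proof -
  have "0 <= Ex N k (B j)" using Cons.prems(3)[of j] by (intro Ex_nonneg[OF _ N]) (auto intro: order_trans[OF abs_ge_zero])
  moreover have "Ex N k (B j) <= C" using Cons.prems(9) by simp
  ultimately show ?thesis by (meson abs_ge_self abs_ge_zero mult_mono order_trans mult_left_mono mult_right_mono)
 qed
 also have "(\<lambda>x. B j x * dbl k j R x) = (\<lambda>x. (B j x * dbl k j h x) * (\<Prod>i\<in>set js. dbl k j (b i) x))"
  unfolding R_def dbl_mult dbl_prod by (simp add: mult_ac)
 finally have 1: "(Ex N k (\<lambda>x. h x * (\<Prod>i\<in>set (j # js). b i x)))\<^sup>2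
   <= C * \<bar>Ex N k (\<lambda>x. (B j x * dbl k j h x) * (\<Prod>i\<in>set js. dbl k j (b i) x))\<bar>"
  unfolding hR .
 have ne: "l ~= j" "l + k ~= j" "l + k ~= j + k" "l ~= j + k" if "l \<in> set js" for l
  using that jjs jk Cons.prems(2)[of l] by auto
 have 2: "\<bar>Ex N k (\<lambda>x. (B j x * dbl k j h x) * (\<Prod>i\<in>set js. dbl k j (b i) x))\<bar> ^ (2 ^ n)
  <= C ^ (2 ^ n - 1) * \<bar>Ex N k (fin k (j # js) h B)\<bar>"
  unfolding n_def fin.simps
 proof (rule Cons.IH[OF djs])
  show "\<bar>dbl k j (b i) x\<bar> <= dbl k j (B i) x" if "i \<in> set js" for i x
   unfolding dbl_def abs_mult using Cons.prems(3)[of i] that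
   by (intro mult_mono) (auto intro: order_trans[OF abs_ge_zero])
  show "ign (l + k) (\<lambda>x. B j x * dbl k j h x)" if "l \<in> set js" for l
   using that ne[OF that] by (intro ign_binop[of _ _ _ "(*)"] ign_dbl Cons.prems(7,8)) auto
 qed (use Cons.prems ne in "auto intro!: ign_dbl")
 have "2 ^ length (j # js) = 2 * (2::nat) ^ n" by (simp add: n_def)
 hence "\<bar>Ex N k (\<lambda>x. h x * (\<Prod>i\<in>set (j # js). b i x))\<bar> ^ (2 ^ length (j # js))
  = ((Ex N k (\<lambda>x. h x * (\<Prod>i\<in>set (j # js). b i x)))\<^sup>2) ^ (2 ^ n)" by (simp only: power_mult power2_abs)
 also have "... <= (C * \<bar>Ex N k (\<lambda>x. (B j x * dbl k j h x) * (\<Prod>i\<in>set js. dbl k j (b i) x))\<bar>) ^ (2 ^ n)"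
  by (rule power_mono[OF 1]) simp
 also have "... <= C ^ (2 ^ n) * (C ^ (2 ^ n - 1) * \<bar>Ex N k (fin k (j # js) h B)\<bar>)"
  unfolding power_mult_distrib using 2 C by (intro mult_left_mono) auto
 also have "... = C ^ (2 ^ length (j # js) - 1) * \<bar>Ex N k (fin k (j # js) h B)\<bar>"
 proof -
  have "2 ^ length (j # js) - 1 = 2 ^ n + (2 ^ n - 1 :: nat)" by (simp add: n_def)
  thus ?thesis by (simp only: power_add mult.assoc)
 qed
 finally show ?case .
qed

text \<open>A vertex of the cube of doubled variables: \<open>A\<close> lists those evaluated at
  their second copy.\<close>

definition copy :: "nat => nat set => (nat => int) => nat => int" where
 "copy k A x = (\<lambda>l. if l \<in> A then x (l + k) else x l)"

lemma copy_insert: "j \<notin> A ==> j < k ==> A \<subseteq> {..<k} ==> (copy k A x)(j := copy k A x (j + k)) = copy k (insert j A) x"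
 by (rule ext) (auto simp: copy_def)

lemma prod_Pow_insert:
 assumes "finite J" "j \<notin> J"
 shows "(\<Prod>A\<in>Pow (insert j J). f A) = (\<Prod>A\<in>Pow J. f A * f (insert j A) :: real)"
proof -
 have "(\<Prod>A\<in>Pow (insert j J). f A) = (\<Prod>A\<in>Pow J. f A) * (\<Prod>A\<in>insert j ` Pow J. f A)"
  unfolding Pow_insert by (rule prod.union_disjoint) (use assms in auto)
 also have "(\<Prod>A\<in>insert j ` Pow J. f A) = (\<Prod>A\<in>Pow J. f (insert j A))"
  by (rule prod.reindex_cong[of "insert j"]) (use assms in "auto simp: inj_on_def")
 finally show ?thesis by (simp add: prod.distrib)
qed

lemma fin_closed:
 shows "distinct js ==> (\<And>j. j \<in> set js ==> j < k) ==>
  fin k js h B x = (\<Prod>A\<in>Pow (set js). h (copy k A x)) * (\<Prod>i\<in>set js. \<Prod>A\<in>Pow (set js - {i}). B i (copy k A x))"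
proof (induction js arbitrary: h B)
 case Nil
 thus ?case by (simp add: copy_def)
next
 case (Cons j js)
 have jjs: "j \<notin> set js" and djs: "distinct js" and jk: "j < k" and js: "\<And>i. i \<in> set js ==> i < k" using Cons.prems by auto
 have dc: "dbl k j F (copy k A x) = F (copy k A x) * F (copy k (insert j A) x)" if "A \<subseteq> set js" for A F
 proof -
  have "j \<notin> A" "A \<subseteq> {..<k}" using that jjs js by auto
  from copy_insert[OF this(1) jk this(2)] show ?thesis by (simp add: dbl_def)
 qed
 have "fin k (j # js) h B x = (\<Prod>A\<in>Pow (set js). B j (copy k A x) * dbl k j h (copy k A x)) *
  (\<Prod>i\<in>set js. \<Prod>A\<in>Pow (set js - {i}). dbl k j (B i) (copy k A x))"
  using Cons.IH[OF djs js] by simp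
 also have "(\<Prod>A\<in>Pow (set js). B j (copy k A x) * dbl k j h (copy k A x))
  = (\<Prod>A\<in>Pow (set js). B j (copy k A x)) * (\<Prod>A\<in>Pow (set (j # js)). h (copy k A x))"
  using prod_Pow_insert[of "set js" j "\<lambda>A. h (copy k A x)"] jjs by (simp add: prod.distrib dc)
 also have "(\<Prod>i\<in>set js. \<Prod>A\<in>Pow (set js - {i}). dbl k j (B i) (copy k A x))
  = (\<Prod>i\<in>set js. \<Prod>A\<in>Pow (set (j # js) - {i}). B i (copy k A x))"
 proof (rule prod.cong[OF refl])
  fix i assume i: "i \<in> set js"
  have "set (j # js) - {i} = insert j (set js - {i})" using i jjs by auto
  thus "(\<Prod>A\<in>Pow (set js - {i}). dbl k j (B i) (copy k A x)) = (\<Prod>A\<in>Pow (set (j # js) - {i}). B i (copy k A x))"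
   using prod_Pow_insert[of "set js - {i}" j "\<lambda>A. B i (copy k A x)"] jjs dc by (auto intro!: prod.cong)
 qed
 also have "(\<Prod>A\<in>Pow (set js). B j (copy k A x)) = (\<Prod>A\<in>Pow (set (j # js) - {j}). B j (copy k A x))"
  using jjs by simp
 finally show ?case using jjs by (simp add: mult_ac)
qed

section \<open>Linear forms and the hypergraph of progressions\<close>

definition form :: "nat => (nat => int) => (nat => int) => int" where
 "form k c x = (\<Sum>l<2 * k. c l * x l)"

text \<open>Any two of the forms each contain a variable that the other does not.\<close>

definition good_forms :: "nat => (nat \<times> nat set) set => (nat \<times> nat set => nat => int) => bool" where
 "good_forms k S c \<longleftrightarrow> finite S \<and> card S <= k * 2 ^ k \<and> (\<forall>s\<in>S. \<forall>l. \<bar>c s l\<bar> <= int k) \<and>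
  (\<forall>s\<in>S. \<exists>l<2 * k. c s l ~= 0) \<and> (\<forall>s\<in>S. \<forall>t\<in>S. s ~= t --> (\<exists>l<2 * k. c s l ~= 0 \<and> c t l = 0))"

text \<open>The index type \<open>nat \<times> nat set\<close> of the systems anticipates pairs of
  an edge and a cube vertex.\<close>

definition LF :: "nat => nat => (int => real) => real => bool" where
 "LF N k nv ep \<longleftrightarrow> (\<forall>S c. good_forms k S c --> \<bar>Ex N k (\<lambda>x. \<Prod>s\<in>S. nv (form k (c s) x)) - 1\<bar> <= ep)"

lemma good_forms_subset: "good_forms k S c ==> T \<subseteq> S ==> good_forms k T c"
 unfolding good_forms_def by (meson card_mono finite_subset le_trans subsetD)

lemma LF_mono: "LF N k nv ep ==> ep <= ep' ==> LF N k nv ep'"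
 unfolding LF_def by (meson order_trans)

text \<open>Expanding everything gives signed averages of products, each within \<open>ep\<close> of
  its sign. The signs cancel because at least one factor has the shape \<open>nv - 1\<close>, and
  only the at most \<open>2 ^ (k * 2 ^ k)\<close> errors survive.\<close>

lemma LF_signed:
 assumes LF: "LF N k nv ep" and gf: "good_forms k (S0 \<union> S1) c" and dis: "S0 \<inter> S1 = {}" and ne: "S0 ~= {}" and N: "N > 0"
 shows "\<bar>Ex N k (\<lambda>x. (\<Prod>s\<in>S0. nv (form k (c s) x) - 1) * (\<Prod>s\<in>S1. nv (form k (c s) x) + 1))\<bar> <= 2 ^ (k * 2 ^ k) * ep"
proof -
 define S where "S = S0 \<union> S1"
 define si :: "nat \<times> nat set => real" where "si = (\<lambda>s. if s \<in> S0 then - 1 else 1)"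
 have fin: "finite S" "finite S0" "finite S1" and card: "card S <= k * 2 ^ k"
  using gf by (auto simp: good_forms_def S_def)
 define ta where "ta = (\<lambda>X. \<Prod>s\<in>S - X. si s)"
 have ta: "\<bar>ta X\<bar> = 1" for X unfolding ta_def abs_prod by (rule prod.neutral) (auto simp: si_def)
 define w where "w = (\<lambda>s x. nv (form k (c s) x))"
 have "(\<Prod>s\<in>S0. w s x - 1) * (\<Prod>s\<in>S1. w s x + 1) = (\<Prod>s\<in>S. w s x + si s)" for x
 proof -
  have "(\<Prod>s\<in>S. w s x + si s) = (\<Prod>s\<in>S0. w s x + si s) * (\<Prod>s\<in>S1. w s x + si s)"
   unfolding S_def by (rule prod.union_disjoint[OF fin(2,3) dis])
  also have "(\<Prod>s\<in>S0. w s x + si s) = (\<Prod>s\<in>S0. w s x - 1)" by (rule prod.cong) (auto simp: si_def)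
  also have "(\<Prod>s\<in>S1. w s x + si s) = (\<Prod>s\<in>S1. w s x + 1)" by (rule prod.cong) (use dis in "auto simp: si_def")
  finally show ?thesis by simp
 qed
 also have "(\<Prod>s\<in>S. w s x + si s) = (\<Sum>X\<in>Pow S. ta X * (\<Prod>s\<in>X. w s x))" for x
  unfolding prod_add[OF fin(1)] ta_def by (simp add: mult.commute)
 finally have expand: "(\<lambda>x. (\<Prod>s\<in>S0. w s x - 1) * (\<Prod>s\<in>S1. w s x + 1)) = (\<lambda>x. \<Sum>X\<in>Pow S. ta X * (\<Prod>s\<in>X. w s x))"
  by (rule ext)
 have "0 = (\<Prod>s\<in>S. 1 + si s)" using ne fin by (auto simp: S_def si_def)
 also have "... = (\<Sum>X\<in>Pow S. ta X)" unfolding prod_add[OF fin(1)] ta_def by simp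
 finally have ta0: "(\<Sum>X\<in>Pow S. ta X) = 0" by simp
 have "Ex N k (\<lambda>x. (\<Prod>s\<in>S0. w s x - 1) * (\<Prod>s\<in>S1. w s x + 1)) = (\<Sum>X\<in>Pow S. ta X * Ex N k (\<lambda>x. \<Prod>s\<in>X. w s x))"
  unfolding expand Ex_sum[OF N] Ex_cmult ..
 also have "... = (\<Sum>X\<in>Pow S. ta X * (Ex N k (\<lambda>x. \<Prod>s\<in>X. w s x) - 1))"
  using ta0 by (simp add: right_diff_distrib sum_subtractf)
 finally have eq: "Ex N k (\<lambda>x. (\<Prod>s\<in>S0. w s x - 1) * (\<Prod>s\<in>S1. w s x + 1)) = (\<Sum>X\<in>Pow S. ta X * (Ex N k (\<lambda>x. \<Prod>s\<in>X. w s x) - 1))" .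
 have "\<bar>Ex N k (\<lambda>x. (\<Prod>s\<in>S0. w s x - 1) * (\<Prod>s\<in>S1. w s x + 1))\<bar> <= (\<Sum>X\<in>Pow S. \<bar>ta X * (Ex N k (\<lambda>x. \<Prod>s\<in>X. w s x) - 1)\<bar>)"
  unfolding eq by (rule sum_abs)
 also have "... <= (\<Sum>X\<in>Pow S. ep)"
 proof (rule sum_mono)
  fix X assume "X \<in> Pow S"
  hence "good_forms k X c" using good_forms_subset[OF gf] by (auto simp: S_def)
  thus "\<bar>ta X * (Ex N k (\<lambda>x. \<Prod>s\<in>X. w s x) - 1)\<bar> <= ep"
   using LF by (simp add: abs_mult ta LF_def w_def)
 qed
 also have "... = 2 ^ card S * ep" using fin by (simp add: card_Pow)
 also have "... <= 2 ^ (k * 2 ^ k) * ep"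
 proof -
  have "\<bar>Ex N k (\<lambda>x. \<Prod>s\<in>{}. nv (form k (c s) x)) - 1\<bar> <= ep"
   using LF good_forms_subset[OF gf, of "{}"] unfolding LF_def by blast
  hence "ep >= 0" by linarith
  thus ?thesis using card by (intro mult_right_mono power_increasing) auto
 qed
 finally show ?thesis by (simp add: w_def)
qed

lemma LF_upper:
 assumes LF: "LF N k nv ep" and gf: "good_forms k S c" and N: "N > 0" and ep: "ep <= 1"
 shows "Ex N k (\<lambda>x. \<Prod>s\<in>S. nv (form k (c s) x) + 1) <= 2 ^ (k * 2 ^ k) * 2"
proof -
 have fin: "finite S" and card: "card S <= k * 2 ^ k" using gf by (auto simp: good_forms_def)
 have "Ex N k (\<lambda>x. \<Prod>s\<in>S. nv (form k (c s) x) + 1) = (\<Sum>X\<in>Pow S. Ex N k (\<lambda>x. \<Prod>s\<in>X. nv (form k (c s) x)))"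
  unfolding prod_add[OF fin] by (simp add: Ex_sum[OF N])
 also have "... <= (\<Sum>X\<in>Pow S. 2)"
 proof (rule sum_mono)
  fix X assume "X \<in> Pow S"
  hence "\<bar>Ex N k (\<lambda>x. \<Prod>s\<in>X. nv (form k (c s) x)) - 1\<bar> <= ep"
   using LF good_forms_subset[OF gf] by (auto simp: LF_def)
  thus "Ex N k (\<lambda>x. \<Prod>s\<in>X. nv (form k (c s) x)) <= 2" using ep by linarith
 qed
 also have "... = 2 ^ card S * 2" using fin by (simp add: card_Pow)
 also have "... <= 2 ^ (k * 2 ^ k) * 2" using card by (intro mult_right_mono power_increasing) auto
 finally show ?thesis .
qed

text \<open>The coefficients of \<open>psi k i\<close> evaluated at the cube vertex
  \<open>A\<close>; variable \<open>i\<close> drops out by itself.\<close>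

definition cf :: "nat => nat \<times> nat set => nat => int" where
 "cf k = (\<lambda>(i, A) l. if l < k then (if l \<in> A then 0 else int l - int i) else if l < 2 * k \<and> l - k \<in> A then int (l - k) - int i else 0)"

text \<open>The \<open>i\<close>-th form does not involve \<open>x i\<close>, and as
  \<open>i\<close> varies the values form a progression of difference
  \<open>- (\<Sum>l<k. x l)\<close>. Progressions thus become simplices of a
  \<open>k\<close>-partite hypergraph whose \<open>i\<close>-th edge omits vertex
  \<open>i\<close>.\<close>

definition psi :: "nat => nat => (nat => int) => int" where
 "psi k i x = (\<Sum>l<k. (int l - int i) * x l)"

lemma sum_double: fixes f :: "nat => int" shows "(\<Sum>l<2 * k. f l) = (\<Sum>l<k. f l + f (l + k) :: int)"
proof -
 have "(\<Sum>l<2 * k. f l) = (\<Sum>l<k. f l) + (\<Sum>l\<in>{k..<2 * k}. f l)"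
  by (simp add: sum.atLeastLessThan_concat[of 0 k "2 * k" f, symmetric] lessThan_atLeast0)
 also have "(\<Sum>l\<in>{k..<2 * k}. f l) = (\<Sum>l<k. f (l + k))"
  using sum.shift_bounds_nat_ivl[of f 0 k k] by (simp add: lessThan_atLeast0 mult_2)
 finally show ?thesis by (simp add: sum.distrib)
qed

lemma form_cf: "form k (cf k (i, A)) x = psi k i (copy k A x)"
 unfolding form_def psi_def sum_double by (rule sum.cong) (auto simp: cf_def copy_def)

definition Om :: "nat => (nat \<times> nat set) set" where
 "Om k = (SIGMA i:{..<k}. Pow ({..<k} - {i}))"

text \<open>For equal \<open>i\<close>, a variable on which the two vertices disagree is taken at
  different copies. For different \<open>i\<close> and \<open>j\<close>, variable \<open>j\<close>
  occurs in the first form and in no copy in the second.\<close>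

lemma good_forms_Om: assumes k: "k >= 2" shows "good_forms k (Om k) (cf k)"
 unfolding good_forms_def
proof (intro conjI ballI allI impI)
 show fin: "finite (Om k)" by (auto simp: Om_def)
 have "Om k \<subseteq> {..<k} \<times> Pow {..<k}" by (auto simp: Om_def)
 hence "card (Om k) <= card ({..<k} \<times> Pow {..<k})" by (intro card_mono) auto
 thus "card (Om k) <= k * 2 ^ k" by (simp add: card_cartesian_product card_Pow)
 show "\<bar>cf k s l\<bar> <= int k" if "s \<in> Om k" for s l
  using that by (auto simp: Om_def cf_def abs_if)
 show "\<exists>l<2 * k. cf k s l ~= 0" if sOm: "s \<in> Om k" for s
 proof -
  obtain i A where s: "s = (i, A)" "i < k" "A \<subseteq> {..<k} - {i}" using sOm by (auto simp: Om_def)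
  define a where "a = (if i = 0 then 1 else 0 :: nat)"
  have a: "a < k" "a ~= i" using k by (auto simp: a_def)
  show ?thesis
   by (rule exI[of _ "if a \<in> A then a + k else a"]) (use a s in "auto simp: cf_def")
 qed
 show "\<exists>l<2 * k. cf k s l ~= 0 \<and> cf k t l = 0" if st: "s \<in> Om k" "t \<in> Om k" "s ~= t" for s t
 proof -
  obtain i A where s: "s = (i, A)" "i < k" "A \<subseteq> {..<k} - {i}" using st(1) by (auto simp: Om_def)
  obtain j B where t: "t = (j, B)" "j < k" "B \<subseteq> {..<k} - {j}" using st(2) by (auto simp: Om_def)
  show ?thesis
  proof (cases "i = j")
   case True
   hence "A ~= B" using st(3) s t by auto
   then obtain a where a: "a \<in> A \<and> a \<notin> B \<or> a \<in> B \<and> a \<notin> A" by blast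
   hence "a < k" "a ~= i" using s t True by auto
   thus ?thesis
    by (intro exI[of _ "if a \<in> A then a + k else a"]) (use a s t in "auto simp: cf_def")
  next
   case False
   have "j \<notin> B" using t by auto
   thus ?thesis
    by (intro exI[of _ "if j \<in> A then j + k else j"]) (use s t False in "auto simp: cf_def")
  qed
 qed
qed

definition W :: "nat => (int => real) => nat \<times> nat set => (nat => int) => real" where
 "W k nv s x = nv (form k (cf k s) x)"

lemma W_copy: "A \<subseteq> {..<k} ==> W k nv (i, {}) (copy k A x) = W k nv (i, A) x"
 by (simp add: W_def form_cf copy_def)

lemma ign_form: "c i = 0 \<or> i >= 2 * k ==> ign i (form k c)"
 unfolding ign_def form_def by (intro allI sum.cong) auto

lemma ign_W: assumes "cf k s i = 0" shows "ign i (W k nv s)"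
 using ign_form[of "cf k s" i k] assms by (simp add: ign_def W_def)

lemma copy_upd: "A \<subseteq> {..<k} ==> j < k ==> j \<notin> A ==> copy k A (x(j := x (j + k))) = copy k (insert j A) x"
 by (rule ext) (auto simp: copy_def)

lemma okB_closed:
 assumes bound: "\<And>i J. i \<in> I ==> J \<subseteq> I - {i} ==> Ex N k (\<lambda>x. \<Prod>A\<in>Pow J. B i (copy k A x)) <= C"
  and I: "I \<subseteq> {..<k}"
 shows "distinct js ==> set js \<subseteq> I ==> J \<subseteq> I - set js ==> okB N k C js (\<lambda>i x. \<Prod>A\<in>Pow J. B i (copy k A x))"
proof (induction js arbitrary: J)
 case (Cons j js)
 have j: "j \<in> I" "j \<notin> J" "j < k" "J \<subseteq> {..<k}" and fJ: "finite J"
  using Cons.prems I finite_subset[of J "{..<k}"] by auto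
 have "dbl k j (\<lambda>x. \<Prod>A\<in>Pow J. B i (copy k A x)) = (\<lambda>x. \<Prod>A\<in>Pow (insert j J). B i (copy k A x))" for i
 proof
  fix x
  have "(\<Prod>A\<in>Pow J. B i (copy k A (x(j := x (j + k))))) = (\<Prod>A\<in>Pow J. B i (copy k (insert j A) x))"
   by (rule prod.cong[OF refl]) (subst copy_upd, use j in auto)
  thus "dbl k j (\<lambda>x. \<Prod>A\<in>Pow J. B i (copy k A x)) x = (\<Prod>A\<in>Pow (insert j J). B i (copy k A x))"
   unfolding prod_Pow_insert[OF fJ j(2)] by (simp add: dbl_def prod.distrib)
 qed
 thus ?case using Cons.IH[of "insert j J"] Cons.prems bound[OF j(1), of J] j by auto
qed simp

text \<open>One weight is close to 1 even when tested against functions that are bounded only by the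
  other weights plus 1. Cauchy-Schwarz in the other \<open>k - 1\<close> variables removes these
  functions and leaves good forms with factors \<open>nv - 1\<close>, to which
  \<open>LF_signed\<close> applies. The second family \<open>Q\<close>, taken at the copy of
  \<open>j0\<close>, arises from squaring codegrees in \<open>counting_step\<close>.\<close>

lemma strong_LF:
 assumes k: "k >= 2" and j0: "j0 < k" and N: "N > 0" and nv: "\<And>t. nv t >= 0" and LF: "LF N k nv ep" and ep: "ep <= 1"
  and P: "\<And>i. i < k ==> ign i (P i)" "\<And>i l. i < k ==> l >= k ==> ign l (P i)" "\<And>i x. i < k ==> \<bar>P i x\<bar> <= W k nv (i, {}) x + 1"
  and Q: "\<And>i. i < k ==> ign i (Q i)" "\<And>i l. i < k ==> l >= k ==> ign l (Q i)" "\<And>i x. i < k ==> \<bar>Q i x\<bar> <= W k nv (i, {}) x + 1"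
 shows "\<bar>Ex N k (\<lambda>x. (W k nv (j0, {}) x - 1) * (\<Prod>i\<in>{..<k} - {j0}. P i x * Q i (x(j0 := x (j0 + k)))))\<bar> ^ (2 ^ (k - 1))
  <= (2 ^ (k * 2 ^ k) * 2) ^ (2 ^ (k - 1)) * ep"
proof -
 define I where "I = {..<k} - {j0}"
 define js where "js = sorted_list_of_set I"
 have finI: "finite I" by (simp add: I_def)
 have js: "set js = I" "distinct js" "length js = k - 1"
  using j0 by (auto simp: js_def finI I_def)
 define C :: real where "C = 2 ^ (k * 2 ^ k) * 2"
 have C: "C >= 0" by (simp add: C_def)
 have w0: "W k nv s x >= 0" for s x by (simp add: W_def nv)
 define h where "h = (\<lambda>x. W k nv (j0, {}) x - 1)"
 define b where "b = (\<lambda>i x. P i x * Q i (x(j0 := x (j0 + k))))"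
 \<comment> \<open>The function \<open>b i\<close> involves both copies of \<open>j0\<close>, so its
   majorant is doubled in \<open>j0\<close> from the start.\<close>
 define B where "B = (\<lambda>i. dbl k j0 (\<lambda>x. W k nv (i, {}) x + 1))"
 have kI: "i < k" "i ~= j0" if "i \<in> I" for i using that by (auto simp: I_def)
 have ignW: "ign l (\<lambda>x. W k nv (i, {}) x + 1)" if "l = i \<and> i < k \<or> l >= k" for l i
  by (rule ign_unop, rule ign_W) (use that in "auto simp: cf_def")
 have ignQ: "ign l (\<lambda>x. Q i (x(j0 := x (j0 + k))))" if "i \<in> I" "l = i \<or> l >= k" "l ~= j0 + k" for l i
 proof -
  have "ign l (Q i)" using that Q(1,2) kI by auto
  moreover have "l ~= j0" using that kI j0 by auto
  ultimately show ?thesis using that(3) by (simp add: ign_def fun_upd_twist[of l j0])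
 qed
 have B_copy: "B i (copy k A x) = (W k nv (i, A) x + 1) * (W k nv (i, insert j0 A) x + 1)" if "A \<subseteq> I" for i A x
 proof -
  have A: "A \<subseteq> {..<k}" "j0 \<notin> A" using that by (auto simp: I_def)
  show ?thesis unfolding B_def dbl_def copy_insert[OF A(2) j0 A(1)]
   using A j0 by (simp add: W_copy)
 qed
 have B_prod: "(\<Prod>A\<in>Pow J. B i (copy k A x)) = (\<Prod>A\<in>Pow (insert j0 J). W k nv (i, A) x + 1)" if "J \<subseteq> I" for J i x
 proof -
  have "finite J" "j0 \<notin> J" using that finI finite_subset by (auto simp: I_def)
  from prod_Pow_insert[OF this] show ?thesis using that by (auto simp: B_copy intro!: prod.cong)
 qed
 have okB: "okB N k C js B"
 proof -
  have "okB N k C js (\<lambda>i x. \<Prod>A\<in>Pow {}. B i (copy k A x))"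
  proof (rule okB_closed[where I = I])
   fix i J assume iJ: "i \<in> I" "J \<subseteq> I - {i}"
   hence sub: "J \<subseteq> I" by blast
   have "{i} \<times> Pow (insert j0 J) \<subseteq> Om k" using iJ j0 by (auto simp: Om_def I_def)
   from good_forms_subset[OF good_forms_Om[OF k] this]
   have "Ex N k (\<lambda>x. \<Prod>s\<in>{i} \<times> Pow (insert j0 J). nv (form k (cf k s) x) + 1) <= C"
    unfolding C_def by (rule LF_upper[OF LF _ N ep])
   moreover have "(\<Prod>s\<in>{i} \<times> Pow (insert j0 J). nv (form k (cf k s) x) + 1) = (\<Prod>A\<in>Pow (insert j0 J). W k nv (i, A) x + 1)" for x
    unfolding W_def by (rule prod.reindex_cong[of "\<lambda>A. (i, A)"]) (auto simp: inj_on_def)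
   ultimately show "Ex N k (\<lambda>x. \<Prod>A\<in>Pow J. B i (copy k A x)) <= C" by (simp add: B_prod[OF sub])
  qed (use js in "auto simp: I_def")
  moreover have "(\<lambda>i x. \<Prod>A\<in>Pow {}. B i (copy k A x)) = B" by (intro ext) (simp add: copy_def)
  ultimately show ?thesis by simp
 qed
 have CS: "\<bar>Ex N k (\<lambda>x. h x * (\<Prod>i\<in>set js. b i x))\<bar> ^ (2 ^ length js) <= C ^ (2 ^ length js - 1) * \<bar>Ex N k (fin k js h B)\<bar>"
 proof (rule CS_iterated[OF N C js(2)])
  show "\<bar>b i x\<bar> <= B i x" if "i \<in> set js" for i x
   unfolding b_def B_def dbl_def abs_mult
   by (intro mult_mono P(3) Q(3)) (use that js kI w0 in "auto intro: add_nonneg_nonneg")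
  show "ign i (b i)" if "i \<in> set js" for i
   unfolding b_def using that js kI[of i] P(1) by (intro ign_binop[of _ _ _ "(*)"] ignQ) auto
  show "ign i (B i)" if "i \<in> set js" for i
   unfolding B_def using that js kI[of i] by (intro ign_dbl ignW) auto
  show "ign (l + k) (b i)" if "i \<in> set js" "l \<in> set js" for i l
   unfolding b_def using that js kI[of i] kI[of l] P(2) by (intro ign_binop[of _ _ _ "(*)"] ignQ) auto
  show "ign (l + k) (B i)" if "i \<in> set js" "l \<in> set js" for i l
   unfolding B_def using that js kI[of i] kI[of l] j0 by (intro ign_dbl ignW) auto
  show "ign (l + k) h" if "l \<in> set js" for l
   unfolding h_def by (rule ign_unop, rule ign_W) (simp add: cf_def)
 qed (use js kI okB in auto)
 have final: "\<bar>Ex N k (fin k js h B)\<bar> <= 2 ^ (k * 2 ^ k) * ep"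
 proof -
  define S0 where "S0 = {j0} \<times> Pow I"
  define S1 where "S1 = (SIGMA i:I. Pow ({..<k} - {i}))"
  have "S0 \<union> S1 \<subseteq> Om k" using j0 by (auto simp: S0_def S1_def Om_def I_def)
  from good_forms_subset[OF good_forms_Om[OF k] this] have gf: "good_forms k (S0 \<union> S1) (cf k)" .
  have "fin k js h B x = (\<Prod>s\<in>S0. nv (form k (cf k s) x) - 1) * (\<Prod>s\<in>S1. nv (form k (cf k s) x) + 1)" for x
  proof -
   have "fin k js h B x = (\<Prod>A\<in>Pow I. h (copy k A x)) * (\<Prod>i\<in>I. \<Prod>A\<in>Pow (I - {i}). B i (copy k A x))"
    using fin_closed[OF js(2), of k h B x] js kI by simp
   also have "(\<Prod>A\<in>Pow I. h (copy k A x)) = (\<Prod>A\<in>Pow I. W k nv (j0, A) x - 1)"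
   proof (rule prod.cong[OF refl])
    fix A assume "A \<in> Pow I"
    hence "A \<subseteq> {..<k}" by (auto simp: I_def)
    thus "h (copy k A x) = W k nv (j0, A) x - 1" by (simp add: h_def W_copy)
   qed
   also have "... = (\<Prod>s\<in>S0. nv (form k (cf k s) x) - 1)"
    unfolding S0_def W_def by (rule prod.reindex_cong[of "\<lambda>A. (j0, A)", symmetric]) (auto simp: inj_on_def)
   also have "(\<Prod>i\<in>I. \<Prod>A\<in>Pow (I - {i}). B i (copy k A x)) = (\<Prod>i\<in>I. \<Prod>A\<in>Pow ({..<k} - {i}). W k nv (i, A) x + 1)"
   proof (rule prod.cong[OF refl])
    fix i assume i: "i \<in> I"
    have "insert j0 (I - {i}) = {..<k} - {i}" using i j0 by (auto simp: I_def)
    thus "(\<Prod>A\<in>Pow (I - {i}). B i (copy k A x)) = (\<Prod>A\<in>Pow ({..<k} - {i}). W k nv (i, A) x + 1)"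
     using B_prod[of "I - {i}" i x] by auto
   qed
   also have "... = (\<Prod>s\<in>S1. nv (form k (cf k s) x) + 1)"
    unfolding S1_def W_def by (subst prod.Sigma) (auto simp: finI split_def)
   finally show ?thesis .
  qed
  hence eq: "fin k js h B = (\<lambda>x. (\<Prod>s\<in>S0. nv (form k (cf k s) x) - 1) * (\<Prod>s\<in>S1. nv (form k (cf k s) x) + 1))" by (rule ext)
  show ?thesis unfolding eq
   by (rule LF_signed[OF LF gf _ _ N]) (auto simp: S0_def S1_def I_def)
 qed
 have "\<bar>Ex N k (\<lambda>x. h x * (\<Prod>i\<in>I. b i x))\<bar> ^ (2 ^ (k - 1)) <= C ^ (2 ^ (k - 1) - 1) * \<bar>Ex N k (fin k js h B)\<bar>"
  using CS unfolding js .
 also have "... <= C ^ (2 ^ (k - 1) - 1) * (2 ^ (k * 2 ^ k) * ep)"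
  by (rule mult_left_mono[OF final]) (simp add: C)
 also have "... <= C ^ (2 ^ (k - 1) - 1) * (C * ep)"
 proof -
  have "\<bar>Ex N k (\<lambda>x. \<Prod>s\<in>{}. nv (form k (cf k s) x)) - 1\<bar> <= ep"
   using LF good_forms_subset[OF good_forms_Om[OF k], of "{}"] unfolding LF_def by blast
  hence "ep >= 0" by linarith
  thus ?thesis using C by (intro mult_left_mono mult_right_mono) (auto simp: C_def)
 qed
 also have "... = C ^ (2 ^ (k - 1)) * ep"
  by (metis mult.assoc power_minus_mult zero_less_numeral zero_less_power)
 finally show ?thesis by (simp add: h_def b_def I_def C_def)
qed

section \<open>The relative counting lemma\<close>

abbreviation EP :: "nat => nat => (nat => (nat => int) => real) => real" where
 "EP N k g \<equiv> Ex N k (\<lambda>x. \<Prod>i<k. g i x)"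

text \<open>Smallness in the hypergraph cut norm: each factor of the test product misses its own
  vertex variable.\<close>

definition cutok :: "nat => nat => real => nat => ((nat => int) => real) => bool" where
 "cutok N k ep i F \<longleftrightarrow> (\<forall>u. (\<forall>l<k. ign l (u l) \<and> (\<forall>m\<ge>k. ign m (u l)) \<and> (\<forall>x. 0 <= u l x \<and> u l x <= 1)) -->
  \<bar>Ex N k (\<lambda>x. F x * (\<Prod>l\<in>{..<k} - {i}. u l x))\<bar> <= ep)"

lemma cutok_mono: "cutok N k ep i F ==> ep <= ep' ==> cutok N k ep' i F"
 unfolding cutok_def by (meson order_trans)

lemma cutok_zero: "0 <= ep ==> N > 0 ==> cutok N k ep i (\<lambda>x. F x - F x)"
 by (simp add: cutok_def Ex_const)

text \<open>\<open>J\<close> is the set of edges still bounded only by the pseudorandom weight; the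
  counting lemma inducts on its size.\<close>

definition edges_ok :: "nat => nat => (int => real) => real => nat set => (nat => (nat => int) => real) => (nat => (nat => int) => real) => bool" where
 "edges_ok N k nv ep J g h \<longleftrightarrow> (\<forall>i<k. ign i (g i) \<and> ign i (h i) \<and> (\<forall>m\<ge>k. ign m (g i) \<and> ign m (h i)) \<and>
  (\<forall>x. 0 <= g i x \<and> g i x <= (if i \<in> J then W k nv (i, {}) x else 1)) \<and> (\<forall>x. 0 <= h i x \<and> h i x <= 1) \<and>
  cutok N k ep i (\<lambda>x. g i x - h i x))"

lemma edges_ok_mono: "edges_ok N k nv ep J g h ==> ep <= ep' ==> edges_ok N k nv ep' J g h"
 unfolding edges_ok_def by (meson cutok_mono)

text \<open>Edges are exchanged one at a time; as all others are bounded by 1, each exchange is a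
  single cut-norm test.\<close>

lemma counting_dense:
 assumes ok: "edges_ok N k nv ep {} g h" and N: "N > 0"
 shows "\<bar>EP N k g - EP N k h\<bar> <= real k * ep"
proof -
 define G where "G = (\<lambda>j. Ex N k (\<lambda>x. \<Prod>i<k. if i < j then h i x else g i x))"
 have "\<bar>G j - G 0\<bar> <= real j * ep" if "j <= k" for j
  using that
 proof (induction j)
  case (Suc j)
  define u where "u = (\<lambda>l. if l < j then h l else g l)"
  have j: "j < k" using Suc.prems by simp
  have pr: "(\<Prod>i<k. if i < Suc j then h i x else g i x) = h j x * (\<Prod>l\<in>{..<k} - {j}. u l x)"
   "(\<Prod>i<k. if i < j then h i x else g i x) = g j x * (\<Prod>l\<in>{..<k} - {j}. u l x)" for x
   using j unfolding prod.remove[of "{..<k}" j, OF finite_lessThan lessThan_iff[THEN iffD2, OF j]]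
   by (auto simp: u_def less_Suc_eq intro!: prod.cong split: if_splits)
  have "G j - G (Suc j) = Ex N k (\<lambda>x. (g j x - h j x) * (\<Prod>l\<in>{..<k} - {j}. u l x))"
   unfolding G_def pr Ex_diff[symmetric] by (simp add: left_diff_distrib)
  moreover have "\<bar>Ex N k (\<lambda>x. (g j x - h j x) * (\<Prod>l\<in>{..<k} - {j}. u l x))\<bar> <= ep"
  proof -
   have "cutok N k ep j (\<lambda>x. g j x - h j x)" using ok j by (simp add: edges_ok_def)
   moreover have "\<forall>l<k. ign l (u l) \<and> (\<forall>m\<ge>k. ign m (u l)) \<and> (\<forall>x. 0 <= u l x \<and> u l x <= 1)"
    using ok by (auto simp: edges_ok_def u_def)
   ultimately show ?thesis unfolding cutok_def by blast
  qed
  ultimately show ?case using Suc.IH Suc.prems by (simp add: algebra_simps)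
 qed simp
 from this[of k] have "\<bar>G k - G 0\<bar> <= real k * ep" by simp
 moreover have "G k = EP N k h" unfolding G_def by (intro arg_cong[of _ _ "Ex N k"] ext prod.cong) auto
 moreover have "G 0 = EP N k g" unfolding G_def by simp
 ultimately show ?thesis by (simp add: abs_minus_commute)
qed

lemma Ex_sq_CS: assumes N: "N > 0" shows "(Ex N k (\<lambda>x. F x * G x))\<^sup>2 <= Ex N k (\<lambda>x. (F x)\<^sup>2) * Ex N k (\<lambda>x. (G x)\<^sup>2)"
proof (rule quad_disc)
 fix s :: real
 have "0 <= Ex N k (\<lambda>x. (s * F x - G x)\<^sup>2)" by (rule Ex_nonneg[OF _ N]) simp
 also have "(\<lambda>x. (s * F x - G x)\<^sup>2) = (\<lambda>x. (s\<^sup>2 * (F x)\<^sup>2 - (2 * s) * (F x * G x)) + (G x)\<^sup>2)"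
  by (rule ext) (simp add: power2_diff power_mult_distrib algebra_simps)
 also have "Ex N k ... = s\<^sup>2 * Ex N k (\<lambda>x. (F x)\<^sup>2) - 2 * s * Ex N k (\<lambda>x. F x * G x) + Ex N k (\<lambda>x. (G x)\<^sup>2)"
  unfolding Ex_add Ex_diff Ex_cmult ..
 finally show "0 <= s\<^sup>2 * Ex N k (\<lambda>x. (F x)\<^sup>2) - 2 * s * Ex N k (\<lambda>x. F x * G x) + Ex N k (\<lambda>x. (G x)\<^sup>2)" .
 show "0 <= Ex N k (\<lambda>x. (F x)\<^sup>2)" by (rule Ex_nonneg[OF _ N]) simp
qed

text \<open>One sparse edge \<open>j\<close> is traded for a dense one: after Cauchy--Schwarz in the weight of \<open>j\<close>, the
 edge is replaced by the (truncated) codegree functions of the remaining edges.\<close>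

lemma counting_step:
 assumes k: "k >= 2" and N: "N > 0" and nv: "\<And>t. nv t >= 0" and LF: "LF N k nv ep" and ep: "ep <= 1" "0 <= ep"
  and ok: "edges_ok N k nv ep J g h" and j: "j < k" "j \<in> J"
  and strong: "(2 ^ (k * 2 ^ k) * 2) ^ (2 ^ (k - 1)) * ep <= e2 ^ (2 ^ (k - 1))" "e2 >= 0"
  and e3: "21 * ep <= e3\<^sup>2" "e3 >= 0"
  and IH: "\<And>g' h'. edges_ok N k nv ep (J - {j}) g' h' ==> \<bar>EP N k g' - EP N k h'\<bar> <= e1"
 shows "\<bar>EP N k g - EP N k h\<bar> <= ep + sqrt (2 * (4 * e2 + 2 * e1 + e3))"
proof -
 define I where "I = {..<k} - {j}"
 define w where "w = W k nv (j, {})"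
 define pg where "pg = (\<lambda>x. \<Prod>i\<in>I. g i x)"
 define ph where "ph = (\<lambda>x. \<Prod>i\<in>I. h i x)"
 \<comment> \<open>Codegrees: the product of the other edges averaged over variable
   \<open>j\<close>, the one on which edge \<open>j\<close> does not depend.\<close>
 define G where "G = av N j pg"
 define H where "H = av N j ph"
 have kI: "i < k" "i ~= j" if "i \<in> I" for i using that by (auto simp: I_def)
 have W0: "W k nv s x >= 0" for s x by (simp add: W_def nv)
 have g: "ign i (g i)" "m >= k ==> ign m (g i)" "0 <= g i x" "g i x <= (if i \<in> J then W k nv (i, {}) x else 1)" if "i < k" for i m x
  using ok that by (auto simp: edges_ok_def)
 have h: "ign i (h i)" "m >= k ==> ign m (h i)" "0 <= h i x" "h i x <= 1" if "i < k" for i m x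
  using ok that by (auto simp: edges_ok_def)
 have j2: "j < 2 * k" using j by simp
 have jk: "j + k >= k" by simp
 have ipg: "ign m pg" "ign m ph" if "m >= k" for m
  unfolding pg_def ph_def using that by (auto intro!: ign_prod g h kI)
 have ipgw: "ign j w" "ign m w" if "m >= k" for m
  unfolding w_def using that by (auto intro!: ign_W simp: cf_def)
 have ij: "ign j G" "ign j H" by (simp_all add: G_def H_def ign_av)
 have ik: "ign m G" "ign m H" if "m >= k" for m
  using that by (auto simp: G_def H_def intro!: ign_av' ipg)
 have prg: "(\<Prod>i<k. g' i x) = g' j x * (\<Prod>i\<in>I. g' i x)" for g' :: "nat => (nat => int) => real" and x
  using j by (simp add: prod.remove[of "{..<k}" j] I_def)
 have pg0: "0 <= pg x" for x unfolding pg_def by (intro prod_nonneg) (auto simp: g kI)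
 have ph0: "0 <= ph x" "ph x <= 1" for x
  unfolding ph_def by (auto intro!: prod_nonneg prod_le_1 simp: h kI)
 have G0: "0 <= G x" for x unfolding G_def using av_mono[of "\<lambda>_. 0" pg N j x] pg0 N by (simp add: av_def avg_const)
 have H0: "0 <= H x" for x unfolding H_def using av_mono[of "\<lambda>_. 0" ph N j x] ph0 N by (simp add: av_def avg_const)
 have H1: "H x <= 1" for x unfolding H_def using av_mono[of ph "\<lambda>_. 1" N j x] ph0 N by (simp add: av_def avg_const)

 have "EP N k g = Ex N k (\<lambda>x. g j x * G x)"
  unfolding prg G_def pg_def by (rule Ex_mult_av[OF j2 N g(1)[OF j(1)], symmetric])
 moreover have "EP N k h = Ex N k (\<lambda>x. g j x * H x) - Ex N k (\<lambda>x. (g j x - h j x) * ph x)"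
 proof -
  have "Ex N k (\<lambda>x. g j x * H x) = Ex N k (\<lambda>x. g j x * ph x)"
   unfolding H_def by (rule Ex_mult_av[OF j2 N g(1)[OF j(1)]])
  moreover have "(\<Prod>i\<in>I. h i x) = ph x" for x by (simp add: ph_def)
  ultimately show ?thesis unfolding prg by (simp add: left_diff_distrib Ex_diff)
 qed
 moreover have "\<bar>Ex N k (\<lambda>x. (g j x - h j x) * ph x)\<bar> <= ep"
 proof -
  have "cutok N k ep j (\<lambda>x. g j x - h j x)" using ok j by (simp add: edges_ok_def)
  moreover have "\<forall>l<k. ign l (h l) \<and> (\<forall>m\<ge>k. ign m (h l)) \<and> (\<forall>x. 0 <= h l x \<and> h l x <= 1)"
   using h by auto
  ultimately show ?thesis unfolding cutok_def ph_def I_def by blast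
 qed
 moreover define T where "T = Ex N k (\<lambda>x. g j x * (G x - H x))"
 ultimately have main: "\<bar>EP N k g - EP N k h\<bar> <= ep + \<bar>T\<bar>"
  by (simp add: T_def right_diff_distrib Ex_diff)

 have Ew: "Ex N k w <= 2"
 proof -
  have "{(j, {})} \<subseteq> Om k" using j by (auto simp: Om_def)
  from good_forms_subset[OF good_forms_Om[OF k] this]
  have "\<bar>Ex N k (\<lambda>x. \<Prod>s\<in>{(j, {})}. nv (form k (cf k s) x)) - 1\<bar> <= ep" using LF unfolding LF_def by blast
  moreover have "(\<lambda>x. \<Prod>s\<in>{(j, {})}. nv (form k (cf k s) x)) = w" by (rule ext) (simp add: w_def W_def)
  ultimately show ?thesis using ep by simp
 qed
 have T2: "T\<^sup>2 <= Ex N k w * Ex N k (\<lambda>x. w x * (G x - H x)\<^sup>2)"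
  unfolding T_def by (rule Ex_CS[OF N]) (use g[OF j(1)] j in "auto simp: w_def")

 have strongX: "\<bar>Ex N k (\<lambda>x. (w x - 1) * (av N j (\<lambda>x. \<Prod>i\<in>I. P i x) x * av N j (\<lambda>x. \<Prod>i\<in>I. Q i x) x))\<bar> <= e2"
  if P: "P = g \<or> P = h" and Q: "Q = g \<or> Q = h" for P Q
 proof -
  let ?X = "Ex N k (\<lambda>x. (w x - 1) * (av N j (\<lambda>x. \<Prod>i\<in>I. P i x) x * av N j (\<lambda>x. \<Prod>i\<in>I. Q i x) x))"
  have leg: "\<bar>g i x\<bar> <= W k nv (i, {}) x + 1" if i: "i < k" for i x
   using g(3)[OF i, of x] g(4)[OF i, of x] W0[of "(i, {})" x] by (cases "i \<in> J") simp_all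
  have leh: "\<bar>h i x\<bar> <= W k nv (i, {}) x + 1" if i: "i < k" for i x
   using h(3)[OF i, of x] h(4)[OF i, of x] W0[of "(i, {})" x] by simp
  have fam: "ign i (R i)" "l >= k ==> ign l (R i)" "\<bar>R i x\<bar> <= W k nv (i, {}) x + 1"
   if R: "R = g \<or> R = h" and i: "i < k" for R i l x
  proof -
   show "ign i (R i)" using R g(1)[OF i] h(1)[OF i] by blast
   show "l >= k ==> ign l (R i)" using R g(2)[OF i] h(2)[OF i] by blast
   show "\<bar>R i x\<bar> <= W k nv (i, {}) x + 1" using R leg[OF i, of x] leh[OF i, of x] by blast
  qed
  have w1: "ign j (\<lambda>x. w x - 1)" "ign (j + k) (\<lambda>x. w x - 1)"
   using ipgw[OF jk] by (simp_all add: ign_def)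
  have pP: "ign m (\<lambda>x. \<Prod>i\<in>I. P i x)" "ign m (\<lambda>x. \<Prod>i\<in>I. Q i x)" if "m >= k" for m
   using ipg[OF that] P Q by (auto simp: pg_def ph_def)
  have "?X
   = Ex N k (\<lambda>x. (w x - 1) * ((\<Prod>i\<in>I. P i x) * (\<Prod>i\<in>I. Q i (x(j := x (j + k))))))"
   by (rule Ex_product_copy[OF j(1) N pP[OF jk] w1])
  also have "... = Ex N k (\<lambda>x. (W k nv (j, {}) x - 1) * (\<Prod>i\<in>{..<k} - {j}. P i x * Q i (x(j := x (j + k)))))"
   by (simp add: w_def I_def prod.distrib)
  finally have eq: "?X = ..." .
  have "\<bar>?X\<bar> ^ (2 ^ (k - 1))
   <= (2 ^ (k * 2 ^ k) * 2) ^ (2 ^ (k - 1)) * ep"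
   unfolding eq
   by (rule strong_LF[OF k j(1) N nv LF ep(1) fam(1)[OF P] fam(2)[OF P] fam(3)[OF P] fam(1)[OF Q] fam(2)[OF Q] fam(3)[OF Q]])
  with strong(1) have "\<bar>?X\<bar> ^ (2 ^ (k - 1)) <= e2 ^ (2 ^ (k - 1))"
   by linarith
  thus ?thesis using power_mono_iff[of _ e2 "2 ^ (k - 1)"] strong(2) by simp
 qed
 have X1: "\<bar>Ex N k (\<lambda>x. (w x - 1) * (G x * G x))\<bar> <= e2" using strongX[of g g] by (simp add: G_def pg_def)
 have X2: "\<bar>Ex N k (\<lambda>x. (w x - 1) * (G x * H x))\<bar> <= e2" using strongX[of g h] by (simp add: G_def H_def pg_def ph_def)
 have X3: "\<bar>Ex N k (\<lambda>x. (w x - 1) * (H x * H x))\<bar> <= e2" using strongX[of h h] by (simp add: H_def ph_def)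

 \<comment> \<open>The codegree \<open>G\<close> of sparse edges is unbounded, so it is truncated
   before it can serve as a dense edge \<open>j\<close>.\<close>
 define G' where "G' = (\<lambda>x. min (G x) 1)"
 have G': "ign j G'" "ign m G'" "0 <= G' x" "G' x <= 1" if "m >= k" for m x
  using ij ik[OF that] G0 by (auto simp: G'_def ign_def)
 \<comment> \<open>Putting \<open>D\<close> in place of edge \<open>j\<close> on both sides leaves
   one sparse edge fewer; this is where the induction hypothesis enters.\<close>
 have dense: "\<bar>Ex N k (\<lambda>x. (G x - H x) * D x)\<bar> <= e1"
  if D: "ign j D" "\<And>m. m >= k ==> ign m D" "\<And>x. 0 <= D x" "\<And>x. D x <= 1" for D
 proof -
  have "edges_ok N k nv ep (J - {j}) (g(j := D)) (h(j := D))"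
   unfolding edges_ok_def
  proof (intro allI impI)
   fix i assume i: "i < k"
   have "cutok N k ep i (\<lambda>x. (g(j := D)) i x - (h(j := D)) i x)"
    using ok i cutok_zero[OF ep(2) N, of k j D] by (cases "i = j") (auto simp: edges_ok_def)
   thus "ign i ((g(j := D)) i) \<and> ign i ((h(j := D)) i) \<and> (\<forall>m\<ge>k. ign m ((g(j := D)) i) \<and> ign m ((h(j := D)) i)) \<and>
    (\<forall>x. 0 <= (g(j := D)) i x \<and> (g(j := D)) i x <= (if i \<in> J - {j} then W k nv (i, {}) x else 1)) \<and>
    (\<forall>x. 0 <= (h(j := D)) i x \<and> (h(j := D)) i x <= 1) \<and> cutok N k ep i (\<lambda>x. (g(j := D)) i x - (h(j := D)) i x)"
    using i D g[OF i] h[OF i] by (cases "i = j") auto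
  qed
  have pru: "(\<Prod>i\<in>I. (g'(j := D)) i x) = (\<Prod>i\<in>I. g' i x)" for g' :: "nat => (nat => int) => real" and x
   by (rule prod.cong) (auto simp: I_def)
  from IH[OF \<open>edges_ok N k nv ep (J - {j}) (g(j := D)) (h(j := D))\<close>]
  have "\<bar>Ex N k (\<lambda>x. D x * pg x) - Ex N k (\<lambda>x. D x * ph x)\<bar> <= e1"
   unfolding prg pru by (simp add: pg_def ph_def)
  moreover have "Ex N k (\<lambda>x. D x * pg x) = Ex N k (\<lambda>x. D x * G x)" "Ex N k (\<lambda>x. D x * ph x) = Ex N k (\<lambda>x. D x * H x)"
   unfolding G_def H_def by (simp_all add: Ex_mult_av[OF j2 N D(1)])
  ultimately show ?thesis by (simp add: right_diff_distrib Ex_diff mult.commute)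
 qed
 have D1: "\<bar>Ex N k (\<lambda>x. (G x - H x) * G' x)\<bar> <= e1" by (rule dense) (use G'[of k] G'(2) in auto)
 have D2: "\<bar>Ex N k (\<lambda>x. (G x - H x) * H x)\<bar> <= e1" by (rule dense) (use ij ik H0 H1 in auto)

 \<comment> \<open>The truncation only acts where the codegree \<open>M\<close> of the weights
   exceeds 1. Its first two moments are within \<open>ep\<close> of 1, so the mean of
   \<open>(M - 1)\<^sup>2\<close> is at most \<open>3 * ep\<close>; with second moment at most 7 for
   \<open>M + 1\<close> this yields the constant 21.\<close>
 have D3: "Ex N k (\<lambda>x. (G x - H x) * (G x - G' x)) <= e3"
 proof -
  define pM where "pM = (\<lambda>x. \<Prod>i\<in>I \<inter> J. W k nv (i, {}) x)"
  define M where "M = av N j pM"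
  have pM0: "0 <= pM x" for x unfolding pM_def by (intro prod_nonneg) (simp add: W0)
  have M0: "0 <= M x" for x unfolding M_def using av_mono[of "\<lambda>_. 0" pM N j x] pM0 N by (simp add: av_def avg_const)
  have "pg x <= pM x" for x
  proof -
   have "pg x <= (\<Prod>i\<in>I. if i \<in> J then W k nv (i, {}) x else 1)"
    unfolding pg_def by (intro prod_mono) (use g kI in auto)
   also have "... = pM x" unfolding pM_def by (simp add: prod.If_cases I_def Int_def)
   finally show ?thesis .
  qed
  hence GM: "G x <= M x" for x unfolding G_def M_def by (intro av_mono)
  have "Ex N k (\<lambda>x. (G x - H x) * (G x - G' x)) <= Ex N k (\<lambda>x. (M x + 1) * \<bar>M x - 1\<bar>)"
  proof (rule Ex_mono)
   fix x
   have "G x - G' x <= \<bar>M x - 1\<bar>" "0 <= G x - G' x" using GM[of x] by (auto simp: G'_def)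
   moreover have "G x - H x <= M x + 1" using GM[of x] H0[of x] by simp
   ultimately have "(G x - H x) * (G x - G' x) <= (M x + 1) * (G x - G' x)" "(M x + 1) * (G x - G' x) <= (M x + 1) * \<bar>M x - 1\<bar>"
    using M0[of x] by (auto intro: mult_right_mono mult_left_mono)
   thus "(G x - H x) * (G x - G' x) <= (M x + 1) * \<bar>M x - 1\<bar>" by linarith
  qed
  also have "... <= e3"
  proof (rule power2_le_imp_le[OF order_trans e3(2)])
   show "(Ex N k (\<lambda>x. (M x + 1) * \<bar>M x - 1\<bar>))\<^sup>2 <= Ex N k (\<lambda>x. (M x + 1)\<^sup>2) * Ex N k (\<lambda>x. \<bar>M x - 1\<bar>\<^sup>2)"
    by (rule Ex_sq_CS[OF N])
   have lf: "\<bar>Ex N k (\<lambda>x. \<Prod>s\<in>S. W k nv s x) - 1\<bar> <= ep" if "S \<subseteq> Om k" for S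
    using LF good_forms_subset[OF good_forms_Om[OF k] that] unfolding LF_def W_def by blast
   have pMS: "pM x = (\<Prod>s\<in>(I \<inter> J) \<times> {{}}. W k nv s x)" for x
    unfolding pM_def by (rule prod.reindex_cong[of "\<lambda>i. (i, {})", symmetric]) (auto simp: inj_on_def)
   have "(I \<inter> J) \<times> {{}} \<subseteq> Om k" by (auto simp: I_def Om_def)
   from lf[OF this] have E1: "\<bar>Ex N k M - 1\<bar> <= ep"
    unfolding M_def Ex_av[OF j2 N] pMS[symmetric] by simp
   have "Ex N k (\<lambda>x. 1 * (M x * M x)) = Ex N k (\<lambda>x. 1 * (pM x * pM (x(j := x (j + k)))))"
    unfolding M_def by (rule Ex_product_copy[OF j(1) N]) (auto simp: pM_def ign_def[of _ "\<lambda>_. 1"] cf_def intro!: ign_prod ign_W)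
   also have "(\<lambda>x. 1 * (pM x * pM (x(j := x (j + k))))) = (\<lambda>x. \<Prod>s\<in>(I \<inter> J) \<times> {{}, {j}}. W k nv s x)"
   proof
    fix x
    have "pM (x(j := x (j + k))) = (\<Prod>i\<in>I \<inter> J. W k nv (i, {j}) x)"
     unfolding pM_def
    proof (rule prod.cong[OF refl])
     fix i
     show "W k nv (i, {}) (x(j := x (j + k))) = W k nv (i, {j}) x"
      using copy_upd[of "{}" k j x] j by (simp add: W_def form_cf)
    qed
    moreover have "(\<Prod>s\<in>(I \<inter> J) \<times> {{}, {j}}. W k nv s x) = (\<Prod>i\<in>I \<inter> J. W k nv (i, {}) x * W k nv (i, {j}) x)"
    proof -
     have "(\<Prod>s\<in>(I \<inter> J) \<times> {{}, {j}}. W k nv s x) = (\<Prod>i\<in>I \<inter> J. \<Prod>A\<in>{{}, {j}}. W k nv (i, A) x)"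
      by (subst prod.cartesian_product) (simp add: split_def)
     thus ?thesis by simp
    qed
    ultimately show "1 * (pM x * pM (x(j := x (j + k)))) = (\<Prod>s\<in>(I \<inter> J) \<times> {{}, {j}}. W k nv s x)"
     by (simp add: pM_def prod.distrib)
   qed
   also have "\<bar>Ex N k ... - 1\<bar> <= ep" by (rule lf) (use j in "auto simp: I_def Om_def")
   finally have E2: "\<bar>Ex N k (\<lambda>x. (M x)\<^sup>2) - 1\<bar> <= ep" by (simp add: power2_eq_square)
   have "(\<lambda>x. \<bar>M x - 1\<bar>\<^sup>2) = (\<lambda>x. ((M x)\<^sup>2 - 2 * M x) + 1)" by (rule ext) (simp add: power2_diff)
   hence "Ex N k (\<lambda>x. \<bar>M x - 1\<bar>\<^sup>2) = Ex N k (\<lambda>x. (M x)\<^sup>2) - 2 * Ex N k M + 1"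
    using Ex_const[OF N, of k 1] by (simp add: Ex_add Ex_diff Ex_cmult)
   hence a: "Ex N k (\<lambda>x. \<bar>M x - 1\<bar>\<^sup>2) <= 3 * ep" using E1 E2 by linarith
   have "(\<lambda>x. (M x + 1)\<^sup>2) = (\<lambda>x. ((M x)\<^sup>2 + 2 * M x) + 1)" by (rule ext) (simp add: power2_sum)
   hence "Ex N k (\<lambda>x. (M x + 1)\<^sup>2) = Ex N k (\<lambda>x. (M x)\<^sup>2) + 2 * Ex N k M + 1"
    using Ex_const[OF N, of k 1] by (simp add: Ex_add Ex_cmult)
   hence b: "Ex N k (\<lambda>x. (M x + 1)\<^sup>2) <= 7" using E1 E2 ep by linarith
   have "0 <= Ex N k (\<lambda>x. \<bar>M x - 1\<bar>\<^sup>2)" by (rule Ex_nonneg[OF _ N]) simp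
   hence "Ex N k (\<lambda>x. (M x + 1)\<^sup>2) * Ex N k (\<lambda>x. \<bar>M x - 1\<bar>\<^sup>2) <= 7 * (3 * ep)"
    using a b by (intro mult_mono) auto
   thus "Ex N k (\<lambda>x. (M x + 1)\<^sup>2) * Ex N k (\<lambda>x. \<bar>M x - 1\<bar>\<^sup>2) <= e3\<^sup>2" using e3(1) by linarith
  qed
  finally show ?thesis .
 qed

 \<comment> \<open>The weight \<open>w\<close> is exchanged for 1 at the price of the three terms
   with \<open>w - 1\<close>. The unweighted square is then tested against \<open>G'\<close> and
   \<open>H\<close>, which leaves the truncation term.\<close>
 have "Ex N k (\<lambda>x. w x * (G x - H x)\<^sup>2) = ((((Ex N k (\<lambda>x. (w x - 1) * (G x * G x)) - 2 * Ex N k (\<lambda>x. (w x - 1) * (G x * H x))) + Ex N k (\<lambda>x. (w x - 1) * (H x * H x)))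
   + Ex N k (\<lambda>x. (G x - H x) * G' x)) - Ex N k (\<lambda>x. (G x - H x) * H x)) + Ex N k (\<lambda>x. (G x - H x) * (G x - G' x))"
  unfolding Ex_add[symmetric] Ex_diff[symmetric] Ex_cmult[symmetric]
  by (rule arg_cong[of _ _ "Ex N k"], rule ext) (simp add: power2_eq_square algebra_simps)
 hence E: "Ex N k (\<lambda>x. w x * (G x - H x)\<^sup>2) <= 4 * e2 + 2 * e1 + e3"
  using X1 X2 X3 D1 D2 D3 by linarith
 have "0 <= Ex N k (\<lambda>x. w x * (G x - H x)\<^sup>2)" by (rule Ex_nonneg[OF _ N]) (simp add: w_def W0)
 hence "T\<^sup>2 <= 2 * (4 * e2 + 2 * e1 + e3)"
  using T2 Ew E by (meson mult_mono order_trans zero_le_numeral)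
 hence "\<bar>T\<bar> <= sqrt (2 * (4 * e2 + 2 * e1 + e3))" by (rule real_le_rsqrt[of "\<bar>T\<bar>", simplified])
 with main show ?thesis by linarith
qed

text \<open>Induction on the number of sparse edges. One step loses a square root, so the auxiliary
  errors are multiples of \<open>et\<^sup>2\<close>, small enough for
  \<open>2 * (4 * e2 + 2 * e1 + e3) \<le> (et / 2)\<^sup>2\<close>.\<close>

theorem counting:
 assumes k: "k >= 2"
 shows "et > 0 ==> \<exists>ep>0. \<forall>N nv J g h. N > 0 \<and> (\<forall>t. nv t >= 0) \<and> LF N k nv ep \<and> J \<subseteq> {..<k} \<and> card J = s \<and> edges_ok N k nv ep J g h
  --> \<bar>EP N k g - EP N k h\<bar> <= et"
proof (induction s arbitrary: et)
 case 0
 show ?case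
 proof (intro exI[of _ "et / k"] conjI allI impI)
  show "et / k > 0" using 0 k by simp
  fix N nv J g h
  assume a: "N > 0 \<and> (\<forall>t. nv t >= 0) \<and> LF N k nv (et / k) \<and> J \<subseteq> {..<k} \<and> card J = 0 \<and> edges_ok N k nv (et / k) J g h"
  hence "J = {}" using finite_subset[of J "{..<k}"] by auto
  thus "\<bar>EP N k g - EP N k h\<bar> <= et"
   using counting_dense[of N k nv "et / k" g h] a k by simp
 qed
next
 case (Suc s)
 define e1 where "e1 = et\<^sup>2 / 64"
 have e1: "e1 > 0" using Suc.prems by (simp add: e1_def)
 from Suc.IH[OF e1] obtain ep1 where ep1: "ep1 > 0" and IH: "\<And>N nv J g h. N > 0 ==> (\<And>t. nv t >= 0) ==> LF N k nv ep1 ==> J \<subseteq> {..<k} ==>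
  card J = s ==> edges_ok N k nv ep1 J g h ==> \<bar>EP N k g - EP N k h\<bar> <= e1" by blast
 define D :: real where "D = (2 ^ (k * 2 ^ k) * 2) ^ (2 ^ (k - 1))"
 have D: "D > 0" by (simp add: D_def)
 define e2 where "e2 = et\<^sup>2 / 128"
 have e2: "e2 > 0" using Suc.prems by (simp add: e2_def)
 define e3 where "e3 = et\<^sup>2 / 32"
 have e3: "e3 > 0" using Suc.prems by (simp add: e3_def)
 define ep where "ep = Min {ep1, 1, e2 ^ (2 ^ (k - 1)) / D, e3\<^sup>2 / 21, et / 2}"
 have ep: "ep > 0" using ep1 D e2 e3 Suc.prems by (simp add: ep_def)
 have le: "ep <= ep1" "ep <= 1" "ep <= e2 ^ (2 ^ (k - 1)) / D" "ep <= e3\<^sup>2 / 21" "ep <= et / 2"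
  unfolding ep_def by (rule Min_le, simp, simp)+
 show ?case
 proof (intro exI[of _ ep] conjI allI impI)
  fix N nv J g h
  assume a: "N > 0 \<and> (\<forall>t. nv t >= 0) \<and> LF N k nv ep \<and> J \<subseteq> {..<k} \<and> card J = Suc s \<and> edges_ok N k nv ep J g h"
  then obtain j where j: "j \<in> J" "j < k" by (metis card.empty all_not_in_conv lessThan_iff nat.distinct(1) subsetD)
  have "card (J - {j}) = s" using a j finite_subset[of J "{..<k}"] by simp
  moreover have "J - {j} \<subseteq> {..<k}" using a by blast
  ultimately have IH': "\<bar>EP N k g' - EP N k h'\<bar> <= e1"
   if "edges_ok N k nv ep (J - {j}) g' h'" for g' h'
   using IH[of N nv "J - {j}" g' h'] a LF_mono[OF _ le(1)] edges_ok_mono[OF that le(1)] by blast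
  have s1: "(2 ^ (k * 2 ^ k) * 2) ^ (2 ^ (k - 1)) * ep <= e2 ^ (2 ^ (k - 1))"
   using le(3) D by (simp only: D_def[symmetric]) (simp add: pos_le_divide_eq mult.commute)
  have s2: "21 * ep <= e3\<^sup>2" using le(4) by simp
  have aa: "N > 0" "\<And>t. nv t >= 0" "LF N k nv ep" "edges_ok N k nv ep J g h" using a by auto
  have "\<bar>EP N k g - EP N k h\<bar> <= ep + sqrt (2 * (4 * e2 + 2 * e1 + e3))"
   by (rule counting_step[OF k aa(1,2,3) le(2) less_imp_le[OF ep] aa(4) j(2,1) s1 less_imp_le[OF e2] s2 less_imp_le[OF e3] IH'])
  also have "2 * (4 * e2 + 2 * e1 + e3) <= (et / 2)\<^sup>2" by (simp add: e1_def e2_def e3_def power_divide)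
  hence "sqrt (2 * (4 * e2 + 2 * e1 + e3)) <= et / 2" using Suc.prems by (intro real_le_lsqrt) auto
  finally show "\<bar>EP N k g - EP N k h\<bar> <= et" using le by linarith
 qed (rule ep)
qed

section \<open>The dense model theorem\<close>

definition clip :: "real => real" where "clip s = max 0 (min 1 s)"

text \<open>The convex function with derivative \<open>clip\<close>: the maximum of
  \<open>c * s - c\<^sup>2 / 2\<close> over \<open>c\<close> in \<open>[0, 1]\<close>, attained at
  \<open>c = clip s\<close>.\<close>

definition potential :: "real => real" where "potential s = clip s * s - (clip s)\<^sup>2 / 2"

lemma clip_bounds: "0 <= clip s" "clip s <= 1" by (auto simp: clip_def)

text \<open>As \<open>clip s\<close> is the maximiser, exchanging it for \<open>clip (s + h)\<close>
  loses at least half the square of their difference, and this absorbs the mixed term.\<close>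

lemma potential_step: "potential (s + h) <= potential s + h * clip s + h\<^sup>2 / 2"
proof -
 define c c' where "c = clip s" and "c' = clip (s + h)"
 have "(c - c') * (s - c) >= 0"
  using clip_bounds[of "s + h"] unfolding c'_def[symmetric]
  by (cases "s < 0"; cases "s > 1") (auto simp: c_def clip_def mult_nonneg_nonpos mult_nonpos_nonpos)
 moreover have "(c * s - c\<^sup>2 / 2) - (c' * s - c'\<^sup>2 / 2) = (c - c') * (s - c) + (c - c')\<^sup>2 / 2"
  by (simp add: power2_eq_square field_simps)
 moreover have "potential (s + h) = (c' * s - c'\<^sup>2 / 2) + c' * h"
  by (simp add: potential_def c'_def field_simps)
 moreover have "(c' - c) * h <= (c - c')\<^sup>2 / 2 + h\<^sup>2 / 2"
 proof -
  have "0 <= ((c' - c) - h)\<^sup>2" by simp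
  hence "2 * ((c' - c) * h) <= (c - c')\<^sup>2 + h\<^sup>2" by (simp add: power2_eq_square algebra_simps)
  thus ?thesis by linarith
 qed
 ultimately show ?thesis unfolding potential_def c_def[symmetric] by (simp add: algebra_simps)
qed

lemma potential_upper:
 assumes "0 <= f" "f <= nv"
 shows "f * s - potential s <= (nv - 1) * max 0 s + 1 / 2"
proof -
 have "f * s <= nv * max 0 s"
 proof (cases "s >= 0")
  case True thus ?thesis using assms by (simp add: mult_right_mono)
 next
  case False thus ?thesis using assms by (simp add: mult_nonneg_nonpos)
 qed
 moreover have "max 0 s - potential s <= 1 / 2"
 proof -
  have "0 <= (1 - s)\<^sup>2" by simp
  thus ?thesis by (cases "s < 0"; cases "s > 1") (auto simp: potential_def clip_def power2_eq_square algebra_simps)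
 qed
 ultimately show ?thesis by (simp add: algebra_simps)
qed

text \<open>Closure under products lets polynomials, and by approximation the function
  \<open>max 0\<close>, be applied to averages of test functions.\<close>

definition test_class :: "nat => (int => real) set => bool" where
 "test_class N H \<longleftrightarrow> (\<forall>ff\<in>H. periodic N ff \<and> (\<forall>t. \<bar>ff t\<bar> <= 1) \<and> (\<lambda>t. - ff t) \<in> H) \<and> (\<lambda>_. 1) \<in> H \<and>
  (\<forall>ff\<in>H. \<forall>\<psi>\<in>H. (\<lambda>t. ff t * \<psi> t) \<in> H) \<and>
  (\<forall>A Ph. finite (A :: int set) \<and> A ~= {} \<and> (\<forall>a\<in>A. Ph a \<in> H) --> (\<lambda>t. (\<Sum>a\<in>A. Ph a t) / card A) \<in> H)"

lemma avg_add: "avg N (\<lambda>t. f t + g t) = avg N f + avg N g" by (simp add: avg_def sum.distrib add_divide_distrib)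
lemma avg_diff: "avg N (\<lambda>t. f t - g t) = avg N f - avg N g" by (simp add: avg_def sum_subtractf diff_divide_distrib)
lemma avg_cmult: "avg N (\<lambda>t. c * f t) = c * avg N f" by (simp add: avg_def sum_distrib_left[symmetric])
lemma avg_sum: "avg N (\<lambda>t. \<Sum>a\<in>A. f a t) = (\<Sum>a\<in>A. avg N (f a))"
 by (simp add: avg_def sum_divide_distrib[symmetric]) (subst sum.swap, simp)

text \<open>The dense model is found by gradient descent: \<open>S n\<close> moves along a test function that
 distinguishes \<open>f\<close> from \<open>clip (S n)\<close>; since \<open>nv\<close> is indistinguishable from 1 this
 cannot go on for long.\<close>

theorem dense_model:
 assumes ep: "ep > 0"
 shows "\<exists>ep'>0. \<forall>N nv f H. N > 0 \<and> (\<forall>t. 0 <= f t \<and> f t <= nv t) \<and> test_class N H \<and>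
  (\<forall>ff\<in>H. \<bar>avg N (\<lambda>t. (nv t - 1) * ff t)\<bar> <= ep') -->
  (\<exists>g. periodic N g \<and> (\<forall>t. 0 <= g t \<and> g t <= 1) \<and> (\<forall>ff\<in>H. \<bar>avg N (\<lambda>t. (f t - g t) * ff t)\<bar> <= ep))"
proof -
 \<comment> \<open>Each step raises the objective \<open>A\<close> by \<open>ep\<^sup>2 / 2\<close>,
   so \<open>T\<close> steps bring it to 2, while the near-uniformity of \<open>nv\<close> will keep
   it at most \<open>3 / 2\<close>.\<close>
 define T where "T = nat \<lceil>4 / ep\<^sup>2\<rceil>"
 have T: "real T >= 4 / ep\<^sup>2" unfolding T_def by linarith
 hence "real T > 0" using ep by (smt (verit) divide_pos_pos zero_less_power)
 hence T0: "T > 0" by simp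
 \<comment> \<open>With \<open>u = (1 + a) / 2\<close>, where \<open>a\<close> is the mean of the
   chosen test functions, \<open>F u\<close> is \<open>max 0 a\<close>. Its Bernstein polynomials
   are combinations of products of \<open>u\<close> and \<open>1 - u\<close>, both of which are in
   the test class.\<close>
 define F where "F = (\<lambda>u::real. max 0 (2 * u - 1))"
 have contF: "continuous_on {0..1} F" unfolding F_def by (intro continuous_intros)
 define ka where "ka = 1 / (6 * (ep * T))"
 have epT: "ep * T > 0" using ep T0 by simp
 have ka: "ka > 0" using epT by (simp add: ka_def)
 obtain n where n: "\<And>u. u \<in> {0..1} ==> \<bar>F u - (\<Sum>k\<le>n. F (k / n) * Bernstein n k u)\<bar> < ka"
  using Bernstein_Weierstrass[OF contF ka] by blast
 define ep' where "ep' = min 1 (1 / (2 ^ n * (2 * (ep * T))))"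
 have ep': "ep' > 0" using epT by (simp add: ep'_def)
 have "\<exists>g. periodic N g \<and> (\<forall>t. 0 <= g t \<and> g t <= 1) \<and> (\<forall>ff\<in>H. \<bar>avg N (\<lambda>t. (f t - g t) * ff t)\<bar> <= ep)"
  if N: "N > 0" and f: "\<And>t. 0 <= f t" "\<And>t. f t <= nv t" and H: "test_class N H"
   and nvH: "\<And>ff. ff \<in> H ==> \<bar>avg N (\<lambda>t. (nv t - 1) * ff t)\<bar> <= ep'" for N nv f H
 proof (rule ccontr)
  assume neg: "\<not> ?thesis"
  have Hper: "periodic N ff" and Hb: "\<bar>ff t\<bar> <= 1" and Hneg: "(\<lambda>t. - ff t) \<in> H" if "ff \<in> H" for ff t
   using H that by (auto simp: test_class_def)
  have H1: "(\<lambda>_. 1) \<in> H" and Hmult: "\<And>ff \<psi>. ff \<in> H ==> \<psi> \<in> H ==> (\<lambda>t. ff t * \<psi> t) \<in> H"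
   using H by (auto simp: test_class_def)
  have Havg: "(\<lambda>t. (\<Sum>a\<in>A. Ph a t) / card A) \<in> H" if "finite A" "A ~= {}" "\<And>a. a \<in> A ==> Ph a \<in> H" for A :: "int set" and Ph
   using H that unfolding test_class_def by blast
  have ex: "\<exists>ff\<in>H. avg N (\<lambda>t. (f t - clip (S t)) * ff t) > ep" if "periodic N S" for S
  proof -
   have "periodic N (\<lambda>t. clip (S t))" using that by (simp add: periodic_def)
   then obtain ff where ff: "ff \<in> H" "\<bar>avg N (\<lambda>t. (f t - clip (S t)) * ff t)\<bar> > ep"
   proof -
    have "\<not> (\<forall>ff\<in>H. \<bar>avg N (\<lambda>t. (f t - clip (S t)) * ff t)\<bar> <= ep)"
     using neg clip_bounds \<open>periodic N (\<lambda>t. clip (S t))\<close> by blast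
    thus ?thesis using that by (auto simp: not_le)
   qed
   show ?thesis
   proof (cases "avg N (\<lambda>t. (f t - clip (S t)) * ff t) > ep")
    case False
    have "avg N (\<lambda>t. (f t - clip (S t)) * (- ff t)) = - avg N (\<lambda>t. (f t - clip (S t)) * ff t)"
     using avg_cmult[of N "-1" "\<lambda>t. (f t - clip (S t)) * ff t"] by simp
    thus ?thesis using False ff by (intro bexI[of _ "\<lambda>t. - ff t"] Hneg) auto
   qed (use ff in blast)
  qed
  define sel where "sel = (\<lambda>S. SOME ff. ff \<in> H \<and> avg N (\<lambda>t. (f t - clip (S t)) * ff t) > ep)"
  have sel: "sel S \<in> H" "avg N (\<lambda>t. (f t - clip (S t)) * sel S t) > ep" if "periodic N S" for S
   using someI_ex[of "\<lambda>ff. ff \<in> H \<and> avg N (\<lambda>t. (f t - clip (S t)) * ff t) > ep"] ex[OF that] unfolding sel_def by blast+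
  define S where "S = rec_nat (\<lambda>_. 0) (\<lambda>_ S t. S t + ep * sel S t)"
  have S0: "S 0 = (\<lambda>_. 0)" and SS: "S (Suc m) = (\<lambda>t. S m t + ep * sel (S m) t)" for m by (simp_all add: S_def)
  have Sper: "periodic N (S m)" for m
  proof (induction m)
   case (Suc m)
   thus ?case using Hper[OF sel(1)[OF Suc]] by (simp add: SS periodic_def)
  qed (simp add: S0 periodic_def)
  note selm = sel[OF Sper]
  have Ssum: "S m t = ep * (\<Sum>a\<in>{0..<int m}. sel (S (nat a)) t)" for m t
  proof (induction m)
   case (Suc m)
   have "{0..<int (Suc m)} = insert (int m) {0..<int m}" by auto
   thus ?case by (simp add: SS Suc algebra_simps)
  qed (simp add: S0)
  define A where "A = (\<lambda>m. avg N (\<lambda>t. f t * S m t - potential (S m t)))"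
  have A_step: "A (Suc m) >= A m + ep\<^sup>2 / 2" for m
  proof -
   have "avg N (\<lambda>t. potential (S (Suc m) t)) <= avg N (\<lambda>t. (potential (S m t) + ep * (clip (S m t) * sel (S m) t)) + ep\<^sup>2 / 2)"
   proof (rule avg_mono)
    fix t
    have "(ep * sel (S m) t)\<^sup>2 <= ep\<^sup>2 * 1"
     unfolding power_mult_distrib using Hb[OF selm(1), of m t] by (intro mult_left_mono) (auto simp: abs_square_le_1)
    thus "potential (S (Suc m) t) <= (potential (S m t) + ep * (clip (S m t) * sel (S m) t)) + ep\<^sup>2 / 2"
     using potential_step[of "S m t" "ep * sel (S m) t"] by (simp add: SS mult_ac)
   qed
   hence 1: "avg N (\<lambda>t. potential (S (Suc m) t)) <= avg N (\<lambda>t. potential (S m t)) + ep * avg N (\<lambda>t. clip (S m t) * sel (S m) t) + ep\<^sup>2 / 2"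
    using avg_const[OF N, of "ep\<^sup>2 / 2"] by (simp add: avg_add avg_cmult)
   have "avg N (\<lambda>t. (f t - clip (S m t)) * sel (S m) t) = avg N (\<lambda>t. f t * sel (S m) t) - avg N (\<lambda>t. clip (S m t) * sel (S m) t)"
    by (simp add: left_diff_distrib avg_diff)
   hence "ep * avg N (\<lambda>t. clip (S m t) * sel (S m) t) <= ep * (avg N (\<lambda>t. f t * sel (S m) t) - ep)"
    using selm(2)[of m] ep by (intro mult_left_mono) auto
   moreover have "avg N (\<lambda>t. f t * S (Suc m) t) = avg N (\<lambda>t. f t * S m t) + ep * avg N (\<lambda>t. f t * sel (S m) t)"
    unfolding avg_cmult[symmetric] avg_add[symmetric] by (simp add: SS algebra_simps)
   ultimately show ?thesis using 1 by (simp add: A_def avg_diff power2_eq_square algebra_simps)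
  qed
  have "A m >= real m * (ep\<^sup>2 / 2)" for m
  proof (induction m)
   case 0 show ?case using avg_const[OF N, of 0] by (simp add: A_def S0 potential_def clip_def)
  next
   case (Suc m) thus ?case using A_step[of m] by (simp add: field_simps)
  qed
  hence "A T >= real T * (ep\<^sup>2 / 2)" .
  moreover have "real T * (ep\<^sup>2 / 2) >= 4 / ep\<^sup>2 * (ep\<^sup>2 / 2)" using T by (intro mult_right_mono) auto
  ultimately have A2: "A T >= 2" using ep by simp
  have "A T <= avg N (\<lambda>t. (nv t - 1) * max 0 (S T t) + 1 / 2)"
   unfolding A_def by (intro avg_mono potential_upper f)
  hence big: "avg N (\<lambda>t. (nv t - 1) * max 0 (S T t)) >= 3 / 2"
   using A2 avg_const[OF N, of "1/2"] by (simp add: avg_add)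
  define a where "a = (\<lambda>t. (\<Sum>b\<in>{0..<int T}. sel (S (nat b)) t) / card {0..<int T})"
  have aH: "a \<in> H" unfolding a_def by (rule Havg) (use T0 selm in auto)
  define u where "u = (\<lambda>t. (\<Sum>b\<in>{0, 1::int}. (if b = 0 then (\<lambda>_. 1) else a) t) / card {0, 1::int})"
  have uH: "u \<in> H" unfolding u_def by (rule Havg) (use H1 aH in auto)
  define v where "v = (\<lambda>t. (\<Sum>b\<in>{0, 1::int}. (if b = 0 then (\<lambda>_. 1) else (\<lambda>t. - a t)) t) / card {0, 1::int})"
  have vH: "v \<in> H" unfolding v_def by (rule Havg) (use H1 Hneg[OF aH] in auto)
  have u: "u t = (1 + a t) / 2" and v: "v t = 1 - u t" for t by (simp_all add: u_def v_def field_simps)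
  have u01: "u t \<in> {0..1}" for t using Hb[OF aH, of t] unfolding u by auto
  have ST: "max 0 (S T t) = (ep * T) * F (u t)" for t
  proof -
   have "S T t = (ep * T) * a t" using T0 by (simp add: Ssum a_def)
   moreover have "max 0 ((ep * T) * a t) = (ep * T) * max 0 (a t)" using epT by (simp add: max_mult_distrib_left)
   moreover have "2 * u t - 1 = a t" unfolding u by (simp add: field_simps)
   ultimately show ?thesis by (simp add: F_def)
  qed
  have powH: "(\<lambda>t. ff t ^ j) \<in> H" if "ff \<in> H" for ff j
   by (induction j) (use H1 Hmult that in auto)
  have bern: "\<bar>avg N (\<lambda>t. (nv t - 1) * (u t ^ j * v t ^ (n - j)))\<bar> <= ep'" for j
   by (intro nvH Hmult powH uH vH)
  define P where "P = (\<lambda>t. \<Sum>j\<le>n. F (j / n) * Bernstein n j (u t))"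
  have "avg N (\<lambda>t. (nv t - 1) * P t) <= 2 ^ n * ep'"
  proof -
   have "avg N (\<lambda>t. (nv t - 1) * P t) = avg N (\<lambda>t. \<Sum>j\<le>n. (F (j / n) * (n choose j)) * ((nv t - 1) * (u t ^ j * v t ^ (n - j))))"
    by (simp add: P_def Bernstein_def v sum_distrib_left mult_ac)
   also have "... = (\<Sum>j\<le>n. (F (j / n) * (n choose j)) * avg N (\<lambda>t. (nv t - 1) * (u t ^ j * v t ^ (n - j))))"
    unfolding avg_sum avg_cmult ..
   also have "... <= (\<Sum>j\<le>n. real (n choose j) * ep')"
   proof (rule sum_mono)
    fix j assume j: "j \<in> {..n}"
    have Fj: "0 <= F (j / n)" "F (j / n) <= 1" using j by (auto simp: F_def divide_simps)
    have "(F (j / n) * (n choose j)) * avg N (\<lambda>t. (nv t - 1) * (u t ^ j * v t ^ (n - j))) <= (F (j / n) * (n choose j)) * ep'"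
     using bern[of j] Fj by (intro mult_left_mono) auto
    also have "... <= (1 * (n choose j)) * ep'" using Fj ep' by (intro mult_right_mono) (auto simp: mult_left_le_one_le)
    finally show "(F (j / n) * (n choose j)) * avg N (\<lambda>t. (nv t - 1) * (u t ^ j * v t ^ (n - j))) <= real (n choose j) * ep'" by simp
   qed
   also have "... = real (\<Sum>j\<le>n. n choose j) * ep'" by (simp add: sum_distrib_right)
   also have "... = 2 ^ n * ep'" by (simp add: choose_row_sum)
   finally show ?thesis .
  qed
  moreover have "avg N (\<lambda>t. (nv t - 1) * F (u t)) <= avg N (\<lambda>t. (nv t - 1) * P t + ka * (nv t + 1))"
  proof (rule avg_mono)
   fix t
   have nv0: "nv t >= 0" using f[of t] by linarith
   have "(nv t - 1) * (F (u t) - P t) <= \<bar>nv t - 1\<bar> * \<bar>F (u t) - P t\<bar>" by (metis abs_ge_self abs_mult)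
   also have "... <= (nv t + 1) * ka" using n[OF u01[of t]] nv0 by (intro mult_mono) (auto simp: P_def)
   finally show "(nv t - 1) * F (u t) <= (nv t - 1) * P t + ka * (nv t + 1)" by (simp add: algebra_simps)
  qed
  moreover have "avg N (\<lambda>t. (nv t - 1) * P t + ka * (nv t + 1)) = avg N (\<lambda>t. (nv t - 1) * P t) + ka * (avg N nv + 1)"
   using avg_const[OF N, of 1] by (simp add: avg_add avg_cmult)
  moreover have "avg N nv <= 2"
  proof -
   have "\<bar>avg N (\<lambda>t. (nv t - 1) * 1)\<bar> <= ep'" by (rule nvH[OF H1])
   hence "\<bar>avg N nv - 1\<bar> <= ep'" using avg_const[OF N, of 1] by (simp add: avg_diff)
   moreover have "ep' <= 1" by (simp add: ep'_def)
   ultimately show ?thesis by linarith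
  qed
  ultimately have "avg N (\<lambda>t. (nv t - 1) * F (u t)) <= 2 ^ n * ep' + ka * 3"
   using ka mult_left_mono[of "avg N nv + 1" 3 ka] by linarith
  hence "(ep * T) * avg N (\<lambda>t. (nv t - 1) * F (u t)) <= (ep * T) * (2 ^ n * ep' + ka * 3)"
   using epT by (intro mult_left_mono) auto
  moreover have "(ep * T) * avg N (\<lambda>t. (nv t - 1) * F (u t)) = avg N (\<lambda>t. (nv t - 1) * max 0 (S T t))"
   unfolding ST avg_cmult[symmetric] by (simp add: mult_ac)
  moreover have "(ep * T) * (2 ^ n * ep' + ka * 3) <= 1"
  proof -
   have "(2 ^ n * (2 * (ep * T))) * ep' <= (2 ^ n * (2 * (ep * T))) * (1 / (2 ^ n * (2 * (ep * T))))"
    unfolding ep'_def using epT by (intro mult_left_mono) auto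
   also have "... = 1" using ep T0 by simp
   finally have "(ep * T) * (2 ^ n * ep') <= 1 / 2" by (simp add: mult_ac)
   moreover have "(ep * T) * (ka * 3) = 1 / 2" using ep T0 by (simp add: ka_def)
   ultimately show ?thesis by (simp add: distrib_left)
  qed
  ultimately show False using big by linarith
 qed
 thus ?thesis using ep' by (intro exI[of _ ep'] conjI) blast+
qed

section \<open>Dual functions\<close>

definition pmod :: "nat => ((nat => int) => real) => bool" where
 "pmod N u \<longleftrightarrow> (\<forall>x y. (\<forall>m. x m mod int N = y m mod int N) --> u x = u y)"

lemma pmodD: "pmod N u ==> (\<And>m. x m mod int N = y m mod int N) ==> u x = u y"
 unfolding pmod_def by blast

lemma pmod_per: "pmod N u ==> per N i u"
 unfolding per_def by (auto intro: pmodD)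

definition tests :: "nat => nat => (nat => (nat => int) => real) set" where
 "tests N k = {u. \<forall>l<k. ign l (u l) \<and> (\<forall>m\<ge>k. ign m (u l)) \<and> pmod N (u l) \<and> (\<forall>x. \<bar>u l x\<bar> <= 1)}"

text \<open>The dual function of the system \<open>u\<close>: the mean of the product over all
  points with coordinate sum \<open>y\<close>, coordinate 0 being solved for.\<close>

definition phi :: "nat => nat => (nat => (nat => int) => real) => int => real" where
 "phi N k u y = ex N [1..<k] (\<lambda>z. \<Prod>l<k. u l (z(0 := y - (\<Sum>l\<in>{1..<k}. z l)))) (\<lambda>_. 0)"

lemma phi_periodic: assumes "u \<in> tests N k" shows "periodic N (phi N k u)"
 unfolding periodic_def
proof
 fix t
 have "u l (z(0 := t + int N - s)) = u l (z(0 := t - s))" if "l < k" for l z s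
  by (rule pmodD[of N]) (use assms that in \<open>auto simp: tests_def mod_diff_left_eq[symmetric, of "t + int N"] mod_diff_left_eq[of t]\<close>)
 thus "phi N k u (t + int N) = phi N k u t" unfolding phi_def by simp
qed

lemma prod_abs_le_1: "(\<And>l. l \<in> L ==> \<bar>f l\<bar> <= (1::real)) ==> \<bar>\<Prod>l\<in>L. f l\<bar> <= 1"
 unfolding abs_prod by (rule prod_le_1) auto

lemma phi_bound: assumes "u \<in> tests N k" "N > 0" shows "\<bar>phi N k u y\<bar> <= 1"
proof -
 have "\<bar>phi N k u y\<bar> <= ex N [1..<k] (\<lambda>z. \<bar>\<Prod>l<k. u l (z(0 := y - (\<Sum>l\<in>{1..<k}. z l)))\<bar>) (\<lambda>_. 0)"
  unfolding phi_def by (rule ex_abs[OF assms(2)])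
 also have "... <= ex N [1..<k] (\<lambda>_. 1) (\<lambda>_. 0)"
  by (rule ex_mono, rule prod_abs_le_1) (use assms in "auto simp: tests_def")
 finally show ?thesis by (simp add: ex_const[OF assms(2)])
qed

lemma avg_ex_swap: "avg N (\<lambda>t. ex M is (F t) z) = ex M is (\<lambda>z. avg N (\<lambda>t. F t z)) z" if "M > 0"
proof -
 have "ex M is (\<lambda>z. avg N (\<lambda>t. F t z)) z = ex M is (\<lambda>z. (1 / N) * (\<Sum>t\<in>{0..<int N}. F t z)) z"
  by (simp add: avg_def)
 thus ?thesis unfolding ex_cmult ex_sum[OF that] by (simp add: avg_def)
qed

lemma ex_ex_swap: "ex M is (\<lambda>z. ex N js (F z) v0) z0 = ex N js (\<lambda>v. ex M is (\<lambda>z. F z v) z0) v0" if "M > 0"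
proof (induction js arbitrary: v0)
 case (Cons j js)
 have "ex M is (\<lambda>z. ex N (j # js) (F z) v0) z0 = ex M is (\<lambda>z. avg N (\<lambda>t. ex N js (F z) (v0(j := t)))) z0"
  by (simp add: av_def)
 also have "... = avg N (\<lambda>t. ex M is (\<lambda>z. ex N js (F z) (v0(j := t))) z0)" by (rule avg_ex_swap[OF that, symmetric])
 also have "... = avg N (\<lambda>t. ex N js (\<lambda>v. ex M is (\<lambda>z. F z v) z0) (v0(j := t)))" by (simp only: Cons)
 finally show ?case by (simp add: av_def)
qed simp

lemma per_av: assumes "pmod N F" shows "pmod N (av N i F)"
 unfolding pmod_def av_def
proof (intro allI impI arg_cong[of _ _ "avg N"] ext)
 fix x y :: "nat => int" and t assume "\<forall>m. x m mod int N = y m mod int N"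
 thus "F (x(i := t)) = F (y(i := t))" by (intro pmodD[OF assms]) simp
qed

lemma pmod_ex: "pmod N F ==> pmod N (ex N is F)"
 by (induction "is") (auto intro: per_av)

lemma ex_shift_all:
 assumes "pmod N G" "N > 0"
 shows "ex N is (\<lambda>v. G (\<lambda>l. z l + v l)) v0 = ex N is G (\<lambda>l. z l + v0 l)"
proof (induction "is" arbitrary: v0)
 case (Cons i "is")
 have upd: "(\<lambda>l. z l + (v0(i := t)) l) = (\<lambda>l. z l + v0 l)(i := t + z i)" for t by (rule ext) simp
 have per: "periodic N (\<lambda>t. ex N is G ((\<lambda>l. z l + v0 l)(i := t)))"
  unfolding periodic_def by (intro allI pmodD[OF pmod_ex[OF assms(1)]]) auto
 show ?case unfolding ex_Cons av_def Cons upd avg_shift[OF per assms(2)] ..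
qed simp

text \<open>Averaging also over \<open>y\<close> frees coordinate 0: correlation with a dual
  function is a cut-norm test for the form \<open>\<Sum>l<k. x l\<close>.\<close>

lemma avg_phi:
 assumes u: "u \<in> tests N k" and k: "k > 0" and N: "N > 0" and h: "periodic N h"
 shows "avg N (\<lambda>y. h y * phi N k u y) = Ex N k (\<lambda>x. h (\<Sum>l<k. x l) * (\<Prod>l<k. u l x))"
proof -
 define F where "F = (\<lambda>x. h (\<Sum>l<k. x l) * (\<Prod>l<k. u l x))"
 have igF: "ign m F" if "m >= k" for m
  unfolding F_def
 proof (rule ign_binop[of _ _ _ "(*)"])
  show "ign m (\<lambda>x. h (\<Sum>l<k. x l))" unfolding ign_def using that by (intro allI arg_cong[of _ _ h] sum.cong) auto
  show "ign m (\<lambda>x. \<Prod>l<k. u l x)" by (rule ign_prod) (use u that in "auto simp: tests_def")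
 qed
 have triv: "ex N js F = F" if "\<And>m. m \<in> set js ==> m >= k" for js
  using that by (induction js) (auto simp: av_ign[OF igF N])
 have split0: "(\<Sum>l<k. x l) = x 0 + (\<Sum>l\<in>{1..<k}. x l)" for x :: "nat => int"
 proof -
  have "{..<k} = insert 0 {1..<k}" using k by auto
  thus ?thesis by simp
 qed
 have t1: "ex N [k..<2 * k] F = F" by (rule triv) simp
 have "[0..<2 * k] = [0..<k] @ [k..<2 * k]" using upt_add_eq_append[of 0 k k] by (simp add: mult_2)
 moreover have "[0..<k] = 0 # [1..<k]" using k by (simp add: upt_conv_Cons)
 ultimately have "Ex N k F = av N 0 (ex N [1..<k] F) (\<lambda>_. 0)"
  unfolding Ex_def by (simp add: ex_append t1)
 also have "... = ex N [1..<k] (av N 0 F) (\<lambda>_. 0)" by (simp add: av_ex_commute)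
 also have "av N 0 F = (\<lambda>z. avg N (\<lambda>y. h y * (\<Prod>l<k. u l (z(0 := y - (\<Sum>l\<in>{1..<k}. z l))))))"
 proof
  fix z
  define K where "K = (\<lambda>y. h y * (\<Prod>l<k. u l (z(0 := y - (\<Sum>l\<in>{1..<k}. z l)))))"
  have "periodic N K" unfolding periodic_def
  proof
   fix t
   have "u l (z(0 := t + int N - s)) = u l (z(0 := t - s))" if "l < k" for l z s
    by (rule pmodD[of N]) (use u that in \<open>auto simp: tests_def mod_diff_left_eq[symmetric, of "t + int N"] mod_diff_left_eq[of t]\<close>)
   thus "K (t + int N) = K t" using h by (simp add: K_def periodic_def)
  qed
  from avg_shift[OF this N, of "\<Sum>l\<in>{1..<k}. z l"]
  have "avg N (\<lambda>t. K (t + (\<Sum>l\<in>{1..<k}. z l))) = avg N K" .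
  moreover have "K (t + (\<Sum>l\<in>{1..<k}. z l)) = F (z(0 := t))" for t
   by (simp add: K_def F_def split0)
  ultimately show "av N 0 F z = avg N (\<lambda>y. h y * (\<Prod>l<k. u l (z(0 := y - (\<Sum>l\<in>{1..<k}. z l)))))"
   by (simp add: av_def K_def)
 qed
 also have "ex N [1..<k] ... (\<lambda>_. 0) = avg N (\<lambda>y. ex N [1..<k] (\<lambda>z. h y * (\<Prod>l<k. u l (z(0 := y - (\<Sum>l\<in>{1..<k}. z l))))) (\<lambda>_. 0))"
  by (rule avg_ex_swap[OF N, symmetric])
 finally show ?thesis by (simp add: ex_cmult phi_def F_def)
qed

text \<open>Averages are included because a product of two dual functions is in general not a dual
  function but an average of such.\<close>

inductive_set dhull :: "nat => nat => (int => real) set" for N k where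
 base: "u \<in> tests N k ==> phi N k u \<in> dhull N k"
| avgs: "finite (A :: int set) ==> A ~= {} ==> (\<And>a. a \<in> A ==> Ph a \<in> dhull N k) ==> (\<lambda>t. (\<Sum>a\<in>A. Ph a t) / card A) \<in> dhull N k"

lemma dhull_ex:
 assumes "\<And>v. Ph v \<in> dhull N k" "N > 0"
 shows "(\<lambda>y. ex N is (\<lambda>v. Ph v y) v0) \<in> dhull N k"
proof (induction "is" arbitrary: v0)
 case (Cons i "is")
 have "(\<lambda>y. (\<Sum>t\<in>{0..<int N}. ex N is (\<lambda>v. Ph v y) (v0(i := t))) / card {0..<int N}) \<in> dhull N k"
  by (rule avgs) (use assms Cons in auto)
 thus ?case by (simp add: av_def avg_def)
qed (simp add: assms)

text \<open>Writing the second family of variables as \<open>z + v\<close> with \<open>v\<close> of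
  coordinate sum zero exhibits the product as the average over \<open>v\<close> of the dual
  functions of \<open>u l x * w l (x + v)\<close>.\<close>

lemma phi_mult:
 assumes u: "u \<in> tests N k" and w: "w \<in> tests N k" and k: "k > 0" and N: "N > 0"
 shows "(\<lambda>y. phi N k u y * phi N k w y) \<in> dhull N k"
proof -
 define sh where "sh = (\<lambda>v::nat => int. v(0 := - (\<Sum>l\<in>{1..<k}. v l)))"
 define uw where "uw = (\<lambda>v l x. u l x * w l (\<lambda>m. x m + sh v m))"
 have uw: "uw v \<in> tests N k" for v
  unfolding tests_def
 proof (intro CollectI allI impI conjI)
  fix l assume l: "l < k"
  have upd: "(\<lambda>m. (x(i := t)) m + sh v m) = (\<lambda>m. x m + sh v m)(i := t + sh v i)" for x i t by (rule ext) simp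
  have ign_sh: "ign j (\<lambda>x. w l (\<lambda>m. x m + sh v m))" if "ign j (w l)" for j
   unfolding ign_def upd by (intro allI ignD[OF that])
  show "ign l (uw v l)" unfolding uw_def
   by (rule ign_binop[of _ _ _ "(*)"], use u l in \<open>simp add: tests_def\<close>, rule ign_sh, use w l in "simp add: tests_def")
  show "ign m (uw v l)" if "k <= m" for m unfolding uw_def
   by (rule ign_binop[of _ _ _ "(*)"], use u l that in \<open>simp add: tests_def\<close>, rule ign_sh, use w l that in "simp add: tests_def")
  show "\<bar>uw v l x\<bar> <= 1" for x
   using u w l by (auto simp: tests_def uw_def abs_mult intro!: mult_le_one)
  show "pmod N (uw v l)" unfolding pmod_def uw_def
  proof (intro allI impI)
   fix x y :: "nat => int" assume xy: "\<forall>m. x m mod int N = y m mod int N"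
   have "u l x = u l y" by (rule pmodD[of N]) (use u l xy in "auto simp: tests_def")
   moreover have "w l (\<lambda>m. x m + sh v m) = w l (\<lambda>m. y m + sh v m)"
    by (rule pmodD[of N]) (use w l xy in "auto simp: tests_def intro: mod_add_cong")
   ultimately show "u l x * w l (\<lambda>m. x m + sh v m) = u l y * w l (\<lambda>m. y m + sh v m)" by simp
  qed
 qed
 have "phi N k u y * phi N k w y = ex N [1..<k] (\<lambda>v. phi N k (uw v) y) (\<lambda>_. 0)" for y
 proof -
  define U where "U = (\<lambda>z. \<Prod>l<k. u l (z(0 := y - (\<Sum>l\<in>{1..<k}. z l))))"
  define G where "G = (\<lambda>z. \<Prod>l<k. w l (z(0 := y - (\<Sum>l\<in>{1..<k}. z l))))"
  have pG: "pmod N G" unfolding pmod_def G_def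
  proof (intro allI impI prod.cong refl)
   fix x z :: "nat => int" and l assume xz: "\<forall>m. x m mod int N = z m mod int N" and l: "l \<in> {..<k}"
   have "(\<Sum>l\<in>{1..<k}. x l) mod int N = (\<Sum>l\<in>{1..<k}. z l) mod int N"
   proof -
    have "(\<Sum>l\<in>{1..<k}. x l mod int N) = (\<Sum>l\<in>{1..<k}. z l mod int N)" using xz by simp
    thus ?thesis using mod_sum_eq[of x "int N" "{1..<k}"] mod_sum_eq[of z "int N" "{1..<k}"] by simp
   qed
   thus "w l (x(0 := y - (\<Sum>l\<in>{1..<k}. x l))) = w l (z(0 := y - (\<Sum>l\<in>{1..<k}. z l)))"
    by (intro pmodD[of N]) (use w l xz in "auto simp: tests_def intro: mod_diff_cong")
  qed
  have "phi N k u y * phi N k w y = ex N [1..<k] U (\<lambda>_. 0) * ex N [1..<k] G (\<lambda>_. 0)"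
   by (simp add: phi_def U_def G_def)
  also have "... = ex N [1..<k] (\<lambda>z. ex N [1..<k] G z * U z) (\<lambda>_. 0)"
   by (subst ex_mult_ign) (auto intro: ign_ex)
  also have "... = ex N [1..<k] (\<lambda>z. ex N [1..<k] (\<lambda>v. U z * G (\<lambda>l. z l + v l)) (\<lambda>_. 0)) (\<lambda>_. 0)"
   using ex_shift_all[OF pG N, of "[1..<k]" _ "\<lambda>_. 0"] by (simp add: ex_cmult mult.commute)
  also have "... = ex N [1..<k] (\<lambda>v. ex N [1..<k] (\<lambda>z. U z * G (\<lambda>l. z l + v l)) (\<lambda>_. 0)) (\<lambda>_. 0)"
   by (rule ex_ex_swap[OF N])
  also have "(\<lambda>v. ex N [1..<k] (\<lambda>z. U z * G (\<lambda>l. z l + v l)) (\<lambda>_. 0)) = (\<lambda>v. phi N k (uw v) y)"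
  proof
   fix v
   have "(\<lambda>l. z l + v l)(0 := y - (\<Sum>l\<in>{1..<k}. z l + v l)) = (\<lambda>m. (z(0 := y - (\<Sum>l\<in>{1..<k}. z l))) m + sh v m)" for z
    by (rule ext) (simp add: sh_def sum.distrib)
   thus "ex N [1..<k] (\<lambda>z. U z * G (\<lambda>l. z l + v l)) (\<lambda>_. 0) = phi N k (uw v) y"
    by (simp add: phi_def U_def G_def uw_def prod.distrib)
  qed
  finally show ?thesis .
 qed
 hence "(\<lambda>y. phi N k u y * phi N k w y) = (\<lambda>y. ex N [1..<k] (\<lambda>v. phi N k (uw v) y) (\<lambda>_. 0))" by (rule ext)
 thus ?thesis using dhull_ex[of "\<lambda>v. phi N k (uw v)" N k, OF base[OF uw] N] by simp
qed

lemma dhull_mult: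
 assumes k: "k > 0" and N: "N > 0" and f: "f \<in> dhull N k" and g: "g \<in> dhull N k"
 shows "(\<lambda>t. f t * g t) \<in> dhull N k"
 using f
proof induction
 case (base u)
 show ?case using g
 proof induction
  case (base w)
  show ?case by (rule phi_mult[OF \<open>u \<in> _\<close> base k N])
 next
  case (avgs A Ph)
  have "(\<lambda>t. (\<Sum>a\<in>A. phi N k u t * Ph a t) / card A) \<in> dhull N k" by (rule dhull.avgs) (use avgs in auto)
  thus ?case by (simp add: sum_distrib_left)
 qed
next
 case (avgs A Ph)
 have "(\<lambda>t. (\<Sum>a\<in>A. Ph a t * g t) / card A) \<in> dhull N k" by (rule dhull.avgs) (use avgs in auto)
 thus ?case by (simp add: sum_distrib_right)
qed

lemma dhull_test_class:
 assumes k: "k > 0" and N: "N > 0"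
 shows "test_class N (dhull N k)"
 unfolding test_class_def
proof (intro conjI ballI allI impI)
 fix ff assume ff: "ff \<in> dhull N k"
 show "periodic N ff" using ff
  by induction (auto simp: phi_periodic, simp add: periodic_def)
 show "\<bar>ff t\<bar> <= 1" for t using ff
 proof induction
  case (avgs A Ph)
  have "\<bar>\<Sum>a\<in>A. Ph a t\<bar> <= (\<Sum>a\<in>A. 1)" by (rule order_trans[OF sum_abs sum_mono]) (use avgs in auto)
  moreover have "card A > 0" using avgs by (simp add: card_gt_0_iff)
  ultimately show ?case by simp
 qed (use phi_bound N in auto)
 show "(\<lambda>t. - ff t) \<in> dhull N k" using ff
 proof induction
  case (base u)
  define w where "w = u(0 := \<lambda>x. - u 0 x)"
  have "w \<in> tests N k" using base by (auto simp: tests_def w_def ign_def pmod_def)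
  moreover have "phi N k w = (\<lambda>t. - phi N k u t)"
  proof
   fix t
   have "(\<Prod>l<k. w l x) = - (\<Prod>l<k. u l x)" for x
    using k by (simp add: prod.remove[of "{..<k}" 0] w_def)
   thus "phi N k w t = - phi N k u t" by (simp add: phi_def ex_minus)
  qed
  ultimately show ?case using dhull.base by metis
 next
  case (avgs A Ph)
  have "(\<lambda>t. (\<Sum>a\<in>A. - Ph a t) / card A) \<in> dhull N k" by (rule dhull.avgs) (use avgs in auto)
  thus ?case by (simp add: sum_negf)
 qed
next
 have "(\<lambda>_ _. 1) \<in> tests N k" by (auto simp: tests_def ign_def pmod_def)
 from dhull.base[OF this] have "phi N k (\<lambda>_ _. 1) \<in> dhull N k" .
 moreover have "phi N k (\<lambda>_ _. 1) = (\<lambda>_. 1)" by (rule ext) (simp add: phi_def ex_const[OF N])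
 ultimately show "(\<lambda>_. 1) \<in> dhull N k" by simp
next
 fix ff \<psi> assume "ff \<in> dhull N k" "\<psi> \<in> dhull N k"
 thus "(\<lambda>t. ff t * \<psi> t) \<in> dhull N k" by (rule dhull_mult[OF k N])
next
 fix A :: "int set" and Ph
 assume "finite A \<and> A ~= {} \<and> (\<forall>a\<in>A. Ph a \<in> dhull N k)"
 thus "(\<lambda>t. (\<Sum>a\<in>A. Ph a t) / real (card A)) \<in> dhull N k" by (intro dhull.avgs) auto
qed

lemma dhull_avg_bound:
 assumes "\<And>u. u \<in> tests N k ==> \<bar>avg N (\<lambda>y. h y * phi N k u y)\<bar> <= ep" "ff \<in> dhull N k"
 shows "\<bar>avg N (\<lambda>y. h y * ff y)\<bar> <= ep"
 using assms(2)
proof induction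
 case (avgs A Ph)
 have c: "real (card A) > 0" using avgs by (simp add: card_gt_0_iff)
 have "avg N (\<lambda>y. h y * ((\<Sum>a\<in>A. Ph a y) / card A)) = (\<Sum>a\<in>A. avg N (\<lambda>y. h y * Ph a y)) / card A"
 proof -
  have "avg N (\<lambda>y. h y * ((\<Sum>a\<in>A. Ph a y) / card A)) = avg N (\<lambda>y. (1 / card A) * (\<Sum>a\<in>A. h y * Ph a y))"
   by (simp add: sum_distrib_left[symmetric])
  thus ?thesis unfolding avg_cmult avg_sum by simp
 qed
 moreover have "\<bar>\<Sum>a\<in>A. avg N (\<lambda>y. h y * Ph a y)\<bar> <= (\<Sum>a\<in>A. ep)"
  by (rule order_trans[OF sum_abs sum_mono]) (use avgs in auto)
 ultimately show ?case using c by (simp add: pos_divide_le_eq mult.commute)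
qed (use assms(1) in auto)

definition c1 :: "nat => nat \<times> nat set => nat => int" where
 "c1 k = (\<lambda>(i, A) l. if l < k then (if l \<in> A then 0 else 1) else if l < 2 * k \<and> l - k \<in> A then 1 else 0)"

lemma form_c1: "form k (c1 k (i, A)) x = (\<Sum>l<k. copy k A x l)"
 unfolding form_def sum_double by (rule sum.cong) (auto simp: c1_def copy_def)

lemma good_forms_c1: assumes k: "k >= 1" shows "good_forms k ({0} \<times> Pow {..<k}) (c1 k)"
 unfolding good_forms_def
proof (intro conjI ballI allI impI)
 show "finite ({0::nat} \<times> Pow {..<k})" by simp
 show "card ({0::nat} \<times> Pow {..<k}) <= k * 2 ^ k" using k by (simp add: card_cartesian_product card_Pow)
 show "\<bar>c1 k s l\<bar> <= int k" for s l using k by (cases s) (auto simp: c1_def)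
 fix s assume s: "s \<in> {0::nat} \<times> Pow {..<k}"
 then obtain A where A: "s = (0, A)" "A \<subseteq> {..<k}" by auto
 show "\<exists>l<2 * k. c1 k s l ~= 0"
  by (rule exI[of _ "if 0 \<in> A then k else 0"]) (use A k in "auto simp: c1_def")
 fix t assume t: "t \<in> {0::nat} \<times> Pow {..<k}" and ne: "s ~= t"
 then obtain B where B: "t = (0, B)" "B \<subseteq> {..<k}" by auto
 hence "A ~= B" using ne A by auto
 then obtain a where a: "a \<in> A \<and> a \<notin> B \<or> a \<in> B \<and> a \<notin> A" by blast
 hence "a < k" using A B by auto
 thus "\<exists>l<2 * k. c1 k s l ~= 0 \<and> c1 k t l = 0"
  by (intro exI[of _ "if a \<in> A then a + k else a"]) (use a A B in "auto simp: c1_def")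
qed

text \<open>Cauchy-Schwarz in all \<open>k\<close> variables with trivial weights removes the test
  functions and leaves \<open>nv - 1\<close> on the \<open>2 ^ k\<close> forms \<open>c1\<close>,
  each the sum of one copy of every variable.\<close>

lemma nu_tests:
 assumes k: "k >= 1" and N: "N > 0" and LF: "LF N k nv ep" and nv: "periodic N nv" and u: "u \<in> tests N k"
 shows "\<bar>avg N (\<lambda>t. (nv t - 1) * phi N k u t)\<bar> ^ (2 ^ k) <= 2 ^ (k * 2 ^ k) * ep"
proof -
 define h where "h = (\<lambda>x::nat => int. nv (\<Sum>l<k. x l) - 1)"
 have js: "set [0..<k] = {..<k}" "distinct [0..<k]" "length [0..<k] = k" by auto
 have dbl1: "dbl k j (\<lambda>_. 1) = (\<lambda>_. 1)" for j by (rule ext) (simp add: dbl_def)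
 have ok: "okB N k 1 js (\<lambda>_ _. 1)" for js
  by (induction js) (simp_all add: dbl1 Ex_const[OF N])
 have eq: "avg N (\<lambda>t. (nv t - 1) * phi N k u t) = Ex N k (\<lambda>x. h x * (\<Prod>l\<in>set [0..<k]. u l x))"
  unfolding js h_def
  by (rule avg_phi[OF u _ N, where h = "\<lambda>t. nv t - 1"]) (use k nv in "auto simp: periodic_def")
 have "\<bar>Ex N k (\<lambda>x. h x * (\<Prod>l\<in>set [0..<k]. u l x))\<bar> ^ (2 ^ length [0..<k]) <= 1 ^ (2 ^ length [0..<k] - 1) * \<bar>Ex N k (fin k [0..<k] h (\<lambda>_ _. 1))\<bar>"
 proof (rule CS_iterated[OF N _ js(2)])
  show "ign (l + k) h" for l
   unfolding ign_def h_def by (intro allI arg_cong[of _ _ "\<lambda>s. nv s - 1"] sum.cong) auto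
 qed (use u ok in \<open>auto simp: tests_def ign_def[of _ "\<lambda>_. 1"]\<close>)
 also have "fin k [0..<k] h (\<lambda>_ _. 1) = (\<lambda>x. (\<Prod>s\<in>{0} \<times> Pow {..<k}. nv (form k (c1 k s) x) - 1) * (\<Prod>s\<in>{}. nv (form k (c1 k s) x) + 1))"
 proof
  fix x
  have "fin k [0..<k] h (\<lambda>_ _. 1) x = (\<Prod>A\<in>Pow {..<k}. h (copy k A x))"
   using fin_closed[OF js(2), of k h "\<lambda>_ _. 1" x] by (simp add: lessThan_atLeast0)
  also have "... = (\<Prod>s\<in>{0} \<times> Pow {..<k}. nv (form k (c1 k s) x) - 1)"
   by (rule prod.reindex_cong[of "\<lambda>A. (0, A)", symmetric]) (auto simp: inj_on_def h_def form_c1)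
  finally show "fin k [0..<k] h (\<lambda>_ _. 1) x = (\<Prod>s\<in>{0} \<times> Pow {..<k}. nv (form k (c1 k s) x) - 1) * (\<Prod>s\<in>{}. nv (form k (c1 k s) x) + 1)" by simp
 qed
 also have "\<bar>Ex N k ...\<bar> <= 2 ^ (k * 2 ^ k) * ep"
  by (rule LF_signed[OF LF _ _ _ N]) (use good_forms_c1[OF k] in auto)
 finally show ?thesis using eq by simp
qed

lemma ex_cong_box:
 assumes "N > 0" "\<And>x. (\<And>l. l \<in> set is ==> 0 <= x l \<and> x l < int N) ==> (\<And>l. l \<notin> set is ==> x l = y l) ==> F x = G x"
 shows "ex N is F y = ex N is G y"
 using assms(2)
proof (induction "is" arbitrary: y)
 case Nil
 thus ?case by simp
next
 case (Cons i "is")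
 have "ex N is F (y(i := t)) = ex N is G (y(i := t))" if "t \<in> {0..<int N}" for t
 proof (rule Cons.IH)
  fix x assume x: "\<And>l. l \<in> set is ==> 0 <= x l \<and> x l < int N" "\<And>l. l \<notin> set is ==> x l = (y(i := t)) l"
  show "F x = G x"
  proof (rule Cons.prems)
   fix l assume "l \<in> set (i # is)"
   thus "0 <= x l \<and> x l < int N" using x(1)[of l] x(2)[of l] that by (cases "l \<in> set is") auto
  next
   fix l assume "l \<notin> set (i # is)"
   thus "x l = y l" using x(2)[of l] by auto
  qed
 qed
 thus ?case by (simp add: av_def avg_def)
qed

definition scale :: "(nat => int) => nat set => (nat => int) => nat => int" where
 "scale a J x = (\<lambda>l. if l \<in> J then a l * x l else x l)"

lemma Ex_scale:
 assumes N: "N > 0" and F: "pmod N F"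
 shows "finite J ==> J \<subseteq> {..<2 * k} ==> (\<And>l. l \<in> J ==> coprime (a l) (int N)) ==> Ex N k (\<lambda>x. F (scale a J x)) = Ex N k F"
proof (induction J rule: finite_induct)
 case (insert j J)
 have j: "j < 2 * k" "coprime (a j) (int N)" using insert.prems by auto
 have "pmod N (\<lambda>x. F (scale a J x))" unfolding pmod_def
  by (intro allI impI pmodD[OF F]) (auto simp: scale_def intro: mod_mult_cong)
 from av_scale[OF pmod_per[OF this] N j(2)]
 have "av N j (\<lambda>x. F (scale a J (x(j := a j * x j)))) = av N j (\<lambda>x. F (scale a J x))" .
 moreover have "scale a J (x(j := a j * x j)) = scale a (insert j J) x" for x
  using insert.hyps by (auto simp: scale_def)
 ultimately have "av N j (\<lambda>x. F (scale a (insert j J) x)) = av N j (\<lambda>x. F (scale a J x))" by simp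
 hence "Ex N k (\<lambda>x. F (scale a (insert j J) x)) = Ex N k (\<lambda>x. F (scale a J x))"
  using Ex_av[OF j(1) N] by metis
 thus ?case using insert by simp
qed (simp add: scale_def)

lemma mod_sum_cong:
 fixes f g :: "'a => int"
 assumes "\<And>l. l \<in> A ==> f l mod n = g l mod n"
 shows "sum f A mod n = sum g A mod n"
proof -
 have "(\<Sum>l\<in>A. f l mod n) = (\<Sum>l\<in>A. g l mod n)" using assms by (rule sum.cong[OF refl])
 thus ?thesis using mod_sum_eq[of f n A] mod_sum_eq[of g n A] by simp
qed

text \<open>Dilating \<open>x l\<close> by the inverse of \<open>l - i\<close> modulo
  \<open>N\<close> turns \<open>psi k i\<close> into the plain sum of the variables other than
  \<open>i\<close>. The test functions may depend on \<open>x i\<close>, so that variable is frozen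
  first; afterwards a fresh \<open>x i\<close> is brought in by translating another coordinate
  \<open>p\<close>, which gives the sum over all \<open>k\<close> variables that dual functions
  require.\<close>

lemma psi_to_tests:
 assumes k: "k >= 2" and N: "N > 0" and cop: "\<And>d. 0 < d ==> d < k ==> coprime (int d) (int N)"
  and h: "periodic N h" and bound: "\<And>u. u \<in> tests N k ==> \<bar>avg N (\<lambda>y. h y * phi N k u y)\<bar> <= ep" and i: "i < k"
 shows "cutok N k ep i (\<lambda>x. h (psi k i x))"
 unfolding cutok_def
proof (intro allI impI)
 fix u :: "nat => (nat => int) => real"
 assume u: "\<forall>l<k. ign l (u l) \<and> (\<forall>m\<ge>k. ign m (u l)) \<and> (\<forall>x. 0 <= u l x \<and> u l x <= 1)"
 define I where "I = {..<k} - {i}"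
 define p where "p = (if i = 0 then 1 else 0 :: nat)"
 have p: "p < k" "p ~= i" using k by (auto simp: p_def)
 have Ik: "l < k" "l ~= i" if "l \<in> I" for l using that by (auto simp: I_def)
 have finI: "finite I" by (simp add: I_def)
 have h_cong: "h s = h t" if "s mod int N = t mod int N" for s t using periodic_cong[OF h that] .
 \<comment> \<open>Variable \<open>i\<close> is frozen at \<open>s\<close>. Cut-norm tests need not
   be periodic, so arguments are reduced modulo \<open>N\<close>, which changes nothing on the box
   that is averaged.\<close>
 define v where "v = (\<lambda>s l x. u l (\<lambda>m. (x(i := s)) m mod int N))"
 have v_ign: "ign l (v s l)" "ign i (v s l)" "m >= k ==> ign m (v s l)" "pmod N (v s l)" "\<bar>v s l x\<bar> <= 1" if l: "l \<in> I" for s l m x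
 proof -
  have upd: "(\<lambda>m. ((x(j := t))(i := s)) m mod int N) = (\<lambda>m. (x(i := s)) m mod int N)(j := t mod int N)" if "j ~= i" for x j t
   using that by auto
  have ign_v: "ign j (v s l)" if "ign j (u l)" "j ~= i" for j
   unfolding ign_def v_def upd[OF that(2)] by (intro allI ignD[OF that(1)])
  show "ign l (v s l)" by (rule ign_v) (use u Ik[OF l] in auto)
  show "ign i (v s l)" unfolding ign_def v_def fun_upd_upd by simp
  show "ign m (v s l)" if "m >= k" by (rule ign_v) (use u Ik[OF l] that i in auto)
  show "pmod N (v s l)" unfolding pmod_def v_def by (intro allI impI arg_cong[of _ _ "u l"] ext) simp
  show "\<bar>v s l x\<bar> <= 1" using u Ik[OF l] by (simp add: v_def)
 qed
 define K where "K = (\<lambda>s x. h (psi k i x) * (\<Prod>l\<in>I. v s l x))"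
 have "Ex N k (\<lambda>x. h (psi k i x) * (\<Prod>l\<in>I. u l x)) = Ex N k (\<lambda>x. h (psi k i x) * (\<Prod>l\<in>I. u l (\<lambda>m. x m mod int N)))"
  unfolding Ex_def
 proof (rule ex_cong_box[OF N])
  fix x :: "nat => int"
  assume x: "\<And>l. l \<in> set [0..<2 * k] ==> 0 <= x l \<and> x l < int N" "\<And>l. l \<notin> set [0..<2 * k] ==> x l = 0"
  have "x m mod int N = x m" for m using x(1)[of m] x(2)[of m] by (cases "m < 2 * k") auto
  thus "h (psi k i x) * (\<Prod>l\<in>I. u l x) = h (psi k i x) * (\<Prod>l\<in>I. u l (\<lambda>m. x m mod int N))" by simp
 qed
 also have "... = Ex N k (av N i (\<lambda>x. h (psi k i x) * (\<Prod>l\<in>I. u l (\<lambda>m. x m mod int N))))"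
  by (rule Ex_av[symmetric, OF _ N]) (use i in simp)
 also have "... = Ex N k (\<lambda>x. avg N (\<lambda>s. K s x))"
 proof -
  have upd: "psi k i (x(i := s)) = psi k i x" for x s unfolding psi_def by (rule sum.cong) auto
  have "av N i (\<lambda>x. h (psi k i x) * (\<Prod>l\<in>I. u l (\<lambda>m. x m mod int N))) = (\<lambda>x. avg N (\<lambda>s. K s x))"
   by (rule ext) (simp only: av_def K_def v_def upd)
  thus ?thesis by (simp only:)
 qed
 also have "... = avg N (\<lambda>s. Ex N k (K s))" unfolding Ex_def by (rule avg_ex_swap[OF N, symmetric])
 finally have E1: "Ex N k (\<lambda>x. h (psi k i x) * (\<Prod>l\<in>I. u l x)) = avg N (\<lambda>s. Ex N k (K s))" .

 have "\<exists>b. (int l - int i) * b mod int N = 1 mod int N \<and> coprime b (int N)" if "l \<in> I" for l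
 proof -
  have "coprime (int l - int i) (int N)"
  proof (cases "l > i")
   case True
   thus ?thesis using cop[of "l - i"] Ik[OF that] by (simp add: of_nat_diff)
  next
   case False
   hence "coprime (int (i - l)) (int N)" using cop[of "i - l"] Ik[OF that] i by simp
   hence "coprime (- int (i - l)) (int N)" by simp
   thus ?thesis using False by (simp add: of_nat_diff)
  qed
  then obtain b where b: "[(int l - int i) * b = 1] (mod int N)" using cong_solve_coprime_int by blast
  hence "coprime ((int l - int i) * b) (int N)" by (metis cong_imp_coprime cong_sym coprime_1_left)
  thus ?thesis using b by (auto simp: cong_def)
 qed
 then obtain a where a: "\<And>l. l \<in> I ==> (int l - int i) * a l mod int N = 1 mod int N" "\<And>l. l \<in> I ==> coprime (a l) (int N)"
  by metis
 have bnd: "\<bar>Ex N k (K s)\<bar> <= ep" for s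
 proof -
  have pK: "pmod N (K s)" unfolding pmod_def K_def
  proof (intro allI impI arg_cong2[of _ _ _ _ "(*)"] prod.cong refl)
   fix x y :: "nat => int" assume xy: "\<forall>m. x m mod int N = y m mod int N"
   have "psi k i x mod int N = psi k i y mod int N" unfolding psi_def
    by (intro mod_sum_cong mod_mult_cong refl) (use xy in auto)
   thus "h (psi k i x) = h (psi k i y)" by (rule h_cong)
   fix l assume "l \<in> I"
   thus "v s l x = v s l y" using v_ign(4)[of l s] xy by (auto simp: pmod_def)
  qed
  define w where "w = (\<lambda>l. if l = i then (\<lambda>_. 1) else (\<lambda>x. v s l (scale a I x)))"
  have sc_upd: "scale a I (x(j := t)) = (scale a I x)(j := (if j \<in> I then a j * t else t))" for x j t
   by (auto simp: scale_def)
  have w: "ign l (w l)" "ign i (w l)" "m >= k ==> ign m (w l)" "pmod N (w l)" "\<bar>w l x\<bar> <= 1" if l: "l \<in> I" for l m x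
  proof -
   have wl: "w l = (\<lambda>x. v s l (scale a I x))" using Ik[OF l] by (simp add: w_def)
   have ign_sc: "ign j (\<lambda>x. v s l (scale a I x))" if "ign j (v s l)" for j
    unfolding ign_def sc_upd by (intro allI ignD[OF that])
   show "ign l (w l)" "ign i (w l)" "m >= k ==> ign m (w l)"
    unfolding wl by (rule ign_sc[OF v_ign(1)[OF l]], rule ign_sc[OF v_ign(2)[OF l]], rule ign_sc[OF v_ign(3)[OF l]], assumption)
   show "\<bar>w l x\<bar> <= 1" unfolding wl by (rule v_ign(5)[OF l])
   have "w l x = w l y" if "\<forall>m. x m mod int N = y m mod int N" for x y
   proof -
    have "scale a I x m mod int N = scale a I y m mod int N" for m
     using that mod_mult_cong[OF refl, of "x m" "int N" "y m" "a m"] by (simp add: scale_def)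
    thus ?thesis unfolding wl by (rule pmodD[OF v_ign(4)[OF l]])
   qed
   thus "pmod N (w l)" unfolding pmod_def by blast
  qed
  have wt: "(\<lambda>l x. w l (x(p := x p + x i))) \<in> tests N k"
   unfolding tests_def
  proof (intro CollectI allI impI conjI)
   fix l assume l: "l < k"
   have mod: "(x(p := x p + x i)) m mod int N = (y(p := y p + y i)) m mod int N" if "\<forall>m. x m mod int N = y m mod int N" for x y :: "nat => int" and m
    using that by (auto intro: mod_add_cong)
   show "pmod N (\<lambda>x. w l (x(p := x p + x i)))"
   proof (cases "l = i")
    case False
    hence "l \<in> I" using l by (simp add: I_def)
    thus ?thesis using mod w(4)[of l] unfolding pmod_def by metis
   qed (simp add: w_def pmod_def)
   show "\<bar>w l (x(p := x p + x i))\<bar> <= 1" for x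
    using w(5)[of l] l by (cases "l = i") (auto simp: w_def I_def)
   show "ign l (\<lambda>x. w l (x(p := x p + x i)))"
   proof (cases "l = i")
    case False
    hence "l \<in> I" using l by (simp add: I_def)
    thus ?thesis using w(1)[of l] False
     by (cases "l = p") (auto simp: ign_def fun_upd_twist[of l p])
   qed (simp add: w_def ign_def)
   show "ign m (\<lambda>x. w l (x(p := x p + x i)))" if "k <= m" for m
   proof (cases "l = i")
    case False
    hence "l \<in> I" using l by (simp add: I_def)
    thus ?thesis using w(3)[of l m] that p i by (auto simp: ign_def fun_upd_twist[of m p])
   qed (simp add: w_def ign_def)
  qed
  have "I \<subseteq> {..<2 * k}" by (auto simp: I_def)
  hence "Ex N k (K s) = Ex N k (\<lambda>x. K s (scale a I x))"
   by (rule Ex_scale[OF N pK finI _ a(2), symmetric])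
  also have "(\<lambda>x. K s (scale a I x)) = (\<lambda>x. h (\<Sum>l\<in>I. x l) * (\<Prod>l\<in>I. w l x))"
  proof
   fix x
   have "psi k i (scale a I x) = (\<Sum>l\<in>I. (int l - int i) * (a l * x l))"
    unfolding psi_def using i by (subst sum.remove[of _ i]) (auto simp: I_def scale_def intro!: sum.cong)
   moreover have "(\<Sum>l\<in>I. (int l - int i) * (a l * x l)) mod int N = (\<Sum>l\<in>I. x l) mod int N"
   proof -
    have "(int l - int i) * (a l * x l) mod int N = x l mod int N" if "l \<in> I" for l
     using mod_mult_cong[OF a(1)[OF that] refl, of "x l"] by (simp add: mult.assoc)
    thus ?thesis by (rule mod_sum_cong)
   qed
   ultimately have "h (psi k i (scale a I x)) = h (\<Sum>l\<in>I. x l)" by (intro h_cong) simp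
   moreover have "(\<Prod>l\<in>I. v s l (scale a I x)) = (\<Prod>l\<in>I. w l x)" by (rule prod.cong) (auto simp: w_def I_def)
   ultimately show "K s (scale a I x) = h (\<Sum>l\<in>I. x l) * (\<Prod>l\<in>I. w l x)" by (simp add: K_def)
  qed
  also have "Ex N k (\<lambda>x. h (\<Sum>l\<in>I. x l) * (\<Prod>l\<in>I. w l x)) = Ex N k (\<lambda>x. h (\<Sum>l<k. x l) * (\<Prod>l<k. w l (x(p := x p + x i))))"
  proof -
   define F where "F = (\<lambda>x. h (\<Sum>l\<in>I. x l) * (\<Prod>l\<in>I. w l x))"
   have "per N p F" unfolding per_def
   proof
    fix x
    have pI: "p \<in> I" using p by (simp add: I_def)
    have "(\<Sum>l\<in>I. (x(p := x p + int N)) l) = (\<Sum>l\<in>I. x l) + int N"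
     using finI pI by (subst (1 2) sum.remove[of _ p]) auto
    hence "h (\<Sum>l\<in>I. (x(p := x p + int N)) l) = h (\<Sum>l\<in>I. x l)" by (simp add: h[unfolded periodic_def])
    moreover have "w l (x(p := x p + int N)) = w l x" if "l \<in> I" for l
     using pmod_per[OF w(4)[OF that]] by (simp add: per_def)
    ultimately show "F (x(p := x p + int N)) = F x" by (simp add: F_def)
   qed
   moreover have "ign p (\<lambda>x::nat => int. x i)" using p by (simp add: ign_def)
   ultimately have "av N p (\<lambda>x. F (x(p := x p + x i))) = av N p F" by (rule av_shift[OF _ _ N])
   hence "Ex N k (\<lambda>x. F (x(p := x p + x i))) = Ex N k F"
    using Ex_av[of p k N] p N by (metis mult_2 trans_less_add1)
   moreover have "F (x(p := x p + x i)) = h (\<Sum>l<k. x l) * (\<Prod>l<k. w l (x(p := x p + x i)))" for x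
   proof -
    have pI: "p \<in> I" using p by (simp add: I_def)
    have "(\<Sum>l\<in>I. (x(p := x p + x i)) l) = (\<Sum>l\<in>I. x l) + x i"
     using finI pI by (subst (1 2) sum.remove[of _ p]) auto
    also have "... = (\<Sum>l<k. x l)" using i by (subst (2) sum.remove[of _ i]) (auto simp: I_def)
    finally have "(\<Sum>l\<in>I. (x(p := x p + x i)) l) = (\<Sum>l<k. x l)" .
    moreover have "(\<Prod>l<k. w l y) = (\<Prod>l\<in>I. w l y)" for y
     using i by (subst prod.remove[of _ i]) (auto simp: I_def w_def)
    ultimately show ?thesis by (simp add: F_def)
   qed
   ultimately show ?thesis by (simp add: F_def)
  qed
  also have "... = avg N (\<lambda>y. h y * phi N k (\<lambda>l x. w l (x(p := x p + x i))) y)"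
   by (rule avg_phi[OF wt _ N h, symmetric]) (use k in simp)
  finally have "Ex N k (K s) = avg N (\<lambda>y. h y * phi N k (\<lambda>l x. w l (x(p := x p + x i))) y)" .
  thus ?thesis using bound[OF wt] by simp
 qed
 have "\<bar>avg N (\<lambda>s. Ex N k (K s))\<bar> <= ep"
 proof -
  have "avg N (\<lambda>s. Ex N k (K s)) <= avg N (\<lambda>_. ep)" "avg N (\<lambda>_. - ep) <= avg N (\<lambda>s. Ex N k (K s))"
   by (rule avg_mono, use bnd in "auto simp: abs_le_iff minus_le_iff")+
  thus ?thesis using avg_const[OF N] by (simp add: abs_le_iff minus_le_iff)
 qed
 thus "\<bar>Ex N k (\<lambda>x. h (psi k i x) * (\<Prod>l\<in>{..<k} - {i}. u l x))\<bar> <= ep"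
  using E1 by (simp add: I_def)
qed

lemma avg_swap: "avg N (\<lambda>s. avg M (\<lambda>t. f s t)) = avg M (\<lambda>t. avg N (\<lambda>s. f s t))"
 by (simp add: avg_def sum_divide_distrib[symmetric]) (subst sum.swap, simp add: mult.commute)

text \<open>\<open>psi k i x\<close> is \<open>(x 1 + D x) - i * (x 0 + C x)\<close>, so first term
  and difference are jointly uniform; a reflection fixes the sign of the difference.\<close>

lemma Ex_psi:
 assumes k: "k >= 2" and N: "N > 0" and f: "periodic N f"
 shows "EP N k (\<lambda>i x. f (psi k i x)) = av2 N (\<lambda>a d. \<Prod>i<k. f (a + int i * d))"
proof -
 define C where "C = (\<lambda>x::nat => int. \<Sum>l\<in>{1..<k}. x l)"
 define D where "D = (\<lambda>x::nat => int. \<Sum>l\<in>{2..<k}. int l * x l)"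
 define h where "h = (\<lambda>s0 s1. \<Prod>i<k. f (s1 - int i * s0))"
 have set: "{..<k} = insert 0 (insert 1 {2..<k})" "{1..<k} = insert 1 {2..<k}" using k by auto
 have "psi k i x = (x 1 + D x) - int i * (x 0 + C x)" for i x
 proof -
  have "psi k i x = (\<Sum>l<k. int l * x l) - int i * (\<Sum>l<k. x l)"
   by (simp add: psi_def left_diff_distrib sum_subtractf sum_distrib_left)
  also have "(\<Sum>l<k. int l * x l) = x 1 + D x" unfolding set D_def by simp
  also have "(\<Sum>l<k. x l) = x 0 + C x" unfolding set C_def by simp
  finally show ?thesis .
 qed
 hence "EP N k (\<lambda>i x. f (psi k i x)) = Ex N k (\<lambda>x. h (x 0 + C x) (x 1 + D x))" by (simp add: h_def)
 also have "... = av2 N h" unfolding Ex_def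
 proof (rule ex_two_forms[OF N])
  show "periodic N (\<lambda>a. h a d)" for d
   unfolding periodic_def h_def
  proof (intro allI prod.cong refl)
   fix t i show "f (d - int i * (t + int N)) = f (d - int i * t)"
    using periodic_mult[OF f, of "d - int i * t" "- int i"] by (simp add: algebra_simps)
  qed
  show "periodic N (\<lambda>d. h a d)" for a
   unfolding periodic_def h_def
  proof (intro allI prod.cong refl)
   fix t i show "f (t + int N - int i * a) = f (t - int i * a)"
    using f[unfolded periodic_def, rule_format, of "t - int i * a"] by (simp add: algebra_simps)
  qed
  show "ign 0 C" unfolding ign_def C_def by (intro allI sum.cong) auto
  show "ign 0 D" unfolding ign_def D_def by (intro allI sum.cong) auto
  show "ign 1 D" unfolding ign_def D_def by (intro allI sum.cong) auto
 qed (use k in auto)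
 also have "av2 N h = avg N (\<lambda>s. avg N (\<lambda>d. \<Prod>i<k. f (s + int i * d)))"
  unfolding av2_def
 proof (rule arg_cong[of _ _ "avg N"], rule ext)
  fix s
  define q where "q = (\<lambda>d. \<Prod>i<k. f (s + int i * d))"
  have "periodic N q"
   unfolding periodic_def q_def
  proof (intro allI prod.cong refl)
   fix t i show "f (s + int i * (t + int N)) = f (s + int i * t)"
    using periodic_mult[OF f, of "s + int i * t" "int i"] by (simp add: algebra_simps)
  qed
  hence "avg N (\<lambda>t. q (- t)) = avg N q"
   by (rule avg_reindex[OF _ N]) (simp add: dvd_eq_mod_eq_0[symmetric] dvd_diff_commute)
  thus "avg N (\<lambda>a. h a s) = avg N q" by (simp add: h_def q_def)
 qed
 also have "... = av2 N (\<lambda>a d. \<Prod>i<k. f (a + int i * d))" unfolding av2_def by (rule avg_swap)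
 finally show ?thesis .
qed

text \<open>The hull of dual functions is the test class: \<open>nu_tests\<close> shows that
  \<open>nv\<close> is near 1 there, \<open>dense_model\<close> matches \<open>f\<close> with a
  bounded \<open>g\<close>, \<open>counting\<close> compares their progression counts, and
  \<open>varnavides\<close> bounds that of \<open>g\<close>. Since the constant 1 is a dual
  function, \<open>g\<close> keeps mean at least \<open>dl / 2\<close>.\<close>

theorem relative_szemeredi:
 assumes k: "k >= 2" and dl: "dl > 0"
 shows "\<exists>c>0. \<exists>ep>0. \<forall>N nv f. N > 0 \<and> (\<forall>d. 0 < d \<and> d < k --> coprime (int d) (int N)) \<and> periodic N nv \<and> periodic N f \<and>
  (\<forall>t. 0 <= f t \<and> f t <= nv t) \<and> LF N k nv ep \<and> avg N f >= dl --> av2 N (\<lambda>a d. \<Prod>i<k. f (a + int i * d)) >= c"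
proof -
 have k1: "k >= 1" and dl2: "dl / 2 > 0" using k dl by auto
 obtain c0 where c0: "c0 > 0" and van: "\<And>N f. N > 0 ==> periodic N f ==> (\<And>x. 0 <= f x \<and> f x <= 1) ==> avg N f >= dl / 2 ==>
  av2 N (\<lambda>a d. \<Prod>i<k. f (a + int i * d)) >= c0"
  using varnavides[OF k1 dl2] by blast
 have c02: "c0 / 2 > 0" using c0 by simp
 obtain ep1 where ep1: "ep1 > 0" and count: "\<And>N nv J g h. N > 0 ==> (\<And>t. nv t >= 0) ==> LF N k nv ep1 ==> J \<subseteq> {..<k} ==> card J = k ==>
  edges_ok N k nv ep1 J g h ==> \<bar>EP N k g - EP N k h\<bar> <= c0 / 2"
  using counting[OF k c02, of k] by blast
 define e where "e = min ep1 (dl / 2)"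
 have e: "e > 0" using ep1 dl by (simp add: e_def)
 obtain e' where e': "e' > 0" and model: "\<forall>N nv f H. N > 0 \<and> (\<forall>t. 0 <= f t \<and> f t <= nv t) \<and> test_class N H \<and>
  (\<forall>ff\<in>H. \<bar>avg N (\<lambda>t. (nv t - 1) * ff t)\<bar> <= e') -->
  (\<exists>g. periodic N g \<and> (\<forall>t. 0 <= g t \<and> g t <= 1) \<and> (\<forall>ff\<in>H. \<bar>avg N (\<lambda>t. (f t - g t) * ff t)\<bar> <= e))"
  using dense_model[OF e] by (elim exE conjE)
 \<comment> \<open>The power \<open>2 ^ k\<close> compensates the root that is taken in
   \<open>nu_tests\<close>.\<close>
 define ep where "ep = min ep1 (e' ^ (2 ^ k) / 2 ^ (k * 2 ^ k))"
 have ep: "ep > 0" using ep1 e' by (simp add: ep_def)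
 have main: "av2 N (\<lambda>a d. \<Prod>i<k. f (a + int i * d)) >= c0 / 2"
  if N: "N > 0" and cop: "\<And>d. 0 < d ==> d < k ==> coprime (int d) (int N)" and nv: "periodic N nv" and f: "periodic N f"
   and fb: "\<And>t. 0 <= f t" "\<And>t. f t <= nv t" and LF: "LF N k nv ep" and fd: "avg N f >= dl" for N nv f
 proof -
  have k0: "k > 0" using k by simp
  have tc: "test_class N (dhull N k)" by (rule dhull_test_class[OF k0 N])
  have nu_hull: "\<bar>avg N (\<lambda>t. (nv t - 1) * ff t)\<bar> <= e'" if "ff \<in> dhull N k" for ff
  proof (rule dhull_avg_bound[OF _ that, where h = "\<lambda>t. nv t - 1"])
   fix u assume u: "u \<in> tests N k"
   have "\<bar>avg N (\<lambda>t. (nv t - 1) * phi N k u t)\<bar> ^ (2 ^ k) <= 2 ^ (k * 2 ^ k) * ep"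
    by (rule nu_tests[OF k1 N LF nv u])
   also have "... <= 2 ^ (k * 2 ^ k) * (e' ^ (2 ^ k) / 2 ^ (k * 2 ^ k))"
    by (rule mult_left_mono) (simp_all add: ep_def)
   also have "... = e' ^ (2 ^ k)" by simp
   finally show "\<bar>avg N (\<lambda>t. (nv t - 1) * phi N k u t)\<bar> <= e'"
    using power_mono_iff[of "\<bar>avg N (\<lambda>t. (nv t - 1) * phi N k u t)\<bar>" e' "2 ^ k"] e' by simp
  qed
  obtain g where g: "periodic N g" "\<And>t. 0 <= g t" "\<And>t. g t <= 1" and fg: "\<And>ff. ff \<in> dhull N k ==> \<bar>avg N (\<lambda>t. (f t - g t) * ff t)\<bar> <= e"
   using model[rule_format, of N f nv "dhull N k"] N tc nu_hull fb by blast
  have "(\<lambda>_. 1) \<in> dhull N k" using tc by (simp add: test_class_def)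
  from fg[OF this] have "\<bar>avg N f - avg N g\<bar> <= dl / 2" by (simp add: avg_diff e_def)
  hence "avg N g >= dl / 2" using fd by linarith
  hence vg: "av2 N (\<lambda>a d. \<Prod>i<k. g (a + int i * d)) >= c0" by (intro van[OF N g(1)]) (use g in auto)
  define h where "h = (\<lambda>t. f t - g t)"
  have hper: "periodic N h" using f g(1) by (simp add: periodic_def h_def)
  have "edges_ok N k nv ep1 {..<k} (\<lambda>i x. f (psi k i x)) (\<lambda>i x. g (psi k i x))"
   unfolding edges_ok_def
  proof (intro allI impI conjI)
   fix i assume i: "i < k"
   have ip: "ign m (\<lambda>x. F (psi k i x))" if "m = i \<or> m >= k" for m and F :: "int => real"
    unfolding ign_def psi_def by (intro allI arg_cong[of _ _ F] sum.cong) (use that in auto)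
   show "ign i (\<lambda>x. f (psi k i x))" "ign i (\<lambda>x. g (psi k i x))" by (simp_all add: ip)
   show "ign m (\<lambda>x. f (psi k i x))" "ign m (\<lambda>x. g (psi k i x))" if "k <= m" for m using that by (simp_all add: ip)
   show "0 <= f (psi k i x)" "0 <= g (psi k i x)" "g (psi k i x) <= 1" for x by (simp_all add: fb g)
   have "copy k {} x = x" for x by (simp add: copy_def)
   thus "f (psi k i x) <= (if i \<in> {..<k} then W k nv (i, {}) x else 1)" for x
    using i by (simp add: W_def form_cf fb)
   have "cutok N k e i (\<lambda>x. h (psi k i x))"
    by (rule psi_to_tests[OF k N cop hper _ i]) (use fg dhull.base in "auto simp: h_def")
   thus "cutok N k ep1 i (\<lambda>x. f (psi k i x) - g (psi k i x))"
    unfolding h_def by (rule cutok_mono) (simp add: e_def)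
  qed
  hence "\<bar>EP N k (\<lambda>i x. f (psi k i x)) - EP N k (\<lambda>i x. g (psi k i x))\<bar> <= c0 / 2"
   by (intro count[OF N _ LF_mono[OF LF]]) (auto simp: ep_def intro: order_trans[OF fb])
  hence "\<bar>av2 N (\<lambda>a d. \<Prod>i<k. f (a + int i * d)) - av2 N (\<lambda>a d. \<Prod>i<k. g (a + int i * d))\<bar> <= c0 / 2"
   unfolding Ex_psi[OF k N f] Ex_psi[OF k N g(1)] .
  thus ?thesis using vg by linarith
 qed
 show ?thesis
  by (intro exI[of _ "c0 / 2"] exI[of _ ep] conjI allI impI c02 ep, elim conjE, rule main) simp_all
qed

section \<open>Selberg majorants\<close>

lemma sum_Pow_prod: "finite A ==> (\<Sum>K\<in>Pow A. \<Prod>a\<in>K. f a) = (\<Prod>a\<in>A. f a + (1::'a::comm_semiring_1))"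
 by (subst prod_add) simp_all

text \<open>Moebius inversion on an interval of the subset lattice.\<close>

lemma sum_between_minus_one:
 assumes "finite E" "D \<subseteq> E"
 shows "(\<Sum>P | D \<subseteq> P \<and> P \<subseteq> E. (- 1) ^ card P) = (if D = E then (- 1) ^ card D else (0::real))"
proof -
 have fD: "finite D" using assms finite_subset by auto
 have "(\<Sum>P | D \<subseteq> P \<and> P \<subseteq> E. (- 1) ^ card P) = (\<Sum>K\<in>Pow (E - D). (- 1) ^ card D * (\<Prod>a\<in>K. - 1 :: real))"
 proof (rule sum.reindex_bij_witness[of _ "\<lambda>K. D \<union> K" "\<lambda>P. P - D"])
  fix P assume P: "P \<in> {P. D \<subseteq> P \<and> P \<subseteq> E}"
  hence "finite P" using assms(1) finite_subset by auto
  hence "card P = card D + card (P - D)" using P card_Un_disjoint[of D "P - D"] fD by (auto simp: Un_absorb1)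
  thus "(- 1) ^ card D * (\<Prod>a\<in>P - D. - 1) = (- 1 :: real) ^ card P" by (simp add: power_add)
 qed (use assms in auto)
 also have "... = (- 1) ^ card D * (\<Prod>a\<in>E - D. - 1 + 1)"
  by (subst sum_Pow_prod[symmetric]) (use assms in "simp_all add: sum_distrib_left")
 also have "... = (if D = E then (- 1) ^ card D else 0)"
 proof (cases "E = D")
  case False
  then obtain a where "a \<in> E - D" using assms by auto
  hence "(\<Prod>a\<in>E - D. - 1 + 1 :: real) = 0" using assms by (intro prod_zero) auto
  thus ?thesis using False by simp
 qed simp
 finally show ?thesis .
qed

text \<open>Squarefree integers are represented by their sets of prime factors, so unions are least
  common multiples and intersections greatest common divisors. \<open>PP\<close> holds the sieving
  primes, \<open>R\<close> is the level.\<close>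

locale selberg =
 fixes PP :: "nat set" and R :: real
 assumes fin: "finite PP" and primes: "\<And>p. p \<in> PP ==> prime p" and R: "R >= 1"
begin

definition adm :: "nat set set" where "adm = {P. P \<subseteq> PP \<and> real (\<Prod>P) <= R}"

text \<open>The reciprocal of Euler's totient of \<open>\<Prod>P\<close>.\<close>

definition gw :: "nat set => real" where "gw P = (\<Prod>p\<in>P. 1 / (real p - 1))"

definition V :: real where "V = (\<Sum>P\<in>adm. gw P)"

definition tail :: "nat set => real" where "tail P = (\<Sum>D | D \<in> adm \<and> P \<subseteq> D. gw D)"

text \<open>Selberg's optimal weights, those that minimise the quadratic form of
  \<open>quadratic_form\<close> subject to \<open>lam {} = 1\<close>.\<close>

definition lam :: "nat set => real" where "lam P = (- 1) ^ card P * real (\<Prod>P) * tail P / V"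

lemma finite_adm: "finite adm" unfolding adm_def
 by (rule finite_subset[of _ "Pow PP"]) (use fin in auto)

lemma p1: "p \<in> PP ==> real p - 1 > 0" using primes prime_gt_1_nat by fastforce

lemma sub_fin: "P \<subseteq> PP ==> finite P" using fin finite_subset by auto

lemma adm_PP: "P \<in> adm ==> P \<subseteq> PP" by (simp add: adm_def)

lemma adm_fin: "P \<in> adm ==> finite P" using adm_PP sub_fin by auto

lemma prod_pos: "P \<subseteq> PP ==> \<Prod>P > 0" 
 by (rule prod_pos) (use primes prime_gt_0_nat in auto)

lemma adm_subset: assumes "P \<in> adm" "Q \<subseteq> P" shows "Q \<in> adm"
proof -
 have "\<Prod>P = \<Prod>Q * \<Prod>(P - Q)" using prod.subset_diff[OF assms(2) adm_fin[OF assms(1)], of "\<lambda>x. x"] by (simp add: mult.commute)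
 moreover have "\<Prod>(P - Q) > 0" by (rule prod_pos) (use adm_PP[OF assms(1)] in auto)
 ultimately have "\<Prod>Q <= \<Prod>P" by (cases "\<Prod>(P - Q)") auto
 hence "real (\<Prod>Q) <= real (\<Prod>P)" by linarith
 thus ?thesis using assms unfolding adm_def by auto
qed

lemma empty_adm: "{} \<in> adm" using R by (simp add: adm_def)

lemma gw_pos: "P \<subseteq> PP ==> gw P > 0" unfolding gw_def by (rule Groups_Big.prod_pos) (use p1 in auto)

lemma gw_Un: "P \<inter> Q = {} ==> P \<subseteq> PP ==> Q \<subseteq> PP ==> gw (P \<union> Q) = gw P * gw Q"
 unfolding gw_def by (rule prod.union_disjoint) (auto intro: sub_fin)

lemma V_ge_1: "V >= 1"
proof -
 have "gw {} <= V" unfolding V_def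
  by (rule member_le_sum[OF empty_adm]) (use finite_adm gw_pos adm_PP in "auto intro: less_imp_le")
 thus ?thesis by (simp add: gw_def)
qed

lemma lam_empty: "lam {} = 1"
 using V_ge_1 by (simp add: lam_def tail_def V_def)

lemma tail_nonneg: "tail P >= 0" unfolding tail_def
 by (rule sum_nonneg) (use gw_pos adm_PP in "auto intro: less_imp_le")

text \<open>\<open>\<Prod>P * gw P\<close> is the sum of \<open>gw K\<close> over
  \<open>K \<subseteq> P\<close>. Pairs of such a \<open>K\<close> with an admissible
  \<open>D\<close> containing \<open>P\<close> give distinct admissible sets
  \<open>D - P \<union> K\<close>, so the total is part of \<open>V\<close>.\<close>

lemma tail_bound: assumes P: "P \<in> adm" shows "real (\<Prod>P) * tail P <= V"
proof -
 let ?T = "{D. D \<in> adm \<and> P \<subseteq> D}"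
 have Pp: "P \<subseteq> PP" by (rule adm_PP[OF P])
 have fT: "finite ?T" using finite_adm by simp
 have split: "gw D = gw P * gw (D - P)" if "D \<in> ?T" for D
  using gw_Un[of P "D - P"] that adm_PP[of D] by (auto simp: Un_absorb1)
 have KT: "(D - P) \<union> K \<in> adm" if "D \<in> ?T" "K \<subseteq> P" for D K
  using that by (intro adm_subset[of D "D - P \<union> K"]) auto
 have pz: "real (\<Prod>P) * gw P = (\<Sum>K\<in>Pow P. gw K)"
 proof -
  have "(\<Sum>K\<in>Pow P. gw K) = (\<Prod>p\<in>P. 1 / (real p - 1) + 1)"
   unfolding gw_def by (rule sum_Pow_prod[OF sub_fin[OF Pp]])
  also have "... = (\<Prod>p\<in>P. real p * (1 / (real p - 1)))"
  proof (rule prod.cong[OF refl])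
   fix p assume "p \<in> P"
   hence "real p - 1 > 0" using p1 Pp by auto
   thus "1 / (real p - 1) + 1 = real p * (1 / (real p - 1))" by (simp add: field_simps)
  qed
  finally show ?thesis unfolding gw_def prod.distrib of_nat_prod by simp
 qed
 have "real (\<Prod>P) * tail P = (\<Sum>D\<in>?T. real (\<Prod>P) * gw P * gw (D - P))"
  unfolding tail_def sum_distrib_left by (rule sum.cong) (simp_all add: split mult.assoc)
 also have "... = (\<Sum>D\<in>?T. \<Sum>K\<in>Pow P. gw (D - P \<union> K))"
  unfolding pz sum_distrib_right
 proof (intro sum.cong refl)
  fix D K assume "D \<in> ?T" "K \<in> Pow P"
  hence "(D - P) \<inter> K = {}" "D - P \<subseteq> PP" "K \<subseteq> PP" using Pp adm_PP[of D] by auto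
  thus "gw K * gw (D - P) = gw (D - P \<union> K)" using gw_Un by simp
 qed
 also have "... = (\<Sum>(D,K)\<in>?T \<times> Pow P. gw (D - P \<union> K))" by (rule sum.cartesian_product)
 also have "... = (\<Sum>E\<in>(\<lambda>(D,K). D - P \<union> K) ` (?T \<times> Pow P). gw E)"
 proof (subst sum.reindex)
  show "inj_on (\<lambda>(D,K). D - P \<union> K) (?T \<times> Pow P)"
  proof (rule inj_onI, clarify)
   fix D K D' K' assume "P \<subseteq> D" "P \<subseteq> D'" "K \<subseteq> P" "K' \<subseteq> P" and eq: "D - P \<union> K = D' - P \<union> K'"
   hence "K = (D - P \<union> K) \<inter> P" "K' = (D' - P \<union> K') \<inter> P" "D = (D - P \<union> K) \<union> P" "D' = (D' - P \<union> K') \<union> P" by blast+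
   thus "D = D' \<and> K = K'" using eq by metis
  qed
 qed (simp add: case_prod_unfold o_def)
 also have "... <= V" unfolding V_def
  by (rule sum_mono2[OF finite_adm]) (use KT gw_pos adm_PP in "auto intro: less_imp_le")
 finally show ?thesis .
qed

lemma lam_bound: assumes P: "P \<in> adm" shows "\<bar>lam P\<bar> <= 1"
proof -
 have "\<bar>lam P\<bar> = real (\<Prod>P) * tail P / V"
  using tail_nonneg[of P] V_ge_1 by (simp add: lam_def abs_mult power_abs flip: of_nat_prod)
 also have "... <= 1" using tail_bound[OF P] V_ge_1 by simp
 finally show ?thesis .
qed

lemma Prod_Un: assumes "P \<subseteq> PP" "Q \<subseteq> PP" shows "1 / real (\<Prod>(P \<union> Q)) = real (\<Prod>(P \<inter> Q)) / (real (\<Prod>P) * real (\<Prod>Q))"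
proof -
 have "\<Prod>(P \<union> Q) * \<Prod>(P \<inter> Q) = \<Prod>P * \<Prod>Q" using prod.union_inter[of P Q "\<lambda>x. x"] assms sub_fin by auto
 hence "real (\<Prod>(P \<union> Q)) * real (\<Prod>(P \<inter> Q)) = real (\<Prod>P) * real (\<Prod>Q)" by (metis of_nat_mult)
 moreover have "real (\<Prod>P) > 0" "real (\<Prod>Q) > 0" "real (\<Prod>(P \<union> Q)) > 0" using prod_pos[of P] prod_pos[of Q] prod_pos[of "P \<union> Q"] assms by (simp_all del: of_nat_prod)
 ultimately show ?thesis by (simp add: field_simps del: of_nat_prod)
qed

text \<open>Exchanging the sums leaves for each \<open>E\<close> an alternating sum between
  \<open>D\<close> and \<open>E\<close>, which vanishes unless \<open>E = D\<close>.\<close>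

lemma diagonal: assumes D: "D \<in> adm"
 shows "(\<Sum>P | P \<in> adm \<and> D \<subseteq> P. lam P / real (\<Prod>P)) = (- 1) ^ card D * gw D / V"
proof -
 have "(\<Sum>P | P \<in> adm \<and> D \<subseteq> P. lam P / real (\<Prod>P)) = (\<Sum>P | P \<in> adm \<and> D \<subseteq> P. (- 1) ^ card P * tail P / V)"
 proof (rule sum.cong)
  fix P assume "P \<in> {P. P \<in> adm \<and> D \<subseteq> P}"
  hence "real (\<Prod>P) > 0" using prod_pos[of P] adm_PP[of P] by (simp del: of_nat_prod)
  thus "lam P / real (\<Prod>P) = (- 1) ^ card P * tail P / V" by (simp add: lam_def del: of_nat_prod)
 qed simp
 also have "... = (\<Sum>P | P \<in> adm \<and> D \<subseteq> P. \<Sum>E | E \<in> adm \<and> P \<subseteq> E. (- 1) ^ card P * gw E) / V"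
  by (simp add: tail_def sum_distrib_left sum_divide_distrib)
 also have "(\<Sum>P | P \<in> adm \<and> D \<subseteq> P. \<Sum>E | E \<in> adm \<and> P \<subseteq> E. (- 1) ^ card P * gw E)
  = (\<Sum>E | E \<in> adm \<and> D \<subseteq> E. \<Sum>P | D \<subseteq> P \<and> P \<subseteq> E. (- 1) ^ card P * gw E)"
 proof -
  have "(\<Sum>P\<in>{P \<in> adm. D \<subseteq> P}. \<Sum>E\<in>{E \<in> {E \<in> adm. D \<subseteq> E}. P \<subseteq> E}. (- 1) ^ card P * gw E)
   = (\<Sum>E\<in>{E \<in> adm. D \<subseteq> E}. \<Sum>P\<in>{P \<in> {P \<in> adm. D \<subseteq> P}. P \<subseteq> E}. (- 1) ^ card P * gw E)"
   by (rule sum.swap_restrict) (use finite_adm in auto)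
  moreover have "{E \<in> {E \<in> adm. D \<subseteq> E}. P \<subseteq> E} = {E. E \<in> adm \<and> P \<subseteq> E}" if "P \<in> {P \<in> adm. D \<subseteq> P}" for P using that by auto
  moreover have "{P \<in> {P \<in> adm. D \<subseteq> P}. P \<subseteq> E} = {P. D \<subseteq> P \<and> P \<subseteq> E}" if "E \<in> {E \<in> adm. D \<subseteq> E}" for E
   using that adm_subset by auto
  ultimately show ?thesis by simp
 qed
 also have "... = (\<Sum>E | E \<in> adm \<and> D \<subseteq> E. (if E = D then (- 1) ^ card D * gw D else 0))"
 proof (rule sum.cong)
  fix E assume E: "E \<in> {E. E \<in> adm \<and> D \<subseteq> E}"
  hence "(\<Sum>P | D \<subseteq> P \<and> P \<subseteq> E. (- 1) ^ card P * gw E) = (if D = E then (- 1) ^ card D else 0) * gw E"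
   unfolding sum_distrib_right[symmetric] by (subst sum_between_minus_one) (use adm_fin in auto)
  thus "(\<Sum>P | D \<subseteq> P \<and> P \<subseteq> E. (- 1) ^ card P * gw E) = (if E = D then (- 1) ^ card D * gw D else 0)" by auto
 qed simp
 also have "... = (- 1) ^ card D * gw D" using finite_adm D by (subst sum.delta) auto
 finally show ?thesis .
qed

text \<open>Writing the greatest common divisor as the sum of the totient \<open>h D\<close> over
  its divisors turns the form into a sum of squares, which \<open>diagonal\<close> evaluates; as
  \<open>h D * gw D = 1\<close>, the result is \<open>V / V\<^sup>2\<close>.\<close>

theorem quadratic_form: "(\<Sum>P\<in>adm. \<Sum>Q\<in>adm. lam P * lam Q / real (\<Prod>(P \<union> Q))) = 1 / V"
proof -
 define u where "u = (\<lambda>P. lam P / real (\<Prod>P))"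
 define h where "h = (\<lambda>D::nat set. \<Prod>p\<in>D. real p - 1)"
 have "(\<Sum>P\<in>adm. \<Sum>Q\<in>adm. lam P * lam Q / real (\<Prod>(P \<union> Q))) = (\<Sum>P\<in>adm. \<Sum>Q\<in>adm. \<Sum>D\<in>{D \<in> adm. D \<subseteq> P \<and> D \<subseteq> Q}. u P * u Q * h D)"
 proof (intro sum.cong refl)
  fix P Q assume P: "P \<in> adm" and Q: "Q \<in> adm"
  have "finite (P \<inter> Q)" using adm_fin[OF P] by simp
  have "real (\<Prod>(P \<inter> Q)) = (\<Prod>p\<in>P \<inter> Q. (real p - 1) + 1)" by simp
  also have "... = (\<Sum>D\<in>Pow (P \<inter> Q). h D)" unfolding h_def by (rule sum_Pow_prod[symmetric]) fact
  also have "Pow (P \<inter> Q) = {D \<in> adm. D \<subseteq> P \<and> D \<subseteq> Q}" using adm_subset[OF P] by auto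
  finally have e: "real (\<Prod>(P \<inter> Q)) = (\<Sum>D\<in>{D \<in> adm. D \<subseteq> P \<and> D \<subseteq> Q}. h D)" .
  have "lam P * lam Q / real (\<Prod>(P \<union> Q)) = u P * u Q * real (\<Prod>(P \<inter> Q))"
   using arg_cong[OF Prod_Un[OF adm_PP[OF P] adm_PP[OF Q]], of "\<lambda>t. lam P * lam Q * t"] by (simp add: u_def del: of_nat_prod)
  thus "lam P * lam Q / real (\<Prod>(P \<union> Q)) = (\<Sum>D\<in>{D \<in> adm. D \<subseteq> P \<and> D \<subseteq> Q}. u P * u Q * h D)"
   by (simp add: e sum_distrib_left del: of_nat_prod)
 qed
 also have "... = (\<Sum>P\<in>adm. \<Sum>Q\<in>adm. \<Sum>D\<in>adm. if D \<subseteq> P \<and> D \<subseteq> Q then u P * u Q * h D else 0)"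
  by (simp add: sum.inter_filter[OF finite_adm])
 also have "... = (\<Sum>D\<in>adm. \<Sum>P\<in>adm. \<Sum>Q\<in>adm. if D \<subseteq> P \<and> D \<subseteq> Q then u P * u Q * h D else 0)"
  (is "(\<Sum>P\<in>adm. \<Sum>Q\<in>adm. \<Sum>D\<in>adm. ?t P Q D) = _")
 proof -
  have "(\<Sum>P\<in>adm. \<Sum>Q\<in>adm. \<Sum>D\<in>adm. ?t P Q D) = (\<Sum>P\<in>adm. \<Sum>D\<in>adm. \<Sum>Q\<in>adm. ?t P Q D)"
   by (rule sum.cong[OF refl]) (rule sum.swap)
  also have "... = (\<Sum>D\<in>adm. \<Sum>P\<in>adm. \<Sum>Q\<in>adm. ?t P Q D)" by (rule sum.swap)
  finally show ?thesis .
 qed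
 also have "... = (\<Sum>D\<in>adm. h D * (\<Sum>P | P \<in> adm \<and> D \<subseteq> P. u P)\<^sup>2)"
 proof (rule sum.cong[OF refl])
  fix D
  have "(\<Sum>P\<in>adm. \<Sum>Q\<in>adm. if D \<subseteq> P \<and> D \<subseteq> Q then u P * u Q * h D else 0)
   = (\<Sum>P\<in>adm. \<Sum>Q\<in>adm. h D * ((if D \<subseteq> P then u P else 0) * (if D \<subseteq> Q then u Q else 0)))"
   by (intro sum.cong refl) simp
  also have "... = h D * ((\<Sum>P\<in>adm. if D \<subseteq> P then u P else 0) * (\<Sum>Q\<in>adm. if D \<subseteq> Q then u Q else 0))"
   by (simp only: sum_distrib_left[symmetric] sum_product)
  finally show "(\<Sum>P\<in>adm. \<Sum>Q\<in>adm. if D \<subseteq> P \<and> D \<subseteq> Q then u P * u Q * h D else 0) = h D * (\<Sum>P | P \<in> adm \<and> D \<subseteq> P. u P)\<^sup>2"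
   by (simp add: sum.inter_filter[OF finite_adm] power2_eq_square)
 qed
 also have "... = (\<Sum>D\<in>adm. gw D / V\<^sup>2)"
 proof (rule sum.cong[OF refl])
  fix D assume D: "D \<in> adm"
  have "h D * gw D = (\<Prod>p\<in>D. 1)" unfolding h_def gw_def prod.distrib[symmetric]
   by (rule prod.cong[OF refl]) (use p1 adm_PP[OF D] in force)
  hence hg: "h D * gw D = 1" by simp
  have "h D * ((- 1) ^ card D * gw D / V)\<^sup>2 = (h D * gw D) * gw D / V\<^sup>2"
   by (simp add: power_divide power_mult_distrib power2_eq_square[of "gw D"] power_mult[symmetric] mult.commute[of "card D"] power_mult)
  thus "h D * (\<Sum>P | P \<in> adm \<and> D \<subseteq> P. u P)\<^sup>2 = gw D / V\<^sup>2"
   unfolding u_def diagonal[OF D] by (simp add: hg)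
 qed
 also have "... = V / V\<^sup>2" by (simp add: V_def sum_divide_distrib)
 also have "... = 1 / V" by (simp add: power2_eq_square)
 finally show ?thesis .
qed

end

section \<open>Averages of divisibility conditions on linear forms\<close>

lemma pmod_periodic: "pmod N F ==> periodic N (\<lambda>t. F (x(i := t)))"
 unfolding periodic_def by (auto intro!: pmodD[of N F])

lemma pmod_dvd: assumes "pmod a F" "a dvd b" shows "pmod b F"
 unfolding pmod_def
proof (intro allI impI pmodD[OF assms(1)])
 fix x y :: "nat => int" and m assume "\<forall>m. x m mod int b = y m mod int b"
 hence "x m mod int b mod int a = y m mod int b mod int a" by simp
 thus "x m mod int a = y m mod int a" using assms(2) by (simp add: mod_mod_cancel)
qed

text \<open>The Chinese remainder theorem.\<close>

lemma avg_coprime_mult: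
 assumes ab: "coprime a b" "a > 0" "b > 0" and f: "periodic a f" and g: "periodic b g"
 shows "avg (a * b) (\<lambda>t. f t * g t) = avg a f * avg b g"
proof -
 define ff where "ff = (\<lambda>t. (t mod int a, t mod int b))"
 let ?X = "{0..<int a} \<times> {0..<int b}"
 have inj: "inj_on ff {0..<int (a * b)}"
 proof (rule inj_onI)
  fix s t assume st: "s \<in> {0..<int (a * b)}" "t \<in> {0..<int (a * b)}" "ff s = ff t"
  hence "int a dvd s - t" "int b dvd s - t" by (simp_all add: ff_def mod_eq_dvd_iff)
  hence "int a * int b dvd s - t" using ab by (intro divides_mult) simp_all
  hence "s mod int (a * b) = t mod int (a * b)" by (simp add: mod_eq_dvd_iff)
  thus "s = t" using st by simp
 qed
 have sub: "ff ` {0..<int (a * b)} \<subseteq> ?X" using ab by (auto simp: ff_def)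
 have "card (ff ` {0..<int (a * b)}) = card ?X"
  using card_image[OF inj] by (simp add: nat_mult_distrib)
 hence im: "ff ` {0..<int (a * b)} = ?X" using card_subset_eq[OF _ sub] by simp
 have "(\<Sum>t\<in>{0..<int (a * b)}. f t * g t) = (\<Sum>t\<in>{0..<int (a * b)}. (\<lambda>(u, v). f u * g v) (ff t))"
  by (simp add: ff_def periodic_mod[OF f] periodic_mod[OF g])
 also have "... = (\<Sum>(u, v)\<in>?X. f u * g v)" using sum.reindex[OF inj, of "\<lambda>(u, v). f u * g v"] im by (simp add: o_def)
 also have "... = (\<Sum>u\<in>{0..<int a}. f u) * (\<Sum>v\<in>{0..<int b}. g v)"
  by (simp add: sum_product sum.cartesian_product)
 finally show ?thesis by (simp add: avg_def)
qed

lemma ex_coprime_mult: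
 assumes ab: "coprime a b" "a > 0" "b > 0" and F: "pmod a F" and G: "pmod b G"
 shows "ex (a * b) is (\<lambda>x. F x * G x) = (\<lambda>x. ex a is F x * ex b is G x)"
proof (induction "is")
 case (Cons i "is")
 show ?case
 proof
  fix x
  have "ex (a * b) (i # is) (\<lambda>x. F x * G x) x = avg (a * b) (\<lambda>t. ex a is F (x(i := t)) * ex b is G (x(i := t)))"
   by (simp add: Cons.IH av_def)
  also have "... = avg a (\<lambda>t. ex a is F (x(i := t))) * avg b (\<lambda>t. ex b is G (x(i := t)))"
   by (rule avg_coprime_mult[OF ab]; rule pmod_periodic; rule pmod_ex; fact)
  finally show "ex (a * b) (i # is) (\<lambda>x. F x * G x) x = ex a (i # is) F x * ex b (i # is) G x"
   by (simp add: av_def)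
 qed
qed simp

lemma Ex_prod_primes:
 assumes "finite U" "\<And>p. p \<in> U ==> prime p" "\<And>p. p \<in> U ==> pmod p (B p)"
 shows "Ex (\<Prod>U) k (\<lambda>x. \<Prod>p\<in>U. B p x) = (\<Prod>p\<in>U. Ex p k (B p)) \<and> pmod (\<Prod>U) (\<lambda>x. \<Prod>p\<in>U. B p x)"
 using assms
proof (induction U rule: finite_induct)
 case empty
 thus ?case by (simp add: Ex_const pmod_def)
next
 case (insert p U)
 have p: "prime p" "p > 0" and U: "\<Prod>U > 0" using insert.prems(1) prime_gt_0_nat by (auto intro!: prod_pos)
 have cop: "coprime p (\<Prod>U)"
  by (rule prod_coprime_right) (use insert in "auto intro: primes_coprime")
 have IH: "Ex (\<Prod>U) k (\<lambda>x. \<Prod>p\<in>U. B p x) = (\<Prod>p\<in>U. Ex p k (B p))" "pmod (\<Prod>U) (\<lambda>x. \<Prod>p\<in>U. B p x)"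
  using insert by auto
 have eq: "(\<lambda>x. \<Prod>q\<in>insert p U. B q x) = (\<lambda>x. B p x * (\<Prod>q\<in>U. B q x))" "\<Prod>(insert p U) = p * \<Prod>U"
  using insert.hyps by auto
 have "pmod (p * \<Prod>U) (B p)" "pmod (p * \<Prod>U) (\<lambda>x. \<Prod>q\<in>U. B q x)"
  using pmod_dvd[of p "B p"] insert.prems(2) pmod_dvd[OF IH(2)] by auto
 hence "pmod (p * \<Prod>U) (\<lambda>x. B p x * (\<Prod>q\<in>U. B q x))" unfolding pmod_def by metis
 moreover have "Ex (p * \<Prod>U) k (\<lambda>x. B p x * (\<Prod>q\<in>U. B q x)) = Ex p k (B p) * (\<Prod>q\<in>U. Ex q k (B q))"
  using ex_coprime_mult[OF cop p(2) U insert.prems(2) IH(2)] IH(1) by (simp add: Ex_def)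
 ultimately show ?case using insert.hyps unfolding eq by simp
qed

lemma av_form:
 assumes g: "periodic m g" and m: "m > 0" and l: "l < 2 * k" "coprime (c l) (int m)"
 shows "av m l (\<lambda>x. g (form k c x)) = (\<lambda>x. avg m g)"
proof
 fix x
 define r where "r = (\<Sum>j\<in>{..<2 * k} - {l}. c j * x j)"
 have f: "form k c (x(l := t)) = c l * t + r" for t
  unfolding form_def r_def using l by (subst sum.remove[of _ l]) (auto intro!: sum.cong)
 have "periodic m (\<lambda>t. g (t + r))" using g by (simp add: periodic_def algebra_simps)
   (metis add.commute add.left_commute)
 from avg_scale[OF this m l(2)] show "av m l (\<lambda>x. g (form k c x)) x = avg m g"
  by (simp add: av_def f avg_shift[OF g m])
qed

lemma Ex_form:
 assumes "periodic m g" "m > 0" "l < 2 * k" "coprime (c l) (int m)"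
 shows "Ex m k (\<lambda>x. g (form k c x)) = avg m g"
 using Ex_av[OF assms(3,2), of "\<lambda>x. g (form k c x)"] av_form[where g = g and c = c, OF assms] assms(2) by (simp add: Ex_const)

lemma periodic_dvd: "periodic p (\<lambda>t. of_bool (int p dvd e + M * t))"
proof -
 have "e + M * (t + int p) = (e + M * t) + M * int p" for t by (simp add: algebra_simps)
 thus ?thesis by (simp only: periodic_def dvd_add_times_triv_right_iff simp_thms)
qed

lemma avg_dvd:
 assumes p: "prime p" and M: "\<not> int p dvd M"
 shows "avg p (\<lambda>t. of_bool (int p dvd e + M * t)) = 1 / real p"
proof -
 have p0: "p > 0" using p prime_gt_0_nat by auto
 have cop: "coprime M (int p)" using p M prime_imp_coprime[of "int p" M] by (simp add: coprime_commute)
 have per: "periodic p (\<lambda>t. of_bool (int p dvd e + t))" for e using periodic_dvd[of p e 1] by simp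
 have "avg p (\<lambda>t. of_bool (int p dvd e + M * t)) = avg p (\<lambda>t. of_bool (int p dvd e + t))"
  using avg_scale[OF per p0 cop, of e] by simp
 also have "... = avg p (\<lambda>t. of_bool (int p dvd t))" using avg_shift[OF per[of 0] p0, of e] by (simp add: add.commute)
 also have "(\<Sum>t\<in>{0..<int p}. of_bool (int p dvd t)) = (\<Sum>t\<in>{0..<int p}. if t = 0 then 1 else 0 :: real)"
  by (rule sum.cong) (auto dest: zdvd_imp_le)
 hence "avg p (\<lambda>t. of_bool (int p dvd t)) = 1 / real p" using p0 by (simp add: avg_def)
 finally show ?thesis .
qed

lemma coeff_coprime:
 fixes c :: int
 assumes "c ~= 0" "\<bar>c\<bar> <= int k" "\<And>d. 0 < d ==> d <= k ==> coprime (int d) (int N)"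
 shows "coprime c (int N)"
 using assms(3)[of "nat \<bar>c\<bar>"] assms(1,2) by simp

text \<open>A nonzero coefficient is at most \<open>k < p\<close> in absolute value, hence
  invertible, and one condition has probability \<open>1 / p\<close>. For two conditions, a variable
  present in only one of the forms makes them independent.\<close>

lemma local_factor:
 assumes p: "prime p" "p > k" and M: "\<not> int p dvd M" and good: "good_forms k S c" and T: "T \<subseteq> S" "T ~= {}"
 shows "0 <= Ex p k (\<lambda>x. of_bool (\<forall>s\<in>T. int p dvd e s + M * form k (c s) x))"
  and "card T = 1 ==> Ex p k (\<lambda>x. of_bool (\<forall>s\<in>T. int p dvd e s + M * form k (c s) x)) = 1 / real p"
  and "Ex p k (\<lambda>x. of_bool (\<forall>s\<in>T. int p dvd e s + M * form k (c s) x)) <= (1 / real p) ^ (if card T = 1 then 1 else 2)"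
proof -
 let ?F = "(\<lambda>x. of_bool (\<forall>s\<in>T. int p dvd e s + M * form k (c s) x))"
 have p0: "p > 0" using p by simp
 define g where "g = (\<lambda>s t. of_bool (int p dvd e s + M * t) :: real)"
 have per: "periodic p (g s)" for s unfolding g_def by (rule periodic_dvd)
 have avg: "avg p (g s) = 1 / real p" for s unfolding g_def by (rule avg_dvd[OF p(1) M])
 have cop: "coprime (c s l) (int p)" if "s \<in> S" "c s l ~= 0" for s l
 proof (rule coeff_coprime[of _ k])
  show "\<bar>c s l\<bar> <= int k" using good that by (simp add: good_forms_def)
  fix d assume "0 < d" "d <= k"
  hence "\<not> p dvd d" using p(2) by (auto dest: dvd_imp_le)
  thus "coprime (int d) (int p)" using prime_imp_coprime[OF p(1)] by (simp add: coprime_commute)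
 qed fact
 show "0 <= Ex p k ?F" by (rule Ex_nonneg) (use p0 in auto)
 show one: "Ex p k ?F = 1 / real p" if c1: "card T = 1"
 proof -
  obtain s where s: "T = {s}" using card_1_singletonE[OF c1] by blast
  then obtain l where "l < 2 * k" "c s l ~= 0" using good T by (auto simp: good_forms_def)
  hence "Ex p k (\<lambda>x. g s (form k (c s) x)) = 1 / real p" using Ex_form[OF per p0] cop avg T s by auto
  thus ?thesis by (simp add: s g_def)
 qed
 show "Ex p k ?F <= (1 / real p) ^ (if card T = 1 then 1 else 2)"
 proof (cases "card T = 1")
  case False
  obtain s where s: "s \<in> T" using T by auto
  have "T ~= {s}" using False by auto
  then obtain t where t: "t \<in> T" "t ~= s" using s by blast
  have sS: "s \<in> S" "t \<in> S" using s t T by auto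
  obtain l where l: "l < 2 * k" "c s l ~= 0" "c t l = 0"
   using good sS t(2) by (auto simp: good_forms_def) metis
  obtain l' where l': "l' < 2 * k" "c t l' ~= 0" using good sS by (auto simp: good_forms_def)
  have ign: "ign l (\<lambda>x. g t (form k (c t) x))" using ign_form[of "c t" l k] l(3) by (simp add: ign_def)
  have "Ex p k ?F <= Ex p k (\<lambda>x. g t (form k (c t) x) * g s (form k (c s) x))"
   by (rule Ex_mono) (use s t in "auto simp: g_def")
  also have "... = Ex p k (av p l (\<lambda>x. g t (form k (c t) x) * g s (form k (c s) x)))" by (rule Ex_av[symmetric, OF l(1) p0])
  also have "av p l (\<lambda>x. g t (form k (c t) x) * g s (form k (c s) x)) = (\<lambda>x. g t (form k (c t) x) * (1 / real p))"
   by (simp only: av_mult_ign[OF ign] av_form[where g = "g s" and c = "c s", OF per p0 l(1) cop[OF sS(1) l(2)]] avg)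
  also have "Ex p k ... = (1 / real p) * Ex p k (\<lambda>x. g t (form k (c t) x))"
   by (simp only: Ex_cmult[symmetric] mult.commute)
  also have "... = (1 / real p) ^ 2" using Ex_form[where g = "g t" and c = "c t", OF per p0 l'(1) cop[OF sS(2) l'(2)]] avg by (simp add: power2_eq_square)
  finally show ?thesis using False by simp
 qed (simp add: one)
qed

lemma prod_of_bool: "finite A ==> (\<Prod>a\<in>A. of_bool (P a)) = (of_bool (\<forall>a\<in>A. P a) :: real)"
 by (induction A rule: finite_induct) auto

text \<open>Both quantities factor over the primes of \<open>U\<close>. If every prime is attached
  to a single form they agree; otherwise a prime shared by two forms contributes to each of them an
  extra \<open>1 / p\<close>, which is at most \<open>1 / w\<close>.\<close>

lemma box_average:
 assumes good: "good_forms k S c" and U: "finite U" "\<And>p. p \<in> U ==> prime p \<and> p > k \<and> real p >= w \<and> \<not> int p dvd M"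
  and w: "w > 0" and UD: "U = (\<Union>s\<in>S. D s)"
 shows "\<bar>Ex (\<Prod>U) k (\<lambda>x. \<Prod>s\<in>S. of_bool (\<forall>p\<in>D s. int p dvd e s + M * form k (c s) x)) - (\<Prod>s\<in>S. 1 / real (\<Prod>(D s)))\<bar> <= 1 / (w * real (\<Prod>U))"
proof -
 have S: "finite S" using good by (simp add: good_forms_def)
 define T where "T = (\<lambda>p. {s \<in> S. p \<in> D s})"
 define B where "B = (\<lambda>p x. of_bool (\<forall>s\<in>T p. int p dvd e s + M * form k (c s) x) :: real)"
 have T: "T p \<subseteq> S" "finite (T p)" for p using S by (auto simp: T_def)
 have Tne: "T p ~= {}" if "p \<in> U" for p using that UD by (auto simp: T_def)
 have pU: "prime p" "p > k" "real p >= w" "\<not> int p dvd M" "real p > 0" if "p \<in> U" for p using U(2)[OF that] w by auto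
 have "(\<lambda>x. \<Prod>s\<in>S. of_bool (\<forall>p\<in>D s. int p dvd e s + M * form k (c s) x)) = (\<lambda>x. \<Prod>p\<in>U. B p x)"
  unfolding B_def prod_of_bool[OF S] prod_of_bool[OF U(1)] T_def
  by (rule ext, rule arg_cong[of _ _ of_bool]) (use UD in blast)
 moreover have "pmod p (B p)" if "p \<in> U" for p
  unfolding pmod_def
 proof (intro allI impI)
  fix x y :: "nat => int" assume xy: "\<forall>m. x m mod int p = y m mod int p"
  have "form k (c s) x mod int p = form k (c s) y mod int p" for s
   unfolding form_def by (intro mod_sum_cong mod_mult_cong refl) (use xy in auto)
  hence "(e s + M * form k (c s) x) mod int p = (e s + M * form k (c s) y) mod int p" for s
   by (intro mod_add_cong mod_mult_cong refl)
  thus "B p x = B p y" by (simp add: B_def dvd_eq_mod_eq_0)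
 qed
 ultimately have E: "Ex (\<Prod>U) k (\<lambda>x. \<Prod>s\<in>S. of_bool (\<forall>p\<in>D s. int p dvd e s + M * form k (c s) x)) = (\<Prod>p\<in>U. Ex p k (B p))"
  using Ex_prod_primes[OF U(1), of B k] pU(1) by simp
 have "1 / real (\<Prod>(D s)) = (\<Prod>p\<in>U. if p \<in> D s then 1 / real p else 1)" if "s \<in> S" for s
 proof -
  have "{p \<in> U. p \<in> D s} = D s" using that UD by auto
  thus ?thesis using prod.inter_filter[OF U(1), of "\<lambda>p. 1 / real p" "\<lambda>p. p \<in> D s"] by (simp add: prod_dividef)
 qed
 hence "(\<Prod>s\<in>S. 1 / real (\<Prod>(D s))) = (\<Prod>s\<in>S. \<Prod>p\<in>U. if p \<in> D s then 1 / real p else 1)" by (rule prod.cong[OF refl])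
 also have "... = (\<Prod>p\<in>U. \<Prod>s\<in>S. if p \<in> D s then 1 / real p else 1)" by (rule prod.swap)
 also have "... = (\<Prod>p\<in>U. (1 / real p) ^ card (T p))"
  by (intro prod.cong refl) (simp only: T_def prod.inter_filter[OF S, symmetric] prod_constant)
 finally have R: "(\<Prod>s\<in>S. 1 / real (\<Prod>(D s))) = (\<Prod>p\<in>U. (1 / real p) ^ card (T p))" .
 show ?thesis
 proof (cases "\<forall>p\<in>U. card (T p) = 1")
  case True
  have "(\<Prod>p\<in>U. Ex p k (B p)) = (\<Prod>p\<in>U. (1 / real p) ^ card (T p))"
  proof (rule prod.cong[OF refl])
   fix p assume p: "p \<in> U"
   show "Ex p k (B p) = (1 / real p) ^ card (T p)"
    using local_factor(2)[where e = e, OF pU(1,2,4)[OF p] good T(1) Tne[OF p]] True p by (simp add: B_def)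
  qed
  thus ?thesis using E R w by (simp add: prod_nonneg)
 next
  case False
  then obtain q where q: "q \<in> U" "card (T q) ~= 1" by auto
  define X where "X = (\<lambda>p. (1 / real p) ^ (if p = q then 2 else 1))"
  have le: "(1 / real p) ^ (if card (T p) = 1 then 1 else 2) <= X p" if p: "p \<in> U" for p
   using q(2) power_decreasing[of 1 2 "1 / real p"] pU(2,5)[OF p] by (auto simp: X_def)
  have "(\<Prod>p\<in>U. Ex p k (B p)) <= prod X U"
  proof (rule prod_mono)
   fix p assume p: "p \<in> U"
   show "0 <= Ex p k (B p) \<and> Ex p k (B p) <= X p"
    using local_factor(1,3)[where e = e, OF pU(1,2,4)[OF p] good T(1) Tne[OF p]] le[OF p] by (simp add: B_def)
  qed
  moreover have "(\<Prod>p\<in>U. (1 / real p) ^ card (T p)) <= prod X U"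
  proof (rule prod_mono)
   fix p assume p: "p \<in> U"
   have "card (T p) > 0" using Tne[OF p] T by (simp add: card_gt_0_iff)
   hence "(1 / real p) ^ card (T p) <= (1 / real p) ^ (if card (T p) = 1 then 1 else 2)"
    by (intro power_decreasing) (use pU(2)[OF p] in auto)
   thus "0 <= (1 / real p) ^ card (T p) \<and> (1 / real p) ^ card (T p) <= X p" using le[OF p] by auto
  qed
  moreover have "prod X U <= 1 / (w * real (\<Prod>U))"
  proof -
   have "prod X U = X q * prod X (U - {q})" by (rule prod.remove[OF U(1) q(1)])
   also have "prod X (U - {q}) = (\<Prod>p\<in>U - {q}. 1 / real p)" by (rule prod.cong) (auto simp: X_def)
   also have "X q = 1 / real q * (1 / real q)" by (simp add: X_def power2_eq_square)
   finally have "prod X U = 1 / real q * (\<Prod>p\<in>U. 1 / real p)" by (simp add: prod.remove[OF U(1) q(1)])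
   also have "... <= 1 / w * (\<Prod>p\<in>U. 1 / real p)"
    by (intro mult_right_mono prod_nonneg divide_left_mono) (use pU[OF q(1)] w in auto)
   finally show ?thesis by (simp add: prod_dividef)
  qed
  moreover have "0 <= (\<Prod>p\<in>U. Ex p k (B p))"
   by (rule prod_nonneg) (use local_factor(1)[where e = e, OF pU(1,2,4) good T(1) Tne] in "auto simp: B_def")
  moreover have "0 <= (\<Prod>p\<in>U. (1 / real p) ^ card (T p))" by (rule prod_nonneg) auto
  ultimately show ?thesis unfolding E R by linarith
 qed
qed

lemma ex_base: "(\<And>l. l \<notin> set is ==> y l = z l) ==> ex N is F y = ex N is F z"
proof (induction "is" arbitrary: y z)
 case (Cons i "is")
 have "ex N is F (y(i := t)) = ex N is F (z(i := t))" for t by (rule Cons.IH) (use Cons.prems in auto)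
 thus ?case by (simp add: av_def)
next
 case Nil
 hence "y = z" by auto
 thus ?case by simp
qed

lemma avg_boundary:
 assumes N: "N > 0" and B: "B >= 0"
 shows "avg N (\<lambda>t. of_bool (t mod int N < B \<or> t mod int N >= int N - B)) <= 2 * real_of_int B / real N"
proof -
 have "(\<Sum>t\<in>{0..<int N}. of_bool (t mod int N < B \<or> t mod int N >= int N - B)) = (\<Sum>t\<in>{0..<int N}. of_bool (t < B \<or> t >= int N - B) :: real)"
  by (rule sum.cong) auto
 also have "... = real (card {t \<in> {0..<int N}. t < B \<or> t >= int N - B})" by (simp add: of_bool_def sum.If_cases Int_def)
 also have "... <= real (card ({0..<B} \<union> {int N - B..<int N}))" by (intro of_nat_mono card_mono) auto
 also have "... <= real (card {0..<B} + card {int N - B..<int N})" by (intro of_nat_mono card_Un_le)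
 also have "... = 2 * real_of_int B" using B by simp
 finally show ?thesis unfolding avg_def by (rule divide_right_mono) simp
qed

lemma form_mod: "(\<And>l. x l mod n = y l mod n) ==> form k c x mod n = form k c y mod n"
 unfolding form_def by (intro mod_sum_cong mod_mult_cong refl)

lemma form_box:
 assumes "\<And>l. \<bar>c l\<bar> <= int k" "\<And>l. l < 2 * k ==> 0 <= h l \<and> h l < int L"
 shows "\<bar>form k c h\<bar> <= 2 * int k * int k * int L"
proof -
 have "\<bar>form k c h\<bar> <= (\<Sum>l<2 * k. \<bar>c l * h l\<bar>)" unfolding form_def by (rule sum_abs)
 also have "... <= (\<Sum>l<2 * k. int k * int L)"
 proof (rule sum_mono)
  fix l assume "l \<in> {..<2 * k}"
  thus "\<bar>c l * h l\<bar> <= int k * int L"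
   using mult_mono[OF assms(1)[of l], of "h l" "int L"] assms(2)[of l] by (simp add: abs_mult)
 qed
 finally show ?thesis by simp
qed

text \<open>Averaging over boxes of side \<open>L\<close>, the product of all primes involved, replaces the modulus \<open>N\<close>
 by \<open>L\<close>; only the boxes in which some form wraps around modulo \<open>N\<close> are lost.\<close>

lemma sieve_correlation:
 assumes good: "good_forms k S c" and N: "N > 0" and cop: "\<And>d. 0 < d ==> d <= k ==> coprime (int d) (int N)"
  and U: "finite U" "\<And>p. p \<in> U ==> prime p \<and> p > k \<and> real p >= w \<and> \<not> int p dvd M"
  and w: "w > 0" and UD: "U = (\<Union>s\<in>S. D s)"
 shows "\<bar>Ex N k (\<lambda>x. \<Prod>s\<in>S. of_bool (\<forall>p\<in>D s. int p dvd b + M * (form k (c s) x mod int N))) - (\<Prod>s\<in>S. 1 / real (\<Prod>(D s)))\<bar>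
  <= 1 / (w * real (\<Prod>U)) + real (card S) * (4 * (real k)\<^sup>2 * real (\<Prod>U) / real N)"
proof -
 define L where "L = \<Prod>U"
 define I where "I = (\<lambda>x. \<Prod>s\<in>S. of_bool (\<forall>p\<in>D s. int p dvd b + M * (form k (c s) x mod int N)) :: real)"
 define rh where "rh = (\<Prod>s\<in>S. 1 / real (\<Prod>(D s)))"
 define B where "B = 2 * int k * int k * int L"
 define bad where "bad = (\<lambda>t. of_bool (t mod int N < B \<or> t mod int N >= int N - B) :: real)"
 define G where "G = (\<lambda>v. Ex L k (\<lambda>h. I (\<lambda>l. h l + v l)))"
 have S: "finite S" using good by (simp add: good_forms_def)
 have L: "L > 0" unfolding L_def by (rule prod_pos) (use U prime_gt_0_nat in auto)
 have cS: "\<bar>c s l\<bar> <= int k" if "s \<in> S" for s l using good that by (simp add: good_forms_def)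
 have I01: "0 <= I x" "I x <= 1" for x unfolding I_def by (auto intro!: prod_nonneg prod_le_1)
 have D1: "1 <= real (\<Prod>(D s))" if "s \<in> S" for s
 proof -
  have "0 < \<Prod>(D s)" by (rule prod_pos) (use that U UD prime_gt_0_nat in auto)
  thus ?thesis by (simp del: of_nat_prod)
 qed
 have rh01: "0 <= rh" "rh <= 1" unfolding rh_def
  by (intro prod_nonneg, use D1 in force) (intro prod_le_1, use D1 in force)
 have pI: "pmod N I" unfolding pmod_def
 proof (intro allI impI)
  fix x y :: "nat => int" assume xy: "\<forall>m. x m mod int N = y m mod int N"
  have "form k (c s) x mod int N = form k (c s) y mod int N" for s by (rule form_mod) (use xy in auto)
  thus "I x = I y" by (simp add: I_def)
 qed
 have "Ex N k I = Ex N k G"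
 proof -
  have "Ex L k (\<lambda>h. Ex N k (\<lambda>v. I (\<lambda>l. h l + v l))) = Ex L k (\<lambda>h. Ex N k I)" unfolding Ex_def
  proof (rule ex_cong_box[OF L])
   fix h :: "nat => int" assume h: "\<And>l. l \<notin> set [0..<2 * k] ==> h l = 0"
   have "ex N [0..<2 * k] (\<lambda>v. I (\<lambda>l. h l + v l)) (\<lambda>_. 0) = ex N [0..<2 * k] I h"
    using ex_shift_all[OF pI N, of "[0..<2 * k]" h "\<lambda>_. 0"] by simp
   also have "... = ex N [0..<2 * k] I (\<lambda>_. 0)" by (rule ex_base) (rule h)
   finally show "ex N [0..<2 * k] (\<lambda>v. I (\<lambda>l. h l + v l)) (\<lambda>_. 0) = ex N [0..<2 * k] I (\<lambda>_. 0)" .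
  qed
  hence "Ex N k I = Ex L k (\<lambda>h. Ex N k (\<lambda>v. I (\<lambda>l. h l + v l)))" using Ex_const[OF L] by simp
  also have "... = Ex N k G" unfolding G_def Ex_def by (rule ex_ex_swap[OF L])
  finally show ?thesis .
 qed
 hence "\<bar>Ex N k I - rh\<bar> = \<bar>Ex N k (\<lambda>v. G v - rh)\<bar>" using N by (simp add: Ex_diff Ex_const)
 also have "... <= Ex N k (\<lambda>v. \<bar>G v - rh\<bar>)" by (rule Ex_abs[OF N])
 also have "... <= Ex N k (\<lambda>v. 1 / (w * real L) + (\<Sum>s\<in>S. bad (form k (c s) v)))"
 proof (rule Ex_mono)
  fix v
  show "\<bar>G v - rh\<bar> <= 1 / (w * real L) + (\<Sum>s\<in>S. bad (form k (c s) v))"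
  proof (cases "\<exists>s\<in>S. bad (form k (c s) v) = 1")
   case True
   then obtain s where s: "s \<in> S" "bad (form k (c s) v) = 1" by blast
   have "0 <= G v" "G v <= 1" using Ex_nonneg[of "\<lambda>h. I (\<lambda>l. h l + v l)" L k] Ex_mono[of "\<lambda>h. I (\<lambda>l. h l + v l)" "\<lambda>_. 1" L k] I01 L
    by (auto simp: G_def Ex_const)
   hence "\<bar>G v - rh\<bar> <= 1" using rh01 by linarith
   moreover have "bad (form k (c s) v) <= (\<Sum>s\<in>S. bad (form k (c s) v))"
    by (rule member_le_sum[OF s(1) _ S]) (simp add: bad_def)
   moreover have "0 <= 1 / (w * real L)" using w by simp
   ultimately show ?thesis using s(2) by linarith
  next
   case False
   hence nb: "B <= form k (c s) v mod int N" "form k (c s) v mod int N < int N - B" if "s \<in> S" for s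
    using False that unfolding bad_def of_bool_eq_1_iff by (auto simp: not_less not_le)
   have "G v = Ex L k (\<lambda>h. \<Prod>s\<in>S. of_bool (\<forall>p\<in>D s. int p dvd (b + M * (form k (c s) v mod int N)) + M * form k (c s) h))"
    unfolding G_def Ex_def I_def
   proof (rule ex_cong_box[OF L], rule prod.cong[OF refl])
    fix h :: "nat => int" and s
    assume h: "\<And>l. l \<in> set [0..<2 * k] ==> 0 <= h l \<and> h l < int L" and s: "s \<in> S"
    have "\<bar>form k (c s) h\<bar> <= B" unfolding B_def by (rule form_box) (use cS[OF s] h in auto)
    hence "0 <= form k (c s) v mod int N + form k (c s) h" "form k (c s) v mod int N + form k (c s) h < int N" using nb[OF s] by linarith+
    hence "form k (c s) v mod int N + form k (c s) h = (form k (c s) v mod int N + form k (c s) h) mod int N" by simp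
    also have "... = form k (c s) (\<lambda>l. h l + v l) mod int N"
     by (simp add: form_def distrib_left sum.distrib mod_add_left_eq mod_add_right_eq add.commute)
    finally show "of_bool (\<forall>p\<in>D s. int p dvd b + M * (form k (c s) (\<lambda>l. h l + v l) mod int N))
     = (of_bool (\<forall>p\<in>D s. int p dvd (b + M * (form k (c s) v mod int N)) + M * form k (c s) h) :: real)"
     by (simp add: distrib_left[symmetric] add.assoc)
   qed
   hence "\<bar>G v - rh\<bar> <= 1 / (w * real L)"
    using box_average[OF good U w UD, of "\<lambda>s. b + M * (form k (c s) v mod int N)"] by (simp add: L_def rh_def)
   moreover have "0 <= (\<Sum>s\<in>S. bad (form k (c s) v))" by (rule sum_nonneg) (simp add: bad_def)
   ultimately show ?thesis by linarith
  qed
 qed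
 also have "... = 1 / (w * real L) + (\<Sum>s\<in>S. Ex N k (\<lambda>v. bad (form k (c s) v)))"
  using N by (simp add: Ex_add Ex_const Ex_sum)
 also have "(\<Sum>s\<in>S. Ex N k (\<lambda>v. bad (form k (c s) v))) <= (\<Sum>s\<in>S. 2 * real_of_int B / real N)"
 proof (rule sum_mono)
  fix s assume s: "s \<in> S"
  obtain l where l: "l < 2 * k" "c s l ~= 0" using good s by (auto simp: good_forms_def)
  have "periodic N bad" by (simp add: periodic_def bad_def)
  from Ex_form[where g = bad and c = "c s", OF this N l(1) coeff_coprime[OF l(2) cS[OF s] cop]]
  have "Ex N k (\<lambda>v. bad (form k (c s) v)) = avg N bad" by simp
  also have "... <= 2 * real_of_int B / real N" unfolding bad_def by (rule avg_boundary[OF N]) (simp add: B_def)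
  finally show "Ex N k (\<lambda>v. bad (form k (c s) v)) <= 2 * real_of_int B / real N" .
 qed
 also have "... = real (card S) * (4 * (real k)\<^sup>2 * real L / real N)" by (simp add: B_def power2_eq_square)
 finally show ?thesis by (simp add: I_def rh_def L_def)
qed

lemma prod_UN_le:
 fixes D :: "'a => nat set"
 assumes "finite S" "\<And>s. s \<in> S ==> finite (D s) \<and> (\<forall>p\<in>D s. p > 0)"
 shows "\<Prod>(\<Union>s\<in>S. D s) <= (\<Prod>s\<in>S. \<Prod>(D s))"
 using assms
proof (induction S rule: finite_induct)
 case (insert s S)
 have f: "finite (D s)" "finite (\<Union>s\<in>S. D s)" using insert by auto
 have "\<Prod>(D s \<union> (\<Union>s\<in>S. D s)) * 1 <= \<Prod>(D s \<union> (\<Union>s\<in>S. D s)) * \<Prod>(D s \<inter> (\<Union>s\<in>S. D s))"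
 proof (intro mult_left_mono)
  have "0 < \<Prod>(D s \<inter> (\<Union>s\<in>S. D s))" by (rule prod_pos) (use insert.prems[of s] in auto)
  thus "1 <= \<Prod>(D s \<inter> (\<Union>s\<in>S. D s))" by simp
 qed simp
 also have "... = \<Prod>(D s) * \<Prod>(\<Union>s\<in>S. D s)" by (rule prod.union_inter[OF f])
 also have "... <= \<Prod>(D s) * (\<Prod>s\<in>S. \<Prod>(D s))" by (intro mult_left_mono insert.IH) (use insert.prems in auto)
 finally show ?case using insert.hyps by simp
qed simp

context selberg
begin

text \<open>Selberg's square, multiplied by \<open>V\<close> so that its mean is near 1 by
  \<open>quadratic_form\<close>. Where no sieving prime divides the value, only
  \<open>P = {}\<close> contributes and the weight is \<open>V\<close>.\<close>

definition nu :: "nat => int => int => int => real" where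
 "nu N b M t = V * (\<Sum>P\<in>adm. lam P * of_bool (\<forall>p\<in>P. int p dvd b + M * (t mod int N)))\<^sup>2"

lemma nu_expand: "nu N b M t = (\<Sum>a\<in>adm \<times> adm. V * (lam (fst a) * lam (snd a)) * of_bool (\<forall>p\<in>fst a \<union> snd a. int p dvd b + M * (t mod int N)))"
 unfolding nu_def power2_eq_square sum_product sum.cartesian_product unfolding sum_distrib_left
 by (intro sum.cong refl) (auto simp: ball_Un)

text \<open>By unique factorisation, distinct admissible sets have distinct products.\<close>

lemma card_adm: "real (card adm) <= R"
proof -
 have inj: "inj_on (\<lambda>P. \<Prod>P) adm"
 proof (rule inj_onI)
  have eq: "P = {p \<in> PP. p dvd \<Prod>P}" if P: "P \<in> adm" for P
  proof (intro equalityI subsetI)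
   fix p assume "p \<in> {p \<in> PP. p dvd \<Prod>P}"
   hence p: "p \<in> PP" "p dvd \<Prod>P" by auto
   then obtain q where "q \<in> P" "p dvd q" using prime_dvd_prod_iff[OF adm_fin[OF P] primes[OF p(1)], of "\<lambda>x. x"] by auto
   thus "p \<in> P" using primes_dvd_imp_eq[OF primes[OF p(1)], of q] primes[of q] adm_PP[OF P] by auto
  qed (use adm_PP[OF P] adm_fin[OF P] in "auto intro: dvd_prodI")
  fix P Q assume "P \<in> adm" "Q \<in> adm" "\<Prod>P = \<Prod>Q"
  thus "P = Q" using eq[of P] eq[of Q] by simp
 qed
 have "(\<lambda>P. \<Prod>P) ` adm \<subseteq> {1..nat \<lfloor>R\<rfloor>}"
 proof clarify
  fix P assume P: "P \<in> adm"
  hence "real (\<Prod>P) <= R" by (simp add: adm_def)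
  hence "\<Prod>P <= nat \<lfloor>R\<rfloor>" by (simp add: le_nat_floor del: of_nat_prod)
  thus "\<Prod>P \<in> {1..nat \<lfloor>R\<rfloor>}" using prod_pos[OF adm_PP[OF P]] by simp
 qed
 hence "card adm <= card {1..nat \<lfloor>R\<rfloor>}" by (intro card_inj_on_le[OF inj]) auto
 hence "real (card adm) <= real (nat \<lfloor>R\<rfloor>)" by simp
 thus ?thesis using R by linarith
qed

text \<open>Choices are grouped by their union \<open>W\<close>. Each prime of \<open>W\<close> has
  at most \<open>4 ^ card S\<close> ways of being distributed among the \<open>2 * card S\<close>
  sets, and the sum over all \<open>W\<close> is an Euler product.\<close>

lemma sum_over_supports:
 fixes S :: "'a set"
 assumes S: "finite S"
 shows "(\<Sum>si\<in>S \<rightarrow>\<^sub>E adm \<times> adm. 1 / real (\<Prod>(\<Union>s\<in>S. fst (si s) \<union> snd (si s)))) <= (\<Prod>p\<in>PP. 1 + 4 ^ card S / real p)"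
proof -
 let ?X = "S \<rightarrow>\<^sub>E adm \<times> adm"
 define U where "U = (\<lambda>si. \<Union>s\<in>S. fst (si s) \<union> snd (si s) :: nat set)"
 let ?P = "\<lambda>W. {si \<in> ?X. U si = W}"
 have fX: "finite ?X" using S finite_adm by (intro finite_PiE) auto
 have U: "U ` ?X \<subseteq> Pow PP"
 proof clarify
  fix si p assume si: "si \<in> ?X" "p \<in> U si"
  then obtain s where s: "s \<in> S" "p \<in> fst (si s) \<union> snd (si s)" by (auto simp: U_def)
  have "si s \<in> adm \<times> adm" using PiE_mem[OF si(1) s(1)] .
  thus "p \<in> PP" using s(2) adm_PP[of "fst (si s)"] adm_PP[of "snd (si s)"] by (auto simp: mem_Times_iff)
 qed
 have "(\<Sum>si\<in>?X. 1 / real (\<Prod>(U si))) = (\<Sum>W\<in>Pow PP. \<Sum>si\<in>?P W. 1 / real (\<Prod>(U si)))"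
  by (rule sum.group[symmetric, OF fX _ U]) (use fin in simp)
 also have "... <= (\<Sum>W\<in>Pow PP. \<Prod>p\<in>W. 4 ^ card S / real p)"
 proof (rule sum_mono)
  fix W assume W: "W \<in> Pow PP"
  hence fW: "finite W" using sub_fin by auto
  have "?P W \<subseteq> S \<rightarrow>\<^sub>E Pow W \<times> Pow W"
  proof (rule subsetI, rule PiE_I)
   fix si s assume si: "si \<in> ?P W" and s: "s \<in> S"
   hence "fst (si s) \<union> snd (si s) \<subseteq> W" by (auto simp: U_def)
   thus "si s \<in> Pow W \<times> Pow W" by (simp add: mem_Times_iff)
  next
   fix si s assume "si \<in> ?P W" "s \<notin> S"
   thus "si s = undefined" by (auto simp: PiE_def extensional_def)
  qed
  hence "card (?P W) <= card (S \<rightarrow>\<^sub>E Pow W \<times> Pow W)"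
   by (rule card_mono[rotated]) (use S fW in "auto intro!: finite_PiE")
  also have "... = (2 ^ card W * 2 ^ card W) ^ card S" using S fW by (simp add: card_PiE card_Pow)
  also have "... = (4 ^ card S) ^ card W" by (simp add: power_mult_distrib[symmetric] power_mult[symmetric] mult.commute)
  finally have "real (card (?P W)) <= real ((4 ^ card S) ^ card W)" by (rule of_nat_mono)
  hence "real (card (?P W)) <= (4 ^ card S) ^ card W" by simp
  hence "real (card (?P W)) * (1 / real (\<Prod>W)) <= (4 ^ card S) ^ card W * (1 / real (\<Prod>W))"
   by (rule mult_right_mono) (simp add: prod_nonneg)
  also have "... = (\<Prod>p\<in>W. 4 ^ card S / real p)" by (simp add: prod_dividef)
  finally show "(\<Sum>si\<in>?P W. 1 / real (\<Prod>(U si))) <= (\<Prod>p\<in>W. 4 ^ card S / real p)" by simp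
 qed
 also have "... = (\<Prod>p\<in>PP. 1 + 4 ^ card S / real p)" by (subst sum_Pow_prod[OF fin]) (simp add: add.commute)
 finally show ?thesis by (simp add: U_def)
qed

text \<open>The squares are expanded and every term is compared with its product of densities by
  \<open>sieve_correlation\<close>; those products sum to a power of \<open>V * (1 / V)\<close>,
  that is to 1. The errors with \<open>1 / w\<close> are summed by \<open>sum_over_supports\<close>.
  The boundary errors are bounded by counting: at most \<open>R ^ (2 * card S)\<close> terms, each
  with modulus at most \<open>R ^ (2 * card S)\<close>.\<close>

theorem nu_linear_forms:
 assumes good: "good_forms k S c" and N: "N > 0" and cop: "\<And>d. 0 < d ==> d <= k ==> coprime (int d) (int N)"
  and PP: "\<And>p. p \<in> PP ==> p > k \<and> real p >= w \<and> \<not> int p dvd M" and w: "w > 0"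
 shows "\<bar>Ex N k (\<lambda>x. \<Prod>s\<in>S. nu N b M (form k (c s) x)) - 1\<bar>
  <= V ^ card S * ((1 / w) * (\<Prod>p\<in>PP. 1 + 4 ^ card S / real p) + real (card S) * (4 * (real k)\<^sup>2) * R ^ (4 * card S) / real N)"
proof -
 let ?F = "(\<lambda>x. \<Prod>s\<in>S. nu N b M (form k (c s) x))"
 let ?X = "S \<rightarrow>\<^sub>E adm \<times> adm" and ?n = "card S"
 have S: "finite S" using good by (simp add: good_forms_def)
 have fX: "finite ?X" using S finite_adm by (intro finite_PiE) auto
 define D where "D = (\<lambda>(si :: nat \<times> nat set => nat set \<times> nat set) s. fst (si s) \<union> snd (si s) :: nat set)"
 define l where "l = (\<lambda>si :: nat \<times> nat set => nat set \<times> nat set. \<Prod>s\<in>S. lam (fst (si s)) * lam (snd (si s)))"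
 define A where "A = (\<lambda>si. Ex N k (\<lambda>x. \<Prod>s\<in>S. of_bool (\<forall>p\<in>D si s. int p dvd b + M * (form k (c s) x mod int N))))"
 define rh where "rh = (\<lambda>si. \<Prod>s\<in>S. 1 / real (\<Prod>(D si s)))"
 have "?F = (\<lambda>x. \<Sum>si\<in>?X. V ^ ?n * l si * (\<Prod>s\<in>S. of_bool (\<forall>p\<in>D si s. int p dvd b + M * (form k (c s) x mod int N))))"
  unfolding nu_expand
  by (subst prod_sum_PiE[OF S]) (use finite_adm in "auto simp: l_def D_def prod.distrib")
 hence E: "Ex N k ?F = (\<Sum>si\<in>?X. V ^ ?n * l si * A si)"
  by (simp add: Ex_sum[OF N] Ex_cmult A_def)
 have "1 = (\<Prod>s\<in>S. V * (\<Sum>P\<in>adm. \<Sum>Q\<in>adm. lam P * lam Q / real (\<Prod>(P \<union> Q))))"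
  unfolding quadratic_form using V_ge_1 by simp
 also have "... = (\<Prod>s\<in>S. \<Sum>a\<in>adm \<times> adm. V * (lam (fst a) * lam (snd a)) * (1 / real (\<Prod>(fst a \<union> snd a))))"
  by (simp add: sum.cartesian_product sum_distrib_left case_prod_unfold del: of_nat_prod)
 also have "... = (\<Sum>si\<in>?X. V ^ ?n * l si * rh si)"
  by (subst prod_sum_PiE[OF S]) (simp_all only: l_def D_def rh_def prod.distrib prod_constant finite_cartesian_product finite_adm)
 finally have one: "1 = (\<Sum>si\<in>?X. V ^ ?n * l si * rh si)" .
 define bt where "bt = real ?n * (4 * (real k)\<^sup>2) * R ^ (2 * ?n) / real N"
 have tm: "\<bar>V ^ ?n * l si * A si - V ^ ?n * l si * rh si\<bar> <= V ^ ?n * ((1 / w) * (1 / real (\<Prod>(\<Union>s\<in>S. D si s))) + bt)" if si: "si \<in> ?X" for si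
 proof -
  have mem: "fst (si s) \<in> adm" "snd (si s) \<in> adm" if "s \<in> S" for s
   using PiE_mem[OF si that] by (auto simp: mem_Times_iff)
  define U where "U = (\<Union>s\<in>S. D si s)"
  have DP: "D si s \<subseteq> PP" if "s \<in> S" for s using mem[OF that] adm_PP by (auto simp: D_def)
  have UP: "U \<subseteq> PP" using DP by (auto simp: U_def)
  have U: "finite U" "prime p \<and> p > k \<and> real p >= w \<and> \<not> int p dvd M" if "p \<in> U" for p
   using UP sub_fin PP primes that by auto
  have UR: "real (\<Prod>U) <= R ^ (2 * ?n)"
  proof -
   have pos: "p > 0" if "p \<in> PP" for p using primes[OF that] prime_gt_0_nat by auto
   have "\<Prod>U <= (\<Prod>s\<in>S. \<Prod>(D si s))" unfolding U_def
    by (rule prod_UN_le[OF S]) (use DP sub_fin pos in blast)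
   hence "real (\<Prod>U) <= (\<Prod>s\<in>S. real (\<Prod>(D si s)))" by (metis of_nat_le_iff of_nat_prod)
   also have "... <= (\<Prod>s\<in>S. R ^ 2)"
   proof (rule prod_mono, intro conjI)
    fix s assume s: "s \<in> S"
    have PQ: "fst (si s) \<subseteq> PP" "snd (si s) \<subseteq> PP" using mem[OF s] adm_PP by auto
    have "\<Prod>(D si s) * 1 <= \<Prod>(D si s) * \<Prod>(fst (si s) \<inter> snd (si s))"
    proof (intro mult_left_mono)
     have "0 < \<Prod>(fst (si s) \<inter> snd (si s))" by (rule prod_pos) (use PQ in auto)
     thus "1 <= \<Prod>(fst (si s) \<inter> snd (si s))" by simp
    qed simp
    also have "... = \<Prod>(fst (si s)) * \<Prod>(snd (si s))" unfolding D_def by (rule prod.union_inter) (use PQ sub_fin in auto)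
    finally have "real (\<Prod>(D si s)) <= real (\<Prod>(fst (si s))) * real (\<Prod>(snd (si s)))" by (metis mult.right_neutral of_nat_le_iff of_nat_mult)
    also have "... <= R * R" using mem[OF s] R by (intro mult_mono) (auto simp: adm_def intro: prod_nonneg)
    finally show "real (\<Prod>(D si s)) <= R ^ 2" by (simp add: power2_eq_square)
   qed (simp add: prod_nonneg)
   also have "... = R ^ (2 * ?n)" by (simp add: power_mult)
   finally show ?thesis .
  qed
  have "\<bar>A si - rh si\<bar> <= 1 / (w * real (\<Prod>U)) + real ?n * (4 * (real k)\<^sup>2 * real (\<Prod>U) / real N)"
   unfolding A_def rh_def by (rule sieve_correlation[OF good N cop _ _ w]) (use U sub_fin[OF UP] in "auto simp: U_def")
  also have "... <= (1 / w) * (1 / real (\<Prod>U)) + bt"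
   using UR unfolding bt_def by (auto intro!: mult_left_mono divide_right_mono simp: mult.assoc simp del: of_nat_prod)
  finally have d: "\<bar>A si - rh si\<bar> <= (1 / w) * (1 / real (\<Prod>U)) + bt" .
  have "\<bar>l si\<bar> <= 1" unfolding l_def abs_prod
   by (rule prod_le_1) (use lam_bound mem in "auto simp: abs_mult intro!: mult_le_one")
  hence "\<bar>l si\<bar> * \<bar>A si - rh si\<bar> <= 1 * ((1 / w) * (1 / real (\<Prod>U)) + bt)"
   by (rule mult_mono[OF _ d]) auto
  hence "V ^ ?n * (\<bar>l si\<bar> * \<bar>A si - rh si\<bar>) <= V ^ ?n * ((1 / w) * (1 / real (\<Prod>U)) + bt)"
   using V_ge_1 by (intro mult_left_mono) auto
  moreover have "\<bar>V ^ ?n * l si * A si - V ^ ?n * l si * rh si\<bar> = V ^ ?n * (\<bar>l si\<bar> * \<bar>A si - rh si\<bar>)"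
   using V_ge_1 by (simp add: right_diff_distrib[symmetric] abs_mult)
  ultimately show ?thesis by (simp only: U_def)
 qed
 have cardX: "real (card ?X) <= R ^ (2 * ?n)"
 proof -
  have "real (card ?X) = (real (card adm) * real (card adm)) ^ ?n" using S finite_adm by (simp add: card_PiE)
  also have "... <= (R * R) ^ ?n" using card_adm R by (intro power_mono mult_mono) auto
  finally show ?thesis by (simp add: power_mult power2_eq_square)
 qed
 have bt0: "bt >= 0" using R by (simp add: bt_def)
 have "\<bar>Ex N k ?F - 1\<bar> = \<bar>\<Sum>si\<in>?X. (V ^ ?n * l si * A si - V ^ ?n * l si * rh si)\<bar>"
  by (subst one) (simp only: E sum_subtractf)
 also have "... <= (\<Sum>si\<in>?X. V ^ ?n * ((1 / w) * (1 / real (\<Prod>(\<Union>s\<in>S. D si s))) + bt))"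
  by (rule order_trans[OF sum_abs]) (rule sum_mono, rule tm)
 also have "... = V ^ ?n * ((1 / w) * (\<Sum>si\<in>?X. 1 / real (\<Prod>(\<Union>s\<in>S. D si s))) + real (card ?X) * bt)"
  by (simp only: sum_distrib_left[symmetric] sum.distrib sum_constant)
 also have "... <= V ^ ?n * ((1 / w) * (\<Prod>p\<in>PP. 1 + 4 ^ ?n / real p) + R ^ (2 * ?n) * bt)"
  using sum_over_supports[OF S] cardX bt0 w V_ge_1 unfolding D_def
  by (intro mult_left_mono add_mono mult_right_mono) (auto simp del: of_nat_prod)
 also have "R ^ (2 * ?n) * bt = real ?n * (4 * (real k)\<^sup>2) * R ^ (4 * ?n) / real N"
  by (simp add: bt_def power_add[symmetric])
 finally show ?thesis .
qed

end

section \<open>Elementary bounds for primes and for the normalising factor \<open>V\<close>\<close>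

lemma primes_prod_dvd: "finite P ==> (\<And>p. p \<in> P ==> prime p \<and> p dvd n) ==> \<Prod>P dvd (n::nat)"
proof (induction P rule: finite_induct)
 case (insert p P)
 have "coprime p (\<Prod>P)" by (rule prod_coprime_right) (use insert in "auto intro: primes_coprime")
 thus ?case using insert by (simp add: divides_mult)
qed simp

text \<open>These primes divide \<open>fact (2 * n)\<close> but not \<open>fact n\<close>, hence the
  central binomial coefficient.\<close>

lemma prod_primes_central: "\<Prod>{p. prime p \<and> n < p \<and> p <= 2 * n} <= (4::nat) ^ n"
proof -
 let ?P = "{p. prime p \<and> n < p \<and> p <= 2 * n}"
 have "\<Prod>?P dvd (2 * n choose n)"
 proof (rule primes_prod_dvd)
  fix p assume "p \<in> ?P"
  hence p: "prime p" "n < p" "p <= 2 * n" by auto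
  have "p dvd fact (2 * n)" using p prime_dvd_fact_iff by blast
  also have "fact (2 * n) = fact n * fact n * (2 * n choose n)" using binomial_fact_lemma[of n "2 * n"] by simp
  finally have "p dvd (2 * n choose n)" using p by (auto simp: prime_dvd_mult_iff prime_dvd_fact_iff)
  thus "prime p \<and> p dvd (2 * n choose n)" using p by simp
 qed simp
 hence "\<Prod>?P <= (2 * n choose n)" by (rule dvd_imp_le) simp
 also have "... <= 2 ^ (2 * n)" by (rule binomial_le_pow2)
 finally show ?thesis by (simp add: power_mult)
qed

text \<open>Chebyshev's argument: each prime exceeds \<open>2 ^ j\<close> and the product is at most
  \<open>4 ^ (2 ^ j)\<close>, so there are at most \<open>2 * 2 ^ j / j\<close> of them.\<close>

lemma dyadic_primes:
 assumes j: "j >= 1"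
 shows "(\<Sum>p | prime p \<and> 2 ^ j < p \<and> p <= 2 ^ Suc j. 1 / real p) <= 2 / real j"
proof -
 let ?P = "{p::nat. prime p \<and> 2 ^ j < p \<and> p <= 2 ^ Suc j}"
 have "(2 ^ j) ^ card ?P = (\<Prod>p\<in>?P. (2::nat) ^ j)" by simp
 also have "... <= \<Prod>?P" by (rule prod_mono) auto
 also have "... <= 4 ^ (2 ^ j)" using prod_primes_central[of "2 ^ j"] by simp
 also have "... = 2 ^ (2 * 2 ^ j)" by (simp add: power_mult)
 finally have "(2::nat) ^ (j * card ?P) <= 2 ^ (2 * 2 ^ j)" by (simp add: power_mult)
 hence "j * card ?P <= 2 * 2 ^ j" by (simp add: power_le_imp_le_exp)
 hence "real (j * card ?P) <= real (2 * 2 ^ j)" by (rule of_nat_mono)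
 hence c: "real (card ?P) / 2 ^ j <= 2 / real j" using j by (simp add: field_simps)
 have "(\<Sum>p\<in>?P. 1 / real p) <= (\<Sum>p\<in>?P. 1 / 2 ^ j)"
 proof (rule sum_mono)
  fix p assume "p \<in> ?P"
  hence "2 ^ j <= p" by simp
  hence "real (2 ^ j) <= real p" by (rule of_nat_mono)
  thus "1 / real p <= 1 / 2 ^ j" by (simp add: frac_le)
 qed
 thus ?thesis using c by simp
qed

lemma sum_primes_dyadic:
 assumes a: "a >= 1"
 shows "(\<Sum>p | prime p \<and> 2 ^ a < p \<and> p <= 2 ^ (a + n). 1 / real p) <= (\<Sum>j\<in>{a..<a + n}. 2 / real j)"
proof (induction n)
 case 0
 show ?case by (subst sum.neutral) auto
next
 case (Suc n)
 have "{p::nat. prime p \<and> 2 ^ a < p \<and> p <= 2 ^ (a + Suc n)} =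
  {p. prime p \<and> 2 ^ a < p \<and> p <= 2 ^ (a + n)} \<union> {p. prime p \<and> 2 ^ (a + n) < p \<and> p <= 2 ^ Suc (a + n)}" (is "_ = ?A \<union> ?B")
 proof -
  have h1: "(2::nat) ^ a <= 2 ^ (a + n)" and h2: "(2::nat) ^ (a + n) <= 2 ^ Suc (a + n)" by (rule power_increasing; simp)+
  show ?thesis unfolding add_Suc_right
   by (auto simp del: power_Suc intro: le_less_trans[OF h1] order_trans[OF _ h2])
 qed
 moreover have "(\<Sum>p\<in>?A \<union> ?B. 1 / real p) = (\<Sum>p\<in>?A. 1 / real p) + (\<Sum>p\<in>?B. 1 / real p)"
  by (rule sum.union_disjoint) auto
 ultimately show ?case using Suc.IH dyadic_primes[of "a + n"] a by simp
qed

text \<open>The dyadic blocks contribute twice a harmonic sum up to about \<open>log 2 y\<close>.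
  Only some fixed power of \<open>ln y\<close> matters in the applications, so the factor 2 is
  harmless.\<close>

lemma sum_primes_upto:
 fixes y :: real
 assumes "y >= 2"
 shows "(\<Sum>p | prime p \<and> real p <= y. 1 / real p) <= 3 + 2 * ln (2 * ln y + 1)"
proof -
 define b where "b = nat \<lceil>log 2 y\<rceil>"
 have l1: "log 2 y >= 1" using assms by (simp add: le_log_iff)
 hence b: "real b >= log 2 y" "real b <= log 2 y + 1" unfolding b_def by linarith+
 hence "real b >= 1" using l1 by linarith
 hence "b >= 1" by simp
 note b = b this
 have "log 2 y * ln 2 = ln y" using assms by (simp add: log_def)
 moreover have "ln 2 >= (1/2 :: real)" using ln2_ge_two_thirds by linarith
 moreover have "log 2 y >= 0" using assms by simp
 ultimately have "log 2 y * (1 / 2) <= ln y" by (metis mult_left_mono)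
 hence b2: "real b <= 2 * ln y + 1" using b(2) by simp
 have yb: "y <= 2 ^ b" using b(1) assms by (simp add: log_le_iff powr_realpow)
 have sub: "{p. prime p \<and> real p <= y} \<subseteq> {2} \<union> {p. prime p \<and> 2 ^ 1 < p \<and> p <= 2 ^ (1 + (b - 1))}"
 proof
  fix p assume "p \<in> {p. prime p \<and> real p <= y}"
  hence p: "prime p" "real p <= y" by auto
  have "p <= 2 ^ b" using order_trans[OF p(2) yb] by simp
  thus "p \<in> {2} \<union> {p. prime p \<and> 2 ^ 1 < p \<and> p <= 2 ^ (1 + (b - 1))}"
   using p(1) b(3) prime_ge_2_nat[OF p(1)] by auto
 qed
 have fin: "finite {p::nat. prime p \<and> 2 ^ 1 < p \<and> p <= 2 ^ (1 + (b - 1))}" by simp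
 have "(\<Sum>p | prime p \<and> real p <= y. 1 / real p) <= (\<Sum>p\<in>{2} \<union> {p. prime p \<and> 2 ^ 1 < p \<and> p <= 2 ^ (1 + (b - 1))}. 1 / real p)"
  by (rule sum_mono2[OF _ sub]) (use fin in auto)
 also have "... = 1 / 2 + (\<Sum>p | prime p \<and> 2 ^ 1 < p \<and> p <= 2 ^ (1 + (b - 1)). 1 / real p)" by simp
 also have "... <= 1 / 2 + (\<Sum>j\<in>{1..<b}. 2 / real j)" using sum_primes_dyadic[of 1 "b - 1"] b(3) by simp
 also have "(\<Sum>j\<in>{1..<b}. 2 / real j) <= (\<Sum>j\<in>{1..b}. 2 / real j)" by (rule sum_mono2) auto
 also have "... = 2 * harm b" by (simp add: harm_def sum_distrib_left divide_inverse)
 also have "harm b <= 1 + ln (real b)" using b(3)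
 proof (induction b rule: nat_induct_at_least)
  case base
  thus ?case by (simp add: harm_def)
 next
  case (Suc n)
  have "ln (real n / real (Suc n)) <= real n / real (Suc n) - 1" using Suc.hyps by (intro ln_le_minus_one) simp
  hence "inverse (real (Suc n)) <= ln (real (Suc n)) - ln (real n)" using Suc.hyps by (simp add: ln_div field_simps)
  thus ?case using Suc.IH by (simp add: harm_Suc)
 qed
 also have "ln (real b) <= ln (2 * ln y + 1)" using b2 b(3) by (intro ln_mono) auto
 finally show ?thesis by simp
qed

text \<open>There are at most \<open>2 * a * E\<close> dyadic blocks, each contributing at most
  \<open>2 / a\<close>; so a bounded ratio of logarithms gives a bounded sum.\<close>

lemma sum_primes_between:
 fixes y z :: real
 assumes y: "y >= 2" and z: "z <= y ^ E"
 shows "(\<Sum>p | prime p \<and> y < real p \<and> real p <= z. 1 / real p) <= 4 * real E + 2"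
proof -
 define a where "a = nat \<lfloor>log 2 y\<rfloor>"
 have l: "log 2 y >= 1" using y by (simp add: le_log_iff)
 hence a: "a >= 1" "real a <= log 2 y" "log 2 y < real a + 1" unfolding a_def by (simp_all add: le_nat_iff le_floor_iff)
 have ya: "2 ^ a <= y" "y <= 2 ^ Suc a"
  using a y by (simp_all add: le_log_iff log_less_iff powr_realpow powr_add less_imp_le)
 define n where "n = Suc a * E - a"
 have "z <= (2 ^ Suc a) ^ E" using z power_mono[OF ya(2), of E] y by simp
 also have "... = 2 ^ (Suc a * E)" by (simp only: power_mult)
 also have "... <= 2 ^ (a + n)" by (rule power_increasing) (auto simp: n_def)
 finally have zn: "z <= 2 ^ (a + n)" .
 have "{p. prime p \<and> y < real p \<and> real p <= z} \<subseteq> {p. prime p \<and> 2 ^ a < p \<and> p <= 2 ^ (a + n)}"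
 proof
  fix p assume "p \<in> {p. prime p \<and> y < real p \<and> real p <= z}"
  hence p: "prime p" "y < real p" "real p <= z" by auto
  thus "p \<in> {p. prime p \<and> 2 ^ a < p \<and> p <= 2 ^ (a + n)}"
   using le_less_trans[OF ya(1) p(2)] order_trans[OF p(3) zn] by simp
 qed
 hence "(\<Sum>p | prime p \<and> y < real p \<and> real p <= z. 1 / real p) <= (\<Sum>p | prime p \<and> 2 ^ a < p \<and> p <= 2 ^ (a + n). 1 / real p)"
  by (intro sum_mono2) auto
 also have "... <= (\<Sum>j\<in>{a..<a + n}. 2 / real j)" by (rule sum_primes_dyadic[OF a(1)])
 also have "... <= (\<Sum>j\<in>{a..<a + n}. 2 / real a)" by (intro sum_mono divide_left_mono) (use a in auto)
 also have "... = 2 * real n / real a" by simp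
 also have "... <= 4 * real E + 2"
 proof -
  have "n <= Suc a * E" by (simp add: n_def)
  also have "... <= (2 * a) * E" using a(1) by (intro mult_right_mono) auto
  finally have "real n <= real (2 * a * E)" by (rule of_nat_mono)
  thus ?thesis using a(1) by (simp add: field_simps)
 qed
 finally show ?thesis .
qed

lemma prod_exp_bound: "(\<And>p. p \<in> P ==> 0 <= f p \<and> f p <= exp (K * g p)) ==> (\<Prod>p\<in>P. f p) <= exp (K * (\<Sum>p\<in>P. g p :: real))"
 by (cases "finite P") (auto simp: sum_distrib_left exp_sum intro: prod_mono)

lemma prod_primes_upto:
 fixes y :: real
 assumes y: "y >= 2" and P: "\<And>p. p \<in> P ==> prime p \<and> real p <= y"
 shows "(\<Prod>p\<in>P. 1 + real K / real p) <= exp (3 * real K) * (2 * ln y + 1) ^ (2 * K)"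
proof -
 have f: "finite {p. prime p \<and> real p <= y}"
  by (rule finite_subset[of _ "{..nat \<lfloor>y\<rfloor>}"]) (auto simp: le_nat_floor)
 have "(\<Sum>p\<in>P. 1 / real p) <= (\<Sum>p | prime p \<and> real p <= y. 1 / real p)" by (rule sum_mono2[OF f]) (use P in auto)
 also have "... <= 3 + 2 * ln (2 * ln y + 1)" by (rule sum_primes_upto[OF y])
 finally have s: "(\<Sum>p\<in>P. 1 / real p) <= 3 + 2 * ln (2 * ln y + 1)" .
 have l: "2 * ln y + 1 > 0" using y by (simp add: add_nonneg_pos)
 have "(\<Prod>p\<in>P. 1 + real K / real p) <= exp (real K * (\<Sum>p\<in>P. 1 / real p))"
  by (rule prod_exp_bound) (use exp_ge_add_one_self[of "real K / real p" for p] in auto)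
 also have "... <= exp (real K * (3 + 2 * ln (2 * ln y + 1)))" using s by (simp add: mult_left_mono)
 also have "... = exp (3 * real K) * exp (real (2 * K) * ln (2 * ln y + 1))" by (simp add: exp_add[symmetric] algebra_simps)
 also have "exp (real (2 * K) * ln (2 * ln y + 1)) = (2 * ln y + 1) ^ (2 * K)"
  using l by (simp add: exp_of_nat_mult del: of_nat_mult)
 finally show ?thesis .
qed

lemma inverse_one_minus_le: "p >= 2 ==> 1 / (1 - 1 / p) <= exp (2 * (1 / p))" for p :: real
proof -
 assume p: "p >= 2"
 define x where "x = 1 / p"
 have x: "0 <= x" "x <= 1 / 2" using p by (simp_all add: x_def)
 hence "x * x <= x * (1 / 2)" by (intro mult_left_mono)
 hence "- (2 * x) <= ln (1 - x)" using ln_one_minus_pos_lower_bound[OF x] by (simp add: power2_eq_square)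
 hence "exp (- (2 * x)) <= 1 - x" using x by (simp add: ln_ge_iff)
 hence "1 / (1 - x) <= 1 / exp (- (2 * x))" by (intro divide_left_mono) (use x in auto)
 thus ?thesis by (simp add: x_def exp_minus inverse_eq_divide)
qed

context selberg
begin

lemma V_upper: "V <= (\<Prod>p\<in>PP. 1 + 2 / real p)"
proof -
 have "V <= (\<Sum>P\<in>Pow PP. gw P)" unfolding V_def
  by (rule sum_mono2) (use fin gw_pos adm_PP in "auto intro: less_imp_le")
 also have "... = (\<Prod>p\<in>PP. 1 / (real p - 1) + 1)" unfolding gw_def by (rule sum_Pow_prod[OF fin])
 also have "... <= (\<Prod>p\<in>PP. 1 + 2 / real p)"
 proof (rule prod_mono, intro conjI)
  fix p assume "p \<in> PP"
  hence p: "real p >= 2" using primes prime_ge_2_nat by fastforce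
  thus "0 <= 1 / (real p - 1) + 1" "1 / (real p - 1) + 1 <= 1 + 2 / real p" by (simp_all add: field_simps)
 qed
 finally show ?thesis .
qed

text \<open>The set \<open>P\<close> of prime factors in \<open>PP\<close> of an integer
  \<open>m\<close> up to \<open>R\<close> is admissible. Summing \<open>1 / m\<close> over all
  exponents gives geometric series: \<open>gw P\<close> from the primes of \<open>P\<close> and
  factors \<open>1 / (1 - 1 / p)\<close> from the primes outside \<open>PP\<close>. The harmonic sum
  up to \<open>R\<close> is thus at most the right-hand side.\<close>

lemma V_lower:
 assumes Q: "finite Q" "PP \<subseteq> Q" "\<And>p. p \<in> Q ==> prime p" "\<And>p. prime p ==> real p <= R ==> p \<in> Q"
 shows "ln R <= V * (\<Prod>p\<in>Q - PP. 1 / (1 - 1 / real p))"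
proof -
 define n where "n = nat \<lfloor>R\<rfloor>"
 have n: "real n <= R" "R < real n + 1" "n >= 1" using R unfolding n_def by (simp_all add: le_nat_iff le_floor_iff)
 \<comment> \<open>The exponents allowed at \<open>p\<close>: positive on \<open>P\<close>, zero on
   the rest of \<open>PP\<close>, free elsewhere. No exponent of an integer up to \<open>n\<close>
   exceeds \<open>n\<close>.\<close>
 define T where "T = (\<lambda>P p. if p \<in> P then {1..n} else if p \<in> PP then {0} else {0..n})"
 define I where "I = Sigma adm (\<lambda>P. PiE Q (T P))"
 have p2: "real p >= 2" if "p \<in> Q" for p using Q(3)[OF that] prime_ge_2_nat by fastforce
 have fT: "finite (T P p)" for P p by (simp add: T_def)
 have fI: "finite I" unfolding I_def using finite_adm Q(1) fT by (intro finite_SigmaI finite_PiE) auto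
 have ex: "\<exists>Pe\<in>I. (\<Prod>p\<in>Q. p ^ (snd Pe p)) = m" if m: "m \<in> {1..n}" for m
 proof -
  define P where "P = {p \<in> PP. p dvd m}"
  define e where "e = restrict (\<lambda>p. multiplicity p m) Q"
  have m0: "m > 0" using m by simp
  have "\<Prod>P dvd m" by (rule primes_prod_dvd) (use sub_fin[of P] primes in "auto simp: P_def")
  hence "\<Prod>P <= n" using dvd_imp_le[OF _ m0] m by fastforce
  hence "real (\<Prod>P) <= real n" by (rule of_nat_mono)
  hence "P \<in> adm" using n(1) by (simp add: adm_def P_def del: of_nat_prod)
  moreover have "e \<in> PiE Q (T P)"
  proof (rule PiE_I)
   fix p assume p: "p \<in> Q"
   have "p ^ multiplicity p m <= m" using dvd_imp_le[OF multiplicity_dvd m0] .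
   moreover have "multiplicity p m < p ^ multiplicity p m" using Q(3)[OF p] prime_gt_1_nat by (intro power_gt_expt) auto
   ultimately have le: "multiplicity p m <= n" using m by simp
   have pos: "p dvd m ==> multiplicity p m >= 1"
    using Q(3)[OF p] m0 prime_multiplicity_gt_zero_iff[of p m] by (simp add: Suc_leI)
   show "e p \<in> T P p" using p le pos not_dvd_imp_multiplicity_0[of p m] by (auto simp: e_def T_def P_def)
  qed (simp add: e_def)
  moreover have "(\<Prod>p\<in>Q. p ^ e p) = m"
  proof -
   have sub: "prime_factors m \<subseteq> Q"
   proof
    fix p assume "p \<in> prime_factors m"
    hence "prime p" "p <= m" using m0 by (auto simp: prime_factors_dvd dvd_imp_le)
    thus "p \<in> Q" using m n(1) by (intro Q(4)) (auto intro: order_trans[of _ "real n"])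
   qed
   have "(\<Prod>p\<in>Q. p ^ e p) = (\<Prod>p\<in>Q. p ^ multiplicity p m)" by (rule prod.cong) (auto simp: e_def)
   also have "... = (\<Prod>p\<in>prime_factors m. p ^ multiplicity p m)"
    by (rule prod.mono_neutral_right[OF Q(1) sub]) (use Q(3) m0 in "auto simp: prime_factors_dvd not_dvd_imp_multiplicity_0")
   finally show ?thesis using prime_factorization_nat[OF m0] by simp
  qed
  ultimately show ?thesis by (intro bexI[of _ "(P, e)"]) (auto simp: I_def)
 qed
 have "ln R <= ln (real n + 1)" using n(2) R by (intro ln_mono) auto
 also have "... <= harm n" by (rule ln_le_harm)
 also have "... = (\<Sum>m\<in>{1..n}. 1 / real m)" by (simp add: harm_def inverse_eq_divide)
 also have "... <= (\<Sum>Pe\<in>I. \<Prod>p\<in>Q. (1 / real p) ^ (snd Pe p))"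
 proof (rule sum_le_included[where i = "\<lambda>Pe. \<Prod>p\<in>Q. p ^ (snd Pe p)"])
  show "\<forall>Pe\<in>I. 0 <= (\<Prod>p\<in>Q. (1 / real p) ^ (snd Pe p))" by (auto intro: prod_nonneg)
  show "\<forall>m\<in>{1..n}. \<exists>Pe\<in>I. (\<Prod>p\<in>Q. p ^ (snd Pe p)) = m \<and> 1 / real m <= (\<Prod>p\<in>Q. (1 / real p) ^ (snd Pe p))"
  proof
   fix m assume "m \<in> {1..n}"
   then obtain Pe where Pe: "Pe \<in> I" "(\<Prod>p\<in>Q. p ^ (snd Pe p)) = m" using ex by blast
   have "1 / real m = (\<Prod>p\<in>Q. (1 / real p) ^ (snd Pe p))"
    unfolding Pe(2)[symmetric] by (simp add: power_one_over prod_dividef)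
   thus "\<exists>Pe\<in>I. (\<Prod>p\<in>Q. p ^ (snd Pe p)) = m \<and> 1 / real m <= (\<Prod>p\<in>Q. (1 / real p) ^ (snd Pe p))"
    using Pe by (intro bexI[of _ Pe]) auto
  qed
 qed (use fI in auto)
 also have "... = (\<Sum>P\<in>adm. \<Sum>e\<in>PiE Q (T P). \<Prod>p\<in>Q. (1 / real p) ^ (e p))"
  unfolding I_def by (subst sum.Sigma) (use finite_adm Q(1) fT in "auto intro!: finite_PiE simp: case_prod_unfold")
 also have "... = (\<Sum>P\<in>adm. \<Prod>p\<in>Q. \<Sum>i\<in>T P p. (1 / real p) ^ i)"
  by (subst prod_sum_PiE[OF Q(1) fT]) simp
 also have "... <= (\<Sum>P\<in>adm. gw P * (\<Prod>p\<in>Q - PP. 1 / (1 - 1 / real p)))"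
 proof (rule sum_mono)
  fix P assume P: "P \<in> adm"
  have geo: "(\<Sum>i\<in>{0..n}. (1 / real p) ^ i) <= 1 / (1 - 1 / real p)" if "p \<in> Q" for p
  proof -
   have x: "1 / real p ~= 1" "1 / real p <= 1 / 2" using p2[OF that] by auto
   have "(\<Sum>i\<in>{0..n}. (1 / real p) ^ i) = (1 - (1 / real p) ^ Suc n) / (1 - 1 / real p)"
    using sum_gp0[of "1 / real p" n] x(1) by (simp add: atMost_atLeast0)
   also have "... <= 1 / (1 - 1 / real p)" by (rule divide_right_mono) (use x in auto)
   finally show ?thesis .
  qed
  have geo1: "(\<Sum>i\<in>{1..n}. (1 / real p) ^ i) <= 1 / (real p - 1)" if "p \<in> Q" for p
  proof -
   have "(\<Sum>i\<in>{0..n}. (1 / real p) ^ i) = 1 + (\<Sum>i\<in>{1..n}. (1 / real p) ^ i)"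
    by (simp add: sum.atLeast_Suc_atMost)
   moreover have "1 / (1 - 1 / real p) = 1 + 1 / (real p - 1)" using p2[OF that] by (simp add: field_simps)
   ultimately show ?thesis using geo[OF that] by linarith
  qed
  have "(\<Prod>p\<in>Q. \<Sum>i\<in>T P p. (1 / real p) ^ i) <= (\<Prod>p\<in>Q. (if p \<in> P then 1 / (real p - 1) else 1) * (if p \<in> PP then 1 else 1 / (1 - 1 / real p)))"
  proof (rule prod_mono, intro conjI)
   fix p assume p: "p \<in> Q"
   show "0 <= (\<Sum>i\<in>T P p. (1 / real p) ^ i)" by (rule sum_nonneg) simp
   show "(\<Sum>i\<in>T P p. (1 / real p) ^ i) <= (if p \<in> P then 1 / (real p - 1) else 1) * (if p \<in> PP then 1 else 1 / (1 - 1 / real p))"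
    using geo[OF p] geo1[OF p] adm_PP[OF P] by (auto simp: T_def simp del: sum.cl_ivl_Suc)
  qed
  also have "... = (\<Prod>p\<in>{p \<in> Q. p \<in> P}. 1 / (real p - 1)) * (\<Prod>p\<in>{p \<in> Q. p \<notin> PP}. 1 / (1 - 1 / real p))"
   unfolding prod.distrib prod.inter_filter[OF Q(1)] by (intro arg_cong2[of _ _ _ _ "(*)"] prod.cong refl) auto
  also have "{p \<in> Q. p \<in> P} = P" using adm_PP[OF P] Q(2) by auto
  also have "{p \<in> Q. p \<notin> PP} = Q - PP" by auto
  finally show "(\<Prod>p\<in>Q. \<Sum>i\<in>T P p. (1 / real p) ^ i) <= gw P * (\<Prod>p\<in>Q - PP. 1 / (1 - 1 / real p))" by (simp only: gw_def)
 qed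
 finally show ?thesis by (simp add: V_def sum_distrib_right)
qed

end

lemma prod_Un_le: 
 fixes f :: "'a => real"
 assumes "finite A" "finite B" "\<And>a. a \<in> A \<union> B ==> 1 <= f a"
 shows "prod f (A \<union> B) <= prod f A * prod f B"
proof -
 have "prod f (A \<union> B) = prod f A * prod f (B - A)" using prod.union_disjoint[of A "B - A" f] assms by simp
 also have "... <= prod f A * prod f B"
  by (intro mult_left_mono prod_mono2 prod_nonneg) (use assms in "auto intro: order_trans[of 0 1]")
 finally show ?thesis .
qed

lemma finite_primes_le: "finite {p. prime p \<and> real p <= y}"
 by (rule finite_subset[of _ "{..nat \<lfloor>y\<rfloor>}"]) (auto simp: le_nat_floor)

text \<open>At most \<open>2 * a\<close> primes occur, since their product divides
  \<open>M\<close>.\<close>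

lemma sum_prime_divisors:
 assumes M: "M > 0" "ln (real M) <= a" and w: "w > 0" and P: "finite P" "\<And>p. p \<in> P ==> prime p \<and> p dvd M \<and> real p >= w"
 shows "(\<Sum>p\<in>P. 1 / real p) <= 2 * a / w"
proof -
 have "2 ^ card P = (\<Prod>p\<in>P. 2 :: nat)" by simp
 also have "... <= \<Prod>P" by (rule prod_mono) (use P prime_ge_2_nat in auto)
 also have "... <= M" by (rule dvd_imp_le[OF primes_prod_dvd M(1)]) (use P in auto)
 finally have "ln (real (2 ^ card P)) <= ln (real M)" using M(1) by (intro ln_mono of_nat_mono) auto
 hence "real (card P) * ln 2 <= a" using M(2) by (simp add: ln_realpow)
 moreover have "real (card P) * (1 / 2) <= real (card P) * ln 2" by (rule mult_left_mono) (use ln2_ge_two_thirds in linarith)+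
 ultimately have c: "real (card P) <= 2 * a" by linarith
 have "(\<Sum>p\<in>P. 1 / real p) <= (\<Sum>p\<in>P. 1 / w)" by (rule sum_mono) (use P w in "auto intro: frac_le")
 also have "... = real (card P) / w" by simp
 also have "... <= 2 * a / w" using c w by (intro divide_right_mono) auto
 finally show ?thesis .
qed

text \<open>Equal to \<open>totient W / W\<close> for the product \<open>W\<close> of the primes up
  to \<open>w\<close>.\<close>

definition mertens :: "real => real" where
 "mertens w = (\<Prod>p | prime p \<and> real p <= w. 1 - 1 / real p)"

text \<open>\<open>M\<close> may be as large as a power of \<open>N\<close>, as it stems from
  Dirichlet approximation, and \<open>w ^ 3\<close> leaves room for \<open>w\<close> to be the
  square root of a logarithm.\<close>

definition sieve_params :: "nat => real => nat => real => nat => bool" where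
 "sieve_params k al N w M \<longleftrightarrow> (\<forall>d. 0 < d \<and> d <= k --> coprime (int d) (int N)) \<and> w >= 2 \<and> ln (real N) <= w ^ 3 \<and>
  M > 0 \<and> ln (real M) <= al * ln (real N)"

text \<open>\<open>V ^ k \<le> ep * N\<close> makes progressions of difference 0 negligible; the
  last clause gives full weight to every prime value above \<open>N\<close>.\<close>

definition majorant :: "nat => nat => real => real => nat => int => (int => real) => real => bool" where
 "majorant k N ep v M b nv V \<longleftrightarrow> periodic N nv \<and> (\<forall>t. nv t >= 0) \<and> LF N k nv ep \<and> V >= v \<and> V > 0 \<and> V ^ k <= ep * real N \<and>
  (\<forall>t. (\<forall>p. prime p \<and> p <= N --> \<not> int p dvd b + int M * (t mod int N)) --> nv t = V)"

text \<open>The sieve uses the primes from a power of \<open>ln N\<close> up to a small power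
  \<open>R\<close> of \<open>N\<close>, except divisors of \<open>M\<close>. The lower cut lets
  \<open>1 / w\<close> beat all powers of \<open>ln N\<close> in \<open>nu_linear_forms\<close>, and
  \<open>R\<close> is small enough for the boundary error. The unsieved primes between the given
  \<open>w\<close> and the cut, and those dividing \<open>M\<close>, change \<open>V\<close> by a
  bounded factor only.\<close>

theorem sieve_majorant:
 assumes k: "k >= 1" and al: "al >= 0"
 shows "\<exists>c>0. \<forall>ep>0. \<exists>N0. \<forall>N\<ge>N0. \<forall>w M b. sieve_params k al N w M -->
  (\<exists>nv V. majorant k N ep (c * mertens w * ln (real N)) M b nv V)"
proof -
 define n0 where "n0 = k * 2 ^ k"
 have n0: "n0 >= 1" "k <= n0" using k by (auto simp: n0_def Suc_le_eq)
 define K where "K = (4::nat) ^ n0"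
 \<comment> \<open>At most \<open>n0\<close> forms occur, so \<open>V\<close> and the Euler product
   contribute at most \<open>L ^ (4 * n0 + 2 * K)\<close>; the cut \<open>L ^ E\<close> wins by one
   factor \<open>L\<close>.\<close>
 define E where "E = 4 * n0 + 2 * K + 1"
 define a where "a = 1 / (40 * real n0)"
 have a: "a > 0" "a * real (4 * n0) = 1 / 10" using n0 by (simp_all add: a_def)
 define A1 where "A1 = (exp 6 * 81 :: real) ^ n0"
 define A2 where "A2 = exp (3 * real K) * 9 ^ K"
 define A3 where "A3 = 4 * real n0 * (real k)\<^sup>2"
 define A4 where "A4 = A1 * (1 / a) ^ (4 * n0)"
 have A: "A1 > 0" "A2 > 0" "A3 >= 0" "A4 > 0" using a by (simp_all add: A1_def A2_def A3_def A4_def)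
 \<comment> \<open>Twice the bound for the sum of \<open>1 / p\<close> over the primes between the
   two cuts, plus twice that for the large primes dividing \<open>M\<close>; neither depends on
   \<open>N\<close>.\<close>
 define Z where "Z = 2 * (4 * real (3 * E) + 2) + 2 * (2 * al)"
 define c where "c = exp (- Z) / (10 * real n0)"
 have c: "c > 0" using n0 by (simp add: c_def)
 show ?thesis
 proof (intro exI[of _ c] conjI c allI impI)
  fix ep :: real assume ep: "ep > 0"
  have lim: "filterlim (\<lambda>N. ln (real N)) at_top sequentially" "filterlim (\<lambda>N. real N powr (1 / 2)) at_top sequentially" by real_asymp+
  have "eventually (\<lambda>N. ln (real N) >= 1 + real k + 2 * A1 * A2 / ep \<and> real N powr (1 / 2) >= (A4 + 2 * A4 * A3) / ep) sequentially"
   using lim unfolding filterlim_at_top by (intro eventually_conj) auto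
  then obtain N0 where N0: "\<And>N. N >= N0 ==> ln (real N) >= 1 + real k + 2 * A1 * A2 / ep"
    "\<And>N. N >= N0 ==> real N powr (1 / 2) >= (A4 + 2 * A4 * A3) / ep"
   unfolding eventually_sequentially by blast
  show "\<exists>N0. \<forall>N\<ge>N0. \<forall>w M b. sieve_params k al N w M --> (\<exists>nv V. majorant k N ep (c * mertens w * ln (real N)) M b nv V)"
  proof (intro exI[of _ N0] allI impI)
   fix N w1 M and b :: int
   assume N: "N >= N0" and "sieve_params k al N w1 M"
   hence cop: "\<forall>d. 0 < d \<and> d <= k --> coprime (int d) (int N)" and w1: "2 <= w1" "ln (real N) <= w1 ^ 3"
    and M: "0 < M" "ln (real M) <= al * ln (real N)" by (auto simp: sieve_params_def)
   define L where "L = ln (real N)"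
   have "0 <= 2 * A1 * A2 / ep" using A ep by simp
   hence L: "L >= 1 + real k" "L >= 2 * A1 * A2 / ep" "L >= 1" using N0(1)[OF N] k by (auto simp: L_def)
   have Npos: "N > 0" using L(3) by (cases N) (auto simp: L_def)
   hence N1: "real N >= 1" by simp
   have N2: "real N >= 2" using L(3) Npos by (cases "N = 1") (auto simp: L_def)
   define w where "w = L ^ E"
   have w: "w >= L" "w > 0" using self_le_power[OF L(3), of E] L(3) by (auto simp: w_def E_def)
   \<comment> \<open>Chosen so that \<open>R ^ (4 * n0)\<close> is \<open>N powr (2 / 5)\<close>,
     which together with \<open>V ^ n0\<close> still leaves a factor \<open>N powr (- 1 / 2)\<close>
     in the boundary error.\<close>
   define R where "R = real N powr (1 / (10 * real n0))"
   have R1: "R >= 1" unfolding R_def using N1 n0 by (intro ge_one_powr_ge_zero) auto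
   have RN: "R <= real N"
    using powr_mono[of "1 / (10 * real n0)" 1 "real N"] N1 n0 by (simp add: R_def field_simps)
   have R4: "R ^ (4 * n0) = real N powr (2 / 5)" unfolding R_def using Npos n0
    by (simp add: powr_realpow[symmetric] powr_powr)
   define Q where "Q = {p. prime p \<and> real p <= R}"
   define PP where "PP = {p \<in> Q. real p >= w \<and> \<not> p dvd M}"
   have Q: "finite Q" "\<And>p. p \<in> Q ==> prime p" "\<And>p. prime p ==> real p <= R ==> p \<in> Q" "PP \<subseteq> Q"
    using finite_primes_le by (auto simp: Q_def PP_def)
   interpret selberg PP R
    by unfold_locales (use Q R1 finite_subset in auto)
   have PPN: "prime p \<and> real p <= real N" if "p \<in> PP" for p using that RN by (auto simp: PP_def Q_def)
   have poly: "(2 * L + 1) ^ j <= 3 ^ j * L ^ j" for j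
    unfolding power_mult_distrib[symmetric] by (rule power_mono) (use L(3) in auto)
   have "V <= (\<Prod>p\<in>PP. 1 + real 2 / real p)" using V_upper by simp
   also have "... <= exp (3 * real 2) * (2 * L + 1) ^ (2 * 2)" unfolding L_def by (rule prod_primes_upto[OF N2 PPN])
   also have "... <= exp 6 * (3 ^ 4 * L ^ 4)" using poly[of 4] by simp
   finally have "V ^ n0 <= (exp 6 * 81 * L ^ 4) ^ n0" using V_ge_1 by (intro power_mono) auto
   hence Vn0: "V ^ n0 <= A1 * L ^ (4 * n0)" by (simp only: power_mult_distrib power_mult A1_def)
   have Lpow: "L ^ (4 * n0) <= (1 / a) ^ (4 * n0) * real N powr (1 / 10)"
   proof -
    have "L ^ (4 * n0) <= (real N powr a / a) ^ (4 * n0)"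
     unfolding L_def by (rule power_mono[OF ln_powr_bound[OF N1 a(1)]]) (use L(3) in "simp add: L_def")
    also have "... = (1 / a) ^ (4 * n0) * (real N powr a) ^ (4 * n0)" by (simp add: power_divide)
    also have "(real N powr a) ^ (4 * n0) = real N powr (a * real (4 * n0))"
     using powr_realpow[of "real N powr a" "4 * n0"] Npos by (simp only: powr_powr[symmetric] powr_gt_zero)
    finally show ?thesis by (simp only: a(2))
   qed
   have VN: "V ^ n0 <= A4 * real N powr (1 / 10)"
    using order_trans[OF Vn0 mult_left_mono[OF Lpow, of A1]] A(1) by (simp only: A4_def mult.assoc less_imp_le)
   have N12: "real N powr (1 / 10) * real N powr (1 / 2) <= real N" using powr_mono[of "3 / 5" 1 "real N"] N1 by (simp add: powr_add[symmetric])
   have N012: "real N powr (1 / 2) >= A4 / ep" "real N powr (1 / 2) >= 2 * A4 * A3 / ep"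
    using N0(2)[OF N] A ep by (auto simp: add_divide_distrib intro: order_trans[rotated])
   define nv where "nv = nu N b (int M)"
   have per: "periodic N nv" by (simp add: periodic_def nv_def nu_def)
   have nonneg: "nv t >= 0" for t using V_ge_1 by (simp add: nv_def nu_def)
   have "LF N k nv ep" unfolding LF_def
   proof (intro allI impI)
    fix S :: "(nat \<times> nat set) set" and e assume good: "good_forms k S e"
    define n where "n = card S"
  let ?\<Pi> = "(\<Prod>p\<in>PP. 1 + 4 ^ n / real p)"
    have n: "n <= n0" using good by (simp add: good_forms_def n_def n0_def)
    have PPk: "p > k \<and> real p >= w \<and> \<not> int p dvd int M" if "p \<in> PP" for p
    proof -
     have "real k < real p" using that L(1) w(1) by (auto simp: PP_def)
     thus ?thesis using that by (auto simp: PP_def)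
    qed
    have "\<bar>Ex N k (\<lambda>x. \<Prod>s\<in>S. nv (form k (e s) x)) - 1\<bar>
     <= V ^ n * ((1 / w) * ?\<Pi> + real n * (4 * (real k)\<^sup>2) * R ^ (4 * n) / real N)"
     unfolding nv_def n_def by (rule nu_linear_forms[OF good Npos _ PPk w(2)]) (use cop in auto)
    also have "... <= V ^ n0 * (A2 * L ^ (2 * K) / w + A3 * real N powr (2 / 5) / real N)"
    proof (intro mult_mono add_mono)
     show "V ^ n <= V ^ n0" using V_ge_1 n by (rule power_increasing[rotated])
     have "?\<Pi> <= (\<Prod>p\<in>PP. 1 + real K / real p)"
      by (rule prod_mono) (use n in "auto simp: K_def intro!: divide_right_mono add_nonneg_nonneg")
     also have "... <= exp (3 * real K) * (2 * L + 1) ^ (2 * K)" unfolding L_def by (rule prod_primes_upto[OF N2 PPN])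
     also have "... <= exp (3 * real K) * (3 ^ (2 * K) * L ^ (2 * K))" by (rule mult_left_mono[OF poly]) simp
     also have "... = A2 * L ^ (2 * K)" by (simp add: A2_def power_mult)
     finally show "1 / w * ?\<Pi> <= A2 * L ^ (2 * K) / w"
      using w(2) by (simp add: divide_right_mono)
     have "R ^ (4 * n) <= real N powr (2 / 5)" unfolding R4[symmetric] by (rule power_increasing) (use n R1 in auto)
     moreover have "real n * (4 * (real k)\<^sup>2) <= A3" using n by (simp add: A3_def mult_right_mono)
     ultimately show "real n * (4 * (real k)\<^sup>2) * R ^ (4 * n) / real N <= A3 * real N powr (2 / 5) / real N"
      using A R1 by (intro divide_right_mono mult_mono) auto
     show "0 <= V ^ n0" using V_ge_1 by simp
     have "0 <= ?\<Pi>" by (intro prod_nonneg) auto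
     thus "0 <= 1 / w * ?\<Pi> + real n * (4 * (real k)\<^sup>2) * R ^ (4 * n) / real N"
      using w(2) R1 by simp
    qed
    also have "... = V ^ n0 * (A2 * L ^ (2 * K) / w) + V ^ n0 * (A3 * real N powr (2 / 5) / real N)" by (rule distrib_left)
    also have "V ^ n0 * (A2 * L ^ (2 * K) / w) <= A1 * L ^ (4 * n0) * (A2 * L ^ (2 * K) / w)"
     using Vn0 by (rule mult_right_mono) (use A w(2) L(3) in auto)
    also have "A1 * L ^ (4 * n0) * (A2 * L ^ (2 * K) / w) = A1 * A2 / L"
     using L(3) by (simp add: w_def E_def power_add)
    also have "... <= ep / 2" using L(2,3) ep by (simp add: field_simps)
    also have "V ^ n0 * (A3 * real N powr (2 / 5) / real N) <= A4 * real N powr (1 / 10) * (A3 * real N powr (2 / 5) / real N)"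
     using VN by (rule mult_right_mono) (use A in auto)
    also have "... = A4 * A3 / real N powr (1 / 2)"
    proof -
     have "real N powr (1 / 10) * real N powr (2 / 5) * real N powr (1 / 2) = real N" using Npos by (simp add: powr_add[symmetric])
     thus ?thesis using Npos by (simp add: field_simps)
    qed
    also have "... <= ep / 2"
    proof -
     have "2 * A4 * A3 <= ep * real N powr (1 / 2)" using N012(2) ep by (simp add: field_simps)
     thus ?thesis using Npos by (simp add: field_simps)
    qed
    finally show "\<bar>Ex N k (\<lambda>x. \<Prod>s\<in>S. nv (form k (e s) x)) - 1\<bar> <= ep" by simp
   qed
   moreover have "V >= c * mertens w1 * ln (real N)"
   proof -
    let ?f = "\<lambda>p. 1 / (1 - 1 / real p)"
    \<comment> \<open>The unsieved primes of \<open>Q\<close>: those up to \<open>w1\<close>, which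
      produce \<open>mertens w1\<close>; those up to the cut \<open>w \<le> w1 ^ (3 * E)\<close>;
      and the large divisors of \<open>M\<close>.\<close>
    define A where "A = {p. prime p \<and> real p <= w1}"
    define B where "B = {p. prime p \<and> w1 < real p \<and> real p <= w}"
    define C where "C = {p \<in> Q. p dvd M \<and> real p >= w}"
    have pr: "real p >= 2" if "prime p" for p using prime_ge_2_nat[OF that] by simp
    have fin: "finite A" "finite B" "finite C"
     using finite_primes_le[of w1] finite_subset[OF _ finite_primes_le[of w], of B] Q(1) by (auto simp: A_def B_def C_def)
    have f1: "1 <= ?f p" if "prime p" for p using pr[OF that] by (simp add: field_simps)
    have pri: "prime p" if "p \<in> A \<union> B \<union> C" for p using that Q(2) by (auto simp: A_def B_def C_def)
    have f0: "0 <= ?f p" if "p \<in> A \<union> B \<union> C" for p using f1[OF pri[OF that]] by linarith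
    have small: "(\<Prod>p\<in>D. ?f p) <= exp (2 * (\<Sum>p\<in>D. 1 / real p))" if "D \<subseteq> A \<union> B \<union> C" for D
     by (rule prod_exp_bound) (use that f1 pri pr inverse_one_minus_le in "meson subsetD order_trans zero_le_one")
    have "Q - PP \<subseteq> A \<union> B \<union> C" by (auto simp: A_def B_def C_def PP_def Q_def)
    hence "(\<Prod>p\<in>Q - PP. ?f p) <= (\<Prod>p\<in>A \<union> B \<union> C. ?f p)"
     by (intro prod_mono2) (use fin in simp, (use f1 pri f0 in blast)+)
    also have "... <= (\<Prod>p\<in>A \<union> B. ?f p) * (\<Prod>p\<in>C. ?f p)" using fin f1 pri by (intro prod_Un_le) auto
    also have "... <= ((\<Prod>p\<in>A. ?f p) * (\<Prod>p\<in>B. ?f p)) * (\<Prod>p\<in>C. ?f p)"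
     by (intro mult_right_mono prod_Un_le prod_nonneg fin) (use f1 pri f0 in blast)+
    also have "... <= ((\<Prod>p\<in>A. ?f p) * exp (2 * (4 * real (3 * E) + 2))) * exp (2 * (2 * al))"
    proof (intro mult_mono mult_nonneg_nonneg prod_nonneg order_refl)
     have "w <= (w1 ^ 3) ^ E" unfolding w_def using w1(2) L(3) by (intro power_mono) (auto simp: L_def)
     hence "w <= w1 ^ (3 * E)" by (simp only: power_mult)
     hence "(\<Sum>p\<in>B. 1 / real p) <= 4 * real (3 * E) + 2" unfolding B_def by (rule sum_primes_between[OF w1(1)])
     thus "(\<Prod>p\<in>B. ?f p) <= exp (2 * (4 * real (3 * E) + 2))"
      by (intro order_trans[OF small]) auto
     have "(\<Sum>p\<in>C. 1 / real p) <= 2 * (al * L) / w"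
      using M Q(2) by (intro sum_prime_divisors[OF M(1) _ w(2) fin(3)]) (auto simp: C_def L_def)
     also have "... <= 2 * al" using mult_left_mono[OF w(1) al] w(2) by (simp add: field_simps)
     finally show "(\<Prod>p\<in>C. ?f p) <= exp (2 * (2 * al))"
      by (intro order_trans[OF small]) auto
    qed (use f0 in blast | simp)+
    finally have P: "(\<Prod>p\<in>Q - PP. ?f p) <= (\<Prod>p\<in>A. ?f p) * exp Z"
     by (simp only: Z_def exp_add mult.assoc)
    have Apos: "(\<Prod>p\<in>A. 1 - 1 / real p) > 0" 
    proof (rule Groups_Big.prod_pos)
     fix p assume "p \<in> A"
     hence "1 / real p <= 1 / 2" using pr[of p] by (simp add: A_def)
     thus "0 < 1 - 1 / real p" by linarith
    qed
    have "L / (10 * real n0) = ln R" using Npos by (simp add: R_def ln_powr L_def)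
    also have "... <= V * (\<Prod>p\<in>Q - PP. ?f p)" by (rule V_lower[OF Q(1,4,2,3)])
    also have "... <= V * ((\<Prod>p\<in>A. ?f p) * exp Z)"
     using P V_ge_1 by (intro mult_left_mono) auto
    also have "(\<Prod>p\<in>A. ?f p) = 1 / (\<Prod>p\<in>A. 1 - 1 / real p)" by (simp add: prod_dividef)
    finally have "L / (10 * real n0) * ((\<Prod>p\<in>A. 1 - 1 / real p) * exp (- Z))
     <= V * (1 / (\<Prod>p\<in>A. 1 - 1 / real p) * exp Z) * ((\<Prod>p\<in>A. 1 - 1 / real p) * exp (- Z))"
     using Apos by (intro mult_right_mono) auto
    also have "... = V" using Apos by (simp add: exp_minus)
    finally show ?thesis by (simp add: mertens_def c_def A_def L_def mult.commute mult.left_commute)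
   qed
   moreover have "V ^ k <= ep * real N"
   proof -
    have "V ^ k <= V ^ n0" using V_ge_1 n0 by (intro power_increasing) auto
    also have "... <= A4 * real N powr (1 / 10)" by (rule VN)
    also have "... <= (ep * real N powr (1 / 2)) * real N powr (1 / 10)"
     using N012(1) ep by (intro mult_right_mono) (auto simp: field_simps)
    also have "... <= ep * real N" using N12 ep by (simp add: mult.assoc mult.commute)
    finally show ?thesis .
   qed
   moreover have "nv t = V" if t: "\<forall>p. prime p \<and> p <= N --> \<not> int p dvd b + int M * (t mod int N)" for t
   proof -
    have "(\<Sum>P\<in>adm. lam P * of_bool (\<forall>p\<in>P. int p dvd b + int M * (t mod int N))) = (\<Sum>P\<in>adm. if P = {} then 1 else 0)"
    proof (rule sum.cong[OF refl])
     fix P assume P: "P \<in> adm"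
     show "lam P * of_bool (\<forall>p\<in>P. int p dvd b + int M * (t mod int N)) = (if P = {} then 1 else 0)"
     proof (cases "P = {}")
      case False
      then obtain p where p: "p \<in> P" by auto
      hence "prime p \<and> p <= N" using PPN[of p] adm_PP[OF P] by auto
      thus ?thesis using t p False by auto
     qed (simp add: lam_empty)
    qed
    also have "... = 1" using empty_adm finite_adm by simp
    finally show ?thesis by (simp add: nv_def nu_def)
   qed
   ultimately show "\<exists>nv V. majorant k N ep (c * mertens w1 * ln (real N)) M b nv V"
    unfolding majorant_def
    using per nonneg V_ge_1 by (intro exI[of _ nv] exI[of _ V]) auto
  qed
 qed
qed

section \<open>Linearising the Piatetski-Shapiro sequence\<close>

lemma card_int_interval: "len >= 0 ==> real (card {y::int. x <= real_of_int y \<and> real_of_int y <= x + len}) <= len + 1"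
proof -
 assume len: "len >= 0"
 have "{y::int. x <= real_of_int y \<and> real_of_int y <= x + len} = {\<lceil>x\<rceil>..\<lfloor>x + len\<rfloor>}" by (auto simp: ceiling_le_iff le_floor_iff)
 moreover have "real (nat (\<lfloor>x + len\<rfloor> - \<lceil>x\<rceil> + 1)) <= len + 1" using len by linarith
 ultimately show ?thesis by simp
qed

lemma card_close: "S \<subseteq> {..<n::nat} ==> d >= 0 ==> (\<And>i j. i \<in> S ==> j \<in> S ==> i < j ==> real j - real i <= d) ==> real (card S) <= d + 1"
proof (cases "S = {}")
 case False
 assume S: "S \<subseteq> {..<n}" and d: "d >= 0" "\<And>i j. i \<in> S ==> j \<in> S ==> i < j ==> real j - real i <= d"
 have fS: "finite S" using S finite_subset by blast
 define i where "i = Min S"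
 have i: "i \<in> S" "\<And>j. j \<in> S ==> i <= j" using fS False by (auto simp: i_def)
 have "S \<subseteq> {i..i + nat \<lfloor>d\<rfloor>}"
 proof
  fix j assume j: "j \<in> S"
  have "real j - real i <= d" using d(2)[OF i(1) j] d(1) i(2)[OF j] by (cases "i = j") auto
  hence "int (j - i) <= \<lfloor>d\<rfloor>" using i(2)[OF j] by (simp add: le_floor_iff of_nat_diff)
  thus "j \<in> {i..i + nat \<lfloor>d\<rfloor>}" using i(2)[OF j] by auto
 qed
 hence "card S <= card {i..i + nat \<lfloor>d\<rfloor>}" by (intro card_mono) auto
 hence "real (card S) <= real (nat \<lfloor>d\<rfloor> + 1)" by simp
 thus ?thesis using d(1) by linarith
qed simp

text \<open>Each term in the residue class of \<open>u\<close> yields an integer \<open>a r - q z\<close> in an interval of length \<open>q / W + 2\<close>,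
 and that integer determines \<open>r\<close> modulo \<open>q\<close>.\<close>

lemma residues_in_run:
 fixes th xi Q :: real and a u :: int and q W :: nat
 assumes q: "q >= 1" "coprime a (int q)" "real q <= Q" and W: "W >= 1" "W <= q"
  and ap: "\<bar>real q * xi - real_of_int a * real W\<bar> <= real W / Q"
 shows "real (card {r. r < q \<and> \<lfloor>th + xi * real r\<rfloor> mod int W = u mod int W}) <= 4 * real q / real W"
proof -
 let ?S = "{r. r < q \<and> \<lfloor>th + xi * real r\<rfloor> mod int W = u mod int W}"
 define v where "v = u mod int W"
 define y where "y = (\<lambda>r. a * int r - int q * (\<lfloor>th + xi * real r\<rfloor> div int W))"
 define x where "x = (real_of_int v - th) * real q / real W - 1"
 have Q: "Q > 0" using q by linarith
 have inj: "inj_on y ?S"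
 proof (rule inj_onI)
  fix r s assume rs: "r \<in> ?S" "s \<in> ?S" "y r = y s"
  hence "a * (int r - int s) = int q * (\<lfloor>th + xi * real r\<rfloor> div int W - \<lfloor>th + xi * real s\<rfloor> div int W)"
   by (simp add: y_def algebra_simps)
  hence "int q dvd a * (int r - int s)" by simp
  hence "int q dvd int r - int s" using q(2) by (simp add: coprime_commute coprime_dvd_mult_right_iff)
  hence "int r mod int q = int s mod int q" by (simp add: mod_eq_dvd_iff)
  thus "r = s" using rs by simp
 qed
 have "y ` ?S \<subseteq> {y. x <= real_of_int y \<and> real_of_int y <= x + (real q / real W + 2)}"
 proof clarify
  fix r assume r: "r < q" "\<lfloor>th + xi * real r\<rfloor> mod int W = u mod int W"
  define z where "z = \<lfloor>th + xi * real r\<rfloor> div int W"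
  have "\<lfloor>th + xi * real r\<rfloor> = int W * z + v" using r(2) by (metis mult_div_mod_eq v_def z_def)
  hence fl: "real W * real_of_int z + real_of_int v <= th + xi * real r" "th + xi * real r < real W * real_of_int z + real_of_int v + 1"
   by (simp_all add: floor_eq_iff)
  have "\<bar>real r * (real q * xi - real_of_int a * real W)\<bar> <= real q * (real W / Q)"
   unfolding abs_mult by (intro mult_mono ap) (use r in auto)
  also have "... <= real W" using mult_left_mono[OF q(3), of "real W"] Q by (simp add: field_simps)
  finally have e: "\<bar>real q * (xi * real r) - real_of_int a * real W * real r\<bar> <= real W" by (simp add: algebra_simps)
  have "real q * (real W * real_of_int z + real_of_int v) <= real q * (th + xi * real r)" "real q * (th + xi * real r) <= real q * (real W * real_of_int z + real_of_int v + 1)"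
   using fl by (intro mult_left_mono; simp)+
  hence "real q * (real_of_int v - th) - real W <= real W * real_of_int (y r)" "real W * real_of_int (y r) <= real q * (real_of_int v - th) + real q + real W"
   using e by (simp_all add: y_def z_def[symmetric] algebra_simps abs_le_iff)
  hence "(real q * (real_of_int v - th) - real W) / real W <= real_of_int (y r)"
    "real_of_int (y r) <= (real q * (real_of_int v - th) + real q + real W) / real W"
   using W by (simp_all add: pos_divide_le_eq pos_le_divide_eq mult.commute)
  thus "x <= real_of_int (y r) \<and> real_of_int (y r) <= x + (real q / real W + 2)"
   using W by (simp add: x_def diff_divide_distrib add_divide_distrib mult.commute)
 qed
 moreover have fin: "finite {y::int. x <= real_of_int y \<and> real_of_int y <= x + (real q / real W + 2)}"
  by (rule finite_subset[of _ "{\<lfloor>x\<rfloor>..\<lceil>x + (real q / real W + 2)\<rceil>}"]) (auto, linarith+)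
 ultimately have "card ?S <= card {y::int. x <= real_of_int y \<and> real_of_int y <= x + (real q / real W + 2)}"
  using inj by (intro card_inj_on_le)
 also have "real ... <= real q / real W + 2 + 1" by (rule card_int_interval) simp
 also have "... <= 4 * real q / real W" using W by (simp add: field_simps)
 finally show ?thesis by simp
qed

section \<open>Smoothness of the power function and passage to indices\<close>

lemma powr_mvt:
 fixes x y b :: real
 assumes "0 < x" "x < y"
 shows "\<exists>z. x < z \<and> z < y \<and> y powr b - x powr b = (y - x) * (b * z powr (b - 1))"
 using MVT2[of x y "\<lambda>z. z powr b" "\<lambda>z. b * z powr (b - 1)"] assms has_real_derivative_powr[of _ b] by auto

text \<open>The mean value theorem twice gives the second-order term, whose factor
  \<open>bt * (bt - 1)\<close> is at most 1.\<close>

lemma powr_linear_approx: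
 fixes bt x h H :: real
 assumes bt: "1 < bt" "bt <= 3 / 2" and x: "x >= 1" and h: "0 <= h" "h <= H"
 shows "\<bar>(x + h) powr bt - x powr bt - bt * x powr (bt - 1) * h\<bar> <= H\<^sup>2 * x powr (bt - 2)"
proof (cases "h = 0")
 case False
 hence h0: "h > 0" using h by simp
 obtain z where z: "x < z" "z < x + h" "(x + h) powr bt - x powr bt = (x + h - x) * (bt * z powr (bt - 1))"
  using powr_mvt[of x "x + h" bt] x h0 by auto
 obtain y where y: "x < y" "y < z" "z powr (bt - 1) - x powr (bt - 1) = (z - x) * ((bt - 1) * y powr (bt - 1 - 1))"
  using powr_mvt[of x z "bt - 1"] x z by force
 have yx: "y powr (bt - 2) <= x powr (bt - 2)" using y x bt by (intro powr_mono2') auto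
 have "(x + h) powr bt - x powr bt - bt * x powr (bt - 1) * h = h * bt * (z powr (bt - 1) - x powr (bt - 1))"
  using z(3) by (simp add: algebra_simps)
 also have "... = (bt * (bt - 1)) * (h * (z - x)) * y powr (bt - 2)" by (simp add: y(3) algebra_simps)
 finally have eq: "(x + h) powr bt - x powr bt - bt * x powr (bt - 1) * h = (bt * (bt - 1)) * (h * (z - x)) * y powr (bt - 2)" .
 have "bt * (bt - 1) <= (3 / 2) * (1 / 2)" using bt by (intro mult_mono) auto
 hence "bt * (bt - 1) <= 1" by simp
 moreover have "h * (z - x) <= H * H" using z h by (intro mult_mono) auto
 ultimately have "(bt * (bt - 1)) * (h * (z - x)) * y powr (bt - 2) <= 1 * (H * H) * x powr (bt - 2)"
  using bt h z yx by (intro mult_mono mult_nonneg_nonneg) auto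
 moreover have "0 <= (bt * (bt - 1)) * (h * (z - x)) * y powr (bt - 2)" using bt h z by (intro mult_nonneg_nonneg) auto
 ultimately show ?thesis unfolding eq by (simp add: power2_eq_square)
qed simp

text \<open>The derivative of the slope is at least \<open>(bt - 1) / X\<close> on
  \<open>[1, X]\<close>; hence the slopes of different blocks are separated.\<close>

lemma powr_slope_gap:
 fixes bt x y X :: real
 assumes bt: "1 < bt" "bt < 2" and xy: "1 <= x" "x < y" "y <= X"
 shows "bt * y powr (bt - 1) - bt * x powr (bt - 1) >= (bt - 1) * (y - x) / X"
proof -
 obtain z where z: "x < z" "z < y" "y powr (bt - 1) - x powr (bt - 1) = (y - x) * ((bt - 1) * z powr (bt - 1 - 1))"
  using powr_mvt[of x y "bt - 1"] xy by force
 have d: "bt * y powr (bt - 1) - bt * x powr (bt - 1) = bt * ((y - x) * ((bt - 1) * z powr (bt - 2)))"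
  using z(3) by (simp add: right_diff_distrib[symmetric])
 have "1 / X <= 1 / z" using z xy by (intro divide_left_mono) auto
 also have "... = z powr (- 1)" using z xy by (simp add: powr_minus_divide)
 also have "... <= z powr (bt - 2)" using z xy bt by (intro powr_mono) auto
 finally have "1 * ((y - x) * ((bt - 1) * (1 / X))) <= bt * ((y - x) * ((bt - 1) * z powr (bt - 2)))"
  using bt xy by (intro mult_mono mult_nonneg_nonneg) auto
 thus ?thesis unfolding d by (simp add: mult.commute)
qed

definition fl :: "real => nat => nat" where "fl bt n = nat \<lfloor>real n powr bt\<rfloor>"

text \<open>Elements of \<open>A\<close> up to \<open>x\<close> come from distinct indices up to
  about \<open>x powr \<gamma>\<close>, and \<open>ln X\<close> is comparable to
  \<open>ln x\<close>; so the limsup becomes density \<open>c / ln X\<close> among the indices for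
  arbitrarily large \<open>X\<close>.\<close>

lemma dense_indices:
 fixes \<gamma> :: real
 assumes \<gamma>: "0 < \<gamma>" "\<gamma> < 1" and A: "A \<subseteq> piatetski_shapiro_primes \<gamma>"
  and lim: "Limsup at_top (\<lambda>x::real. ereal
     (real (card {n \<in> A. 1 <= n \<and> real n <= x}) / (x powr \<gamma> * inverse (ln x)))) > 0"
 shows "\<exists>c>0. \<forall>X0. \<exists>X\<ge>X0. real (card {n. n <= X \<and> fl (1 / \<gamma>) n \<in> A}) >= c * real X / ln (real X)"
proof -
 define F where "F = (\<lambda>x::real. real (card {n \<in> A. 1 <= n \<and> real n <= x}) / (x powr \<gamma> * inverse (ln x)))"
 obtain c0 where c0: "0 < ereal c0" "ereal c0 < Limsup at_top (\<lambda>x. ereal (F x))" using ereal_dense2[OF lim] unfolding F_def by blast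
 have c: "c0 > 0" using c0 by simp
 have freq: "\<exists>x\<ge>x0. F x > c0" for x0
 proof (rule ccontr)
  assume "\<not> ?thesis"
  hence "eventually (\<lambda>x. ereal (F x) <= ereal c0) at_top"
   unfolding eventually_at_top_linorder by (intro exI[of _ x0]) (auto simp: not_less)
  from Limsup_bounded[OF this] show False using c0 by simp
 qed
 define X where "X = (\<lambda>x::real. nat \<lceil>(x + 1) powr \<gamma>\<rceil>)"
 have big: "filterlim X at_top at_top" unfolding X_def using \<gamma> by real_asymp
 have "eventually (\<lambda>x::real. (x + 1) powr \<gamma> + 1 <= 2 * x powr \<gamma>) at_top" using \<gamma> by real_asymp
 moreover have "eventually (\<lambda>x::real. x >= 3) at_top" by (rule eventually_ge_at_top)
 ultimately have ev: "eventually (\<lambda>x::real. (x + 1) powr \<gamma> + 1 <= 2 * x powr \<gamma> \<and> x >= 3) at_top" by eventually_elim simp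
 show ?thesis
 proof (intro exI[of _ "c0 * \<gamma> / 2"] conjI allI)
  show "c0 * \<gamma> / 2 > 0" using c \<gamma> by simp
  fix X0
  have "eventually (\<lambda>x. X x >= X0) at_top" using big by (simp add: filterlim_at_top)
  with ev have "eventually (\<lambda>x. (x + 1) powr \<gamma> + 1 <= 2 * x powr \<gamma> \<and> x >= 3 \<and> X x >= X0) at_top" by eventually_elim simp
  then obtain x0 where x0: "\<And>x. x >= x0 ==> (x + 1) powr \<gamma> + 1 <= 2 * x powr \<gamma> \<and> x >= 3 \<and> X x >= X0"
   unfolding eventually_at_top_linorder by blast
  obtain x where x: "x >= x0" "F x > c0" using freq by blast
  have xx: "(x + 1) powr \<gamma> + 1 <= 2 * x powr \<gamma>" "x >= 3" "X x >= X0" using x0[OF x(1)] by auto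
  have lnx: "ln x > 0" using xx by simp
  let ?S = "{n \<in> A. 1 <= n \<and> real n <= x}" and ?I = "{n. n <= X x \<and> fl (1 / \<gamma>) n \<in> A}"
  have cS: "real (card ?S) >= c0 * (x powr \<gamma> / ln x)" using x(2) lnx xx by (simp add: F_def field_simps)
  have "\<forall>a\<in>?S. \<exists>n. int a = \<lfloor>real n powr (1 / \<gamma>)\<rfloor>" using A by (auto simp: piatetski_shapiro_primes_def)
  then obtain g where g: "\<And>a. a \<in> ?S ==> int a = \<lfloor>real (g a) powr (1 / \<gamma>)\<rfloor>" by metis
  have gfl: "fl (1 / \<gamma>) (g a) = a" if "a \<in> ?S" for a using g[OF that] by (simp add: fl_def)
  have "g ` ?S \<subseteq> ?I"
  proof clarify
   fix a assume a: "a \<in> A" "1 <= a" "real a <= x"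
   hence "real (g a) powr (1 / \<gamma>) < real a + 1" using g[of a] a floor_correct[of "real (g a) powr (1 / \<gamma>)"] by simp linarith
   also have "... <= x + 1" using a by simp
   finally have "(real (g a) powr (1 / \<gamma>)) powr \<gamma> <= (x + 1) powr \<gamma>" using \<gamma> by (intro powr_mono2) auto
   hence "real (g a) <= (x + 1) powr \<gamma>" using \<gamma> by (simp add: powr_powr)
   hence "g a <= X x" unfolding X_def by linarith
   thus "g a <= X x \<and> fl (1 / \<gamma>) (g a) \<in> A" using gfl[of a] a by simp
  qed
  moreover have "inj_on g ?S" by (rule inj_on_inverseI[of _ "fl (1 / \<gamma>)"]) (rule gfl)
  ultimately have "card ?S <= card ?I" by (intro card_inj_on_le) auto
  hence cI: "real (card ?I) >= c0 * (x powr \<gamma> / ln x)" using cS by linarith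
  have "0 <= (x + 1) powr \<gamma>" by simp
  hence Xle: "real (X x) <= 2 * x powr \<gamma>" unfolding X_def using xx(1) by linarith
  have "(x + 1) powr \<gamma> <= real (X x)" unfolding X_def by linarith
  moreover have "x powr \<gamma> <= (x + 1) powr \<gamma>" using \<gamma> xx by (intro powr_mono2) auto
  ultimately have Xge: "x powr \<gamma> <= real (X x)" by linarith
  have "\<gamma> * ln x = ln (x powr \<gamma>)" using xx by (simp add: ln_powr)
  also have "... <= ln (real (X x))" using Xge xx by (intro ln_mono) auto
  finally have l: "\<gamma> * ln x <= ln (real (X x))" .
  have "real (X x) / ln (real (X x)) <= 2 * x powr \<gamma> / (\<gamma> * ln x)"
   using Xle l lnx \<gamma> by (intro frac_le) auto
  hence "c0 * \<gamma> / 2 * (real (X x) / ln (real (X x))) <= c0 * \<gamma> / 2 * (2 * x powr \<gamma> / (\<gamma> * ln x))"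
   using c \<gamma> by (intro mult_left_mono) auto
  also have "... = c0 * (x powr \<gamma> / ln x)" using \<gamma> by simp
  finally have "c0 * \<gamma> / 2 * real (X x) / ln (real (X x)) <= real (card ?I)" using cI by simp
  thus "\<exists>X\<ge>X0. c0 * \<gamma> / 2 * real X / ln (real X) <= real (card {n. n <= X \<and> fl (1 / \<gamma>) n \<in> A})"
   using xx(3) by blast
 qed
qed

section \<open>Good and bad blocks\<close>

lemma fl_ge: "bt >= 1 ==> n >= 1 ==> fl bt n >= n"
proof -
 assume "bt >= 1" "n >= 1"
 hence "real n powr 1 <= real n powr bt" by (intro powr_mono) auto
 hence "real n <= real n powr bt" using \<open>n >= 1\<close> by simp
 thus ?thesis unfolding fl_def by (simp add: le_nat_floor)
qed

lemma fl_eq: "int (fl bt n) = \<lfloor>real n powr bt\<rfloor>" by (simp add: fl_def)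

text \<open>Three shifts times \<open>totient W\<close> residue classes, each of which
  \<open>residues_in_run\<close> bounds by \<open>4 * q / W\<close>.\<close>

lemma coprime_starts:
 fixes th xi Q :: real and a :: int and q W :: nat
 assumes q: "q >= 1" "coprime a (int q)" "real q <= Q" and W: "W >= 1" "W <= q"
  and ap: "\<bar>real q * xi - real_of_int a * real W\<bar> <= real W / Q"
 shows "real (card {(r, si). r < q \<and> si \<in> {-1, 0, 1} \<and> coprime (\<lfloor>th + xi * real r\<rfloor> + si) (int W)}) <= 12 * real q * real (totient W) / real W"
proof -
 let ?R = "{(r, si). r < q \<and> si \<in> {-1, 0, 1} \<and> coprime (\<lfloor>th + xi * real r\<rfloor> + si) (int W)}"
 define G where "G = (\<lambda>si u. {r. r < q \<and> \<lfloor>th + xi * real r\<rfloor> mod int W = (int u - si) mod int W})"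
 have "?R
   \<subseteq> (\<Union>(si, u)\<in>{-1, 0, 1} \<times> totatives W. G si u \<times> {si})"
 proof (rule subsetI, clarify)
  fix r si assume r: "r < q" "si \<in> {-1, 0, 1}" "coprime (\<lfloor>th + xi * real r\<rfloor> + si) (int W)"
  define y where "y = \<lfloor>th + xi * real r\<rfloor> + si"
  define u where "u = (if W = 1 then 1 else nat (y mod int W))"
  have uy: "int u mod int W = y mod int W" using W by (auto simp: u_def)
  have c0: "coprime (y mod int W) (int W)" using r(3) W by (simp add: y_def coprime_mod_left_iff)
  have cop: "coprime (int u) (int W)"
  proof (cases "W = 1")
   case False
   hence "int u = y mod int W" using W by (simp add: u_def)
   thus ?thesis using c0 by simp
  qed simp
  have "u \<in> totatives W" unfolding in_totatives_iff
  proof (intro conjI)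
   show "coprime u W" using cop by simp
   hence "W = 1" if "u = 0" using that by simp
   moreover have "u = 1" if "W = 1" using that by (simp add: u_def)
   ultimately show "u > 0" by (metis gr0I zero_neq_one)
   show "u <= W" using W pos_mod_bound[of "int W" y] by (auto simp: u_def nat_le_iff intro: less_imp_le)
  qed
  moreover have "r \<in> G si u" using r(1) mod_diff_cong[OF uy refl, of si] by (simp add: G_def y_def)
  ultimately show "(r, si) \<in> (\<Union>(si, u)\<in>{-1, 0, 1} \<times> totatives W. G si u \<times> {si})" using r(2) by blast
 qed
 moreover have fin: "finite (\<Union>(si, u)\<in>{-1, 0, 1::int} \<times> totatives W. G si u \<times> {si})" by (auto simp: G_def)
 ultimately have "card ?R
   <= card (\<Union>(si, u)\<in>{-1, 0, 1::int} \<times> totatives W. G si u \<times> {si})" by (rule card_mono[rotated])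
 also have "... <= (\<Sum>(si, u)\<in>{-1, 0, 1} \<times> totatives W. card (G si u \<times> {si}))"
  using card_UN_le[of "{-1, 0, 1::int} \<times> totatives W" "\<lambda>(si, u). G si u \<times> {si}"] by (simp add: case_prod_unfold)
 finally have "real (card ?R)
   <= (\<Sum>(si, u)\<in>{-1, 0, 1} \<times> totatives W. real (card (G si u)))" by (simp add: case_prod_unfold card_cartesian_product flip: of_nat_sum)
 also have "... <= (\<Sum>(si, u)\<in>{-1, 0, 1::int} \<times> totatives W. 4 * real q / real W)"
  unfolding G_def by (intro sum_mono) (auto intro!: residues_in_run[OF q W ap])
 also have "... = 12 * real q * real (totient W) / real W" by (simp add: totient_def)
 finally show ?thesis .
qed

text \<open>Write an offset as \<open>j1 + r + q * t\<close>. As \<open>q\<close> times the slope is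
  close to \<open>a * W\<close>, the value there is \<open>a * W * t\<close> plus a number depending
  only on \<open>r\<close>, with error at most \<open>1 / 2\<close>; so the integer part is
  determined by \<open>t\<close>, \<open>r\<close> and a shift in \<open>{-1, 0, 1}\<close>. The
  values in \<open>A\<close> are primes above \<open>W\<close>, so only starts coprime to
  \<open>W\<close> occur, and pigeonholing over these gains the factor
  \<open>W / totient W\<close>.\<close>

lemma good_block:
 fixes bt s Q :: real and a :: int and q W x0 H T j1 :: nat
 assumes bt: "1 < bt" "bt <= 3 / 2" and A: "\<And>p. p \<in> A ==> prime p" and x0: "x0 > W"
  and q: "q >= 1" "coprime a (int q)" "real q <= Q" and W: "W >= 1" "W <= q"
  and ap: "\<bar>real q * (bt * real x0 powr (bt - 1)) - real_of_int a * real W\<bar> <= real W / Q"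
  and err: "(real H)\<^sup>2 * real x0 powr (bt - 2) <= 1 / 4" "real T * real W / Q <= 1 / 4"
  and j1: "j1 + q * T <= H" and count: "real (card {j. j1 <= j \<and> j < j1 + q * T \<and> fl bt (x0 + j) \<in> A}) >= s" and s: "s > 0"
 shows "\<exists>(c::int) B. B \<subseteq> {..<T} \<and> real (card B) >= s * real W / (12 * real q * real (totient W)) \<and>
  (\<forall>t\<in>B. \<exists>p\<in>A. int p = c + a * int W * int t \<and> p >= x0)"
proof -
 define xi where "xi = bt * real x0 powr (bt - 1)"
 define th where "th = real x0 powr bt + xi * real j1"
 define J where "J = {j. j1 <= j \<and> j < j1 + q * T \<and> fl bt (x0 + j) \<in> A}"
 define ta where "ta = (\<lambda>j. (j - j1) div q)"
 define rh where "rh = (\<lambda>j. (j - j1) mod q)"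
 define si where "si = (\<lambda>j. int (fl bt (x0 + j)) - a * int W * int (ta j) - \<lfloor>th + xi * real (rh j)\<rfloor>)"
 define RS where "RS = {(r, si). r < q \<and> si \<in> {-1, 0, 1} \<and> coprime (\<lfloor>th + xi * real r\<rfloor> + si) (int W)}"
 have finJ: "finite J" by (simp add: J_def)
 have Q: "Q > 0" using q by linarith
 have jt: "j = j1 + (rh j + q * ta j)" "rh j < q" "ta j < T" if "j \<in> J" for j
 proof -
  have j: "j1 <= j" "j < j1 + q * T" using that by (auto simp: J_def)
  show "j = j1 + (rh j + q * ta j)" using j by (simp add: rh_def ta_def)
  show "rh j < q" using q by (simp add: rh_def)
  show "ta j < T" using j q by (simp add: ta_def less_mult_imp_div_less mult.commute)
 qed
 have RS: "(rh j, si j) \<in> RS" if j: "j \<in> J" for j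
 proof -
  define e where "e = real (x0 + j) powr bt - (th + xi * real (rh j)) - real_of_int a * real W * real (ta j)"
  have jH: "real j <= real H" using j j1 by (simp add: J_def)
  have "\<bar>(real x0 + real j) powr bt - real x0 powr bt - xi * real j\<bar> <= (real H)\<^sup>2 * real x0 powr (bt - 2)"
   unfolding xi_def by (rule powr_linear_approx[OF bt _ _ jH]) (use x0 W in auto)
  hence e1: "\<bar>(real x0 + real j) powr bt - real x0 powr bt - xi * real j\<bar> <= 1 / 4" using err(1) by linarith
  have "real j = real j1 + (real (rh j) + real q * real (ta j))" using jt(1)[OF j] by (metis of_nat_add of_nat_mult)
  hence e_eq: "e = ((real x0 + real j) powr bt - real x0 powr bt - xi * real j) + real (ta j) * (real q * xi - real_of_int a * real W)"
   by (simp add: e_def th_def algebra_simps)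
  have "\<bar>real (ta j) * (real q * xi - real_of_int a * real W)\<bar> <= real T * (real W / Q)"
   unfolding abs_mult using ap jt(3)[OF j] by (intro mult_mono) (auto simp: xi_def)
  also have "real T * (real W / Q) = real T * real W / Q" by simp
  also have "... <= 1 / 4" by (rule err(2))
  finally have "\<bar>real (ta j) * (real q * xi - real_of_int a * real W)\<bar> <= 1 / 4" .
  hence "\<bar>e\<bar> <= 1 / 2" using e1 unfolding e_eq by linarith
  moreover have "real (x0 + j) powr bt = (th + xi * real (rh j) + e) + real_of_int (a * int W * int (ta j))" by (simp add: e_def)
  hence "int (fl bt (x0 + j)) = \<lfloor>th + xi * real (rh j) + e\<rfloor> + a * int W * int (ta j)"
   unfolding fl_eq by (simp only: floor_add_int)
  hence sg: "si j = \<lfloor>th + xi * real (rh j) + e\<rfloor> - \<lfloor>th + xi * real (rh j)\<rfloor>" by (simp add: si_def)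
  ultimately have "-1 <= si j" "si j <= 1" by linarith+
  hence s1: "si j \<in> {-1, 0, 1}" by auto
  let ?p = "fl bt (x0 + j)"
  have "?p \<in> A" using j by (simp add: J_def)
  moreover have "?p > W" using fl_ge[of bt "x0 + j"] x0 bt by simp
  ultimately have "\<not> ?p dvd W" "prime ?p" using A W by (auto dest: dvd_imp_le)
  hence "coprime (int ?p) (int W)" using prime_imp_coprime by simp
  moreover have "int ?p = (\<lfloor>th + xi * real (rh j)\<rfloor> + si j) + a * int (ta j) * int W" by (simp add: si_def)
  ultimately have "coprime (\<lfloor>th + xi * real (rh j)\<rfloor> + si j) (int W)" by (metis coprime_iff_gcd_eq_1 gcd_add_mult add.commute gcd.commute)
  thus ?thesis using s1 jt(2)[OF j] by (simp add: RS_def)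
 qed
 have cRS: "real (card RS) <= 12 * real q * real (totient W) / real W"
  unfolding RS_def by (rule coprime_starts[OF q W]) (use ap in "simp add: xi_def")
 have finRS: "finite RS" unfolding RS_def by (rule finite_subset[of _ "{..<q} \<times> {-1, 0, 1}"]) auto
 define s' where "s' = s * real W / (12 * real q * real (totient W))"
 have tot: "real (totient W) > 0" using W by simp
 have "s <= real (card J)" using count by (simp only: J_def)
 hence "J ~= {}" using s by auto
 hence RS0: "RS ~= {}" using RS by blast
 have "s' * real (card RS) <= s' * (12 * real q * real (totient W) / real W)"
  using cRS s by (intro mult_left_mono) (auto simp: s'_def)
 also have "... = s" using q W tot by (simp add: s'_def)
 also have "... <= real (card J)" using count by (simp add: J_def)
 also have "card J = (\<Sum>x\<in>RS. card {j \<in> J. (rh j, si j) = x})"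
  using sum.group[OF finJ finRS image_subsetI[of J "\<lambda>j. (rh j, si j)" RS, OF RS], of "\<lambda>_. 1 :: nat"] by simp
 finally have "(\<Sum>x\<in>RS. real (card {j \<in> J. (rh j, si j) = x})) >= s' * real (card RS)" by simp
 from exists_ge_average[OF finRS RS0 this] obtain r d where rd: "(r, d) \<in> RS" "real (card {j \<in> J. (rh j, si j) = (r, d)}) >= s'" by auto
 let ?F = "{j \<in> J. (rh j, si j) = (r, d)}"
 have "inj_on ta ?F"
 proof (rule inj_onI)
  fix i j assume "i \<in> ?F" "j \<in> ?F" "ta i = ta j"
  thus "i = j" using jt(1)[of i] jt(1)[of j] by auto
 qed
 hence "card (ta ` ?F) = card ?F" by (rule card_image)
 moreover have "ta ` ?F \<subseteq> {..<T}" using jt(3) by auto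
 moreover have "\<exists>p\<in>A. int p = (\<lfloor>th + xi * real r\<rfloor> + d) + a * int W * int t \<and> p >= x0" if t: "t \<in> ta ` ?F" for t
 proof -
  obtain j where j: "j \<in> J" "rh j = r" "si j = d" "t = ta j" using t by auto
  have "fl bt (x0 + j) >= x0" using fl_ge[of bt "x0 + j"] x0 bt by simp
  moreover have "fl bt (x0 + j) \<in> A" using j by (simp add: J_def)
  moreover have "int (fl bt (x0 + j)) = (\<lfloor>th + xi * real r\<rfloor> + d) + a * int W * int t" unfolding j(4) j(2,3)[symmetric] by (simp add: si_def)
  ultimately show ?thesis by blast
 qed
 ultimately show ?thesis using rd(2) unfolding s'_def
  by (intro exI[of _ "\<lfloor>th + xi * real r\<rfloor> + d"] exI[of _ "ta ` ?F"]) simp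
qed

lemma bad_blocks:
 fixes bt X y0 Q A0 :: real and D H W I :: nat
 assumes bt: "1 < bt" "bt < 2" and pos: "X >= 1" "y0 >= 1" "H >= 1" "W >= 1" "real W <= Q" and A0: "real D * (bt * X powr (bt - 1)) + 1 <= A0"
 shows "real (card {i. i < I \<and> y0 <= real (i * H) \<and> real (i * H) <= X \<and>
   (\<exists>q a. 1 <= q \<and> q <= D \<and> \<bar>real q * (bt * real (i * H) powr (bt - 1)) - real_of_int a * real W\<bar> <= real W / Q)})
  <= real D * (A0 + 1) * (2 * real W * X / (Q * real H * (bt - 1)) + 1)"
proof -
 define xi where "xi = (\<lambda>i. bt * real (i * H) powr (bt - 1))"
 define S where "S = (\<lambda>q (a::int). {i. i < I \<and> y0 <= real (i * H) \<and> real (i * H) <= X \<and> \<bar>real q * xi i - real_of_int a * real W\<bar> <= real W / Q})"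
 define d where "d = 2 * real W * X / (Q * real H * (bt - 1))"
 have Q: "Q > 0" "real W / Q <= 1" using pos by auto
 have d0: "d >= 0" using pos bt Q by (simp add: d_def)
 have A00: "A0 >= 0" using order_trans[OF _ A0, of 0] bt by simp
 let ?Bad = "{i. i < I \<and> y0 <= real (i * H) \<and> real (i * H) <= X \<and> (\<exists>q a. 1 <= q \<and> q <= D \<and> \<bar>real q * xi i - real_of_int a * real W\<bar> <= real W / Q)}"
 let ?U = "(\<Union>(q, a)\<in>{1..D} \<times> {0..\<lfloor>A0\<rfloor>}. S q a)"
 have "?Bad \<subseteq> ?U"
 proof clarify
  fix i q and a :: int
  assume i: "i < I" "y0 <= real (i * H)" "real (i * H) <= X" and q: "1 <= q" "q <= D"
   and ap: "\<bar>real q * xi i - real_of_int a * real W\<bar> <= real W / Q"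
  have "1 <= xi i" unfolding xi_def using bt i(2) pos by (intro mult_ge1_I ge_one_powr_ge_zero) auto
  hence "1 <= real q * xi i" using q by (intro mult_ge1_I) auto
  hence "0 <= real_of_int a * real W" using ap Q by linarith
  hence a0: "0 <= a" using pos by (simp add: zero_le_mult_iff)
  have "xi i <= bt * X powr (bt - 1)" unfolding xi_def using i bt by (intro mult_left_mono powr_mono2) auto
  hence "real q * xi i <= real D * (bt * X powr (bt - 1))" using q \<open>1 <= xi i\<close> by (intro mult_mono) auto
  hence "real_of_int a * real W <= A0" using ap Q A0 by linarith
  moreover have "real_of_int a * 1 <= real_of_int a * real W" using a0 pos by (intro mult_left_mono) auto
  ultimately have "a <= \<lfloor>A0\<rfloor>" by (simp add: le_floor_iff)
  hence "(q, a) \<in> {1..D} \<times> {0..\<lfloor>A0\<rfloor>}" "i \<in> S q a" using a0 q i ap by (auto simp: S_def)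
  thus "i \<in> ?U" by blast
 qed
 moreover have "finite ?U" by (auto simp: S_def)
 ultimately have "card ?Bad <= card ?U" by (rule card_mono[rotated])
 also have "... <= (\<Sum>(q, a)\<in>{1..D} \<times> {0..\<lfloor>A0\<rfloor>}. card (S q a))"
  using card_UN_le[of "{1..D} \<times> {0..\<lfloor>A0\<rfloor>}" "\<lambda>(q, a). S q a"] by (simp add: case_prod_unfold)
 finally have "real (card ?Bad) <= (\<Sum>(q, a)\<in>{1..D} \<times> {0..\<lfloor>A0\<rfloor>}. real (card (S q a)))" by (simp add: case_prod_unfold flip: of_nat_sum)
 also have "... <= (\<Sum>(q, a)\<in>{1..D} \<times> {0..\<lfloor>A0\<rfloor>}. d + 1)"
 proof (rule sum_mono, clarify)
  fix q :: nat and a :: int assume q: "q \<in> {1..D}"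
  show "real (card (S q a)) <= d + 1"
  proof (rule card_close[OF _ d0])
   show "S q a \<subseteq> {..<I}" by (auto simp: S_def)
   fix i j assume ij: "i \<in> S q a" "j \<in> S q a" "i < j"
   have lt: "real (i * H) < real (j * H)" using ij(3) pos by simp
   have "(bt - 1) * (real (j * H) - real (i * H)) / X <= xi j - xi i"
    unfolding xi_def using ij pos lt by (intro powr_slope_gap[OF bt]) (auto simp: S_def)
   moreover have "xi j - xi i <= 2 * (real W / Q)"
   proof -
    have nn: "0 <= xi j - xi i" using lt bt unfolding xi_def by (simp add: mult_left_mono powr_mono2)
    have "1 * (xi j - xi i) <= real q * (xi j - xi i)" using nn q by (intro mult_right_mono) auto
    also have "... = (real q * xi j - real_of_int a * real W) - (real q * xi i - real_of_int a * real W)" by (simp add: algebra_simps)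
    also have "... <= 2 * (real W / Q)"
    proof -
     have "\<bar>real q * xi i - real_of_int a * real W\<bar> <= real W / Q" "\<bar>real q * xi j - real_of_int a * real W\<bar> <= real W / Q"
      using ij by (simp_all add: S_def)
     thus ?thesis by linarith
    qed
    finally show ?thesis by simp
   qed
   ultimately have "(bt - 1) * (real j - real i) * real H / X <= 2 * (real W / Q)" by (simp add: algebra_simps)
   thus "real j - real i <= d" using pos bt Q unfolding d_def by (simp add: field_simps)
  qed
 qed
 also have "... = real D * real (nat (\<lfloor>A0\<rfloor> + 1)) * (d + 1)" by simp
 also have "... <= real D * (A0 + 1) * (d + 1)" using d0 A00 by (intro mult_right_mono mult_left_mono) linarith+
 finally show ?thesis by (simp add: d_def xi_def)
qed

lemma nat_floor_bounds: "z >= 1 ==> z / 2 <= real (nat \<lfloor>z\<rfloor>) \<and> real (nat \<lfloor>z\<rfloor>) <= z \<and> nat \<lfloor>z\<rfloor> >= 1"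
proof -
 assume z: "z >= 1"
 hence f: "\<lfloor>z\<rfloor> >= 1" by simp
 hence "real (nat \<lfloor>z\<rfloor>) = real_of_int \<lfloor>z\<rfloor>" by simp
 moreover have "z / 2 <= real_of_int \<lfloor>z\<rfloor>"
 proof (cases "z < 2")
  case True
  have "real_of_int \<lfloor>z\<rfloor> >= 1" using f by linarith
  thus ?thesis using True by linarith
 qed linarith
 ultimately show ?thesis using f by linarith
qed

lemma primorial_le:
 fixes w :: real
 assumes w: "w >= 1"
 shows "real (\<Prod>{p. prime p \<and> real p <= w}) <= w powr w"
proof -
 let ?P = "{p. prime p \<and> real p <= w}"
 have "?P \<subseteq> {1..nat \<lfloor>w\<rfloor>}" using prime_ge_1_nat by (auto simp: le_nat_floor)
 hence "card ?P <= nat \<lfloor>w\<rfloor>" using card_mono[of "{1..nat \<lfloor>w\<rfloor>}" ?P] by simp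
 hence c: "real (card ?P) <= w" using w by linarith
 have "real (\<Prod>?P) = (\<Prod>p\<in>?P. real p)" by simp
 also have "... <= (\<Prod>p\<in>?P. w)" by (rule prod_mono) auto
 also have "... = w powr real (card ?P)" using w by (simp add: powr_realpow)
 also have "... <= w powr w" using c w by (rule powr_mono)
 finally show ?thesis .
qed

lemma totient_primorial:
 fixes W :: nat
 assumes "W = \<Prod>{p. prime p \<and> real p <= w}"
 shows "real (totient W) = real W * mertens w"
proof -
 let ?P = "{p. prime p \<and> real p <= w}"
 have fin: "finite ?P" by (rule finite_primes_le)
 have "W > 0" unfolding assms by (rule prod_pos) (use prime_gt_0_nat in auto)
 moreover have "p \<in> ?P" if p: "prime p" "p dvd W" for p
 proof -
  obtain q where "q \<in> ?P" "p dvd q" using p prime_dvd_prod_iff[OF fin p(1), of "\<lambda>x. x"] by (auto simp: assms)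
  thus ?thesis using primes_dvd_imp_eq[OF p(1), of q] by auto
 qed
 moreover have "p dvd W" if "p \<in> ?P" for p unfolding assms by (rule dvd_prodI[OF fin that])
 ultimately have "prime_factors W = ?P" by (auto simp: prime_factors_dvd)
 thus ?thesis by (simp add: totient_formula2 mertens_def)
qed

text \<open>Pigeonhole over consecutive runs of length \<open>m\<close>; the incomplete last run
  accounts for the extra \<open>m\<close>.\<close>

lemma superblock:
 assumes m: "m >= 1" and c: "real (card {j::nat. j < H \<and> P j}) >= s * real (H div m) + real m"
 shows "\<exists>i. i * m + m <= H \<and> real (card {j. i * m <= j \<and> j < i * m + m \<and> P j}) >= s"
proof (rule ccontr)
 let ?B = "\<lambda>i. {j. i * m <= j \<and> j < i * m + m \<and> P j}"
 assume no: "\<not> ?thesis"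
 have small: "real (card (?B i)) < s" if "i < H div m" for i
 proof -
  have "i * m + m = Suc i * m" by simp
  also have "... <= H div m * m" using that by (intro mult_right_mono) auto
  also have "... <= H" by simp
  finally show ?thesis using no by (meson not_less)
 qed
 have "{j. j < H \<and> P j} \<subseteq> (\<Union>i<H div m. ?B i) \<union> {H div m * m..<H}"
 proof
  fix j assume j: "j \<in> {j. j < H \<and> P j}"
  show "j \<in> (\<Union>i<H div m. ?B i) \<union> {H div m * m..<H}"
  proof (cases "j < H div m * m")
   case True
   hence "j div m < H div m" using less_mult_imp_div_less by blast
   moreover have "j div m * m <= j" "j < j div m * m + m" using m by (simp, metis dividend_less_div_times less_le_trans zero_less_one add.commute)
   ultimately show ?thesis using j by blast
  qed (use j in simp)
 qed
 hence "card {j. j < H \<and> P j} <= card ((\<Union>i<H div m. ?B i) \<union> {H div m * m..<H})"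
  by (rule card_mono[rotated]) auto
 also have "... <= card (\<Union>i<H div m. ?B i) + card {H div m * m..<H}" by (rule card_Un_le)
 also have "card (\<Union>i<H div m. ?B i) <= (\<Sum>i<H div m. card (?B i))"
  by (rule card_UN_le) simp
 also have "card {H div m * m..<H} = H mod m" by (simp add: minus_div_mult_eq_mod)
 finally have "real (card {j. j < H \<and> P j}) <= (\<Sum>i<H div m. real (card (?B i))) + real (H mod m)"
  by (simp flip: of_nat_sum of_nat_add)
 also have "... <= (\<Sum>i<H div m. s) + real (H mod m)" by (intro add_right_mono sum_mono) (use small in "auto intro: less_imp_le")
 also have "... < s * real (H div m) + real m" using m by simp
 finally show False using c by simp
qed

text \<open>The constant 31 reflects that \<open>T\<close> will be at least
  \<open>x powr (1 / 31)\<close> while \<open>M\<close> is at most \<open>x\<close>. Terms above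
  \<open>4 * T\<close> cannot be divisible by primes up to \<open>N \<le> 3 * T\<close> unless
  composite.\<close>

definition dense_progression :: "nat set => real => nat => real => nat => int => nat set => bool" where
 "dense_progression A dl T w M b B \<longleftrightarrow> w >= 2 \<and> ln (3 * real T) <= w ^ 3 \<and> M > 0 \<and> ln (real M) <= 31 * ln (real T) \<and>
  B \<subseteq> {..<T} \<and> real (card B) >= dl * real T / (mertens w * ln (real T)) \<and>
  (\<forall>t\<in>B. \<exists>p\<in>A. int p = b + int M * int t \<and> p > 4 * T)"

text \<open>The indices up to \<open>X\<close> are cut into blocks of length \<open>H\<close>.
  Blocks near the origin, blocks whose slope is well approximated with a denominator up to
  \<open>D\<close>, and blocks poor in \<open>A\<close> cannot hold all indices of \<open>A\<close>.
  In a remaining block Dirichlet's theorem gives a denominator between \<open>D\<close> and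
  \<open>Q\<close>, and some run of length \<open>q * T\<close> is passed to
  \<open>good_block\<close>.\<close>

theorem ps_reduction:
 fixes \<gamma> :: real
 assumes \<gamma>: "1 - 1 / 1000 <= \<gamma>" "\<gamma> < 1" and A: "A \<subseteq> piatetski_shapiro_primes \<gamma>"
  and lim: "Limsup at_top (\<lambda>x::real. ereal
     (real (card {n \<in> A. 1 <= n \<and> real n <= x}) / (x powr \<gamma> * inverse (ln x)))) > 0"
 shows "\<exists>dl>0. \<forall>T0. \<exists>T\<ge>T0. \<exists>w M b B. dense_progression A dl T w M b B"
proof -
 define bt where "bt = 1 / \<gamma>"
 have "\<gamma> > 0" using \<gamma> by linarith
 hence bt: "1 < bt" "bt <= 1 + 1 / 500" using \<gamma> by (simp_all add: bt_def field_simps)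
 have prA: "\<And>p. p \<in> A ==> prime p" using A by (auto simp: piatetski_shapiro_primes_def)
 obtain c where c: "c > 0" and dense: "\<And>X0. \<exists>X\<ge>X0. real (card {n. n <= X \<and> fl bt n \<in> A}) >= c * real X / ln (real X)"
  using dense_indices[OF \<open>\<gamma> > 0\<close> \<gamma>(2) A lim] unfolding bt_def by blast
 define C where "C = 1 / (bt - 1)"
 have C: "C > 0" using bt by (simp add: C_def)
 define dl where "dl = c / 16 / 12 / 31"
 have dl: "dl > 0" using c by (simp add: dl_def)
 show ?thesis
 proof (intro exI[of _ dl] conjI dl allI)
  fix T0 :: nat
  \<comment> \<open>All asymptotic inequalities used below. The exponents \<open>1 / 4\<close>,
    \<open>1 / 30\<close>, \<open>1 / 5\<close>, \<open>1 / 20\<close> of \<open>H\<close>,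
    \<open>T\<close>, \<open>Q\<close>, \<open>D\<close> make \<open>Q * T\<close> smaller than
    \<open>H\<close>, \<open>H\<^sup>2\<close> smaller than \<open>x powr (9 / 10)\<close> for the
    Taylor error, and the bad blocks cover about \<open>x powr (951 / 1000)\<close> indices, which
    is below \<open>x / ln x\<close>.\<close>
  let ?F = "\<lambda>x::real. sqrt (ln x) powr sqrt (ln x) <= x powr (1 / 1000) \<and> ln (3 * x powr (1 / 30)) <= sqrt (ln x) ^ 3 \<and>
   sqrt (ln x) >= 2 \<and> x powr (1 / 30) / 2 >= real T0 \<and> x powr (1 / 30) / 2 >= x powr (1 / 31) \<and> x powr (- (2 / 5)) <= 1 / 4 \<and>
   x powr (1 / 30) * x powr (1 / 1000) * 8 <= x powr (1 / 5) \<and> x powr (1 / 1000) <= x powr (1 / 20) / 2 \<and>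
   2 * x powr (1 / 5) * x powr (1 / 30) <= c / 8 * (x powr (1 / 4) / 2 / ln x) \<and>
   x powr (19 / 20) + x powr (1 / 4) + 1 + x powr (1 / 20) * (x powr (1 / 10) + 1) * (4 * C * x powr (801 / 1000) + x powr (1 / 4))
   + c / 4 * (x + x powr (1 / 4)) / ln x < c * x / ln x \<and>
   x powr (1 / 20) * (2 * x powr (1 / 500)) + 1 <= x powr (1 / 10) \<and> x powr (1 / 1000) < x powr (19 / 20) \<and> 4 * x powr (1 / 30) < x powr (19 / 20) \<and>
   x powr (1 / 5) * (2 * x powr (1 / 500)) + 1 <= x \<and> x >= 3"
  have "eventually ?F at_top" by (intro eventually_conj; use c C in real_asymp)
  then obtain x1 where x1: "\<And>x. x >= x1 ==> ?F x" unfolding eventually_at_top_linorder by blast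
  obtain X :: nat where X: "X >= nat \<lceil>x1\<rceil>" "real (card {n. n <= X \<and> fl bt n \<in> A}) >= c * real X / ln (real X)" using dense by blast
  define x where "x = real X"
  have e: "?F x" by (rule x1) (use X(1) in "simp add: x_def")
  hence x3: "x >= 3" by blast
  define L where "L = ln x"
  have L: "L > 0" using x3 by (simp add: L_def)
  \<comment> \<open>Small enough for the primorial \<open>W \<le> w powr w\<close> to stay below
    \<open>x powr (1 / 1000)\<close>, large enough for \<open>w ^ 3\<close> to exceed
    \<open>ln (3 * T)\<close>.\<close>
  define w where "w = sqrt L"
  define W where "W = \<Prod>{p. prime p \<and> real p <= w}"
  define H where "H = nat \<lfloor>x powr (1 / 4)\<rfloor>"
  define T where "T = nat \<lfloor>x powr (1 / 30)\<rfloor>"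
  define Q where "Q = nat \<lfloor>x powr (1 / 5)\<rfloor>"
  define D where "D = nat \<lfloor>x powr (1 / 20)\<rfloor>"
  have ge1: "x powr e >= 1" if "e >= 0" for e using x3 that by (intro ge_one_powr_ge_zero) auto
  have H: "x powr (1 / 4) / 2 <= real H" "real H <= x powr (1 / 4)" "H >= 1"
   and T: "x powr (1 / 30) / 2 <= real T" "real T <= x powr (1 / 30)" "T >= 1"
   and Q: "x powr (1 / 5) / 2 <= real Q" "real Q <= x powr (1 / 5)" "Q >= 1"
   and D: "x powr (1 / 20) / 2 <= real D" "real D <= x powr (1 / 20)"
   unfolding H_def T_def Q_def D_def using nat_floor_bounds ge1 by auto
  have w2: "w >= 2" using e by (simp add: w_def L_def)
  have W1: "W >= 1"
  proof -
   have "W > 0" unfolding W_def by (rule prod_pos) (use prime_gt_0_nat in auto)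
   thus ?thesis by simp
  qed
  have "real W <= w powr w" unfolding W_def by (rule primorial_le) (use w2 in simp)
  hence Wx: "real W <= x powr (1 / 1000)" using e by (simp add: w_def L_def)
  have WD: "W <= D" using Wx e D(1) by linarith
  have "1 * (x powr (1 / 1000) * 8) <= x powr (1 / 30) * (x powr (1 / 1000) * 8)" by (intro mult_right_mono ge1) auto
  hence WQ: "real W <= real Q" using Wx e Q(1) by linarith
  have slope: "bt * y powr (bt - 1) <= 2 * x powr (1 / 500)" if "0 <= y" "y <= x" for y
  proof -
   have "y powr (bt - 1) <= x powr (bt - 1)" using that bt by (intro powr_mono2) auto
   also have "... <= x powr (1 / 500)" using bt x3 by (intro powr_mono) auto
   finally show ?thesis using bt by (intro mult_mono) auto
  qed

  \<comment> \<open>Indices below \<open>y0\<close> are few and are given up; above it the linear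
    approximation over a whole block is accurate.\<close>
  define y0 where "y0 = x powr (19 / 20)"
  have y01: "y0 >= 1" unfolding y0_def by (rule ge1) simp
  define E where "E = {n. n <= X \<and> fl bt n \<in> A}"
  define blk where "blk = (\<lambda>i. {n \<in> E. n div H = i})"
  define I where "I = X div H + 1"
  define Bad where "Bad = {i. i < I \<and> y0 <= real (i * H) \<and> real (i * H) <= x \<and>
   (\<exists>q a. 1 <= q \<and> q <= D \<and> \<bar>real q * (bt * real (i * H) powr (bt - 1)) - real_of_int a * real W\<bar> <= real W / real Q)}"
  have cBad: "real (card Bad) <= real D * (x powr (1 / 10) + 1) * (2 * real W * x / (real Q * real H * (bt - 1)) + 1)"
   unfolding Bad_def
  proof (rule bad_blocks)
   have "real D * (bt * x powr (bt - 1)) <= x powr (1 / 20) * (2 * x powr (1 / 500))"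
    using D(2) slope[of x] x3 bt by (intro mult_mono) auto
   thus "real D * (bt * x powr (bt - 1)) + 1 <= x powr (1 / 10)" using e by linarith
  qed (use bt x3 y01 H W1 WQ in auto)
  define Y where "Y = x powr (1 / 20) * (x powr (1 / 10) + 1) * (4 * C * x powr (801 / 1000) + x powr (1 / 4))"
  have BadH: "real (card Bad) * real H <= Y"
  proof -
   have "real (card Bad) * real H <= real D * (x powr (1 / 10) + 1) * (2 * real W * x / (real Q * real H * (bt - 1)) + 1) * real H"
    using cBad by (rule mult_right_mono) simp
   also have "... = real D * (x powr (1 / 10) + 1) * (2 * (real W * x / real Q) * C + real H)"
    using H(3) by (simp add: C_def distrib_right)
   also have "real W * x / real Q <= (x powr (1 / 1000) * x) / (x powr (1 / 5) / 2)"
    using Wx Q x3 by (intro frac_le mult_right_mono) auto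
   also have "... = 2 * x powr (801 / 1000)"
   proof -
    have "x powr (1 / 1000) * x = x powr (801 / 1000) * x powr (1 / 5)" using x3 by (simp add: powr_add[symmetric] powr_mult_base mult.commute)
    thus ?thesis using x3 by simp
   qed
   finally have "real (card Bad) * real H <= real D * (x powr (1 / 10) + 1) * (2 * (2 * x powr (801 / 1000)) * C + real H)"
    using C by (simp add: mult_left_mono mult_right_mono)
   also have "... <= Y"
    using D(2) H(2) C unfolding Y_def by (intro mult_mono) auto
   finally show ?thesis .
  qed
  have "\<exists>i. y0 <= real (i * H) \<and> i * H <= X \<and> i \<notin> Bad \<and> real (card (blk i)) >= c / 4 * real H / L"
  proof (rule ccontr)
   assume "\<not> ?thesis"
   hence small: "real (card (blk i)) <= c / 4 * real H / L" if "y0 <= real (i * H)" "i * H <= X" "i \<notin> Bad" for i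
    using that by (meson less_imp_le not_le)
   define Low where "Low = {n \<in> E. real (n div H * H) < y0}"
   define G where "G = {i. i < I \<and> y0 <= real (i * H) \<and> i * H <= X \<and> i \<notin> Bad}"
   have finE: "finite E" unfolding E_def by (rule finite_subset[of _ "{..X}"]) auto
   have finB: "finite Bad" "finite G" unfolding Bad_def G_def by auto
   have cH: "card (blk i) <= H" for i
   proof -
    have "blk i \<subseteq> {i * H..<i * H + H}"
    proof
     fix n assume n: "n \<in> blk i"
     have "n div H * H + n mod H = n" "n mod H < H" using H(3) by simp_all
     hence "n div H * H <= n" "n < n div H * H + H" by linarith+
     thus "n \<in> {i * H..<i * H + H}" using n by (auto simp: blk_def)
    qed
    thus ?thesis using card_mono[of "{i * H..<i * H + H}"] by simp
   qed
   have "E \<subseteq> Low \<union> (\<Union>i\<in>Bad. blk i) \<union> (\<Union>i\<in>G. blk i)"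
   proof
    fix n assume n: "n \<in> E"
    have "n div H < I" "n div H * H <= X" using n div_le_mono[of n X H] order_trans[OF div_times_less_eq_dividend[of n H], of X] by (auto simp: I_def E_def)
    thus "n \<in> Low \<union> (\<Union>i\<in>Bad. blk i) \<union> (\<Union>i\<in>G. blk i)"
     using n by (auto simp: Low_def G_def blk_def not_less)
   qed
   hence "card E <= card (Low \<union> (\<Union>i\<in>Bad. blk i) \<union> (\<Union>i\<in>G. blk i))"
    by (rule card_mono[rotated]) (use finE finB in "auto simp: Low_def blk_def")
   also have "... <= card Low + (\<Sum>i\<in>Bad. card (blk i)) + (\<Sum>i\<in>G. card (blk i))"
    by (intro order_trans[OF card_Un_le] add_mono card_UN_le finB order_refl)
   finally have "real (card E) <= real (card Low) + (\<Sum>i\<in>Bad. real (card (blk i))) + (\<Sum>i\<in>G. real (card (blk i)))"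
    by (simp flip: of_nat_sum of_nat_add)
   also have "... <= (y0 + real H + 1) + real (card Bad) * real H + real I * (c / 4 * real H / L)"
   proof (intro add_mono)
    have "Low \<subseteq> {..<nat \<lceil>y0 + real H\<rceil>}"
    proof
     fix n assume n: "n \<in> Low"
     have "n = n div H * H + n mod H" by simp
     hence "real n = real (n div H * H) + real (n mod H)" by (metis of_nat_add)
     moreover have "real (n mod H) < real H" using H(3) by simp
     ultimately have "real n < y0 + real H" using n by (simp add: Low_def)
     thus "n \<in> {..<nat \<lceil>y0 + real H\<rceil>}" by (simp add: zless_nat_eq_int_zless less_ceiling_iff)
    qed
    hence "card Low <= nat \<lceil>y0 + real H\<rceil>" using card_mono[of "{..<nat \<lceil>y0 + real H\<rceil>}" Low] by simp
    thus "real (card Low) <= y0 + real H + 1" using y01 by linarith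
    have "(\<Sum>i\<in>Bad. real (card (blk i))) <= (\<Sum>i\<in>Bad. real H)" by (rule sum_mono) (use cH in simp)
    thus "(\<Sum>i\<in>Bad. real (card (blk i))) <= real (card Bad) * real H" by simp
    have "(\<Sum>i\<in>G. real (card (blk i))) <= (\<Sum>i\<in>G. c / 4 * real H / L)" by (rule sum_mono) (use small in "auto simp: G_def")
    also have "... = real (card G) * (c / 4 * real H / L)" by simp
    also have "... <= real I * (c / 4 * real H / L)"
    proof (rule mult_right_mono)
     have "card G <= card {..<I}" by (rule card_mono) (auto simp: G_def)
     thus "real (card G) <= real I" by simp
    qed (use c L in simp)
    finally show "(\<Sum>i\<in>G. real (card (blk i))) <= real I * (c / 4 * real H / L)" .
   qed
   also have "real I * (c / 4 * real H / L) <= c / 4 * (x + x powr (1 / 4)) / L"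
   proof -
    have "I * H <= X + H" by (simp add: I_def)
    hence "real (I * H) <= real (X + H)" by (rule of_nat_mono)
    hence "real I * real H <= x + x powr (1 / 4)" using H(2) by (simp add: x_def)
    hence "c / 4 * (real I * real H) / L <= c / 4 * (x + x powr (1 / 4)) / L" using c L by (intro divide_right_mono mult_left_mono) auto
    thus ?thesis by (simp add: mult_ac)
   qed
   finally have "real (card E) <= y0 + x powr (1 / 4) + 1 + Y
    + c / 4 * (x + x powr (1 / 4)) / L" using BadH H(2) by linarith
   thus False using X(2) e unfolding E_def[symmetric] x_def[symmetric] y0_def L_def Y_def by linarith
  qed
  then obtain i where i: "y0 <= real (i * H)" "i * H <= X" "i \<notin> Bad" "real (card (blk i)) >= c / 4 * real H / L" by blast
  define x0 where "x0 = i * H"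
  define xi where "xi = bt * real x0 powr (bt - 1)"
  have x0: "y0 <= real x0" "real x0 <= x" using i by (simp_all add: x0_def x_def del: of_nat_mult)
  have count: "real (card {j. j < H \<and> fl bt (x0 + j) \<in> A}) >= c / 4 * real H / L"
  proof -
   have "inj_on (\<lambda>n. n mod H) (blk i)"
    unfolding blk_def by (rule inj_onI) (metis (mono_tags, lifting) div_mult_mod_eq mem_Collect_eq)
   moreover have "(\<lambda>n. n mod H) ` blk i \<subseteq> {j. j < H \<and> fl bt (x0 + j) \<in> A}"
    using H(3) by (auto simp: E_def x0_def blk_def)
   ultimately have "card (blk i) <= card {j. j < H \<and> fl bt (x0 + j) \<in> A}"
    by (intro card_inj_on_le[where f = "\<lambda>n. n mod H"]) auto
   thus ?thesis using i(4) by linarith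
  qed
  \<comment> \<open>Approximating \<open>xi / W\<close> instead of \<open>xi\<close> makes the step
    \<open>a * W\<close> of the progression a multiple of \<open>W\<close>.\<close>
  obtain a k where ak: "coprime a k" "0 < k" "k <= int Q" "\<bar>real_of_int k * (xi / real W) - real_of_int a\<bar> < 1 / real Q"
   using Dirichlet_approx_coprime[of Q "xi / real W"] Q(3) by auto
  define q where "q = nat k"
  have q: "q >= 1" "coprime a (int q)" "real q <= real Q" using ak by (auto simp: q_def)
  have ap: "\<bar>real q * xi - real_of_int a * real W\<bar> <= real W / real Q"
  proof -
   have "real q * xi - real_of_int a * real W = (real_of_int k * (xi / real W) - real_of_int a) * real W"
    using W1 ak(2) by (simp add: q_def left_diff_distrib)
   hence "\<bar>real q * xi - real_of_int a * real W\<bar> <= 1 / real Q * real W"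
    unfolding abs_mult using ak(4) by (simp only: abs_mult abs_of_nat) (intro mult_right_mono, auto)
   thus ?thesis by simp
  qed
  \<comment> \<open>A denominator up to \<open>D\<close> would make the block bad; hence
    \<open>W \<le> D < q\<close>, as \<open>good_block\<close> requires.\<close>
  have "D < q"
  proof (rule ccontr)
   assume "\<not> D < q"
   moreover have "i < I" using i(2) H(3) by (simp add: I_def less_Suc_eq_le less_eq_div_iff_mult_less_eq)
   ultimately have "i \<in> Bad" unfolding Bad_def using i(1,2) q(1) ap by (auto simp: xi_def x0_def x_def simp del: of_nat_mult)
   thus False using i(3) by simp
  qed
  hence Wq: "W <= q" using WD by simp
  \<comment> \<open>A quarter of the mean number of hits in a run of length \<open>q * T\<close> of
    a rich block; the slack covers the incomplete last run.\<close>
  define s where "s = c / 16 * (real q * real T) / L"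
  have s0: "s > 0" using c q T L by (simp add: s_def)
  have qT: "q * T >= 1" using q T by simp
  have "\<exists>i. i * (q * T) + q * T <= H \<and> real (card {j. i * (q * T) <= j \<and> j < i * (q * T) + q * T \<and> fl bt (x0 + j) \<in> A}) >= s"
  proof (rule superblock[OF qT])
   have qTb: "real (q * T) <= x powr (1 / 5) * x powr (1 / 30)" using q(3) Q(2) T(2) by (simp add: mult_mono)
   have "real (H div (q * T)) <= real H / real (q * T)" by (rule of_nat_div_le_of_nat)
   hence "s * real (H div (q * T)) <= s * (real H / real (q * T))" using s0 by (intro mult_left_mono) auto
   also have "... = c / 16 * real H / L" using q T by (simp add: s_def)
   finally have 1: "s * real (H div (q * T)) <= c / 16 * real H / L" .
   have "c / 8 * (x powr (1 / 4) / 2 / L) <= c / 8 * (real H / L)" using H(1) c L by (intro mult_left_mono divide_right_mono) auto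
   hence "real (q * T) <= c / 16 * (real H / L)" using e qTb unfolding L_def by simp
   hence "s * real (H div (q * T)) + real (q * T) <= c / 8 * real H / L" using 1 by simp
   also have "... <= c / 4 * real H / L" using c L by (intro divide_right_mono mult_right_mono) auto
   finally show "s * real (H div (q * T)) + real (q * T) <= real (card {j. j < H \<and> fl bt (x0 + j) \<in> A})" using count by linarith
  qed
  then obtain b where b: "b * (q * T) + q * T <= H" "real (card {j. b * (q * T) <= j \<and> j < b * (q * T) + q * T \<and> fl bt (x0 + j) \<in> A}) >= s" by blast
  have "real W < y0" "4 * real T < y0" using Wx T(2) e unfolding y0_def by linarith+
  hence x0b: "x0 > W" "x0 > 4 * T" using x0(1) by linarith+
  have err: "(real H)\<^sup>2 * real x0 powr (bt - 2) <= 1 / 4"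
  proof -
   have "real x0 powr (bt - 2) <= y0 powr (bt - 2)" using x0(1) y01 bt by (intro powr_mono2') auto
   also have "... = x powr (19 / 20 * (bt - 2))" by (simp add: y0_def powr_powr)
   also have "... <= x powr (- (9 / 10))" using bt x3 by (intro powr_mono) auto
   finally have "(real H)\<^sup>2 * real x0 powr (bt - 2) <= (x powr (1 / 4))\<^sup>2 * x powr (- (9 / 10))"
    using H(2) by (intro mult_mono power_mono) auto
   also have "... = x powr (- (2 / 5))" by (simp add: power2_eq_square powr_add[symmetric])
   finally show ?thesis using e by linarith
  qed
  have err2: "real T * real W / real Q <= 1 / 4"
  proof -
   have "real T * real W <= x powr (1 / 30) * x powr (1 / 1000)" using T(2) Wx by (intro mult_mono) auto
   hence "real T * real W * 4 <= real Q" using e Q(1) by linarith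
   thus ?thesis using Q(3) by (simp add: field_simps)
  qed
  obtain cc :: int and B where B: "B \<subseteq> {..<T}" "real (card B) >= s * real W / (12 * real q * real (totient W))"
    "\<forall>t\<in>B. \<exists>p\<in>A. int p = cc + a * int W * int t \<and> p >= x0"
   using good_block[OF bt(1) _ prA x0b(1) q W1 Wq ap[unfolded xi_def] err err2 b s0] bt(2) by auto
  have xi1: "xi >= 1" unfolding xi_def using bt x0(1) y01 by (intro mult_ge1_I ge_one_powr_ge_zero) auto
  have qxi: "1 < real q * xi"
  proof -
   have "1 < real q" using \<open>D < q\<close> WD W1 by simp
   thus ?thesis using xi1 by (intro less_le_trans[OF _ mult_left_mono[OF xi1, of "real q"]]) auto
  qed
  have WQ1: "real W / real Q <= 1" using WQ Q(3) by simp
  have aW: "0 < real_of_int a * real W" using ap qxi WQ1 by linarith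
  hence a0: "a > 0" using W1 by (simp add: zero_less_mult_iff)
  define M where "M = nat a * W"
  have M: "int M = a * int W" "M > 0" using a0 W1 by (simp_all add: M_def)
  have "real M = real_of_int a * real W" using M(1) by (metis of_int_mult of_int_of_nat_eq)
  also have "... <= real q * xi + 1" using ap WQ1 by linarith
  also have "real q * xi <= x powr (1 / 5) * (2 * x powr (1 / 500))"
   using q(3) Q(2) slope[of "real x0"] x0(2) xi1 by (intro mult_mono) (auto simp: xi_def)
  finally have Mx: "real M <= x" using e by linarith
  have "ln (x powr (1 / 31)) <= ln (real T)" using e T(1) x3 by (intro ln_mono) auto
  hence LT: "L <= 31 * ln (real T)" using x3 by (simp add: ln_powr L_def)
  have "ln (real M) <= L" unfolding L_def using Mx M(2) x3 by (intro ln_mono) auto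
  hence lnM: "ln (real M) <= 31 * ln (real T)" using LT by linarith
  have "ln (3 * real T) <= ln (3 * x powr (1 / 30))" using T by (intro ln_mono) auto
  hence lnT: "ln (3 * real T) <= w ^ 3" using e unfolding w_def L_def by linarith
  have TT0: "T >= T0" using e T(1) by linarith
  let ?rh = "mertens w"
  have tot: "real (totient W) = real W * ?rh" by (rule totient_primorial[OF W_def])
  moreover have "real (totient W) > 0" using W1 by simp
  ultimately have rh: "?rh > 0" using W1 by (simp add: zero_less_mult_iff)
  have "dl * real T / (?rh * ln (real T)) <= c / 16 / 12 * real T / (?rh * L)"
  proof -
   have "31 * L * (?rh * ln (real T)) >= L * (?rh * L)" using LT rh L by (simp add: mult.commute mult.left_commute mult_left_mono)
   moreover have "ln (real T) > 0" using LT L by linarith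
   ultimately have "1 / 31 / (?rh * ln (real T)) <= 1 / (?rh * L)" using rh L by (simp add: field_simps)
   hence "c / 16 / 12 * real T * (1 / 31 / (?rh * ln (real T))) <= c / 16 / 12 * real T * (1 / (?rh * L))" using c by (intro mult_left_mono) auto
   thus ?thesis by (simp add: dl_def)
  qed
  also have "... = s * real W / (12 * real q * real (totient W))" unfolding tot s_def using q W1 by simp
  also have "... <= real (card B)" by (rule B(2))
  finally have cB: "real (card B) >= dl * real T / (?rh * ln (real T))" .
  have "\<forall>t\<in>B. \<exists>p\<in>A. int p = cc + int M * int t \<and> p > 4 * T" using B(3) x0b(2) unfolding M(1) by (meson less_le_trans)
  hence "dense_progression A dl T w M cc B"
   using w2 lnT M(2) lnM B(1) cB by (simp add: dense_progression_def)
  thus "\<exists>T\<ge>T0. \<exists>w M b B. dense_progression A dl T w M b B" using TT0 by blast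
 qed
qed

section \<open>Progressions of Piatetski-Shapiro primes\<close>

text \<open>Differences of consecutive terms agree modulo \<open>N\<close> and differ by less than
  \<open>2 * T \<le> N\<close>, so they agree as integers.\<close>

lemma progression_of_residues:
 fixes T m :: nat and f :: "nat => int"
 assumes N: "2 * int T <= int N" and f: "\<And>i. i < m ==> 0 <= f i \<and> f i < int T \<and> f i mod int N = (a + int i * d) mod int N" and m: "m >= 2"
 shows "i < m ==> f i = f 0 + int i * (f 1 - f 0)"
proof (induction i)
 case (Suc i)
 have md: "(f (Suc j) - f j) mod int N = d mod int N" if "Suc j < m" for j
  using mod_diff_cong[of "f (Suc j)" "int N" "a + int (Suc j) * d" "f j" "a + int j * d"] f[of j] f[of "Suc j"] that by (simp add: algebra_simps)
 have "(f (Suc i) - f i) mod int N = (f 1 - f 0) mod int N" using md[of i] md[of 0] Suc.prems m by simp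
 hence "int N dvd (f (Suc i) - f i) - (f 1 - f 0)" by (simp only: mod_eq_dvd_iff)
 moreover have "\<bar>(f (Suc i) - f i) - (f 1 - f 0)\<bar> < int N"
 proof -
  have fb: "0 <= f j" "f j < int T" if "j < m" for j using f[OF that] by auto
  have "1 < m" "0 < m" "i < m" using m Suc.prems by auto
  thus ?thesis using fb[of 1] fb[of 0] fb[of i] fb[OF Suc.prems] N by linarith
 qed
 ultimately have "(f (Suc i) - f i) - (f 1 - f 0) = 0" by (metis dvd_imp_le_int linorder_not_less abs_of_nat)
 thus ?case using Suc.IH Suc.prems by (simp add: algebra_simps)
qed simp

text \<open>Representatives of a progression of residues may decrease; a decreasing progression is
  read from its last term.\<close>

lemma nontrivial_AP_int:
 fixes D :: int
 assumes m: "m >= 1" and D: "D ~= 0" and g: "\<And>i. i < m ==> g i > 0 \<and> int (g i) = int (g 0) + int i * D"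
 shows "nontrivial_AP m (g ` {..<m})"
proof (cases "D > 0")
 case True
 have r: "g i = g 0 + i * nat D" if "i < m" for i
 proof -
  have "int (g i) = int (g 0 + i * nat D)" using g[OF that] True by simp
  thus ?thesis by (simp only: of_nat_eq_iff)
 qed
 have "g ` {..<m} = (\<lambda>i. g 0 + i * nat D) ` {..<m}" by (rule image_cong[OF refl]) (rule r, simp)
 also have "... = {g 0 + i * nat D | i. i < m}" by auto
 finally show ?thesis unfolding nontrivial_AP_def using True g[of 0] m by (intro exI[of _ "g 0"] exI[of _ "nat D"]) auto
next
 case False
 have r: "g (m - 1 - i) = g (m - 1) + i * nat (- D)" if "i < m" for i
 proof -
  have "int (g (m - 1 - i)) = int (g (m - 1) + i * nat (- D))"
   using g[of "m - 1 - i"] g[of "m - 1"] that False m by (simp add: of_nat_diff algebra_simps)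
  thus ?thesis by (simp only: of_nat_eq_iff)
 qed
 have "g ` {..<m} = (\<lambda>i. g (m - 1 - i)) ` {..<m}"
 proof -
  have "(\<lambda>i. m - 1 - i) ` {..<m} = {..<m}"
  proof (intro equalityI subsetI)
   fix i assume "i \<in> {..<m}"
   thus "i \<in> (\<lambda>i. m - 1 - i) ` {..<m}" by (intro image_eqI[of _ _ "m - 1 - i"]) auto
  qed auto
  hence "g ` {..<m} = g ` (\<lambda>i. m - 1 - i) ` {..<m}" by (simp only:)
  thus ?thesis by (simp only: image_image)
 qed
 also have "... = (\<lambda>i. g (m - 1) + i * nat (- D)) ` {..<m}" by (rule image_cong[OF refl]) (rule r, simp)
 also have "... = {g (m - 1) + i * nat (- D) | i. i < m}" by auto
 finally show ?thesis unfolding nontrivial_AP_def using False D g[of "m - 1"] m by (intro exI[of _ "g (m - 1)"] exI[of _ "nat (- D)"]) auto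
qed

text \<open>Difference 0 contributes at most \<open>K / N\<close> to the average.\<close>

lemma av2_positive_offdiagonal:
 assumes N: "N > 0" and h: "\<And>a d. h a d >= 0" and c: "av2 N h >= c" and diag: "\<And>a. h a 0 <= K" "K / real N < c"
 shows "\<exists>a d. 0 < d \<and> d < int N \<and> h a d > 0"
proof (rule ccontr)
 assume "\<not> ?thesis"
 hence z: "h a d = 0" if "0 < d" "d < int N" for a d using that h by (metis less_eq_real_def)
 have "(\<Sum>d\<in>{0..<int N}. avg N (\<lambda>a. h a d)) = (\<Sum>d\<in>{0..<int N}. if d = 0 then avg N (\<lambda>a. h a 0) else 0)"
  by (rule sum.cong) (auto simp: z avg_def)
 also have "... = avg N (\<lambda>a. h a 0)" using N by simp
 also have "... <= avg N (\<lambda>_. K)" by (rule avg_mono) (rule diag(1))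
 finally have "(\<Sum>d\<in>{0..<int N}. avg N (\<lambda>a. h a d)) <= K" using avg_const[OF N] by simp
 hence "av2 N h <= K / real N" unfolding av2_def avg_def[of N "\<lambda>d. avg N (\<lambda>a. h a d)"] by (rule divide_right_mono) simp
 thus False using c diag(2) by linarith
qed

text \<open>\<open>f\<close> equals \<open>V\<close> on the residues in \<open>B\<close>. It lies
  below the majorant because the corresponding values are primes above \<open>N\<close>, and its
  mean is bounded below because \<open>mertens w\<close> and the logarithm in \<open>V\<close>
  cancel those in the density of \<open>B\<close>. Terms above an arbitrary \<open>K\<close> will
  give infinitely many progressions.\<close>

theorem progressions_beyond:
 fixes m :: nat and \<gamma> :: real and A :: "nat set"
 assumes m: "m >= 2" and \<gamma>: "1 - 1 / 1000 <= \<gamma>" "\<gamma> < 1" and A: "A \<subseteq> piatetski_shapiro_primes \<gamma>"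
  and lim: "Limsup at_top (\<lambda>x::real. ereal
     (real (card {n \<in> A. 1 <= n \<and> real n <= x}) / (x powr \<gamma> * inverse (ln x)))) > 0"
 shows "\<exists>P. nontrivial_AP m P \<and> P \<subseteq> A \<and> (\<forall>p\<in>P. p > K)"
proof -
 have prA: "\<And>p. p \<in> A ==> prime p" using A by (auto simp: piatetski_shapiro_primes_def)
 obtain dl where dl: "dl > 0" and red: "\<And>T0. \<exists>T\<ge>T0. \<exists>w M b B. dense_progression A dl T w M b B"
  using ps_reduction[OF \<gamma> A lim] by blast
 have m1: "m >= 1" using m by simp
 have "(0::real) <= 31" by simp
 from sieve_majorant[OF m1 this] obtain c1 where c1: "c1 > 0" and maj: "\<And>ep. ep > 0 ==> \<exists>N0. \<forall>N\<ge>N0. \<forall>w M b. sieve_params m 31 N w M -->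
   (\<exists>nv V. majorant m N ep (c1 * mertens w * ln (real N)) M b nv V)" by blast
 have dl': "c1 * dl / 3 > 0" using c1 dl by simp
 obtain c2 ep where c2: "c2 > 0" and ep: "ep > 0" and rel: "\<forall>N nv f. N > 0 \<and> (\<forall>d. 0 < d \<and> d < m --> coprime (int d) (int N)) \<and> periodic N nv \<and> periodic N f \<and>
  (\<forall>t. 0 <= f t \<and> f t <= nv t) \<and> LF N m nv ep \<and> avg N f >= c1 * dl / 3 --> av2 N (\<lambda>a d. \<Prod>i<m. f (a + int i * d)) >= c2"
  using relative_szemeredi[OF m dl'] by (elim exE conjE)
 define ep1 where "ep1 = min ep (c2 / 2)"
 have ep1: "ep1 > 0" "ep1 <= ep" "ep1 < c2" using ep c2 by (auto simp: ep1_def)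
 obtain N0 where maj: "\<And>N w M b. N >= N0 ==> sieve_params m 31 N w M ==> \<exists>nv V. majorant m N ep1 (c1 * mertens w * ln (real N)) M b nv V"
  using maj[OF ep1(1)] by blast
 obtain T w M b B where T: "T >= N0 + fact m + K + 2" and dp: "dense_progression A dl T w M b B" using red by blast
 hence w: "w >= 2" "ln (3 * real T) <= w ^ 3" and M: "M > 0" "ln (real M) <= 31 * ln (real T)"
  and B: "B \<subseteq> {..<T}" "real (card B) >= dl * real T / (mertens w * ln (real T))"
  and BA: "\<forall>t\<in>B. \<exists>p\<in>A. int p = b + int M * int t \<and> p > 4 * T" by (simp_all add: dense_progression_def)
 \<comment> \<open>Congruent to 1 modulo \<open>fact m\<close>, hence coprime to all
   \<open>d \<le> m\<close>; above \<open>2 * T\<close> to prevent wrap-around, and at most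
   \<open>3 * T\<close> so that the terms exceed \<open>N\<close>.\<close>
 define N where "N = (2 * T div fact m + 1) * fact m + 1"
 have Nlo: "2 * T < N"
 proof -
  have "2 * T < 2 * T div fact m * fact m + fact m" using dividend_less_div_times[of "fact m" "2 * T"] by (simp add: add.commute)
  thus ?thesis by (simp add: N_def)
 qed
 have Nhi: "N <= 3 * T"
 proof -
  have "2 * T div fact m * fact m <= 2 * T" by simp
  hence "N <= 2 * T + fact m + 1" by (simp add: N_def)
  thus ?thesis using T by linarith
 qed
 have N0: "N > 0" "N >= N0" using Nlo T by auto
 have cop: "coprime (int d) (int N)" if "0 < d" "d <= m" for d
 proof -
  have "d dvd fact m" using that by (simp add: dvd_fact)
  hence "d dvd (2 * T div fact m + 1) * fact m" by simp
  hence "coprime d N" unfolding N_def by (meson coprime_add_one_right coprime_divisors dvd_refl)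
  thus ?thesis by simp
 qed
 have T2: "real T >= 2" using T by simp
 have lnN: "ln (real T) <= ln (real N)" "ln (real N) <= ln (3 * real T)" using Nlo Nhi T2 by (intro ln_mono; simp)+
 have "sieve_params m 31 N w M"
  unfolding sieve_params_def using cop w lnN M by (intro conjI allI impI) (linarith | simp)+
 then obtain nv V where "majorant m N ep1 (c1 * mertens w * ln (real N)) M b nv V" using maj[OF N0(2)] by blast
 hence nv: "periodic N nv" "\<And>t. nv t >= 0" "LF N m nv ep1" and V: "V >= c1 * mertens w * ln (real N)" "V > 0" "V ^ m <= ep1 * real N"
  and nvV: "\<And>t. (\<forall>p. prime p \<and> p <= N --> \<not> int p dvd b + int M * (t mod int N)) ==> nv t = V"
  unfolding majorant_def by blast+
 define f where "f = (\<lambda>t. if t mod int N \<in> int ` B then V else 0)"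
 have f0: "0 <= f t" for t using V(2) by (simp add: f_def)
 have fnv: "f t <= nv t" for t
 proof (cases "t mod int N \<in> int ` B")
  case True
  then obtain s where s: "s \<in> B" "t mod int N = int s" by auto
  then obtain p where p: "p \<in> A" "int p = b + int M * int s" "p > 4 * T" using BA by blast
  have "\<not> int q dvd b + int M * (t mod int N)" if "prime q" "q <= N" for q
  proof
   assume "int q dvd b + int M * (t mod int N)"
   hence "q dvd p" using p(2) s(2) by (metis of_nat_dvd_iff)
   hence "q = p" using primes_dvd_imp_eq[OF that(1) prA[OF p(1)]] by simp
   thus False using p(3) that(2) Nhi by simp
  qed
  thus ?thesis using nvV[of t] True by (simp add: f_def)
 qed (simp add: f_def nv)
 have BN: "int ` B \<subseteq> {0..<int N}" using B(1) Nlo by auto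
 have "(\<Sum>t\<in>{0..<int N}. f t) = (\<Sum>t\<in>int ` B. V)"
  by (rule sum.mono_neutral_cong_right) (use BN in "auto simp: f_def")
 also have "... = real (card B) * V" by (simp add: card_image)
 finally have avgf: "avg N f = real (card B) * V / real N" by (simp add: avg_def)
 let ?rh = "mertens w"
 have rh: "?rh > 0" unfolding mertens_def
 proof (rule Groups_Big.prod_pos)
  fix p assume "p \<in> {p. prime p \<and> real p <= w}"
  hence "real p > 1" using prime_gt_1_nat by auto
  thus "0 < 1 - 1 / real p" by simp
 qed
 have lnT: "ln (real T) > 0" using T2 by simp
 have "avg N f >= c1 * dl / 3"
 proof -
  have "c1 * dl * real T = (dl * real T / (?rh * ln (real T))) * (c1 * ?rh * ln (real T))" using rh lnT by simp
  also have "... <= real (card B) * V"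
  proof (intro mult_mono B(2))
   have "c1 * ?rh * ln (real T) <= c1 * ?rh * ln (real N)" using lnN c1 rh by (intro mult_left_mono) auto
   thus "c1 * ?rh * ln (real T) <= V" using V(1) by linarith
  qed (use c1 rh lnT in auto)
  finally have "c1 * dl / 3 * real (3 * T) <= real (card B) * V" by simp
  moreover have "c1 * dl / 3 * real N <= c1 * dl / 3 * real (3 * T)" using Nhi dl' by (intro mult_left_mono) auto
  ultimately have "c1 * dl / 3 * real N <= real (card B) * V" by linarith
  thus ?thesis using N0(1) unfolding avgf by (simp add: pos_le_divide_eq)
 qed
 moreover have "periodic N f" by (simp add: periodic_def f_def)
 ultimately have "N > 0 \<and> (\<forall>d. 0 < d \<and> d < m --> coprime (int d) (int N)) \<and> periodic N nv \<and> periodic N f \<and>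
  (\<forall>t. 0 <= f t \<and> f t <= nv t) \<and> LF N m nv ep \<and> avg N f >= c1 * dl / 3"
  using N0(1) cop nv(1) f0 fnv LF_mono[OF nv(3) ep1(2)] by (intro conjI allI impI) (simp_all add: less_imp_le)
 from mp[OF spec[OF spec[OF spec[OF rel]]] this] have av: "av2 N (\<lambda>a d. \<Prod>i<m. f (a + int i * d)) >= c2" .
 have "\<exists>a d. 0 < d \<and> d < int N \<and> (\<Prod>i<m. f (a + int i * d)) > 0"
 proof (rule av2_positive_offdiagonal[OF N0(1) _ av])
  show "0 <= (\<Prod>i<m. f (a + int i * d))" for a d by (rule prod_nonneg) (simp add: f0)
  have "f a <= V" for a using V(2) by (simp add: f_def)
  thus "(\<Prod>i<m. f (a + int i * 0)) <= V ^ m" for a using f0 by (simp add: power_mono)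
  have "V ^ m / real N <= ep1" using V(3) N0(1) by (simp add: pos_divide_le_eq)
  thus "V ^ m / real N < c2" using ep1(3) by linarith
 qed
 then obtain a d where ad: "0 < d" "d < int N" "(\<Prod>i<m. f (a + int i * d)) > 0" by blast
 have "f (a + int i * d) ~= 0" if "i < m" for i
 proof
  assume "f (a + int i * d) = 0"
  hence "(\<Prod>i<m. f (a + int i * d)) = 0" using that by (intro prod_zero) auto
  thus False using ad(3) by linarith
 qed
 hence mem: "(a + int i * d) mod int N \<in> int ` B" if "i < m" for i using that unfolding f_def by meson
 define e where "e = (\<lambda>i::nat. (a + int i * d) mod int N)"
 have eB: "e i \<in> int ` B" if "i < m" for i using mem[OF that] by (simp add: e_def)
 have eb: "0 <= e i \<and> e i < int T \<and> e i mod int N = (a + int i * d) mod int N" if "i < m" for i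
  using eB[OF that] B(1) by (auto simp: e_def)
 have AP: "e i = e 0 + int i * (e 1 - e 0)" if "i < m" for i
  by (rule progression_of_residues[of T N m e a d i]) (use Nlo eb m that in auto)
 have "e 1 - e 0 ~= 0"
 proof
  assume "e 1 - e 0 = 0"
  hence "(a + d) mod int N = a mod int N" by (simp add: e_def)
  hence "int N dvd d" by (simp add: mod_eq_dvd_iff)
  thus False using ad(1,2) zdvd_imp_le by fastforce
 qed
 hence D: "int M * (e 1 - e 0) ~= 0" using M(1) by simp
 have "\<forall>i. \<exists>p. i < m --> p \<in> A \<and> int p = b + int M * e i \<and> p > 4 * T" using eB BA by fastforce
 then obtain g where g: "\<And>i. i < m ==> g i \<in> A \<and> int (g i) = b + int M * e i \<and> g i > 4 * T" by metis
 have "nontrivial_AP m (g ` {..<m})"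
 proof (rule nontrivial_AP_int[OF m1 D])
  fix i assume i: "i < m"
  have "int (g i) = b + int M * (e 0 + int i * (e 1 - e 0))" using g[OF i] AP[OF i] by simp
  thus "g i > 0 \<and> int (g i) = int (g 0) + int i * (int M * (e 1 - e 0))"
   using g[OF i] g[of 0] m by (simp add: algebra_simps)
 qed
 moreover have "g ` {..<m} \<subseteq> A" "\<forall>p\<in>g ` {..<m}. p > K" using g T by fastforce+
 ultimately show ?thesis by blast
qed

theorem theorem1:
  fixes m :: nat and \<gamma> :: real and A :: "nat set"
  assumes "m \<ge> 3"
    and "1 - 2 powr (- (2 ^ (m\<^sup>2 * 4 ^ m))) < \<gamma>" and "\<gamma> < 1"
    and "A \<subseteq> piatetski_shapiro_primes \<gamma>"
    and "Limsup at_top (\<lambda>x::real. ereal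
           (real (card {n \<in> A. 1 \<le> n \<and> real n \<le> x}) / (x powr \<gamma> * inverse (ln x)))) > 0"
  shows "infinite {P. nontrivial_AP m P \<and> P \<subseteq> A}"
proof
  assume fin: "finite {P. nontrivial_AP m P \<and> P \<subseteq> A}"
  have m2: "m \<ge> 2" using assms(1) by simp
  \<comment> \<open>The exponent \<open>2 ^ (m\<^sup>2 * 4 ^ m)\<close> is at least
    \<open>2 ^ 4 = 16\<close>, so \<open>\<gamma>\<close> is at least \<open>999 / 1000\<close>, the
    range in which the exponents of \<open>ps_reduction\<close> fit together.\<close>
  have "(4::nat) * 1 \<le> 4 ^ m * m\<^sup>2" using assms(1) self_le_power[of 4 m] by (intro mult_mono) auto
  then have "(2::real) ^ 4 \<le> 2 ^ (m\<^sup>2 * 4 ^ m)" by (intro power_increasing) (auto simp: mult.commute)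
  then have "2 powr (- (2 ^ (m\<^sup>2 * 4 ^ m))) \<le> (2::real) powr (- 16)" by (intro powr_mono) auto
  also have "\<dots> \<le> 1 / 1000" by (simp add: powr_minus powr_numeral)
  finally have \<gamma>: "1 - 1 / 1000 \<le> \<gamma>" using assms(2) by linarith
  have "finite P" if "nontrivial_AP m P" for P using that unfolding nontrivial_AP_def by auto
  then have "finite (\<Union>{P. nontrivial_AP m P \<and> P \<subseteq> A})" using fin by auto
  \<comment> \<open>Finitely many finite progressions have bounded terms, which a progression beyond
    \<open>K\<close> contradicts.\<close>
  then obtain K where K: "\<And>p. p \<in> \<Union>{P. nontrivial_AP m P \<and> P \<subseteq> A} \<Longrightarrow> p \<le> K"
    by (meson finite_nat_set_iff_bounded_le)
  obtain P where P: "nontrivial_AP m P" "P \<subseteq> A" "\<forall>p\<in>P. p > K"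
    using progressions_beyond[OF m2 \<gamma> assms(3-5)] by blast
  have "P \<noteq> {}" using P(1) m2 unfolding nontrivial_AP_def by force
  then obtain p where "p \<in> P" by blast
  then show False using K[of p] P by force
qed

end
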